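(* Let $G$ be a connected compact semisimple Lie group with maximal torus $T$ and a choice of positive roots, equipped with its standard (Lu-Weinstein) Poisson structure $\pi_G$, and let $(M,\pi_M)$, $M=G/T$, be the manifold of full flags with the Poisson structure onto which $\pi_G$ descends under the quotient map $p:G\to G/T$. Then $p:(G,\pi_G)\to(M,\pi_M)$ is a Poisson submersion with Poisson fibres, and the induced Poisson structures on the fibres are all trivial (zero).
   Context: Standard Poisson structure: let $\mathfrak g,\mathfrak t$ be the Lie algebras of $G,T$, $\mathfrak d=\mathfrak g_{\mathbb C}=\mathfrak t_{\mathbb C}\oplus\bigoplus_{\alpha\in\Delta}\mathfrak d_\alpha$ the root decomposition, $\Delta^+\subset\Delta$ a set of positive roots, $\mathfrak a=\{v\in\mathfrak t_{\mathbb C}:\alpha(v)\in\mathbb R\ \forall\alpha\in\Delta\}$, $\mathfrak n_+=\bigoplus_{\alpha\in\Delta^+}\mathfrak d_\alpha$, $\mathfrak h=\mathfrak a\oplus\mathfrak n_+$, and $\langle v,w\rangle=\operatorname{Im}B_{\mathfrak d}(v,w)$, $B_{\mathfrak d}$ the Killing form of $\mathfrak d$. Then $\mathfrak d=\mathfrak g\oplus\mathfrak h$ as real vector spaces, with $\mathfrak g,\mathfrak h$ Lagrangian subalgebras for $\langle\cdot,\cdot\rangle$. Let $\mathrm{pr}_{\mathfrak g}:\mathfrak d\to\mathfrak g$ be the projection along $\mathfrak h$, $\theta^L\in\Omega^1(G;\mathfrak g)$ the left-invariant Maurer-Cartan form, $l_g$ left multiplication, and for $v\in\mathfrak d$ let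 $\varrho(v)\in\mathfrak X(G)$ be $\varrho(v)_g=(l_g)_*\big(\mathrm{Ad}_{g^{-1}}\mathrm{pr}_{\mathfrak g}\mathrm{Ad}_g(v)\big)$. Then $\pi_G$ is the Poisson-Lie structure with graph $\mathrm{Gr}(\pi_G)=\{\varrho(v)_g+\langle\theta^L_g,v\rangle : g\in G,\ v\in\mathfrak h\}\subset TG\oplus T^*G$, where $\langle\theta^L_g,v\rangle$ denotes the covector $u\mapsto\langle\theta^L_g(u),v\rangle$. It descends to a unique Poisson structure $\pi_M$ on $G/T$ making $p$ a Poisson map. A Poisson submersion is a submersion which is a Poisson map. For a Poisson manifold $(\Sigma,\pi_\Sigma)$ a submanifold $i:X\to\Sigma$ is Poisson-Dirac if $\{u+i^*\xi:i_*u=\pi_\Sigma^\sharp(\xi)\}$ is the graph of a smooth bivector $\pi_X$ on $X$ (automatically Poisson), the induced Poisson structure. A submersion from a Poisson manifold has Poisson fibres if every fibre is a Poisson-Dirac submanifold. *)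

theory Defs
  imports
    "HOL-Analysis.Analysis"
    "HOL-Library.Function_Algebras"
    "HOL-Algebra.Coset"
begin

section \<open>Smooth manifolds\<close>

primrec Ck_on :: "nat \<Rightarrow> 'a::euclidean_space set \<Rightarrow> ('a \<Rightarrow> 'b::real_normed_vector) \<Rightarrow> bool" where
  "Ck_on 0 S f \<longleftrightarrow> continuous_on S f"
| "Ck_on (Suc k) S f \<longleftrightarrow>
     (\<forall>x\<in>S. f differentiable (at x)) \<and> (\<forall>v. Ck_on k S (\<lambda>x. frechet_derivative f (at x) v))"

text \<open>A map on an arbitrary subset of a Euclidean space is smooth if near each point it is the
  restriction of a smooth map on an open set. It is used for open subsets of linear subspaces,
  where it is the usual notion.\<close>

definition smooth_on :: "'a::euclidean_space set \<Rightarrow> ('a \<Rightarrow> 'b::real_normed_vector) \<Rightarrow> bool" where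
  "smooth_on A f \<longleftrightarrow>
     (\<forall>x\<in>A. \<exists>O' F. open O' \<and> x \<in> O' \<and> (\<forall>k. Ck_on k O' F) \<and> (\<forall>y\<in>A \<inter> O'. F y = f y))"

text \<open>A manifold structure lives on the set \<open>topspace (mtop M)\<close>. A chart is a pair
  \<open>(U, \<phi>)\<close>; values of \<open>\<phi>\<close> outside \<open>U\<close> are irrelevant. Charts of an \<open>n\<close>-dimensional manifold take
  values in \<open>n\<close>-dimensional linear subspaces of \<open>'e\<close>, rather than in \<open>'e\<close> itself, so that the dimension
  is not tied to the type: dimension 0 is covered, and submanifolds keep the model type.\<close>

record ('a, 'e) mfd =
  mtop :: "'a topology"
  atlas :: "('a set \<times> ('a \<Rightarrow> 'e)) set"

abbreviation points :: "('a, 'e, 'z) mfd_scheme \<Rightarrow> 'a set" where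
  "points M \<equiv> topspace (mtop M)"

definition smooth_manifold :: "('a, 'e::euclidean_space) mfd \<Rightarrow> bool" where
  "smooth_manifold M \<longleftrightarrow>
     Hausdorff_space (mtop M) \<and> second_countable (mtop M) \<and>
     points M = (\<Union>(U, \<phi>)\<in>atlas M. U) \<and>
     (\<exists>n. \<forall>(U, \<phi>)\<in>atlas M. openin (mtop M) U \<and>
        (\<exists>E. subspace E \<and> dim E = n \<and> openin (top_of_set E) (\<phi> ` U)) \<and>
        homeomorphic_map (subtopology (mtop M) U) (top_of_set (\<phi> ` U)) \<phi>) \<and>
     (\<forall>(U, \<phi>)\<in>atlas M. \<forall>(V, \<psi>)\<in>atlas M. smooth_on (\<phi> ` (U \<inter> V)) (\<psi> \<circ> inv_into U \<phi>))"

text \<open>The maximal atlas.\<close>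

definition charts :: "('a, 'e::euclidean_space) mfd \<Rightarrow> ('a set \<times> ('a \<Rightarrow> 'e)) set" where
  "charts M = {c. smooth_manifold (M\<lparr>atlas := insert c (atlas M)\<rparr>)}"

definition smooth_fun_on :: "('a, 'e::euclidean_space) mfd \<Rightarrow> 'a set \<Rightarrow> ('a \<Rightarrow> real) \<Rightarrow> bool" where
  "smooth_fun_on M W f \<longleftrightarrow> (\<forall>(U, \<phi>)\<in>atlas M. smooth_on (\<phi> ` (U \<inter> W)) (f \<circ> inv_into U \<phi>))"

definition smooth_funs :: "('a, 'e::euclidean_space) mfd \<Rightarrow> ('a \<Rightarrow> real) set" where
  "smooth_funs M = {f. smooth_fun_on M (points M) f}"

definition smooth_map ::
    "('a, 'e::euclidean_space) mfd \<Rightarrow> ('b, 'f::euclidean_space) mfd \<Rightarrow> ('a \<Rightarrow> 'b) \<Rightarrow> bool" where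
  "smooth_map M N F \<longleftrightarrow> continuous_map (mtop M) (mtop N) F \<and>
     (\<forall>(U, \<phi>)\<in>atlas M. \<forall>(V, \<psi>)\<in>atlas N.
        smooth_on (\<phi> ` (U \<inter> F -` V)) (\<psi> \<circ> F \<circ> inv_into U \<phi>))"

definition prod_mfd :: "('a, 'e) mfd \<Rightarrow> ('b, 'f) mfd \<Rightarrow> ('a \<times> 'b, 'e \<times> 'f) mfd" where
  "prod_mfd M N =
     \<lparr>mtop = prod_topology (mtop M) (mtop N),
      atlas = {(U \<times> V, map_prod \<phi> \<psi>) |U \<phi> V \<psi>. (U, \<phi>) \<in> atlas M \<and> (V, \<psi>) \<in> atlas N}\<rparr>"

text \<open>The charts of a submanifold are the restrictions of all slice charts of the ambient
  manifold; \<open>X\<close> is a submanifold if these do form an atlas (in particular cover \<open>X\<close>).\<close>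

definition sub_mfd :: "('a, 'e::euclidean_space) mfd \<Rightarrow> 'a set \<Rightarrow> ('a, 'e) mfd" where
  "sub_mfd M X =
     \<lparr>mtop = subtopology (mtop M) X,
      atlas = {(U \<inter> X, \<phi>) |U \<phi>. (U, \<phi>) \<in> charts M \<and>
                 (\<exists>S. subspace S \<and> \<phi> ` (U \<inter> X) = \<phi> ` U \<inter> S)}\<rparr>"

definition submanifold :: "('a, 'e::euclidean_space) mfd \<Rightarrow> 'a set \<Rightarrow> bool" where
  "submanifold M X \<longleftrightarrow> X \<subseteq> points M \<and> smooth_manifold (sub_mfd M X)"

text \<open>\<open>N\<close> carries the quotient smooth structure of \<open>M\<close> along \<open>p\<close>: the local smooth functions on \<open>N\<close>
  are those whose pullback is smooth. This determines the smooth structure of \<open>N\<close>. That \<open>p\<close> is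
  a submersion is not part of the definition.\<close>

definition quotient_manifold ::
    "('a, 'e::euclidean_space) mfd \<Rightarrow> ('a \<Rightarrow> 'b) \<Rightarrow> ('b, 'f::euclidean_space) mfd \<Rightarrow> bool" where
  "quotient_manifold M p N \<longleftrightarrow>
     smooth_manifold N \<and> quotient_map (mtop M) (mtop N) p \<and>
     (\<forall>W f. openin (mtop N) W \<longrightarrow>
        (smooth_fun_on N W f \<longleftrightarrow> smooth_fun_on M {x \<in> points M. p x \<in> W} (f \<circ> p)))"


section \<open>Tangent and cotangent spaces\<close>

text \<open>Tangent vectors are point derivations of the smooth functions, set to zero on non-smooth
  functions so that equality of tangent vectors is equality in HOL. Addition
  of tangent vectors and covectors is pointwise.\<close>

type_synonym 'a tvec = "('a \<Rightarrow> real) \<Rightarrow> real"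
type_synonym 'a covec = "'a tvec \<Rightarrow> real"

definition tangent_space :: "('a, 'e::euclidean_space) mfd \<Rightarrow> 'a \<Rightarrow> 'a tvec set" where
  "tangent_space M x =
     {D. (\<forall>f\<in>smooth_funs M. \<forall>h\<in>smooth_funs M. D (\<lambda>y. f y + h y) = D f + D h) \<and>
         (\<forall>c. \<forall>f\<in>smooth_funs M. D (\<lambda>y. c * f y) = c * D f) \<and>
         (\<forall>f\<in>smooth_funs M. \<forall>h\<in>smooth_funs M. D (\<lambda>y. f y * h y) = D f * h x + f x * D h) \<and>
         (\<forall>f. f \<notin> smooth_funs M \<longrightarrow> D f = 0)}"

text \<open>\<open>push N F\<close> is the tangent map \<open>F\<^sub>*\<close> of a smooth map \<open>F\<close> into \<open>N\<close>.\<close>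

definition push :: "('b, 'f::euclidean_space) mfd \<Rightarrow> ('a \<Rightarrow> 'b) \<Rightarrow> 'a tvec \<Rightarrow> 'b tvec" where
  "push N F D = (\<lambda>f. if f \<in> smooth_funs N then D (f \<circ> F) else 0)"

definition submersion ::
    "('a, 'e::euclidean_space) mfd \<Rightarrow> ('b, 'f::euclidean_space) mfd \<Rightarrow> ('a \<Rightarrow> 'b) \<Rightarrow> bool" where
  "submersion M N F \<longleftrightarrow> smooth_manifold M \<and> smooth_manifold N \<and> smooth_map M N F \<and>
     (\<forall>x\<in>points M. push N F ` tangent_space M x = tangent_space N (F x))"

text \<open>Covectors are extended by zero outside the tangent space.\<close>

definition cotangent_space :: "('a, 'e::euclidean_space) mfd \<Rightarrow> 'a \<Rightarrow> 'a covec set" where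
  "cotangent_space M x =
     {\<xi>. (\<forall>u\<in>tangent_space M x. \<forall>v\<in>tangent_space M x. \<xi> (u + v) = \<xi> u + \<xi> v) \<and>
         (\<forall>c. \<forall>u\<in>tangent_space M x. \<xi> (\<lambda>f. c * u f) = c * \<xi> u) \<and>
         (\<forall>u. u \<notin> tangent_space M x \<longrightarrow> \<xi> u = 0)}"

definition differential ::
    "('a, 'e::euclidean_space) mfd \<Rightarrow> ('a \<Rightarrow> real) \<Rightarrow> 'a \<Rightarrow> 'a covec" where
  "differential M f x = (\<lambda>u. if u \<in> tangent_space M x then u f else 0)"


section \<open>Poisson geometry\<close>

text \<open>A bivector field is given by its values \<open>\<pi> x \<xi> \<eta>\<close> on pairs of covectors, extended by zero;
  smoothness is tested on differentials of smooth functions, which span the cotangent spaces.\<close>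

type_synonym 'a bivector = "'a \<Rightarrow> 'a covec \<Rightarrow> 'a covec \<Rightarrow> real"

definition bivector_field :: "('a, 'e::euclidean_space) mfd \<Rightarrow> 'a bivector \<Rightarrow> bool" where
  "bivector_field M \<pi> \<longleftrightarrow>
     (\<forall>x\<in>points M. \<forall>\<xi>\<in>cotangent_space M x. \<forall>\<eta>\<in>cotangent_space M x.
        \<pi> x \<xi> \<eta> = - \<pi> x \<eta> \<xi> \<and>
        (\<forall>\<xi>'\<in>cotangent_space M x. \<pi> x (\<xi> + \<xi>') \<eta> = \<pi> x \<xi> \<eta> + \<pi> x \<xi>' \<eta>) \<and>
        (\<forall>c. \<pi> x (\<lambda>u. c * \<xi> u) \<eta> = c * \<pi> x \<xi> \<eta>)) \<and>
     (\<forall>f\<in>smooth_funs M. \<forall>h\<in>smooth_funs M.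
        (\<lambda>x. \<pi> x (differential M f x) (differential M h x)) \<in> smooth_funs M) \<and>
     (\<forall>x \<xi> \<eta>. x \<notin> points M \<or> \<xi> \<notin> cotangent_space M x \<or> \<eta> \<notin> cotangent_space M x
        \<longrightarrow> \<pi> x \<xi> \<eta> = 0)"

definition zero_bivector :: "'a bivector" where
  "zero_bivector = (\<lambda>x \<xi> \<eta>. 0)"

definition pbracket :: "('a, 'e::euclidean_space) mfd \<Rightarrow> 'a bivector \<Rightarrow>
    ('a \<Rightarrow> real) \<Rightarrow> ('a \<Rightarrow> real) \<Rightarrow> 'a \<Rightarrow> real" where
  "pbracket M \<pi> f h x = \<pi> x (differential M f x) (differential M h x)"

definition poisson_structure :: "('a, 'e::euclidean_space) mfd \<Rightarrow> 'a bivector \<Rightarrow> bool" where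
  "poisson_structure M \<pi> \<longleftrightarrow> smooth_manifold M \<and> bivector_field M \<pi> \<and>
     (\<forall>f\<in>smooth_funs M. \<forall>g\<in>smooth_funs M. \<forall>h\<in>smooth_funs M. \<forall>x\<in>points M.
        pbracket M \<pi> f (pbracket M \<pi> g h) x + pbracket M \<pi> g (pbracket M \<pi> h f) x
          + pbracket M \<pi> h (pbracket M \<pi> f g) x = 0)"

text \<open>\<open>Gr \<pi> M x\<close> is the set of pairs \<open>(\<pi>\<^sup>\<sharp> \<xi>, \<xi>)\<close> with \<open>\<xi>\<close> a covector at \<open>x\<close>, where \<open>\<pi>\<^sup>\<sharp> \<xi>\<close> is the
  tangent vector \<open>u\<close> with \<open>\<eta> u = \<pi> x \<xi> \<eta>\<close> for all covectors \<open>\<eta>\<close>.\<close>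

definition Gr :: "('a, 'e::euclidean_space) mfd \<Rightarrow> 'a bivector \<Rightarrow> 'a \<Rightarrow> ('a tvec \<times> 'a covec) set" where
  "Gr M \<pi> x = {(u, \<xi>). u \<in> tangent_space M x \<and> \<xi> \<in> cotangent_space M x \<and>
                 (\<forall>\<eta>\<in>cotangent_space M x. \<eta> u = \<pi> x \<xi> \<eta>)}"

definition poisson_map :: "('a, 'e::euclidean_space) mfd \<Rightarrow> 'a bivector \<Rightarrow>
    ('b, 'f::euclidean_space) mfd \<Rightarrow> 'b bivector \<Rightarrow> ('a \<Rightarrow> 'b) \<Rightarrow> bool" where
  "poisson_map M \<pi> N \<sigma> F \<longleftrightarrow>
     poisson_structure M \<pi> \<and> poisson_structure N \<sigma> \<and> smooth_map M N F \<and>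
     (\<forall>f\<in>smooth_funs N. \<forall>h\<in>smooth_funs N. \<forall>x\<in>points M.
        pbracket M \<pi> (f \<circ> F) (h \<circ> F) x = pbracket N \<sigma> f h (F x))"

definition poisson_submersion :: "('a, 'e::euclidean_space) mfd \<Rightarrow> 'a bivector \<Rightarrow>
    ('b, 'f::euclidean_space) mfd \<Rightarrow> 'b bivector \<Rightarrow> ('a \<Rightarrow> 'b) \<Rightarrow> bool" where
  "poisson_submersion M \<pi> N \<sigma> F \<longleftrightarrow> submersion M N F \<and> poisson_map M \<pi> N \<sigma> F"

text \<open>The Poisson structure on \<open>N\<close> to which \<open>\<pi>\<close> descends along a surjective \<open>p\<close>, if it does.\<close>

definition pushed_poisson :: "('a, 'e::euclidean_space) mfd \<Rightarrow> 'a bivector \<Rightarrow>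
    ('b, 'f::euclidean_space) mfd \<Rightarrow> ('a \<Rightarrow> 'b) \<Rightarrow> 'b bivector" where
  "pushed_poisson M \<pi> N p = (THE \<sigma>. poisson_structure N \<sigma> \<and> poisson_map M \<pi> N \<sigma> p)"

text \<open>Inclusion of a submanifold: \<open>i\<^sub>*\<close> is \<open>push M id\<close>, and \<open>restrict_covec\<close> is \<open>i\<^sup>*\<close>.\<close>

definition restrict_covec ::
    "('a, 'e::euclidean_space) mfd \<Rightarrow> 'a set \<Rightarrow> 'a \<Rightarrow> 'a covec \<Rightarrow> 'a covec" where
  "restrict_covec M X x \<xi> =
     (\<lambda>u. if u \<in> tangent_space (sub_mfd M X) x then \<xi> (push M id u) else 0)"

definition induces_bivector :: "('a, 'e::euclidean_space) mfd \<Rightarrow> 'a bivector \<Rightarrow> 'a set \<Rightarrow>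
    'a bivector \<Rightarrow> bool" where
  "induces_bivector M \<pi> X \<sigma> \<longleftrightarrow> bivector_field (sub_mfd M X) \<sigma> \<and>
     (\<forall>x\<in>X. {(u, restrict_covec M X x \<xi>) |u \<xi>.
                u \<in> tangent_space (sub_mfd M X) x \<and> (push M id u, \<xi>) \<in> Gr M \<pi> x}
             = Gr (sub_mfd M X) \<sigma> x)"

definition poisson_dirac :: "('a, 'e::euclidean_space) mfd \<Rightarrow> 'a bivector \<Rightarrow> 'a set \<Rightarrow> bool" where
  "poisson_dirac M \<pi> X \<longleftrightarrow> submanifold M X \<and> (\<exists>\<sigma>. induces_bivector M \<pi> X \<sigma>)"

definition induced_poisson :: "('a, 'e::euclidean_space) mfd \<Rightarrow> 'a bivector \<Rightarrow> 'a set \<Rightarrow>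
    'a bivector" where
  "induced_poisson M \<pi> X = (THE \<sigma>. induces_bivector M \<pi> X \<sigma>)"

definition fibre :: "('a, 'e) mfd \<Rightarrow> ('a \<Rightarrow> 'b) \<Rightarrow> 'b \<Rightarrow> 'a set" where
  "fibre M p y = {x \<in> points M. p x = y}"

definition has_poisson_fibres :: "('a, 'e::euclidean_space) mfd \<Rightarrow> 'a bivector \<Rightarrow>
    ('b, 'f::euclidean_space) mfd \<Rightarrow> ('a \<Rightarrow> 'b) \<Rightarrow> bool" where
  "has_poisson_fibres M \<pi> N p \<longleftrightarrow>
     poisson_structure M \<pi> \<and> submersion M N p \<and> (\<forall>y\<in>points N. poisson_dirac M \<pi> (fibre M p y))"


section \<open>Lie groups and their Lie algebras\<close>

definition lie_group :: "'g monoid \<Rightarrow> ('g, 'e::euclidean_space) mfd \<Rightarrow> bool" where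
  "lie_group G M \<longleftrightarrow> group G \<and> smooth_manifold M \<and> points M = carrier G \<and>
     smooth_map (prod_mfd M M) M (\<lambda>(x, y). x \<otimes>\<^bsub>G\<^esub> y) \<and> smooth_map M M (\<lambda>x. inv\<^bsub>G\<^esub> x)"

abbreviation lie_algebra :: "'g monoid \<Rightarrow> ('g, 'e::euclidean_space) mfd \<Rightarrow> 'g tvec set" where
  "lie_algebra G M \<equiv> tangent_space M \<one>\<^bsub>G\<^esub>"

text \<open>The function \<open>\<lambda>g. v (\<lambda>x. f (g \<otimes> x))\<close> is the derivative of \<open>f\<close> along the left-invariant vector
  field extending \<open>v\<close>; the bracket is the commutator of such fields, at the unit.\<close>

definition lie_bracket :: "'g monoid \<Rightarrow> 'g tvec \<Rightarrow> 'g tvec \<Rightarrow> 'g tvec" where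
  "lie_bracket G u v =
     (\<lambda>f. u (\<lambda>g. v (\<lambda>x. f (g \<otimes>\<^bsub>G\<^esub> x))) - v (\<lambda>g. u (\<lambda>x. f (g \<otimes>\<^bsub>G\<^esub> x))))"

definition lie_ideal :: "'g monoid \<Rightarrow> ('g, 'e::euclidean_space) mfd \<Rightarrow> 'g tvec set \<Rightarrow> bool" where
  "lie_ideal G M I \<longleftrightarrow> I \<subseteq> lie_algebra G M \<and> 0 \<in> I \<and>
     (\<forall>u\<in>I. \<forall>v\<in>I. u + v \<in> I) \<and> (\<forall>c. \<forall>u\<in>I. (\<lambda>f. c * u f) \<in> I) \<and>
     (\<forall>u\<in>lie_algebra G M. \<forall>v\<in>I. lie_bracket G u v \<in> I)"

text \<open>Semisimplicity in the sense of Bourbaki: there is no nonzero commutative ideal.\<close>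

definition semisimple_lie_group :: "'g monoid \<Rightarrow> ('g, 'e::euclidean_space) mfd \<Rightarrow> bool" where
  "semisimple_lie_group G M \<longleftrightarrow> lie_group G M \<and>
     (\<forall>I. lie_ideal G M I \<and> (\<forall>u\<in>I. \<forall>v\<in>I. lie_bracket G u v = 0) \<longrightarrow> I = {0})"

text \<open>A torus in \<open>G\<close> is a compact connected abelian Lie subgroup.\<close>

definition torus_in :: "'g monoid \<Rightarrow> ('g, 'e::euclidean_space) mfd \<Rightarrow> 'g set \<Rightarrow> bool" where
  "torus_in G M T \<longleftrightarrow> subgroup T G \<and> submanifold M T \<and>
     compactin (mtop M) T \<and> connectedin (mtop M) T \<and>
     (\<forall>s\<in>T. \<forall>t\<in>T. s \<otimes>\<^bsub>G\<^esub> t = t \<otimes>\<^bsub>G\<^esub> s)"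

definition maximal_torus :: "'g monoid \<Rightarrow> ('g, 'e::euclidean_space) mfd \<Rightarrow> 'g set \<Rightarrow> bool" where
  "maximal_torus G M T \<longleftrightarrow> torus_in G M T \<and> (\<forall>T'. torus_in G M T' \<and> T \<subseteq> T' \<longrightarrow> T' = T)"

definition torus_algebra ::
    "'g monoid \<Rightarrow> ('g, 'e::euclidean_space) mfd \<Rightarrow> 'g set \<Rightarrow> 'g tvec set" where
  "torus_algebra G M T = push M id ` tangent_space (sub_mfd M T) \<one>\<^bsub>G\<^esub>"

text \<open>For a subspace \<open>V\<close> of the Lie algebra, \<open>complexification V\<close> is realised as the space of
  complex-valued functionals with real and imaginary part in \<open>V\<close>.\<close>

type_synonym 'a ctvec = "('a \<Rightarrow> real) \<Rightarrow> complex"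

definition scaleC :: "complex \<Rightarrow> 'a ctvec \<Rightarrow> 'a ctvec" where
  "scaleC c x = (\<lambda>f. c * x f)"

definition re_part :: "'a ctvec \<Rightarrow> 'a tvec" where
  "re_part x = (\<lambda>f. Re (x f))"

definition im_part :: "'a ctvec \<Rightarrow> 'a tvec" where
  "im_part x = (\<lambda>f. Im (x f))"

definition cplx :: "'a tvec \<Rightarrow> 'a ctvec" where
  "cplx u = (\<lambda>f. complex_of_real (u f))"

definition complexification :: "'a tvec set \<Rightarrow> 'a ctvec set" where
  "complexification V = {x. re_part x \<in> V \<and> im_part x \<in> V}"

abbreviation dalg :: "'g monoid \<Rightarrow> ('g, 'e::euclidean_space) mfd \<Rightarrow> 'g ctvec set" where
  "dalg G M \<equiv> complexification (lie_algebra G M)"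

definition dbracket :: "'g monoid \<Rightarrow> 'g ctvec \<Rightarrow> 'g ctvec \<Rightarrow> 'g ctvec" where
  "dbracket G x y =
     cplx (lie_bracket G (re_part x) (re_part y) - lie_bracket G (im_part x) (im_part y))
     + scaleC \<i> (cplx (lie_bracket G (re_part x) (im_part y) + lie_bracket G (im_part x) (re_part y)))"

text \<open>The trace of a complex-linear endomorphism of a finite-dimensional space \<open>V\<close> of functionals,
  computed in an arbitrary basis.\<close>

definition ctrace :: "'a ctvec set \<Rightarrow> ('a ctvec \<Rightarrow> 'a ctvec) \<Rightarrow> complex" where
  "ctrace V L =
     (let B = (SOME B. finite B \<and> \<not> module.dependent scaleC B \<and> module.span scaleC B = V)
      in \<Sum>b\<in>B. module.representation scaleC B (L b) b)"

definition killing_form ::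
    "'g monoid \<Rightarrow> ('g, 'e::euclidean_space) mfd \<Rightarrow> 'g ctvec \<Rightarrow> 'g ctvec \<Rightarrow> complex" where
  "killing_form G M x y = ctrace (dalg G M) (\<lambda>z. dbracket G x (dbracket G y z))"

definition pairing ::
    "'g monoid \<Rightarrow> ('g, 'e::euclidean_space) mfd \<Rightarrow> 'g ctvec \<Rightarrow> 'g ctvec \<Rightarrow> real" where
  "pairing G M v w = Im (killing_form G M v w)"


section \<open>Roots and the standard Poisson structure\<close>

abbreviation tcalg :: "'g monoid \<Rightarrow> ('g, 'e::euclidean_space) mfd \<Rightarrow> 'g set \<Rightarrow> 'g ctvec set" where
  "tcalg G M T \<equiv> complexification (torus_algebra G M T)"

definition root_space :: "'g monoid \<Rightarrow> ('g, 'e::euclidean_space) mfd \<Rightarrow> 'g set \<Rightarrow>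
    ('g ctvec \<Rightarrow> complex) \<Rightarrow> 'g ctvec set" where
  "root_space G M T \<alpha> =
     {x \<in> dalg G M. \<forall>h\<in>tcalg G M T. dbracket G h x = scaleC (\<alpha> h) x}"

text \<open>Roots are functionals on the complexified torus algebra, extended by zero.\<close>

definition roots ::
    "'g monoid \<Rightarrow> ('g, 'e::euclidean_space) mfd \<Rightarrow> 'g set \<Rightarrow> ('g ctvec \<Rightarrow> complex) set" where
  "roots G M T =
     {\<alpha>. (\<forall>h\<in>tcalg G M T. \<forall>k\<in>tcalg G M T. \<alpha> (h + k) = \<alpha> h + \<alpha> k) \<and>
         (\<forall>c. \<forall>h\<in>tcalg G M T. \<alpha> (scaleC c h) = c * \<alpha> h) \<and>
         (\<forall>h. h \<notin> tcalg G M T \<longrightarrow> \<alpha> h = 0) \<and>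
         \<alpha> \<noteq> 0 \<and> root_space G M T \<alpha> \<noteq> {0}}"

definition positive_roots :: "'g monoid \<Rightarrow> ('g, 'e::euclidean_space) mfd \<Rightarrow> 'g set \<Rightarrow>
    ('g ctvec \<Rightarrow> complex) set \<Rightarrow> bool" where
  "positive_roots G M T P \<longleftrightarrow> P \<subseteq> roots G M T \<and>
     (\<forall>\<alpha>\<in>roots G M T. \<alpha> \<in> P \<longleftrightarrow> - \<alpha> \<notin> P) \<and>
     (\<forall>\<alpha>\<in>P. \<forall>\<beta>\<in>P. \<alpha> + \<beta> \<in> roots G M T \<longrightarrow> \<alpha> + \<beta> \<in> P)"

definition aalg :: "'g monoid \<Rightarrow> ('g, 'e::euclidean_space) mfd \<Rightarrow> 'g set \<Rightarrow> 'g ctvec set" where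
  "aalg G M T = {v \<in> tcalg G M T. \<forall>\<alpha>\<in>roots G M T. \<alpha> v \<in> \<real>}"

definition nplus :: "'g monoid \<Rightarrow> ('g, 'e::euclidean_space) mfd \<Rightarrow> 'g set \<Rightarrow>
    ('g ctvec \<Rightarrow> complex) set \<Rightarrow> 'g ctvec set" where
  "nplus G M T P = module.span scaleC (\<Union>\<alpha>\<in>P. root_space G M T \<alpha>)"

definition halg :: "'g monoid \<Rightarrow> ('g, 'e::euclidean_space) mfd \<Rightarrow> 'g set \<Rightarrow>
    ('g ctvec \<Rightarrow> complex) set \<Rightarrow> 'g ctvec set" where
  "halg G M T P = {a + n |a n. a \<in> aalg G M T \<and> n \<in> nplus G M T P}"

definition pr_g :: "'g monoid \<Rightarrow> ('g, 'e::euclidean_space) mfd \<Rightarrow> 'g set \<Rightarrow>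
    ('g ctvec \<Rightarrow> complex) set \<Rightarrow> 'g ctvec \<Rightarrow> 'g tvec" where
  "pr_g G M T P v = (THE u. u \<in> lie_algebra G M \<and> v - cplx u \<in> halg G M T P)"

text \<open>One definition serves for the Lie algebra (\<open>'k\<close> real) and for its complexification (\<open>'k\<close> complex).\<close>

definition Ad :: "'g monoid \<Rightarrow> 'g \<Rightarrow> (('g \<Rightarrow> real) \<Rightarrow> 'k) \<Rightarrow> (('g \<Rightarrow> real) \<Rightarrow> 'k)" where
  "Ad G g v = (\<lambda>f. v (\<lambda>x. f (g \<otimes>\<^bsub>G\<^esub> x \<otimes>\<^bsub>G\<^esub> inv\<^bsub>G\<^esub> g)))"

definition rho :: "'g monoid \<Rightarrow> ('g, 'e::euclidean_space) mfd \<Rightarrow> 'g set \<Rightarrow>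
    ('g ctvec \<Rightarrow> complex) set \<Rightarrow> 'g ctvec \<Rightarrow> 'g \<Rightarrow> 'g tvec" where
  "rho G M T P v g =
     push M (\<lambda>x. g \<otimes>\<^bsub>G\<^esub> x) (Ad G (inv\<^bsub>G\<^esub> g) (pr_g G M T P (Ad G g v)))"

definition maurer_cartan :: "'g monoid \<Rightarrow> ('g, 'e::euclidean_space) mfd \<Rightarrow> 'g \<Rightarrow> 'g tvec \<Rightarrow> 'g tvec" where
  "maurer_cartan G M g u = push M (\<lambda>x. inv\<^bsub>G\<^esub> g \<otimes>\<^bsub>G\<^esub> x) u"

definition theta_covec :: "'g monoid \<Rightarrow> ('g, 'e::euclidean_space) mfd \<Rightarrow> 'g ctvec \<Rightarrow> 'g \<Rightarrow> 'g covec" where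
  "theta_covec G M v g =
     (\<lambda>u. if u \<in> tangent_space M g then pairing G M (cplx (maurer_cartan G M g u)) v else 0)"

definition standard_poisson :: "'g monoid \<Rightarrow> ('g, 'e::euclidean_space) mfd \<Rightarrow> 'g set \<Rightarrow>
    ('g ctvec \<Rightarrow> complex) set \<Rightarrow> 'g bivector \<Rightarrow> bool" where
  "standard_poisson G M T P \<pi> \<longleftrightarrow> poisson_structure M \<pi> \<and>
     (\<forall>g\<in>carrier G. Gr M \<pi> g = {(rho G M T P v g, theta_covec G M v g) |v. v \<in> halg G M T P})"

definition flag_proj :: "'g monoid \<Rightarrow> 'g set \<Rightarrow> 'g \<Rightarrow> 'g set" where
  "flag_proj G T g = g <#\<^bsub>G\<^esub> T"

text \<open>\<open>G/T\<close> is the set of left cosets \<open>g T\<close> in \<open>G\<close>, with a manifold structure \<open>M\<close> that makes it the quotient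
  of \<open>G\<close>.\<close>

definition flag_manifold :: "'g monoid \<Rightarrow> ('g, 'e::euclidean_space) mfd \<Rightarrow> 'g set \<Rightarrow>
    ('g set, 'f::euclidean_space) mfd \<Rightarrow> bool" where
  "flag_manifold G MG T M \<longleftrightarrow> quotient_manifold MG (flag_proj G T) M"

definition flag_poisson :: "'g monoid \<Rightarrow> ('g, 'e::euclidean_space) mfd \<Rightarrow> 'g set \<Rightarrow> 'g bivector \<Rightarrow>
    ('g set, 'f::euclidean_space) mfd \<Rightarrow> 'g set bivector" where
  "flag_poisson G MG T piG M = pushed_poisson MG piG M (flag_proj G T)"

end

theory Submission
  imports Defs "HOL-Computational_Algebra.Fundamental_Theorem_Algebra"
begin

text \<open>Suppose that a vector in the image of \<open>\<pi>\<^sup>\<sharp>\<close> at \<open>g\<close> is tangent to the fibre \<open>g T\<close>. Then it is the left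
  translate of some \<open>u\<close> in the torus algebra with \<open>Ad\<^sub>g (v - u) \<in> \<hh>\<close> for some \<open>v = a + n \<in> \<hh>\<close>. The nilpotent part of
  an element of \<open>\<hh>\<close> does not affect the eigenvalues of its adjoint operator, which are hence real. The
  eigenvalues of \<open>v - u\<close> are therefore real, but they are the values of the roots on \<open>a - u\<close>. By compactness of the
  group the roots are imaginary on the torus algebra, so they vanish on \<open>u\<close>; then \<open>u\<close> is central and
  thus zero. So the image of \<open>\<pi>\<^sup>\<sharp>\<close> meets the tangent spaces of the fibres trivially. By skew-symmetry the
  kernel of \<open>\<pi>\<^sup>\<sharp>\<close> then restricts onto their cotangent spaces, and the fibres are Poisson-Dirac with zero
  structure. Right translation by the torus preserves the graph of \<open>\<pi>\<close> since \<open>Ad\<^sub>t \<hh> = \<hh>\<close>, so brackets of functions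
  pulled back from the flag manifold are again pulled back. That the projection is a submersion is a
  consequence of the existence of a slice for the torus and of Hadamard's lemma.\<close>

section \<open>Smooth maps on Euclidean spaces\<close>

text \<open>Sums of ad-nilpotent elements need not be ad-nilpotent, and an element of the positive
  part is a sum of root vectors. Jacobson's theorem on weakly closed sets, applied to the union of
  the positive root spaces, supplies one descending chain of subspaces along which every positive
  element lowers by a step; eigenvalues are compared along it. Compactness enters through critical
  points on the group of functions built from coordinates of \<open>Ad G s y\<close>: there the
  product rule gives what an invariant inner product would give, namely imaginary eigenvalues and
  equal kernels of ad u and its square. Once all eigenvalues of ad u are zero, the latter forces ad
  u = 0, and the line through u is an abelian ideal. The smooth structure of the quotient is known
  only through its functions, so surjectivity of the tangent map is shown dually: a covector that
  kills the image is the differential of a function with critical pullback, and every tangent vector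
  of the quotient annihilates such a function. Tangent vectors are derivations of global functions;
  cutoffs make them local.\<close>

lemma Ck_on_imp_continuous_on: "Ck_on k S f \<Longrightarrow> continuous_on S f"
proof (cases k)
  case (Suc n)
  assume "Ck_on k S f"
  then show ?thesis
    by (metis Suc Ck_on.simps(2) continuous_at_imp_continuous_on differentiable_imp_continuous_within)
qed simp

lemma Ck_on_SucD: "Ck_on (Suc k) S f \<Longrightarrow> Ck_on k S f"
proof (induction k arbitrary: f)
  case 0
  then show ?case using Ck_on_imp_continuous_on[OF 0] by simp
next
  case (Suc k)
  then show ?case by (metis Ck_on.simps(2))
qed

lemma Ck_on_subset: "Ck_on k S f \<Longrightarrow> S' \<subseteq> S \<Longrightarrow> Ck_on k S' f"
  by (induction k arbitrary: f) (auto intro: continuous_on_subset)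

lemma Ck_on_cong:
  assumes "open S" "\<And>x. x \<in> S \<Longrightarrow> f x = g x" "Ck_on k S f"
  shows "Ck_on k S g"
  using assms(2,3)
proof (induction k arbitrary: f g)
  case 0
  then show ?case using continuous_on_cong by fastforce
next
  case (Suc k)
  have d: "(g has_derivative frechet_derivative f (at x)) (at x)" if "x \<in> S" for x
  proof -
    have "(f has_derivative frechet_derivative f (at x)) (at x)"
      using Suc.prems that by (auto simp: frechet_derivative_works)
    then show ?thesis
      using has_derivative_transform_within_open[OF _ assms(1) that] Suc.prems(1) by blast
  qed
  then have eq: "frechet_derivative f (at x) = frechet_derivative g (at x)" if "x \<in> S" for x
    using frechet_derivative_at that by metis
  have "Ck_on k S (\<lambda>x. frechet_derivative g (at x) v)" for v
    by (rule Suc.IH[of "\<lambda>x. frechet_derivative f (at x) v"]) (use Suc.prems eq in auto)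
  moreover have "g differentiable (at x)" if "x \<in> S" for x
    using d[OF that] differentiable_def by blast
  ultimately show ?case by simp
qed

lemma Ck_on_Suc_has_derivative:
  "Ck_on (Suc k) S f \<Longrightarrow> x \<in> S \<Longrightarrow> (f has_derivative frechet_derivative f (at x)) (at x)"
  by (simp add: frechet_derivative_works)

lemma Ck_on_Suc_derivative:
  "Ck_on (Suc k) S f \<Longrightarrow> Ck_on k S (\<lambda>x. frechet_derivative f (at x) v)"
  by simp

lemma Ck_on_SucI:
  assumes "open S" "\<And>x. x \<in> S \<Longrightarrow> (f has_derivative f' x) (at x)" "\<And>v. Ck_on k S (\<lambda>x. f' x v)"
  shows "Ck_on (Suc k) S f"
proof -
  have "frechet_derivative f (at x) = f' x" if "x \<in> S" for x
    using assms(2) frechet_derivative_at that by metis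
  then show ?thesis
    using assms Ck_on_cong[OF assms(1) _ assms(3)] by (auto simp: differentiable_def)
qed

lemma Ck_on_local:
  "(\<And>x. x \<in> S \<Longrightarrow> \<exists>U. open U \<and> x \<in> U \<and> Ck_on k U f) \<Longrightarrow> Ck_on k S f"
proof (induction k arbitrary: f)
  case 0
  then show ?case
    by (metis Ck_on.simps(1) continuous_at_imp_continuous_on continuous_on_eq_continuous_at)
next
  case (Suc k)
  then show ?case by (metis Ck_on.simps(2))
qed

lemma Ck_on_const: "open S \<Longrightarrow> Ck_on k S (\<lambda>x. c)"
proof (induction k arbitrary: c)
  case (Suc k)
  show ?case by (rule Ck_on_SucI[where f' = "\<lambda>x v. 0"]) (use Suc in auto)
qed simp

lemma Ck_on_bounded_linear: "open S \<Longrightarrow> bounded_linear f \<Longrightarrow> Ck_on k S f"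
proof (cases k)
  case 0
  assume "bounded_linear f"
  then show ?thesis using 0 by (simp add: linear_continuous_on)
next
  case (Suc n)
  assume "open S" "bounded_linear f"
  then show ?thesis unfolding Suc
    by (intro Ck_on_SucI[where f' = "\<lambda>x. f"])
       (auto intro: Ck_on_const bounded_linear_imp_has_derivative)
qed

lemma Ck_on_add: "open S \<Longrightarrow> Ck_on k S f \<Longrightarrow> Ck_on k S g \<Longrightarrow> Ck_on k S (\<lambda>x. f x + g x)"
proof (induction k arbitrary: f g)
  case 0
  then show ?case by (auto intro: continuous_intros)
next
  case (Suc k)
  show ?case
  proof (rule Ck_on_SucI[where f' = "\<lambda>x v. frechet_derivative f (at x) v + frechet_derivative g (at x) v"])
    show "((\<lambda>x. f x + g x) has_derivative
        (\<lambda>v. frechet_derivative f (at x) v + frechet_derivative g (at x) v)) (at x)" if "x \<in> S" for x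
      by (intro has_derivative_add Ck_on_Suc_has_derivative[OF Suc.prems(2) that]
            Ck_on_Suc_has_derivative[OF Suc.prems(3) that])
    show "Ck_on k S (\<lambda>x. frechet_derivative f (at x) v + frechet_derivative g (at x) v)" for v
      using Suc.prems by (intro Suc.IH) simp_all
  qed (fact Suc.prems(1))
qed

lemma Ck_on_sum:
  "open S \<Longrightarrow> (\<And>i. i \<in> I \<Longrightarrow> Ck_on k S (f i)) \<Longrightarrow> Ck_on k S (\<lambda>x. \<Sum>i\<in>I. f i x)"
  by (induction I rule: infinite_finite_induct) (auto intro!: Ck_on_const Ck_on_add)

lemma Ck_on_bilinear:
  assumes "bounded_bilinear p" "open S"
  shows "Ck_on k S f \<Longrightarrow> Ck_on k S g \<Longrightarrow> Ck_on k S (\<lambda>x. p (f x) (g x))"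
proof (induction k arbitrary: f g)
  case 0
  then show ?case using bounded_bilinear.continuous_on[OF assms(1)] by auto
next
  case (Suc k)
  have fg: "Ck_on k S f" "Ck_on k S g" "Ck_on k S (\<lambda>x. frechet_derivative f (at x) v)"
    "Ck_on k S (\<lambda>x. frechet_derivative g (at x) v)" for v
    using Suc.prems Ck_on_SucD by simp_all
  show ?case
  proof (rule Ck_on_SucI[where f' = "\<lambda>x v. p (f x) (frechet_derivative g (at x) v)
              + p (frechet_derivative f (at x) v) (g x)"])
    show "((\<lambda>x. p (f x) (g x)) has_derivative (\<lambda>v. p (f x) (frechet_derivative g (at x) v)
              + p (frechet_derivative f (at x) v) (g x))) (at x)" if "x \<in> S" for x
      by (intro bounded_bilinear.FDERIV[OF assms(1)] Ck_on_Suc_has_derivative[OF Suc.prems(1) that]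
            Ck_on_Suc_has_derivative[OF Suc.prems(2) that])
    show "Ck_on k S (\<lambda>x. p (f x) (frechet_derivative g (at x) v)
              + p (frechet_derivative f (at x) v) (g x))" for v
      by (intro Ck_on_add[OF assms(2)] Suc.IH fg)
  qed (fact assms(2))
qed

text \<open>\<open>Ck_on\<close> tests derivatives in a fixed direction, whereas the chain rule
  applies the derivative of \<open>g\<close> to the moving direction
  \<open>frechet_derivative f (at x) v\<close>. Expanding that direction in \<open>Basis\<close>
  leaves products of components of the derivative of \<open>f\<close> with fixed-direction
  derivatives of \<open>g\<close> composed with \<open>f\<close>, and the induction hypothesis
  applies to the latter.\<close>

lemma Ck_on_compose:
  fixes f :: "'a::euclidean_space \<Rightarrow> 'b::euclidean_space" and g :: "'b \<Rightarrow> 'c::real_normed_vector"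
  assumes "open S" "open R" "f ` S \<subseteq> R"
  shows "Ck_on k S f \<Longrightarrow> Ck_on k R g \<Longrightarrow> Ck_on k S (\<lambda>x. g (f x))"
proof (induction k arbitrary: g)
  case 0
  then show ?case using continuous_on_compose2[of R g S f] assms(3) by simp
next
  case (Suc k)
  note df = Ck_on_Suc_has_derivative[OF Suc.prems(1)]
  note dg = Ck_on_Suc_has_derivative[OF Suc.prems(2)]
  have lin: "linear (frechet_derivative g (at x))" if "x \<in> R" for x
    using dg[OF that] has_derivative_linear by blast
  define f' where "f' x v = (\<Sum>b\<in>Basis. (frechet_derivative f (at x) v \<bullet> b) *\<^sub>R frechet_derivative g (at (f x)) b)" for x v
  have eq: "frechet_derivative g (at (f x)) w = (\<Sum>b\<in>Basis. (w \<bullet> b) *\<^sub>R frechet_derivative g (at (f x)) b)"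
    if "x \<in> S" for x w
  proof -
    have "f x \<in> R" using that assms by auto
    then have "frechet_derivative g (at (f x)) (\<Sum>b\<in>Basis. (w \<bullet> b) *\<^sub>R b) = (\<Sum>b\<in>Basis. (w \<bullet> b) *\<^sub>R frechet_derivative g (at (f x)) b)"
      by (simp add: linear_sum[OF lin[OF \<open>f x \<in> R\<close>]] linear_scale[OF lin[OF \<open>f x \<in> R\<close>]])
    then show ?thesis by (simp add: euclidean_representation)
  qed
  show ?case
  proof (rule Ck_on_SucI[where f' = f', OF assms(1)])
    fix x assume "x \<in> S"
    then have "((\<lambda>x. g (f x)) has_derivative (\<lambda>v. frechet_derivative g (at (f x)) (frechet_derivative f (at x) v))) (at x)"
      using diff_chain_at[of f "frechet_derivative f (at x)" x g "frechet_derivative g (at (f x))"]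
        df[of x] dg[of "f x"] assms(3) by (simp add: o_def image_subset_iff)
    moreover have "(\<lambda>v. frechet_derivative g (at (f x)) (frechet_derivative f (at x) v)) = f' x"
      unfolding f'_def by (rule ext) (rule eq[OF \<open>x \<in> S\<close>])
    ultimately show "((\<lambda>x. g (f x)) has_derivative f' x) (at x)" by simp
  next
    fix v
    have "Ck_on k S (\<lambda>x. frechet_derivative f (at x) v \<bullet> b)" for b
      by (intro Ck_on_bilinear[OF bounded_bilinear_inner assms(1)] Ck_on_const assms
            Ck_on_Suc_derivative[OF Suc.prems(1)])
    moreover have "Ck_on k S (\<lambda>x. frechet_derivative g (at (f x)) b)" for b
      using Suc.prems Ck_on_SucD[OF Suc.prems(1)] by (intro Suc.IH) simp_all
    ultimately show "Ck_on k S (\<lambda>x. f' x v)"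
      unfolding f'_def
      by (intro Ck_on_sum Ck_on_bilinear[OF bounded_bilinear_scaleR] assms(1))
  qed
qed

section \<open>Calculus of \<open>smooth_on\<close>: locality, composition, algebraic
  operations\<close>

lemma smooth_on_openI:
  "open S \<Longrightarrow> (\<And>k. Ck_on k S f) \<Longrightarrow> smooth_on S f"
  unfolding smooth_on_def by (intro ballI exI[of _ S] exI[of _ f]) auto

lemma smooth_on_imp_Ck_on:
  assumes "open S" "smooth_on S f"
  shows "Ck_on k S f"
proof (rule Ck_on_local)
  fix x assume "x \<in> S"
  then obtain U F where U: "open U" "x \<in> U" "\<And>k. Ck_on k U F" "\<And>y. y \<in> S \<inter> U \<Longrightarrow> F y = f y"
    using assms(2) unfolding smooth_on_def by meson
  have "open (S \<inter> U)" "x \<in> S \<inter> U" using U(1,2) assms(1) \<open>x \<in> S\<close> by auto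
  moreover have "Ck_on k (S \<inter> U) f"
  proof (rule Ck_on_cong[where f = F])
    show "Ck_on k (S \<inter> U) F" by (rule Ck_on_subset[OF U(3)]) simp
  qed (use U(4) \<open>open (S \<inter> U)\<close> in \<open>simp_all only:\<close>)
  ultimately show "\<exists>V. open V \<and> x \<in> V \<and> Ck_on k V f" by (intro exI conjI)
qed

lemma smooth_on_open: "open S \<Longrightarrow> smooth_on S f \<longleftrightarrow> (\<forall>k. Ck_on k S f)"
proof (intro iffI allI)
  assume "open S" "smooth_on S f"
  then show "Ck_on k S f" for k by (rule smooth_on_imp_Ck_on)
next
  assume S: "open S" and f: "\<forall>k. Ck_on k S f"
  show "smooth_on S f" by (rule smooth_on_openI[OF S]) (rule spec[OF f])
qed

lemma smooth_onE:
  assumes "smooth_on S f" "x \<in> S"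
  obtains U F where "open U" "x \<in> U" "\<And>k. Ck_on k U F" "\<And>y. y \<in> S \<inter> U \<Longrightarrow> F y = f y"
  using assms unfolding smooth_on_def by meson

lemma smooth_onI:
  assumes "\<And>x. x \<in> S \<Longrightarrow> \<exists>U F. open U \<and> x \<in> U \<and> (\<forall>k. Ck_on k U F) \<and> (\<forall>y\<in>S \<inter> U. F y = f y)"
  shows "smooth_on S f"
  unfolding smooth_on_def by (rule ballI) (rule assms)

lemma smooth_on_subset:
  assumes "smooth_on S f" "S' \<subseteq> S"
  shows "smooth_on S' f"
proof (rule smooth_onI)
  fix x assume "x \<in> S'"
  with assms obtain U F where U: "open U" "x \<in> U" "\<And>k. Ck_on k U F" "\<And>y. y \<in> S \<inter> U \<Longrightarrow> F y = f y"
    by (elim smooth_onE[of S f x]) auto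
  then have "\<forall>y\<in>S' \<inter> U. F y = f y" using assms(2) by (simp add: subset_iff)
  then show "\<exists>U F. open U \<and> x \<in> U \<and> (\<forall>k. Ck_on k U F) \<and> (\<forall>y\<in>S' \<inter> U. F y = f y)"
    using U(1-3) by (intro exI conjI allI)
qed

lemma smooth_on_cong:
  assumes "smooth_on S f" "\<And>x. x \<in> S \<Longrightarrow> f x = g x"
  shows "smooth_on S g"
  unfolding smooth_on_def
proof
  fix x assume "x \<in> S"
  then obtain U F where U: "open U" "x \<in> U" "\<forall>k. Ck_on k U F" "\<forall>y\<in>S \<inter> U. F y = f y"
    using assms(1) unfolding smooth_on_def by meson
  then have "\<forall>y\<in>S \<inter> U. F y = g y" using assms(2) by simp
  then show "\<exists>O' F. open O' \<and> x \<in> O' \<and> (\<forall>k. Ck_on k O' F) \<and> (\<forall>y\<in>S \<inter> O'. F y = g y)"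
    using U by (intro exI conjI)
qed

lemma smooth_on_local:
  assumes "\<And>x. x \<in> S \<Longrightarrow> \<exists>U. open U \<and> x \<in> U \<and> smooth_on (S \<inter> U) f"
  shows "smooth_on S f"
  unfolding smooth_on_def
proof
  fix x assume "x \<in> S"
  then obtain U where U: "open U" "x \<in> U" "smooth_on (S \<inter> U) f" using assms by blast
  then obtain V F where V: "open V" "x \<in> V" "\<And>k. Ck_on k V F" "\<And>y. y \<in> S \<inter> U \<inter> V \<Longrightarrow> F y = f y"
    using \<open>x \<in> S\<close> unfolding smooth_on_def by (metis Int_iff)
  show "\<exists>O' F. open O' \<and> x \<in> O' \<and> (\<forall>k. Ck_on k O' F) \<and> (\<forall>y\<in>S \<inter> O'. F y = f y)"
    using U(1,2) V(1,2,4) Ck_on_subset[OF V(3), of "U \<inter> V"]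
    by (intro exI[of _ "U \<inter> V"] exI[of _ F] conjI allI open_Int) simp_all
qed

lemma smooth_on_compose:
  fixes f :: "'a::euclidean_space \<Rightarrow> 'b::euclidean_space" and g :: "'b \<Rightarrow> 'c::real_normed_vector"
  assumes "smooth_on S f" "smooth_on R g" "f ` S \<subseteq> R"
  shows "smooth_on S (\<lambda>x. g (f x))"
  unfolding smooth_on_def
proof
  fix x assume x: "x \<in> S"
  then obtain U F where U: "open U" "x \<in> U" "\<And>k. Ck_on k U F" "\<And>y. y \<in> S \<inter> U \<Longrightarrow> F y = f y"
    using assms(1) unfolding smooth_on_def by meson
  have "f x \<in> R" using x assms by auto
  then obtain V H where V: "open V" "f x \<in> V" "\<And>k. Ck_on k V H" "\<And>y. y \<in> R \<inter> V \<Longrightarrow> H y = g y"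
    using assms(2) unfolding smooth_on_def by meson
  define W where "W = U \<inter> F -` V"
  have W: "open W" unfolding W_def
    using U V Ck_on_imp_continuous_on continuous_open_preimage by blast
  have "Ck_on k W (\<lambda>x. H (F x))" for k
    by (rule Ck_on_compose[OF W V(1) _ Ck_on_subset[OF U(3)] V(3)]) (auto simp: W_def)
  moreover have "x \<in> W" using x U V by (auto simp: W_def)
  moreover have "H (F y) = g (f y)" if "y \<in> S \<inter> W" for y
    using that U V assms by (auto simp: W_def)
  ultimately show "\<exists>O' F. open O' \<and> x \<in> O' \<and> (\<forall>k. Ck_on k O' F) \<and> (\<forall>y\<in>S \<inter> O'. F y = g (f y))"
    using W by (intro exI[of _ W] exI[of _ "\<lambda>x. H (F x)"]) auto
qed

lemma smooth_on_const: "smooth_on S (\<lambda>x. c)"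
  by (rule smooth_on_subset[OF smooth_on_openI[OF open_UNIV]]) (auto intro: Ck_on_const)

lemma smooth_on_bounded_linear: "bounded_linear f \<Longrightarrow> smooth_on S f"
  by (rule smooth_on_subset[OF smooth_on_openI[OF open_UNIV]]) (auto intro: Ck_on_bounded_linear)

lemma smooth_on_id: "smooth_on S (\<lambda>x. x)"
  using smooth_on_bounded_linear bounded_linear_ident by blast

lemma smooth_on_bilinear:
  assumes p: "bounded_bilinear p" and "smooth_on S f" "smooth_on S g"
  shows "smooth_on S (\<lambda>x. p (f x) (g x))"
  unfolding smooth_on_def
proof
  fix x assume x: "x \<in> S"
  then obtain U F where U: "open U" "x \<in> U" "\<And>k. Ck_on k U F" "\<And>y. y \<in> S \<inter> U \<Longrightarrow> F y = f y"
    using assms(2) unfolding smooth_on_def by meson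
  obtain V H where V: "open V" "x \<in> V" "\<And>k. Ck_on k V H" "\<And>y. y \<in> S \<inter> V \<Longrightarrow> H y = g y"
    using x assms(3) unfolding smooth_on_def by meson
  have "Ck_on k (U \<inter> V) (\<lambda>x. p (F x) (H x))" for k
    using U V Ck_on_subset[OF U(3)] Ck_on_subset[OF V(3)] by (intro Ck_on_bilinear[OF p]) auto
  then show "\<exists>O' F. open O' \<and> x \<in> O' \<and> (\<forall>k. Ck_on k O' F) \<and> (\<forall>y\<in>S \<inter> O'. F y = p (f y) (g y))"
    using U V by (intro exI[of _ "U \<inter> V"] exI[of _ "\<lambda>x. p (F x) (H x)"]) auto
qed

lemma smooth_on_add:
  assumes "smooth_on S f" "smooth_on S g"
  shows "smooth_on S (\<lambda>x. f x + g x)"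
  unfolding smooth_on_def
proof
  fix x assume x: "x \<in> S"
  then obtain U F where U: "open U" "x \<in> U" "\<And>k. Ck_on k U F" "\<And>y. y \<in> S \<inter> U \<Longrightarrow> F y = f y"
    using assms(1) unfolding smooth_on_def by meson
  obtain V H where V: "open V" "x \<in> V" "\<And>k. Ck_on k V H" "\<And>y. y \<in> S \<inter> V \<Longrightarrow> H y = g y"
    using x assms(2) unfolding smooth_on_def by meson
  have "Ck_on k (U \<inter> V) (\<lambda>x. F x + H x)" for k
    using U V Ck_on_subset[OF U(3)] Ck_on_subset[OF V(3)] by (intro Ck_on_add) auto
  then show "\<exists>O' F. open O' \<and> x \<in> O' \<and> (\<forall>k. Ck_on k O' F) \<and> (\<forall>y\<in>S \<inter> O'. F y = f y + g y)"
    using U V by (intro exI[of _ "U \<inter> V"] exI[of _ "\<lambda>x. F x + H x"]) auto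
qed

lemmas smooth_on_scaleR = smooth_on_bilinear[OF bounded_bilinear_scaleR]
  and smooth_on_mult = smooth_on_bilinear[OF bounded_bilinear_mult]
  and smooth_on_inner = smooth_on_bilinear[OF bounded_bilinear_inner]

lemma smooth_on_sum:
  "(\<And>i. i \<in> I \<Longrightarrow> smooth_on S (f i)) \<Longrightarrow> smooth_on S (\<lambda>x. \<Sum>i\<in>I. f i x)"
  by (induction I rule: infinite_finite_induct) (auto intro!: smooth_on_const smooth_on_add)

lemma smooth_on_componentwise:
  fixes f :: "'a::euclidean_space \<Rightarrow> 'b::euclidean_space"
  assumes "\<And>b. b \<in> Basis \<Longrightarrow> smooth_on S (\<lambda>x. f x \<bullet> b)"
  shows "smooth_on S f"
proof -
  have "smooth_on S (\<lambda>x. \<Sum>b\<in>Basis. (f x \<bullet> b) *\<^sub>R b)"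
    using assms by (intro smooth_on_sum smooth_on_scaleR smooth_on_const) auto
  then show ?thesis by (simp add: euclidean_representation)
qed

lemma smooth_on_minus: "smooth_on S f \<Longrightarrow> smooth_on S (\<lambda>x. - f x)"
  using smooth_on_scaleR[OF smooth_on_const[of S "-1"]] by auto

lemma smooth_on_diff: "smooth_on S f \<Longrightarrow> smooth_on S g \<Longrightarrow> smooth_on S (\<lambda>x. f x - g x)"
  using smooth_on_add[OF _ smooth_on_minus] by fastforce

lemma smooth_on_Pair:
  fixes f :: "'a::euclidean_space \<Rightarrow> 'b::euclidean_space" and g :: "'a \<Rightarrow> 'c::euclidean_space"
  assumes "smooth_on S f" "smooth_on S g"
  shows "smooth_on S (\<lambda>x. (f x, g x))"
proof (rule smooth_on_componentwise[where f = "\<lambda>x. (f x, g x)"])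
  fix b :: "'b \<times> 'c"
  have "smooth_on S (\<lambda>x. f x \<bullet> fst b + g x \<bullet> snd b)"
    by (intro smooth_on_add smooth_on_inner smooth_on_const assms)
  then show "smooth_on S (\<lambda>x. (f x, g x) \<bullet> b)" by (simp add: inner_prod_def)
qed

lemma smooth_on_derivative:
  assumes "open S" "smooth_on S f"
  shows "smooth_on S (\<lambda>x. frechet_derivative f (at x) v)"
  using assms smooth_on_open Ck_on_Suc_derivative by metis

lemma smooth_on_has_derivative:
  assumes "open S" "smooth_on S f" "x \<in> S"
  shows "(f has_derivative frechet_derivative f (at x)) (at x)"
  using assms smooth_on_open Ck_on_Suc_has_derivative by metis

lemma smooth_on_imp_continuous_on:
  assumes "smooth_on S f"
  shows "continuous_on S f"
proof (subst continuous_on_eq_continuous_within, intro ballI)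
  fix x assume x: "x \<in> S"
  obtain U F where U: "open U" "x \<in> U" "\<And>k. Ck_on k U F" "\<And>y. y \<in> S \<inter> U \<Longrightarrow> F y = f y"
    using smooth_onE[OF assms x] by metis
  have "isCont F x"
    using Ck_on_imp_continuous_on[OF U(3)[of 0]] U(1,2) by (simp add: continuous_on_eq_continuous_at)
  then have F: "continuous (at x within S) F" by (rule continuous_at_imp_continuous_at_within)
  obtain d where d: "d > 0" "ball x d \<subseteq> U"
    using U(1,2) by (meson openE)
  have "F y = f y" if "y \<in> S" "dist y x < d" for y
  proof (rule U(4))
    have "y \<in> ball x d" using that by (simp add: dist_commute)
    then show "y \<in> S \<inter> U" using d(2) that(1) by auto
  qed
  then show "continuous (at x within S) f"
    by (rule continuous_transform_within[OF F d(1) x])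
qed

section \<open>Directional derivatives, their symmetry, and Hadamard's lemma\<close>

abbreviation dd :: "('a::euclidean_space \<Rightarrow> 'b::real_normed_vector) \<Rightarrow> 'a \<Rightarrow> 'a \<Rightarrow> 'b" where
  "dd f v \<equiv> (\<lambda>x. frechet_derivative f (at x) v)"

lemma linear_basis_repr:
  fixes L :: "'a::euclidean_space \<Rightarrow> 'b::real_vector"
  assumes "linear L"
  shows "L w = (\<Sum>b\<in>Basis. (w \<bullet> b) *\<^sub>R L b)"
proof -
  have "L w = L (\<Sum>b\<in>Basis. (w \<bullet> b) *\<^sub>R b)" by (simp only: euclidean_representation)
  then show ?thesis by (simp only: linear_sum[OF assms] linear_scale[OF assms])
qed

lemma dd_along_line:
  fixes f :: "'a::euclidean_space \<Rightarrow> real"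
  assumes "open S" "smooth_on S f" "p + s *\<^sub>R u \<in> S"
  shows "((\<lambda>s. f (p + s *\<^sub>R u)) has_real_derivative dd f u (p + s *\<^sub>R u)) (at s)"
proof -
  let ?D = "frechet_derivative f (at (p + s *\<^sub>R u))"
  note d = smooth_on_has_derivative[OF assms]
  have "((\<lambda>s. p + s *\<^sub>R u) has_derivative (\<lambda>t. t *\<^sub>R u)) (at s)"
    by (auto intro!: derivative_eq_intros)
  from diff_chain_at[OF this d] have "((\<lambda>s. f (p + s *\<^sub>R u)) has_derivative (\<lambda>t. ?D (t *\<^sub>R u))) (at s)"
    by (simp add: o_def)
  moreover have "(\<lambda>t. ?D (t *\<^sub>R u)) = (*) (?D u)"
    by (rule ext) (simp add: linear_scale[OF has_derivative_linear[OF d]] mult.commute)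
  ultimately show ?thesis by (simp add: has_field_derivative_def)
qed

text \<open>Two applications of the mean value theorem: along \<open>u\<close> to the increment in
  direction \<open>v\<close>, then along \<open>v\<close> to the resulting difference of values of
  \<open>dd f u\<close>.\<close>

lemma second_difference:
  fixes f :: "'a::euclidean_space \<Rightarrow> real"
  assumes S: "open S" "smooth_on S f" and h: "h > 0"
    and in_S: "\<And>s t. 0 \<le> s \<Longrightarrow> s \<le> h \<Longrightarrow> 0 \<le> t \<Longrightarrow> t \<le> h \<Longrightarrow> x + s *\<^sub>R u + t *\<^sub>R v \<in> S"
  shows "\<exists>s t. 0 \<le> s \<and> s \<le> h \<and> 0 \<le> t \<and> t \<le> h \<and>
     f (x + h *\<^sub>R u + h *\<^sub>R v) - f (x + h *\<^sub>R u) - f (x + h *\<^sub>R v) + f x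
       = h * h * dd (dd f u) v (x + s *\<^sub>R u + t *\<^sub>R v)"
proof -
  define p where "p s = f ((x + h *\<^sub>R v) + s *\<^sub>R u) - f (x + s *\<^sub>R u)" for s
  define p' where "p' s = dd f u ((x + h *\<^sub>R v) + s *\<^sub>R u) - dd f u (x + s *\<^sub>R u)" for s
  have in1: "(x + h *\<^sub>R v) + s *\<^sub>R u \<in> S" "x + s *\<^sub>R u \<in> S" if "0 \<le> s" "s \<le> h" for s
    using in_S[of s h] in_S[of s 0] that h by (simp_all add: algebra_simps)
  have "DERIV p s :> p' s" if "0 \<le> s" "s \<le> h" for s
    unfolding p_def p'_def
    by (rule DERIV_diff[OF dd_along_line[OF S in1(1)[OF that]] dd_along_line[OF S in1(2)[OF that]]])
  then obtain s where s: "0 < s" "s < h" "p h - p 0 = (h - 0) * p' s"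
    using MVT2[OF h, of p p'] by metis
  note S' = S(1) smooth_on_derivative[OF S, of u]
  have in2: "(x + s *\<^sub>R u) + t *\<^sub>R v \<in> S" if "0 \<le> t" "t \<le> h" for t
    using in_S[of s t] that s by simp
  obtain t where t: "0 < t" "t < h"
    "dd f u ((x + s *\<^sub>R u) + h *\<^sub>R v) - dd f u ((x + s *\<^sub>R u) + 0 *\<^sub>R v)
       = (h - 0) * dd (dd f u) v ((x + s *\<^sub>R u) + t *\<^sub>R v)"
    using MVT2[OF h, of "\<lambda>t. dd f u ((x + s *\<^sub>R u) + t *\<^sub>R v)" "\<lambda>t. dd (dd f u) v ((x + s *\<^sub>R u) + t *\<^sub>R v)"]
      dd_along_line[OF S' in2] by metis
  have "p h - p 0 = h * (h * dd (dd f u) v ((x + s *\<^sub>R u) + t *\<^sub>R v))"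
    using s(3) t(3) by (simp add: p'_def add_ac)
  then have "f (x + h *\<^sub>R u + h *\<^sub>R v) - f (x + h *\<^sub>R u) - f (x + h *\<^sub>R v) + f x
       = h * h * dd (dd f u) v (x + s *\<^sub>R u + t *\<^sub>R v)"
    by (simp add: p_def algebra_simps)
  then show ?thesis using s t by (intro exI[of _ s] exI[of _ t]) simp
qed

text \<open>The second difference is symmetric in \<open>u\<close> and \<open>v\<close>, so by
  \<open>second_difference\<close> some value of \<open>?F\<close> near \<open>x\<close> equals some
  value of \<open>?G\<close> near \<open>x\<close>; both are continuous at \<open>x\<close>.\<close>

lemma second_derivative_symmetric:
  fixes f :: "'a::euclidean_space \<Rightarrow> real"
  assumes S: "open S" "smooth_on S f" and x: "x \<in> S"
  shows "dd (dd f u) v x = dd (dd f v) u x"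
proof -
  let ?F = "dd (dd f u) v" and ?G = "dd (dd f v) u"
  have c: "isCont ?F x" "isCont ?G x"
    using smooth_on_imp_continuous_on[OF smooth_on_derivative[OF S(1) smooth_on_derivative[OF S]]] S x
    by (simp_all add: continuous_on_eq_continuous_at)
  have "\<bar>?F x - ?G x\<bar> \<le> e" if e: "e > 0" for e
  proof -
    obtain d1 where d1: "d1 > 0" "\<And>y. dist y x < d1 \<Longrightarrow> dist (?F y) (?F x) < e / 2"
      using c(1)[unfolded continuous_at_eps_delta] e by (metis half_gt_zero)
    obtain d2 where d2: "d2 > 0" "\<And>y. dist y x < d2 \<Longrightarrow> dist (?G y) (?G x) < e / 2"
      using c(2)[unfolded continuous_at_eps_delta] e by (metis half_gt_zero)
    obtain d3 where d3: "d3 > 0" "ball x d3 \<subseteq> S" using S x by (meson openE)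
    define d where "d = min d1 (min d2 d3)"
    \<comment> \<open>The summand 1 keeps \<open>N\<close> positive when both directions vanish.
      With the \<open>h\<close> below, the whole parallelogram stays within distance
      \<open>d\<close> of \<open>x\<close>.\<close>
    define N where "N = norm u + norm v + 1"
    define h where "h = d / (2 * N)"
    have d: "d > 0" using d1 d2 d3 by (simp add: d_def)
    have n: "N > 0" by (simp add: N_def add_nonneg_pos)
    have h: "h > 0" using d n by (simp add: h_def)
    have hd: "h * N < d" using d n by (simp add: h_def)
    have near: "dist (x + s *\<^sub>R u + t *\<^sub>R v) x < d" if "0 \<le> s" "s \<le> h" "0 \<le> t" "t \<le> h" for s t
    proof -
      have "dist (x + s *\<^sub>R u + t *\<^sub>R v) x \<le> s * norm u + t * norm v"
        using norm_triangle_ineq[of "s *\<^sub>R u" "t *\<^sub>R v"] that by (simp add: dist_norm)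
      also have "\<dots> \<le> h * norm u + h * norm v"
        using that by (intro add_mono mult_right_mono) auto
      also have "\<dots> \<le> h * N" using h by (simp add: N_def algebra_simps)
      finally show ?thesis using hd by simp
    qed
    have in_S: "x + s *\<^sub>R u + t *\<^sub>R v \<in> S" if "0 \<le> s" "s \<le> h" "0 \<le> t" "t \<le> h" for s t
      using near[OF that] d3 by (auto simp: d_def dist_commute subset_iff)
    have in_S': "x + s *\<^sub>R v + t *\<^sub>R u \<in> S" if "0 \<le> s" "s \<le> h" "0 \<le> t" "t \<le> h" for s t
      using in_S[of t s] that by (simp add: add_ac)
    obtain s t where st: "0 \<le> s" "s \<le> h" "0 \<le> t" "t \<le> h"
     "f (x + h *\<^sub>R u + h *\<^sub>R v) - f (x + h *\<^sub>R u) - f (x + h *\<^sub>R v) + f x = h * h * ?F (x + s *\<^sub>R u + t *\<^sub>R v)"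
      using second_difference[OF S h in_S] by blast
    obtain s' t' where st': "0 \<le> s'" "s' \<le> h" "0 \<le> t'" "t' \<le> h"
     "f (x + h *\<^sub>R v + h *\<^sub>R u) - f (x + h *\<^sub>R v) - f (x + h *\<^sub>R u) + f x = h * h * ?G (x + s' *\<^sub>R v + t' *\<^sub>R u)"
      using second_difference[OF S h in_S'] by blast
    have e: "x + h *\<^sub>R v + h *\<^sub>R u = x + h *\<^sub>R u + h *\<^sub>R v"
      "x + s' *\<^sub>R v + t' *\<^sub>R u = x + t' *\<^sub>R u + s' *\<^sub>R v" by (simp_all add: add_ac)
    have "h * h * ?F (x + s *\<^sub>R u + t *\<^sub>R v) = h * h * ?G (x + t' *\<^sub>R u + s' *\<^sub>R v)"
      using st(5) st'(5)[unfolded e] by linarith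
    then have "?F (x + s *\<^sub>R u + t *\<^sub>R v) = ?G (x + t' *\<^sub>R u + s' *\<^sub>R v)" using h by simp
    moreover have "dist (?F (x + s *\<^sub>R u + t *\<^sub>R v)) (?F x) < e / 2"
      using near[OF st(1-4)] by (intro d1(2)) (simp add: d_def)
    moreover have "dist (?G (x + t' *\<^sub>R u + s' *\<^sub>R v)) (?G x) < e / 2"
      using near[OF st'(3,4,1,2)] by (intro d2(2)) (simp add: d_def)
    ultimately show ?thesis unfolding dist_real_def by linarith
  qed
  then have "\<bar>?F x - ?G x\<bar> \<le> 0" by (rule field_le_epsilon) simp
  then show ?thesis by simp
qed

text \<open>Differentiation under the integral sign. The inner derivative contributes a factor
  \<open>t\<close>, so the weight \<open>t ^ j\<close> makes the family of these integrals closed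
  under differentiation, which the induction for smoothness uses.\<close>

lemma segment_integral_has_derivative:
  fixes h :: "'a::euclidean_space \<Rightarrow> real"
  assumes S: "open S" "convex S" "a \<in> S" "smooth_on S h" and x: "x \<in> S"
  shows "((\<lambda>x. integral {0..1} (\<lambda>t. t ^ j * h (a + t *\<^sub>R (x - a)))) has_derivative
     (\<lambda>v. integral {0..1} (\<lambda>t. t ^ Suc j * dd h v (a + t *\<^sub>R (x - a))))) (at x)"
proof -
  have in_S: "a + t *\<^sub>R (y - a) \<in> S" if "y \<in> S" "0 \<le> t" "t \<le> 1" for y t
    using convexD_alt[OF S(2) S(3) that(1), of t] that by (simp add: algebra_simps)
  \<comment> \<open>The derivative in \<open>x\<close> as a bounded linear map, the form that
    \<open>leibniz_rule\<close> asks for. The expansion in \<open>Basis\<close> reduces its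
    continuity in both variables to that of the partial derivatives.\<close>
  define fx where "fx x t = (\<Sum>b\<in>Basis. (t ^ Suc j * dd h b (a + t *\<^sub>R (x - a))) *\<^sub>R blinfun_inner_left b)" for x t
  have lin: "linear (frechet_derivative h (at y))" if "y \<in> S" for y
    using smooth_on_has_derivative[OF S(1,4) that] has_derivative_linear by metis
  note repr = linear_basis_repr[OF lin, unfolded real_scaleR_def]
  have fx: "blinfun_apply (fx y t) v = t ^ Suc j * dd h v (a + t *\<^sub>R (y - a))"
    if "y \<in> S" "0 \<le> t" "t \<le> 1" for y t v
    unfolding repr[OF in_S[OF that], of v] fx_def
    by (simp add: blinfun.sum_left blinfun.scaleR_left sum_distrib_left inner_commute mult_ac)
  have seg: "continuous_on (S \<times> cbox 0 1) (\<lambda>(y, t). a + t *\<^sub>R (y - a))"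
    by (auto intro!: continuous_intros simp: split_beta)
  have seg_in: "(\<lambda>(y, t). a + t *\<^sub>R (y - a)) ` (S \<times> cbox 0 1) \<subseteq> S"
    using in_S by (auto simp: image_subset_iff)
  have c1: "continuous_on (S \<times> cbox 0 1) (\<lambda>(y, t). k (a + t *\<^sub>R (y - a)))" if "smooth_on S k" for k :: "'a \<Rightarrow> real"
    using continuous_on_compose2[OF smooth_on_imp_continuous_on[OF that] seg seg_in] by (simp add: split_beta)
  have c2: "continuous_on (cbox 0 1) (\<lambda>t. k (a + t *\<^sub>R (y - a)))" if "smooth_on S k" "y \<in> S" for k :: "'a \<Rightarrow> real" and y
    by (rule continuous_on_compose2[OF smooth_on_imp_continuous_on[OF that(1)], where f = "\<lambda>t. a + t *\<^sub>R (y - a)"])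
       (use in_S that in \<open>auto intro!: continuous_intros\<close>)
  have d: "((\<lambda>x. integral (cbox 0 1) (\<lambda>t. t ^ j * h (a + t *\<^sub>R (x - a)))) has_derivative integral (cbox 0 1) (fx x)) (at x within S)"
  proof (rule leibniz_rule)
    fix y and t :: real assume y: "y \<in> S" "t \<in> cbox 0 1"
    then have t: "0 \<le> t" "t \<le> 1" by simp_all
    have "((\<lambda>y. a + t *\<^sub>R (y - a)) has_derivative (\<lambda>v. t *\<^sub>R v)) (at y)"
      by (auto intro!: derivative_eq_intros)
    from diff_chain_at[OF this smooth_on_has_derivative[OF S(1,4) in_S[OF y(1) t]]]
    have "((\<lambda>y. h (a + t *\<^sub>R (y - a))) has_derivative (\<lambda>v. frechet_derivative h (at (a + t *\<^sub>R (y - a))) (t *\<^sub>R v))) (at y)"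
      by (simp add: o_def)
    then have "((\<lambda>y. t ^ j * h (a + t *\<^sub>R (y - a))) has_derivative (\<lambda>v. t ^ j * frechet_derivative h (at (a + t *\<^sub>R (y - a))) (t *\<^sub>R v))) (at y)"
      by (rule has_derivative_mult_right)
    moreover have "(\<lambda>v. t ^ j * frechet_derivative h (at (a + t *\<^sub>R (y - a))) (t *\<^sub>R v)) = blinfun_apply (fx y t)"
      by (rule ext) (simp add: fx[OF y(1) t] linear_scale[OF lin[OF in_S[OF y(1) t]]])
    ultimately show "((\<lambda>x. t ^ j * h (a + t *\<^sub>R (x - a))) has_derivative blinfun_apply (fx y t)) (at y within S)"
      by (simp add: has_derivative_at_withinI)
  next
    fix y assume "y \<in> S"
    then show "(\<lambda>t. t ^ j * h (a + t *\<^sub>R (y - a))) integrable_on cbox 0 1"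
      using c2[OF S(4)] by (intro integrable_continuous continuous_intros) auto
  next
    have "continuous_on (S \<times> cbox 0 1) (\<lambda>p. \<Sum>b\<in>Basis. (snd p ^ Suc j * dd h b (a + snd p *\<^sub>R (fst p - a))) *\<^sub>R blinfun_inner_left b)"
      using c1[OF smooth_on_derivative[OF S(1,4)]]
      by (intro continuous_on_sum continuous_on_scaleR continuous_on_mult continuous_on_power
            continuous_on_snd continuous_on_id continuous_on_const) (simp add: split_beta)
    then show "continuous_on (S \<times> cbox 0 1) (\<lambda>(x, t). fx x t)"
      unfolding fx_def by (simp add: split_beta)
  qed (use S x in auto)
  have "(\<lambda>v. integral {0..1} (\<lambda>t. t ^ Suc j * dd h v (a + t *\<^sub>R (x - a)))) = blinfun_apply (integral (cbox 0 1) (fx x))"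
  proof
    fix v
    have "fx x integrable_on cbox 0 1"
    proof (rule integrable_continuous)
      show "continuous_on (cbox 0 1) (fx x)"
        unfolding fx_def using c2[OF smooth_on_derivative[OF S(1,4)] x]
        by (intro continuous_on_sum continuous_on_scaleR continuous_on_mult continuous_on_power
            continuous_on_id continuous_on_const)
    qed
    then have "blinfun_apply (integral (cbox 0 1) (fx x)) v = integral (cbox 0 1) (\<lambda>t. blinfun_apply (fx x t) v)"
      by (rule blinfun_apply_integral)
    also have "\<dots> = integral {0..1} (\<lambda>t. t ^ Suc j * dd h v (a + t *\<^sub>R (x - a)))"
      unfolding cbox_interval by (intro integral_cong fx[OF x]) simp_all
    finally show "integral {0..1} (\<lambda>t. t ^ Suc j * dd h v (a + t *\<^sub>R (x - a))) = blinfun_apply (integral (cbox 0 1) (fx x)) v" ..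
  qed
  with d show ?thesis
    using at_within_open[OF x S(1)] by (simp add: cbox_interval)
qed

lemma smooth_on_segment_integral:
  fixes h :: "'a::euclidean_space \<Rightarrow> real"
  assumes S: "open S" "convex S" "a \<in> S" "smooth_on S h"
  shows "smooth_on S (\<lambda>x. integral {0..1} (\<lambda>t. t ^ j * h (a + t *\<^sub>R (x - a))))"
proof (rule smooth_on_openI[OF S(1)])
  fix k show "Ck_on k S (\<lambda>x. integral {0..1} (\<lambda>t. t ^ j * h (a + t *\<^sub>R (x - a))))"
    using S(4)
  proof (induction k arbitrary: j h)
    case 0
    have "isCont (\<lambda>x. integral {0..1} (\<lambda>t. t ^ j * h (a + t *\<^sub>R (x - a)))) x" if "x \<in> S" for x
      using segment_integral_has_derivative[OF S(1-3) 0 that] by (rule has_derivative_continuous)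
    then show ?case by (simp add: continuous_at_imp_continuous_on)
  next
    case (Suc k)
    show ?case
      by (rule Ck_on_SucI[OF S(1) segment_integral_has_derivative[OF S(1-3) Suc.prems]])
         (assumption, rule Suc.IH[OF smooth_on_derivative[OF S(1) Suc.prems]])
  qed
qed

text \<open>The fundamental theorem of calculus along the segment from \<open>a\<close> to
  \<open>x\<close>: the coefficient \<open>g b\<close> is the mean of \<open>dd f b\<close> over
  that segment. The factor \<open>t ^ 0\<close> in its definition matches the family of segment
  integrals above.\<close>

lemma hadamard:
  fixes f :: "'a::euclidean_space \<Rightarrow> real"
  assumes S: "open S" "convex S" "a \<in> S" "smooth_on S f"
  obtains g where "\<And>b. smooth_on S (g b)" "\<And>b. g b a = dd f b a"
    "\<And>x. x \<in> S \<Longrightarrow> f x = f a + (\<Sum>b\<in>Basis. ((x - a) \<bullet> b) * g b x)"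
proof
  define g where "g b x = integral {0..1} (\<lambda>t. t ^ 0 * dd f b (a + t *\<^sub>R (x - a)))" for b x
  show "smooth_on S (g b)" for b
    unfolding g_def by (rule smooth_on_segment_integral[OF S(1-3) smooth_on_derivative[OF S(1,4)]])
  show "g b a = dd f b a" for b by (simp add: g_def)
  fix x assume x: "x \<in> S"
  have in_S: "a + t *\<^sub>R (x - a) \<in> S" if "0 \<le> t" "t \<le> 1" for t
    using convexD_alt[OF S(2) S(3) x, of t] that by (simp add: algebra_simps)
  have lin: "linear (frechet_derivative f (at y))" if "y \<in> S" for y
    using smooth_on_has_derivative[OF S(1,4) that] has_derivative_linear by metis
  note repr = linear_basis_repr[OF lin, unfolded real_scaleR_def]
  have cont: "continuous_on {0..1} (\<lambda>t. dd f b (a + t *\<^sub>R (x - a)))" for b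
    by (rule continuous_on_compose2[OF smooth_on_imp_continuous_on[OF smooth_on_derivative[OF S(1,4)]],
          where f = "\<lambda>t. a + t *\<^sub>R (x - a)"])
       (use in_S in \<open>auto intro!: continuous_intros\<close>)
  have "((\<lambda>t. dd f (x - a) (a + t *\<^sub>R (x - a))) has_integral
     f (a + 1 *\<^sub>R (x - a)) - f (a + 0 *\<^sub>R (x - a))) {0..1}"
    by (rule fundamental_theorem_of_calculus)
       (auto intro!: has_real_derivative_iff_has_vector_derivative[THEN iffD1]
          has_field_derivative_at_within[OF dd_along_line[OF S(1,4) in_S]])
  then have "f x - f a = integral {0..1} (\<lambda>t. dd f (x - a) (a + t *\<^sub>R (x - a)))"
    by (simp add: integral_unique)
  also have "\<dots> = integral {0..1} (\<lambda>t. \<Sum>b\<in>Basis. ((x - a) \<bullet> b) * dd f b (a + t *\<^sub>R (x - a)))"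
    by (intro integral_cong repr in_S) auto
  also have "\<dots> = (\<Sum>b\<in>Basis. integral {0..1} (\<lambda>t. ((x - a) \<bullet> b) * dd f b (a + t *\<^sub>R (x - a))))"
    by (intro integral_sum integrable_continuous_real continuous_intros cont finite_Basis)
  also have "\<dots> = (\<Sum>b\<in>Basis. ((x - a) \<bullet> b) * g b x)"
    by (simp add: g_def)
  finally show "f x = f a + (\<Sum>b\<in>Basis. ((x - a) \<bullet> b) * g b x)" by simp
qed

text \<open>The classical flat function exp (-1/t) with powers of 1/t, the factors that
  differentiation produces. The induction in \<open>Ck_on_flat\<close> therefore runs over all
  \<open>j\<close> at once.\<close>

definition flat :: "nat \<Rightarrow> real \<Rightarrow> real" where
  "flat j t = (if t > 0 then inverse t ^ j * exp (- inverse t) else 0)"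

lemma flat_tendsto_0: "(flat j \<longlongrightarrow> 0) (at 0)"
proof -
  have "((\<lambda>t. inverse t ^ j * exp (- inverse t)) \<longlongrightarrow> 0) (at_right (0::real))"
    unfolding filterlim_at_right_to_top
    using tendsto_power_div_exp_0[of j] by (simp add: exp_minus divide_inverse)
  then have "(flat j \<longlongrightarrow> 0) (at_right 0)"
    by (rule Lim_transform_eventually)
       (auto simp: flat_def eventually_at_right_field intro!: exI[of _ 1])
  moreover have "(flat j \<longlongrightarrow> 0) (at_left 0)"
    by (rule Lim_transform_eventually[OF tendsto_const])
       (auto simp: flat_def eventually_at_left_field intro!: exI[of _ "-1"])
  ultimately show ?thesis by (simp add: filterlim_at_split)
qed

lemma flat_has_derivative: "(flat j has_real_derivative flat (j + 2) t - j * flat (Suc j) t) (at t)"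
proof -
  consider "t < 0" | "t = 0" | "t > 0" by linarith
  then show ?thesis
  proof cases
    case 1
    have "((\<lambda>_. 0) has_real_derivative 0) (at t)" by simp
    then have "(flat j has_real_derivative 0) (at t)"
      by (rule has_field_derivative_transform_within_open[of _ _ _ "{..<0}"]) (use 1 in \<open>auto simp: flat_def\<close>)
    then show ?thesis using 1 by (simp add: flat_def)
  next
    case 2
    have "((\<lambda>y. (flat j y - flat j 0) / (y - 0)) \<longlongrightarrow> 0) (at 0)"
      by (rule Lim_transform_eventually[OF flat_tendsto_0[of "Suc j"]])
         (auto simp: flat_def eventually_at_filter divide_inverse intro!: always_eventually)
    then show ?thesis using 2 by (simp add: has_field_derivative_iff flat_def)
  next
    case 3
    have "((\<lambda>t. inverse t ^ j * exp (- inverse t)) has_real_derivative flat (j + 2) t - j * flat (Suc j) t) (at t)"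
      using 3 by (auto intro!: derivative_eq_intros simp: flat_def power2_eq_square algebra_simps)
         (cases j; simp add: field_simps power2_eq_square)
    then show ?thesis
      by (rule has_field_derivative_transform_within_open[of _ _ _ "{0<..}"]) (use 3 in \<open>auto simp: flat_def\<close>)
  qed
qed

lemma Ck_on_flat: "Ck_on k UNIV (flat j)"
proof (induction k arbitrary: j)
  case 0
  have "continuous_on UNIV (flat j)"
    by (intro continuous_at_imp_continuous_on ballI DERIV_isCont[OF flat_has_derivative])
  then show ?case by simp
next
  case (Suc k)
  show ?case
  proof (rule Ck_on_SucI[where f' = "\<lambda>t v. (flat (j + 2) t + (- real j) * flat (Suc j) t) * v"])
    show "(flat j has_derivative (\<lambda>v. (flat (j + 2) t + (- real j) * flat (Suc j) t) * v)) (at t)" for t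
      using flat_has_derivative[of j t] by (simp add: has_field_derivative_def)
    show "Ck_on k UNIV (\<lambda>t. (flat (j + 2) t + (- real j) * flat (Suc j) t) * v)" for v
      by (intro Ck_on_bilinear[OF bounded_bilinear_mult] Ck_on_add Ck_on_const Suc.IH) simp_all
  qed simp
qed

text \<open>The flat function of \<open>r\<close> squared minus the squared distance to
  \<open>a\<close>, which is nonpositive off the open ball, normalised by its value at the
  centre.\<close>

lemma bump_exists:
  fixes a :: "'a::euclidean_space"
  assumes "r > 0"
  obtains \<beta> :: "'a \<Rightarrow> real" where "smooth_on UNIV \<beta>" "\<beta> a = 1" "\<And>x. dist x a \<ge> r \<Longrightarrow> \<beta> x = 0"
proof
  define \<beta> where "\<beta> x = inverse (flat 0 (r\<^sup>2)) * flat 0 (r\<^sup>2 - (x - a) \<bullet> (x - a))" for x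
  have 1: "smooth_on UNIV (flat 0)" by (rule smooth_on_openI) (simp_all add: Ck_on_flat)
  have 2: "smooth_on UNIV (\<lambda>x. r\<^sup>2 - (x - a) \<bullet> (x - a))"
    by (intro smooth_on_diff smooth_on_inner smooth_on_const smooth_on_id)
  have "smooth_on UNIV (\<lambda>x. flat 0 (r\<^sup>2 - (x - a) \<bullet> (x - a)))"
    by (rule smooth_on_compose[OF 2 1]) simp
  then show "smooth_on UNIV \<beta>"
    unfolding \<beta>_def by (intro smooth_on_mult smooth_on_const)
  show "\<beta> a = 1" using assms by (simp add: \<beta>_def flat_def)
  show "\<beta> x = 0" if "dist x a \<ge> r" for x
  proof -
    have "r\<^sup>2 \<le> (dist x a)\<^sup>2" using that assms by (intro power_mono) auto
    then show ?thesis by (simp add: \<beta>_def flat_def dist_norm dot_square_norm)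
  qed
qed

text \<open>The inverse function theorem gives a differentiable inverse \<open>g\<close> with
  derivative \<open>B\<close>. Smoothness is bootstrapped: the derivative of \<open>B\<close> is
  polynomial in \<open>B\<close> and in second derivatives of \<open>f\<close> along
  \<open>g\<close>, so if \<open>g\<close> and \<open>B\<close> are k times continuously
  differentiable, then both gain one order.\<close>

lemma smooth_local_inverse:
  fixes f :: "'a::euclidean_space \<Rightarrow> 'a"
  assumes S: "open S" "smooth_on S f" "a \<in> S" and id: "(f has_derivative (\<lambda>x. x)) (at a)"
  obtains U V g where "open U" "a \<in> U" "U \<subseteq> S" "open V" "homeomorphism U V f g" "smooth_on V g"
proof -
  define f' where "f' x = Blinfun (frechet_derivative f (at x))" for x
  note der = smooth_on_has_derivative[OF S(1,2)]
  have f': "blinfun_apply (f' x) = frechet_derivative f (at x)" if "x \<in> S" for x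
    unfolding f'_def using der[OF that] has_derivative_bounded_linear bounded_linear_Blinfun_apply by metis
  have der': "(f has_derivative blinfun_apply (f' x)) (at x)" if "x \<in> S" for x
    using der[OF that] f'[OF that] by simp
  have cont: "continuous_on S f'"
  proof (rule continuous_on_blinfun_componentwise)
    fix i :: 'a assume "i \<in> Basis"
    have "continuous_on S (dd f i)"
      by (rule smooth_on_imp_continuous_on[OF smooth_on_derivative[OF S(1,2)]])
    then show "continuous_on S (\<lambda>x. blinfun_apply (f' x) i)"
      by (rule continuous_on_eq) (simp add: f')
  qed
  have "blinfun_apply (f' a) = (\<lambda>x. x)"
    unfolding f'[OF S(3)] using frechet_derivative_at[OF id] by simp
  then have inv: "id_blinfun o\<^sub>L f' a = id_blinfun" by (intro blinfun_eqI) simp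
  obtain U V g g' where U: "open U" "U \<subseteq> S" "a \<in> U" and V: "open V" and hom: "homeomorphism U V f g"
    and g: "\<And>y. y \<in> V \<Longrightarrow> (g has_derivative (g' y)) (at y)"
    and g': "\<And>y. y \<in> V \<Longrightarrow> g' y = inv_into UNIV (blinfun_apply (f' (g y)))"
    and bij: "\<And>y. y \<in> V \<Longrightarrow> bij (blinfun_apply (f' (g y)))"
    by (rule inverse_function_theorem[OF S(1) der' cont S(3) inv]) (assumption | rule that)+
  have gV: "g y \<in> U" "g y \<in> S" if "y \<in> V" for y using hom that U(2) by (auto simp: homeomorphism_def)
  have gf: "g (f x) = x" "f x \<in> V" if "x \<in> U" for x using hom that by (auto simp: homeomorphism_def)
  have fg: "f (g y) = y" if "y \<in> V" for y using hom that by (auto simp: homeomorphism_def)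
  define A where "A x = frechet_derivative f (at x)" for x
  define B where "B y = g' y" for y
  have AB: "A (g y) (B y w) = w" "B y (A (g y) w) = w" if "y \<in> V" for y w
    using bij[OF that] unfolding A_def B_def g'[OF that] f'[OF gV(2)[OF that]]
    by (simp_all add: bij_is_surj surj_f_inv_f bij_is_inj)
  have linB: "linear (B y)" if "y \<in> V" for y
    unfolding B_def using g[OF that] has_derivative_linear by metis
  have linA: "linear (A x)" if "x \<in> S" for x
    unfolding A_def using der[OF that] has_derivative_linear by metis
  define C where "C x h w = (\<Sum>b\<in>Basis. (w \<bullet> b) *\<^sub>R dd (dd f b) h x)" for x h w
  have A_repr: "A x w = (\<Sum>b\<in>Basis. (w \<bullet> b) *\<^sub>R dd f b x)" if "x \<in> S" for x w
    using linear_basis_repr[OF linA[OF that], of w] by (simp only: A_def)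
  note B_repr = linear_basis_repr[OF linB]
  \<comment> \<open>The inverse of the derivative is differentiated by inverting the tangent map
    \<open>(x, w) \<mapsto> (f x, Df x w)\<close>, whose inverse is \<open>(y, v) \<mapsto> (g y, Dg y v)\<close>.\<close>
  have derB: "((\<lambda>y. B y v) has_derivative (\<lambda>u. - B y (C (g y) (B y u) (B y v)))) (at y)" if y: "y \<in> V" for y v
  proof -
    define F where "F p = (f (fst p), \<Sum>b\<in>Basis. (snd p \<bullet> b) *\<^sub>R dd f b (fst p))" for p :: "'a \<times> 'a"
    define F' where "F' p q = (A (fst p) (fst q), (\<Sum>b\<in>Basis. (snd p \<bullet> b) *\<^sub>R dd (dd f b) (fst q) (fst p) + (snd q \<bullet> b) *\<^sub>R dd f b (fst p)))"
      for p q :: "'a \<times> 'a"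
    define H where "H q = (g (fst q), B (fst q) (snd q))" for q :: "'a \<times> 'a"
    define H' where "H' p q = (B (f (fst p)) (fst q), B (f (fst p)) (snd q - C (fst p) (B (f (fst p)) (fst q)) (snd p)))" for p q :: "'a \<times> 'a"
    define p where "p = (g y, B y v)"
    have F_der: "(F has_derivative F' q) (at q)" if "q \<in> U \<times> UNIV" for q
    proof -
      have q: "fst q \<in> S" using that U by auto
      have 1: "((\<lambda>q. k (fst q)) has_derivative (\<lambda>v. frechet_derivative k (at (fst q)) (fst v))) (at q)"
        if "smooth_on S k" for k :: "'a \<Rightarrow> 'a"
        using diff_chain_at[OF has_derivative_fst[OF has_derivative_ident] smooth_on_has_derivative[OF S(1) that q]]
        by (simp add: o_def)
      show ?thesis
        unfolding F_def F'_def A_def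
        by (intro has_derivative_Pair 1 S(2) has_derivative_sum has_derivative_scaleR
              smooth_on_derivative[OF S(1,2)] has_derivative_inner_left has_derivative_snd has_derivative_ident)
    qed
    have HF: "H (F q) = q" if "q \<in> U \<times> UNIV" for q
    proof -
      have q: "fst q \<in> U" "fst q \<in> S" using that U by auto
      have "F q = (f (fst q), A (fst q) (snd q))" by (simp add: F_def A_repr[OF q(2)])
      then show ?thesis using AB(2)[OF gf(2)[OF q(1)], of "snd q"] gf(1)[OF q(1)] by (simp add: H_def)
    qed
    have p: "p \<in> U \<times> UNIV" using gV[OF y] by (simp add: p_def)
    have F'_eq: "F' p q = (A (g y) (fst q), C (g y) (fst q) (B y v) + A (g y) (snd q))" for q
      unfolding F'_def p_def C_def A_repr[OF gV(2)[OF y], of "snd q"] by (simp add: sum.distrib)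
    have H'_eq: "H' p q = (B y (fst q), B y (snd q - C (g y) (B y (fst q)) (B y v)))" for q
      by (simp add: H'_def p_def fg[OF y])
    have "F' p \<circ> H' p = id"
      by (rule ext) (simp add: F'_eq H'_eq AB(1)[OF y])
    with F_der HF p have "(H has_derivative H' p) (at (F p))"
      by (intro has_derivative_inverse_on[of "U \<times> UNIV" F F']) (auto intro!: open_Times U(1))
    moreover have "F p = (y, v)"
      using AB(1)[OF y, of v] A_repr[OF gV(2)[OF y], of "B y v"] by (simp add: F_def p_def fg[OF y])
    ultimately have "(H has_derivative H' p) (at (y, v))" by simp
    moreover have "((\<lambda>y. (y, v)) has_derivative (\<lambda>u. (u, 0))) (at y)"
      by (intro has_derivative_Pair has_derivative_ident has_derivative_const)
    ultimately have "(H \<circ> (\<lambda>y. (y, v)) has_derivative H' p \<circ> (\<lambda>u. (u, 0))) (at y)"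
      by (intro diff_chain_at)
    then have "((\<lambda>y. H (y, v)) has_derivative (\<lambda>u. H' p (u, 0))) (at y)" by (simp only: o_def)
    from has_derivative_snd[OF this]
    show ?thesis
      by (simp add: H_def H'_eq linear_neg[OF linB[OF y]])
  qed
  define T where "T b d x = dd (dd f b) d x" for b d x
  have T: "smooth_on S (T b d)" for b d
    unfolding T_def by (intro smooth_on_derivative S)
  \<comment> \<open>The formula of \<open>derB\<close> expanded in \<open>Basis\<close>, so that
    only values of \<open>B\<close> in fixed directions and scalar components occur; these are what
    the induction on \<open>k\<close> controls.\<close>
  define B' where "B' y v u = (\<Sum>c\<in>Basis. \<Sum>b\<in>Basis. \<Sum>d\<in>Basis.
      (- ((B y v \<bullet> b) * ((B y u \<bullet> d) * (T b d (g y) \<bullet> c)))) *\<^sub>R B y c)" for y v u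
  have derB': "((\<lambda>y. B y v) has_derivative B' y v) (at y)" if y: "y \<in> V" for y v
  proof -
    have lin2: "linear (frechet_derivative (dd f b) (at (g y)))" for b
      using smooth_on_has_derivative[OF S(1) smooth_on_derivative[OF S(1,2)] gV(2)[OF y]] has_derivative_linear by metis
    have r: "dd (dd f b) w (g y) = (\<Sum>d\<in>Basis. (w \<bullet> d) *\<^sub>R T b d (g y))" for b w
      unfolding T_def by (rule linear_basis_repr[OF lin2])
    have "- B y (C (g y) (B y u) (B y v)) = B' y v u" for u
      unfolding B_repr[OF y, of "C (g y) (B y u) (B y v)"]
      unfolding B'_def C_def r
      by (simp add: inner_sum_left sum_distrib_left scaleR_sum_left sum_negf)
    then have "(\<lambda>u. - B y (C (g y) (B y u) (B y v))) = B' y v" by (rule ext)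
    then show ?thesis using derB[OF y, of v] by simp
  qed
  have "Ck_on k V g \<and> (\<forall>v. Ck_on k V (\<lambda>y. B y v))" for k
  proof (induction k)
    case 0
    have "continuous_on V g" using hom by (simp add: homeomorphism_def)
    moreover have "continuous_on V (\<lambda>y. B y v)" for v
      by (intro continuous_at_imp_continuous_on ballI has_derivative_continuous[OF derB'])
    ultimately show ?case by simp
  next
    case (Suc k)
    then have kg: "Ck_on k V g" and kB: "\<And>v. Ck_on k V (\<lambda>y. B y v)" by simp_all
    have kT: "Ck_on k V (\<lambda>y. T b d (g y))" for b d
      by (rule Ck_on_compose[OF V S(1) _ kg smooth_on_imp_Ck_on[OF S(1) T]]) (use gV in auto)
    have i: "Ck_on k V (\<lambda>y. p y \<bullet> c)" if "Ck_on k V p" for p :: "'a \<Rightarrow> 'a" and c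
      by (rule Ck_on_bilinear[OF bounded_bilinear_inner V that Ck_on_const[OF V]])
    have m: "Ck_on k V (\<lambda>y. - p y)" if "Ck_on k V p" for p :: "'a \<Rightarrow> real"
      using Ck_on_bilinear[OF bounded_bilinear_mult V Ck_on_const[OF V, of _ "-1"] that] by simp
    have "Ck_on k V (\<lambda>y. B' y v u)" for v u
      unfolding B'_def
      by (intro Ck_on_sum[OF V] Ck_on_bilinear[OF bounded_bilinear_scaleR V] m
            Ck_on_bilinear[OF bounded_bilinear_mult V] i kB kT)
    then have "Ck_on (Suc k) V (\<lambda>y. B y v)" for v by (intro Ck_on_SucI[OF V derB'])
    moreover have "Ck_on (Suc k) V g"
      by (rule Ck_on_SucI[OF V g]) (use kB B_def in simp_all)
    ultimately show ?case by blast
  qed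
  then have "smooth_on V g" by (intro smooth_on_openI V) simp
  with U V hom show thesis by (intro that)
qed

section \<open>Smooth functions on manifolds\<close>

lemma linear_projection_exists:
  fixes E :: "'e::euclidean_space set"
  assumes "subspace E"
  obtains p where "linear p" "range p \<subseteq> E" "\<And>x. x \<in> E \<Longrightarrow> p x = x"
proof -
  have "\<exists>g. g ` UNIV \<subseteq> E \<and> linear g \<and> (\<forall>v\<in>E. g (id v) = v)"
    using linear_exists_left_inverse_on[OF linear_id assms inj_on_id] by auto
  then show thesis using that by auto
qed

lemma atlas_subset_charts: "smooth_manifold M \<Longrightarrow> c \<in> atlas M \<Longrightarrow> c \<in> charts M"
  by (simp add: charts_def insert_absorb)

lemma chartD:
  assumes "(U, \<phi>) \<in> charts M"
  shows "openin (mtop M) U"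
    and "\<exists>E. subspace E \<and> openin (top_of_set E) (\<phi> ` U)"
    and "homeomorphic_map (subtopology (mtop M) U) (top_of_set (\<phi> ` U)) \<phi>"
    and "\<And>V \<psi>. (V, \<psi>) \<in> atlas M \<Longrightarrow> smooth_on (\<phi> ` (U \<inter> V)) (\<psi> \<circ> inv_into U \<phi>)"
    and "\<And>V \<psi>. (V, \<psi>) \<in> atlas M \<Longrightarrow> smooth_on (\<psi> ` (V \<inter> U)) (\<phi> \<circ> inv_into V \<psi>)"
proof -
  have *: "smooth_manifold (M\<lparr>atlas := insert (U, \<phi>) (atlas M)\<rparr>)"
    using assms by (simp add: charts_def)
  then obtain n where n: "\<forall>(U, \<phi>)\<in>insert (U, \<phi>) (atlas M). openin (mtop M) U \<and>
        (\<exists>E. subspace E \<and> dim E = n \<and> openin (top_of_set E) (\<phi> ` U)) \<and>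
        homeomorphic_map (subtopology (mtop M) U) (top_of_set (\<phi> ` U)) \<phi>"
    unfolding smooth_manifold_def by auto
  then show "openin (mtop M) U" "\<exists>E. subspace E \<and> openin (top_of_set E) (\<phi> ` U)"
    "homeomorphic_map (subtopology (mtop M) U) (top_of_set (\<phi> ` U)) \<phi>" by auto
  let ?A = "insert (U, \<phi>) (atlas M)"
  have t: "smooth_on (\<phi>' ` (U' \<inter> V)) (\<psi> \<circ> inv_into U' \<phi>')"
    if 1: "(U', \<phi>') \<in> ?A" and 2: "(V, \<psi>) \<in> ?A" for U' \<phi>' V \<psi>
  proof -
    have "\<forall>c\<in>?A. case c of (U', \<phi>') \<Rightarrow> \<forall>c'\<in>?A. case c' of (V, \<psi>) \<Rightarrow>
      smooth_on (\<phi>' ` (U' \<inter> V)) (\<psi> \<circ> inv_into U' \<phi>')"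
      using * unfolding smooth_manifold_def by simp
    from bspec[OF this 1] have "\<forall>c'\<in>?A. case c' of (V, \<psi>) \<Rightarrow>
      smooth_on (\<phi>' ` (U' \<inter> V)) (\<psi> \<circ> inv_into U' \<phi>')" by (simp only: prod.case)
    from bspec[OF this 2] show ?thesis by (simp only: prod.case)
  qed
  show "smooth_on (\<phi> ` (U \<inter> V)) (\<psi> \<circ> inv_into U \<phi>)" "smooth_on (\<psi> ` (V \<inter> U)) (\<phi> \<circ> inv_into V \<psi>)"
    if "(V, \<psi>) \<in> atlas M" for V \<psi>
    by (rule t; simp add: that)+
qed

lemma chart_inj:
  assumes "(U, \<phi>) \<in> charts M"
  shows "inj_on \<phi> U"
proof -
  have "topspace (subtopology (mtop M) U) = U" using openin_subset[OF chartD(1)[OF assms]] by auto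
  then show ?thesis using homeomorphic_imp_injective_map[OF chartD(3)[OF assms]] by simp
qed

lemma chart_subset: "(U, \<phi>) \<in> charts M \<Longrightarrow> U \<subseteq> points M"
  using openin_subset[OF chartD(1)] .

lemma chart_continuous_inv:
  assumes "(U, \<phi>) \<in> charts M"
  shows "continuous_map (top_of_set (\<phi> ` U)) (subtopology (mtop M) U) (inv_into U \<phi>)"
proof -
  have ts: "topspace (subtopology (mtop M) U) = U" using chart_subset[OF assms] by auto
  obtain g where g: "homeomorphic_maps (subtopology (mtop M) U) (top_of_set (\<phi> ` U)) \<phi> g"
    using chartD(3)[OF assms] homeomorphic_map_maps by metis
  then have c: "continuous_map (top_of_set (\<phi> ` U)) (subtopology (mtop M) U) g" and gi: "\<forall>x\<in>U. g (\<phi> x) = x"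
    unfolding homeomorphic_maps_def ts by simp_all
  show ?thesis
    by (rule continuous_map_eq[OF c]) (use gi chart_inj[OF assms] in auto)
qed

lemma chart_image_open:
  assumes c: "(U, \<phi>) \<in> charts M" and W: "openin (mtop M) W"
  obtains O' where "open O'" "\<phi> ` (U \<inter> W) = \<phi> ` U \<inter> O'"
proof -
  have "openin (top_of_set (\<phi> ` U)) {z \<in> \<phi> ` U. inv_into U \<phi> z \<in> U \<inter> W}"
    using openin_continuous_map_preimage[OF chart_continuous_inv[OF c] openin_subtopology_Int2[OF W]] by simp
  moreover have "{z \<in> \<phi> ` U. inv_into U \<phi> z \<in> U \<inter> W} = \<phi> ` (U \<inter> W)"
    using chart_inj[OF c] by auto
  ultimately show thesis using that by (auto simp: openin_open)
qed

text \<open>The vector-valued form of \<open>smooth_fun_on\<close>. Charts are then smooth functions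
  on their own domains, and one calculus serves them and real functions.\<close>

definition vsmooth :: "('a, 'e::euclidean_space) mfd \<Rightarrow> 'a set \<Rightarrow> ('a \<Rightarrow> 'b::real_normed_vector) \<Rightarrow> bool" where
  "vsmooth M W f \<longleftrightarrow> (\<forall>(U, \<phi>)\<in>atlas M. smooth_on (\<phi> ` (U \<inter> W)) (f \<circ> inv_into U \<phi>))"

lemma vsmoothD: "vsmooth M W f \<Longrightarrow> (U, \<phi>) \<in> atlas M \<Longrightarrow> smooth_on (\<phi> ` (U \<inter> W)) (\<lambda>x. f (inv_into U \<phi> x))"
  unfolding vsmooth_def o_def by auto

lemma vsmoothI:
  "(\<And>U \<phi>. (U, \<phi>) \<in> atlas M \<Longrightarrow> smooth_on (\<phi> ` (U \<inter> W)) (\<lambda>x. f (inv_into U \<phi> x))) \<Longrightarrow> vsmooth M W f"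
  unfolding vsmooth_def o_def by auto

lemma smooth_fun_on_iff_vsmooth: "smooth_fun_on M W f \<longleftrightarrow> vsmooth M W f"
  by (simp add: smooth_fun_on_def vsmooth_def)

lemma smooth_funs_iff_vsmooth: "f \<in> smooth_funs M \<longleftrightarrow> vsmooth M (points M) f"
  by (simp add: smooth_funs_def smooth_fun_on_iff_vsmooth)

lemma atlas_cover: "smooth_manifold M \<Longrightarrow> x \<in> points M \<Longrightarrow> \<exists>U \<phi>. (U, \<phi>) \<in> atlas M \<and> x \<in> U"
  unfolding smooth_manifold_def by auto

text \<open>Near each point, \<open>f\<close> in the coordinates \<open>\<phi>\<close> is
  \<open>f\<close> in an atlas chart composed with the transition map, which is smooth because
  \<open>\<phi>\<close> is compatible with the atlas.\<close>

lemma vsmooth_chart: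
  fixes M :: "('a, 'e::euclidean_space) mfd" and f :: "'a \<Rightarrow> 'b::real_normed_vector"
  assumes M: "smooth_manifold M" and c: "(U, \<phi>) \<in> charts M" and f: "vsmooth M W f"
  shows "smooth_on (\<phi> ` (U \<inter> W)) (f \<circ> inv_into U \<phi>)"
proof (rule smooth_on_local)
  note inj = chart_inj[OF c]
  fix z assume "z \<in> \<phi> ` (U \<inter> W)"
  then obtain x where x: "x \<in> U" "x \<in> W" "z = \<phi> x" by auto
  obtain V \<kappa> where V: "(V, \<kappa>) \<in> atlas M" "x \<in> V"
    using atlas_cover[OF M] chart_subset[OF c] x(1) by (meson subsetD)
  have cV: "(V, \<kappa>) \<in> charts M" by (rule atlas_subset_charts[OF M V(1)])
  obtain O' where O': "open O'" "\<phi> ` (U \<inter> V) = \<phi> ` U \<inter> O'"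
    using chart_image_open[OF c chartD(1)[OF cV]] by metis
  have sub: "\<phi> ` (U \<inter> W) \<inter> O' \<subseteq> \<phi> ` (U \<inter> V)" using O'(2) by auto
  have 1: "smooth_on (\<phi> ` (U \<inter> W) \<inter> O') (\<kappa> \<circ> inv_into U \<phi>)"
    by (rule smooth_on_subset[OF chartD(4)[OF c V(1)] sub])
  have 2: "smooth_on (\<kappa> ` (V \<inter> W)) (f \<circ> inv_into V \<kappa>)" using f V(1) unfolding vsmooth_def by auto
  have inv: "inv_into U \<phi> w \<in> V \<inter> W" if "w \<in> \<phi> ` (U \<inter> W) \<inter> O'" for w
  proof -
    have "w \<in> \<phi> ` (U \<inter> V)" using that sub by auto
    then show ?thesis using that inj by (auto simp: inj_on_eq_iff)
  qed
  have "smooth_on (\<phi> ` (U \<inter> W) \<inter> O') (\<lambda>w. (f \<circ> inv_into V \<kappa>) ((\<kappa> \<circ> inv_into U \<phi>) w))"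
    by (rule smooth_on_compose[OF 1 2]) (use inv in auto)
  then have "smooth_on (\<phi> ` (U \<inter> W) \<inter> O') (f \<circ> inv_into U \<phi>)"
    by (rule smooth_on_cong) (use inv chart_inj[OF cV] in auto)
  moreover have "z \<in> O'" using O' x V by auto
  ultimately show "\<exists>Ua. open Ua \<and> z \<in> Ua \<and> smooth_on (\<phi> ` (U \<inter> W) \<inter> Ua) (f \<circ> inv_into U \<phi>)"
    using O'(1) by (intro exI[of _ O'] conjI)
qed

lemma vsmooth_of_chart: "(U, \<phi>) \<in> charts M \<Longrightarrow> vsmooth M U \<phi>"
  unfolding vsmooth_def using chartD(5) by fastforce

lemma vsmooth_subset: "vsmooth M W f \<Longrightarrow> W' \<subseteq> W \<Longrightarrow> vsmooth M W' f"
  by (rule vsmoothI, rule smooth_on_subset[OF vsmoothD]) auto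

lemma vsmooth_cong:
  assumes "vsmooth M W f" "\<And>x. x \<in> W \<Longrightarrow> f x = g x" "smooth_manifold M"
  shows "vsmooth M W g"
  unfolding vsmooth_def
proof (clarify)
  fix U \<phi> assume c: "(U, \<phi>) \<in> atlas M"
  then have "smooth_on (\<phi> ` (U \<inter> W)) (f \<circ> inv_into U \<phi>)" using assms(1) by (auto simp: vsmooth_def)
  then show "smooth_on (\<phi> ` (U \<inter> W)) (g \<circ> inv_into U \<phi>)"
    by (rule smooth_on_cong) (use assms(2) chart_inj[OF atlas_subset_charts[OF assms(3) c]] in auto)
qed

lemma vsmooth_points: "smooth_manifold M \<Longrightarrow> vsmooth M W f \<longleftrightarrow> vsmooth M (W \<inter> points M) f"
proof -
  assume M: "smooth_manifold M"
  have "U \<inter> (W \<inter> points M) = U \<inter> W" if "(U, \<phi>) \<in> atlas M" for U \<phi>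
    using chart_subset[OF atlas_subset_charts[OF M that]] by auto
  then show ?thesis unfolding vsmooth_def by (intro ball_cong) (auto simp del: image_Int)
qed

lemma vsmooth_local:
  fixes M :: "('a, 'e::euclidean_space) mfd" and f :: "'a \<Rightarrow> 'b::real_normed_vector"
  assumes M: "smooth_manifold M"
    and loc: "\<And>x. x \<in> W \<Longrightarrow> x \<in> points M \<Longrightarrow> \<exists>W'. openin (mtop M) W' \<and> x \<in> W' \<and> vsmooth M (W \<inter> W') f"
  shows "vsmooth M W f"
  unfolding vsmooth_def
proof (clarify, rule smooth_on_local)
  fix U \<phi> z assume c: "(U, \<phi>) \<in> atlas M" and "z \<in> \<phi> ` (U \<inter> W)"
  then obtain x where x: "x \<in> U" "x \<in> W" "z = \<phi> x" by auto
  note c' = atlas_subset_charts[OF M c]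
  obtain W' where W': "openin (mtop M) W'" "x \<in> W'" "vsmooth M (W \<inter> W') f"
    using loc[OF x(2)] chart_subset[OF c'] x(1) by auto
  obtain O' where O': "open O'" "\<phi> ` (U \<inter> W') = \<phi> ` U \<inter> O'"
    using chart_image_open[OF c' W'(1)] by metis
  have "\<phi> ` (U \<inter> W) \<inter> O' \<subseteq> \<phi> ` (U \<inter> (W \<inter> W'))"
  proof
    fix w assume w: "w \<in> \<phi> ` (U \<inter> W) \<inter> O'"
    then obtain u where u: "u \<in> U" "u \<in> W" "w = \<phi> u" by auto
    have "w \<in> \<phi> ` (U \<inter> W')" using w O'(2) by auto
    then have "u \<in> W'" using u chart_inj[OF c'] by (auto simp: inj_on_eq_iff)
    then show "w \<in> \<phi> ` (U \<inter> (W \<inter> W'))" using u by auto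
  qed
  moreover have "smooth_on (\<phi> ` (U \<inter> (W \<inter> W'))) (f \<circ> inv_into U \<phi>)"
    using W'(3) c unfolding vsmooth_def by auto
  ultimately have "smooth_on (\<phi> ` (U \<inter> W) \<inter> O') (f \<circ> inv_into U \<phi>)" by (rule smooth_on_subset[rotated])
  moreover have "z \<in> O'" using O'(2) x W'(2) by auto
  ultimately show "\<exists>Ua. open Ua \<and> z \<in> Ua \<and> smooth_on (\<phi> ` (U \<inter> W) \<inter> Ua) (f \<circ> inv_into U \<phi>)"
    using O'(1) by (intro exI[of _ O'] conjI)
qed

lemma vsmooth_compose:
  fixes f :: "'a \<Rightarrow> 'b::euclidean_space" and g :: "'b \<Rightarrow> 'c::real_normed_vector"
  assumes "vsmooth M W f" "smooth_on R g" "f ` W \<subseteq> R" "smooth_manifold M"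
  shows "vsmooth M W (\<lambda>x. g (f x))"
  unfolding vsmooth_def
proof clarify
  fix U \<phi> assume c: "(U, \<phi>) \<in> atlas M"
  then have "smooth_on (\<phi> ` (U \<inter> W)) (f \<circ> inv_into U \<phi>)" using assms(1) by (auto simp: vsmooth_def)
  from smooth_on_compose[OF this assms(2)]
  show "smooth_on (\<phi> ` (U \<inter> W)) ((\<lambda>x. g (f x)) \<circ> inv_into U \<phi>)"
    using assms(3) chart_inj[OF atlas_subset_charts[OF assms(4) c]] by (auto simp: o_def image_subset_iff)
qed

lemma vsmooth_const: "vsmooth M W (\<lambda>x. c)"
  by (rule vsmoothI) (rule smooth_on_const)

lemma vsmooth_add: "vsmooth M W f \<Longrightarrow> vsmooth M W g \<Longrightarrow> vsmooth M W (\<lambda>x. f x + g x)"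
  by (rule vsmoothI, rule smooth_on_add; erule (1) vsmoothD)

lemma vsmooth_bilinear: "bounded_bilinear p \<Longrightarrow> vsmooth M W f \<Longrightarrow> vsmooth M W g \<Longrightarrow> vsmooth M W (\<lambda>x. p (f x) (g x))"
  by (rule vsmoothI, rule smooth_on_bilinear) (assumption | erule (1) vsmoothD)+

lemmas vsmooth_mult = vsmooth_bilinear[OF bounded_bilinear_mult]
  and vsmooth_inner = vsmooth_bilinear[OF bounded_bilinear_inner]
  and vsmooth_scaleR = vsmooth_bilinear[OF bounded_bilinear_scaleR]

lemma vsmooth_sum: "(\<And>i. i \<in> I \<Longrightarrow> vsmooth M W (f i)) \<Longrightarrow> vsmooth M W (\<lambda>x. \<Sum>i\<in>I. f i x)"
  by (induction I rule: infinite_finite_induct) (auto intro!: vsmooth_const vsmooth_add)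

lemma vsmooth_diff:
  fixes f g :: "'a \<Rightarrow> 'b::real_normed_vector"
  shows "vsmooth M W f \<Longrightarrow> vsmooth M W g \<Longrightarrow> vsmooth M W (\<lambda>x. f x - g x)"
  using vsmooth_add[of M W f "\<lambda>x. (- 1) *\<^sub>R g x"] vsmooth_scaleR[OF vsmooth_const[of M W "- 1"], of g] by simp

lemma vsmooth_componentwise:
  fixes f :: "'a \<Rightarrow> 'b::euclidean_space"
  assumes "\<And>b. b \<in> Basis \<Longrightarrow> vsmooth M W (\<lambda>x. f x \<bullet> b)"
  shows "vsmooth M W f"
proof -
  have "vsmooth M W (\<lambda>x. \<Sum>b\<in>Basis. (f x \<bullet> b) *\<^sub>R b)"
    using assms by (intro vsmooth_sum vsmooth_scaleR vsmooth_const)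
  then show ?thesis by (simp add: euclidean_representation)
qed

text \<open>Smooth maps into a manifold from an open set of a Euclidean space are kept apart from
  \<open>smooth_map\<close>, so that functions pulled back along them can be differentiated by
  \<open>frechet_derivative\<close> directly.\<close>

definition psmooth :: "'f::euclidean_space set \<Rightarrow> ('a, 'e::euclidean_space) mfd \<Rightarrow> ('f \<Rightarrow> 'a) \<Rightarrow> bool" where
  "psmooth S M \<iota> \<longleftrightarrow> open S \<and> continuous_map (top_of_set S) (mtop M) \<iota> \<and>
     (\<forall>(V, \<psi>)\<in>atlas M. smooth_on (S \<inter> \<iota> -` V) (\<psi> \<circ> \<iota>))"

lemma psmooth_open_vimage:
  assumes "psmooth S M \<iota>" "openin (mtop M) W"
  shows "open (S \<inter> \<iota> -` W)"
proof -
  have "openin (top_of_set S) {x \<in> S. \<iota> x \<in> W}"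
    using openin_continuous_map_preimage[of "top_of_set S" "mtop M" \<iota> W] assms by (simp add: psmooth_def)
  then have "open {x \<in> S. \<iota> x \<in> W}" using assms(1) openin_open_trans unfolding psmooth_def by metis
  moreover have "{x \<in> S. \<iota> x \<in> W} = S \<inter> \<iota> -` W" by auto
  ultimately show ?thesis by simp
qed

lemma psmooth_in_points: "psmooth S M \<iota> \<Longrightarrow> x \<in> S \<Longrightarrow> \<iota> x \<in> points M"
  unfolding psmooth_def continuous_map_def by auto

lemma psmooth_vsmooth:
  fixes M :: "('a, 'e::euclidean_space) mfd" and f :: "'a \<Rightarrow> 'b::real_normed_vector"
  assumes M: "smooth_manifold M" and \<iota>: "psmooth S M \<iota>" and f: "vsmooth M W f"
  shows "smooth_on (S \<inter> \<iota> -` W) (f \<circ> \<iota>)"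
proof (rule smooth_on_local)
  fix x assume x: "x \<in> S \<inter> \<iota> -` W"
  then obtain V \<psi> where V: "(V, \<psi>) \<in> atlas M" "\<iota> x \<in> V"
    using atlas_cover[OF M, of "\<iota> x"] psmooth_in_points[OF \<iota>, of x] by auto
  note c = atlas_subset_charts[OF M V(1)]
  have 1: "smooth_on (S \<inter> \<iota> -` W \<inter> (S \<inter> \<iota> -` V)) (\<psi> \<circ> \<iota>)"
    by (rule smooth_on_subset[of "S \<inter> \<iota> -` V"]) (use \<iota> V(1) in \<open>auto simp: psmooth_def\<close>)
  have "smooth_on (S \<inter> \<iota> -` W \<inter> (S \<inter> \<iota> -` V)) (\<lambda>w. (f \<circ> inv_into V \<psi>) ((\<psi> \<circ> \<iota>) w))"
    by (rule smooth_on_compose[OF 1 vsmooth_chart[OF M c f]]) auto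
  then have "smooth_on (S \<inter> \<iota> -` W \<inter> (S \<inter> \<iota> -` V)) (f \<circ> \<iota>)"
    by (rule smooth_on_cong) (use chart_inj[OF c] in auto)
  then show "\<exists>U. open U \<and> x \<in> U \<and> smooth_on (S \<inter> \<iota> -` W \<inter> U) (f \<circ> \<iota>)"
    using psmooth_open_vimage[OF \<iota> chartD(1)[OF c]] x V(2)
    by (intro exI[of _ "S \<inter> \<iota> -` V"]) simp
qed

text \<open>A parametrization \<open>\<iota>\<close> is the inverse of a chart \<open>\<phi>\<close>, precomposed with a linear projection onto
  the model subspace. It is defined on an open set of the Euclidean space and has a right inverse,
  so that differentiation can be carried out in the full Euclidean space.\<close>

definition param :: "('a, 'e::euclidean_space) mfd \<Rightarrow> ('a \<Rightarrow> 'e) \<Rightarrow> ('e \<Rightarrow> 'a) \<Rightarrow> 'e set \<Rightarrow> bool" where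
  "param M \<phi> \<iota> S \<longleftrightarrow> psmooth S M \<iota> \<and> openin (mtop M) (\<iota> ` S) \<and> (\<forall>z\<in>\<iota> ` S. \<phi> z \<in> S \<and> \<iota> (\<phi> z) = z) \<and>
     vsmooth M (\<iota> ` S) \<phi> \<and> continuous_map (subtopology (mtop M) (\<iota> ` S)) euclidean \<phi>"

lemma param_of_chart:
  fixes M :: "('a, 'e::euclidean_space) mfd"
  assumes M: "smooth_manifold M" and c: "(U, \<phi>) \<in> charts M"
    and E: "openin (top_of_set E) (\<phi> ` U)"
    and p: "linear p" "range p \<subseteq> E" "\<And>x. x \<in> E \<Longrightarrow> p x = x"
    and W: "openin (mtop M) W"
  obtains S where "param M \<phi> (inv_into U \<phi> \<circ> p) S" "(inv_into U \<phi> \<circ> p) ` S = U \<inter> W"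
    "\<And>x. p (p x) \<in> S \<longleftrightarrow> x \<in> S" "\<And>x. x \<in> S \<Longrightarrow> p x \<in> \<phi> ` (U \<inter> W)"
proof -
  note inj = chart_inj[OF c]
  obtain O1 where O1: "open O1" "\<phi> ` (U \<inter> W) = \<phi> ` U \<inter> O1" using chart_image_open[OF c W] by metis
  obtain O2 where O2: "open O2" "\<phi> ` U = E \<inter> O2" using E by (auto simp: openin_open)
  \<comment> \<open>The image of the chart is open only in the subspace \<open>E\<close>; its
    preimage under the projection \<open>p\<close> is open in the whole Euclidean space.\<close>
  define S where "S = p -` (O2 \<inter> O1)"
  let ?\<iota> = "inv_into U \<phi> \<circ> p"
  have UW: "\<phi> ` (U \<inter> W) = E \<inter> (O2 \<inter> O1)" using O1 O2 by auto
  have cont_p: "continuous_on UNIV p" using p(1) linear_continuous_on linear_conv_bounded_linear by blast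
  have S: "open S" unfolding S_def using open_vimage[OF open_Int[OF O2(1) O1(1)] cont_p] .
  have pS: "p x \<in> \<phi> ` (U \<inter> W)" if "x \<in> S" for x
    using that p(2) unfolding UW S_def by auto
  have \<phi>: "\<phi> z \<in> S" "?\<iota> (\<phi> z) = z" if "z \<in> U \<inter> W" for z
  proof -
    have "\<phi> z \<in> E \<inter> (O2 \<inter> O1)" using that UW by blast
    then show "\<phi> z \<in> S" "?\<iota> (\<phi> z) = z" using p(3) that inj by (auto simp: S_def)
  qed
  have im: "?\<iota> ` S = U \<inter> W"
  proof
    show "?\<iota> ` S \<subseteq> U \<inter> W" using pS inj by fastforce
    show "U \<inter> W \<subseteq> ?\<iota> ` S" using \<phi> by (metis image_eqI subsetI)
  qed
  have cp: "continuous_map (top_of_set S) (top_of_set (\<phi> ` U)) p"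
    using pS cont_p by (auto simp: image_subset_iff intro: continuous_on_subset)
  have sm: "smooth_on (S \<inter> ?\<iota> -` W') (f \<circ> ?\<iota>)" if "vsmooth M W' f" for f :: "'a \<Rightarrow> 'e" and W'
  proof -
    have 1: "smooth_on (\<phi> ` (U \<inter> W')) (f \<circ> inv_into U \<phi>)" by (rule vsmooth_chart[OF M c that])
    have 2: "smooth_on (S \<inter> ?\<iota> -` W') p"
      using p(1) linear_conv_bounded_linear smooth_on_bounded_linear by blast
    have "p ` (S \<inter> ?\<iota> -` W') \<subseteq> \<phi> ` (U \<inter> W')"
    proof safe
      fix x assume x: "x \<in> S" "?\<iota> x \<in> W'"
      then obtain u where u: "u \<in> U" "p x = \<phi> u" using pS by blast
      then show "p x \<in> \<phi> ` (U \<inter> W')" using x inj by auto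
    qed
    from smooth_on_compose[OF 2 1 this] show ?thesis by (simp add: o_def)
  qed
  have "param M \<phi> ?\<iota> S"
    unfolding param_def im
  proof (intro conjI ballI \<phi>)
    show "openin (mtop M) (U \<inter> W)" using chartD(1)[OF c] W by (rule openin_Int)
    show "vsmooth M (U \<inter> W) \<phi>" using vsmooth_of_chart[OF c] by (rule vsmooth_subset) simp
    have "continuous_map (top_of_set S) (mtop M) ?\<iota>"
      using continuous_map_compose[OF cp chart_continuous_inv[OF c]] continuous_map_in_subtopology by blast
    then show "psmooth S M ?\<iota>"
      unfolding psmooth_def using S sm vsmooth_of_chart[OF atlas_subset_charts[OF M]] by blast
    have "continuous_map (subtopology (mtop M) U) euclidean \<phi>"
      using homeomorphic_imp_continuous_map[OF chartD(3)[OF c]] by (simp add: continuous_map_in_subtopology)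
    then show "continuous_map (subtopology (mtop M) (U \<inter> W)) euclidean \<phi>"
      by (rule continuous_map_from_subtopology_mono) simp
  qed auto
  moreover have "p (p x) \<in> S \<longleftrightarrow> x \<in> S" for x
  proof -
    have "p x \<in> E" using p(2) by auto
    then have "p (p x) = p x" by (rule p(3))
    then show ?thesis unfolding S_def by simp
  qed
  ultimately show thesis using that[of S] im pS by simp
qed

lemma param_exists:
  assumes M: "smooth_manifold M" and W: "openin (mtop M) W" "y \<in> W"
  obtains \<phi> \<iota> S where "param M \<phi> \<iota> S" "y \<in> \<iota> ` S" "\<iota> ` S \<subseteq> W"
proof -
  obtain U \<phi> where U: "(U, \<phi>) \<in> charts M" "y \<in> U"
    using atlas_cover[OF M, of y] openin_subset[OF W(1)] W(2) atlas_subset_charts[OF M] by blast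
  obtain E where E: "subspace E" "openin (top_of_set E) (\<phi> ` U)" using chartD(2)[OF U(1)] by blast
  obtain p where p: "linear p" "range p \<subseteq> E" "\<And>x. x \<in> E \<Longrightarrow> p x = x"
    using linear_projection_exists[OF E(1)] by metis
  show thesis
  proof (rule param_of_chart[OF M U(1) E(2) p W(1)])
    fix S assume S: "param M \<phi> (inv_into U \<phi> \<circ> p) S" "(inv_into U \<phi> \<circ> p) ` S = U \<inter> W"
    show thesis by (rule that[OF S(1)]) (use S(2) U W in simp_all)
  qed
qed

section \<open>Tangent vectors\<close>

text \<open>A bump in chart coordinates, supported in a closed ball inside the chart. The part of
  the ball in the model subspace is compact, so its image \<open>K\<close> is compact and, the space
  being Hausdorff, closed. A product with the bump thus extends by zero to a smooth
  function.\<close>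

lemma cutoff_exists:
  fixes M :: "('a, 'e::euclidean_space) mfd"
  assumes M: "smooth_manifold M" and W: "openin (mtop M) W" "y \<in> W"
  obtains b where "b \<in> smooth_funs M" "b y = 1" "\<And>z. z \<notin> W \<Longrightarrow> b z = 0"
    "\<And>f. vsmooth M W f \<Longrightarrow> (\<lambda>z. if z \<in> W then b z * f z else 0) \<in> smooth_funs M"
proof -
  obtain U \<phi> where U: "(U, \<phi>) \<in> charts M" "y \<in> U"
    using atlas_cover[OF M, of y] openin_subset[OF W(1)] W(2) atlas_subset_charts[OF M] by blast
  obtain E where E: "subspace E" "openin (top_of_set E) (\<phi> ` U)" using chartD(2)[OF U(1)] by blast
  note inj = chart_inj[OF U(1)]
  obtain O1 where O1: "open O1" "\<phi> ` (U \<inter> W) = \<phi> ` U \<inter> O1" using chart_image_open[OF U(1) W(1)] by metis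
  obtain O2 where O2: "open O2" "\<phi> ` U = E \<inter> O2" using E(2) by (auto simp: openin_open)
  have UW: "\<phi> ` (U \<inter> W) = E \<inter> (O2 \<inter> O1)" using O1 O2 by auto
  have "\<phi> y \<in> O2 \<inter> O1" using UW U(2) W(2) by blast
  then obtain r where r: "r > 0" "cball (\<phi> y) r \<subseteq> O2 \<inter> O1"
    using open_Int[OF O2(1) O1(1)] open_contains_cball by meson
  define K where "K = inv_into U \<phi> ` (E \<inter> cball (\<phi> y) r)"
  have Esub: "E \<inter> cball (\<phi> y) r \<subseteq> \<phi> ` (U \<inter> W)" using UW r(2) by auto
  have KW: "K \<subseteq> U \<inter> W"
  proof
    fix z assume "z \<in> K"
    then obtain w where w: "w \<in> E \<inter> cball (\<phi> y) r" "z = inv_into U \<phi> w" unfolding K_def by blast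
    then obtain u where "u \<in> U \<inter> W" "w = \<phi> u" using Esub by blast
    then show "z \<in> U \<inter> W" using w(2) inj by simp
  qed
  have Esub': "E \<inter> cball (\<phi> y) r \<subseteq> \<phi> ` U"
    by (rule order_trans[OF Esub]) (rule image_mono, simp)
  have "compact (E \<inter> cball (\<phi> y) r)"
    using closed_Int_compact[OF closed_subspace[OF E(1)] compact_cball] by simp
  then have "compactin (top_of_set (\<phi> ` U)) (E \<inter> cball (\<phi> y) r)"
    using Esub' by (simp only: compactin_subtopology compactin_euclidean_iff simp_thms)
  then have "compactin (subtopology (mtop M) U) K"
    unfolding K_def by (rule image_compactin[OF _ chart_continuous_inv[OF U(1)]])
  then have "compactin (mtop M) K" by (simp add: compactin_subtopology)
  then have K: "closedin (mtop M) K"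
    using M compactin_imp_closedin[of "mtop M" K] unfolding smooth_manifold_def by simp
  obtain \<beta> :: "'e \<Rightarrow> real" where \<beta>: "smooth_on UNIV \<beta>" "\<beta> (\<phi> y) = 1" "\<And>x. dist x (\<phi> y) \<ge> r \<Longrightarrow> \<beta> x = 0"
    using bump_exists[OF r(1)] by metis
  define b where "b z = (if z \<in> U \<inter> W then \<beta> (\<phi> z) else 0)" for z
  have b0: "b z = 0" if "z \<notin> K" for z
  proof (cases "z \<in> U \<inter> W")
    case True
    then have "\<phi> z \<in> E" using UW by blast
    moreover have "z = inv_into U \<phi> (\<phi> z)" using True inj by simp
    ultimately have "\<phi> z \<notin> cball (\<phi> y) r" using that unfolding K_def by blast
    then show ?thesis using \<beta>(3)[of "\<phi> z"] by (simp add: b_def dist_commute)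
  qed (auto simp: b_def)
  have main: "(\<lambda>z. if z \<in> W then b z * f z else 0) \<in> smooth_funs M" (is "?F \<in> _") if f: "vsmooth M W f" for f
    unfolding smooth_funs_iff_vsmooth
  proof (rule vsmooth_local[OF M])
    fix x assume x: "x \<in> points M"
    show "\<exists>W'. openin (mtop M) W' \<and> x \<in> W' \<and> vsmooth M (points M \<inter> W') ?F"
    proof (cases "x \<in> K")
      case True
      have "vsmooth M (U \<inter> W) (\<lambda>z. \<beta> (\<phi> z))"
        by (rule vsmooth_compose[OF vsmooth_subset[OF vsmooth_of_chart[OF U(1)]] \<beta>(1)]) (use M in auto)
      then have "vsmooth M (U \<inter> W) (\<lambda>z. \<beta> (\<phi> z) * f z)"
        by (rule vsmooth_mult) (rule vsmooth_subset[OF f], simp)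
      then have "vsmooth M (U \<inter> W) ?F"
        by (rule vsmooth_cong) (use M in \<open>simp_all add: b_def\<close>)
      then have "vsmooth M (points M \<inter> (U \<inter> W)) ?F" by (rule vsmooth_subset) auto
      then show ?thesis using True KW openin_Int[OF chartD(1)[OF U(1)] W(1)]
        by (intro exI[of _ "U \<inter> W"]) auto
    next
      case False
      have "vsmooth M (points M \<inter> (points M - K)) ?F"
        by (rule vsmooth_cong[OF vsmooth_const[of _ _ 0]]) (use b0 M in auto)
      then show ?thesis using False x K by (intro exI[of _ "points M - K"]) auto
    qed
  qed
  have "b = (\<lambda>z. if z \<in> W then b z * 1 else 0)" by (rule ext) (simp add: b_def)
  with main[OF vsmooth_const[of _ _ 1]] have "b \<in> smooth_funs M" by simp
  moreover have "b y = 1" using U(2) W(2) \<beta>(2) by (simp add: b_def)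
  moreover have "b z = 0" if "z \<notin> W" for z using that by (simp add: b_def)
  ultimately show thesis using that[of b] main by blast
qed

lemma smooth_funs_const: "(\<lambda>x. c) \<in> smooth_funs M"
  unfolding smooth_funs_iff_vsmooth by (rule vsmooth_const)

lemma smooth_funs_add: "f \<in> smooth_funs M \<Longrightarrow> h \<in> smooth_funs M \<Longrightarrow> (\<lambda>x. f x + h x) \<in> smooth_funs M"
  unfolding smooth_funs_iff_vsmooth by (rule vsmooth_add)

lemma smooth_funs_mult: "f \<in> smooth_funs M \<Longrightarrow> h \<in> smooth_funs M \<Longrightarrow> (\<lambda>x. f x * h x) \<in> smooth_funs M"
  unfolding smooth_funs_iff_vsmooth by (rule vsmooth_mult)

lemma smooth_funs_diff: "f \<in> smooth_funs M \<Longrightarrow> h \<in> smooth_funs M \<Longrightarrow> (\<lambda>x. f x - h x) \<in> smooth_funs M"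
  unfolding smooth_funs_iff_vsmooth by (rule vsmooth_diff)

lemma smooth_funs_scale: "f \<in> smooth_funs M \<Longrightarrow> (\<lambda>x. c * f x) \<in> smooth_funs M"
  by (rule smooth_funs_mult[OF smooth_funs_const])

lemma smooth_funs_sum: "(\<And>i. i \<in> I \<Longrightarrow> f i \<in> smooth_funs M) \<Longrightarrow> (\<lambda>x. \<Sum>i\<in>I. f i x) \<in> smooth_funs M"
  unfolding smooth_funs_iff_vsmooth by (rule vsmooth_sum)

context
  fixes M :: "('a, 'e::euclidean_space) mfd" and x :: 'a and D :: "'a tvec"
  assumes D: "D \<in> tangent_space M x"
begin

lemma tangent_add: "f \<in> smooth_funs M \<Longrightarrow> h \<in> smooth_funs M \<Longrightarrow> D (\<lambda>y. f y + h y) = D f + D h"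
  using D by (simp add: tangent_space_def)

lemma tangent_scale: "f \<in> smooth_funs M \<Longrightarrow> D (\<lambda>y. c * f y) = c * D f"
  using D by (simp add: tangent_space_def)

lemma tangent_mult: "f \<in> smooth_funs M \<Longrightarrow> h \<in> smooth_funs M \<Longrightarrow> D (\<lambda>y. f y * h y) = D f * h x + f x * D h"
  using D by (simp add: tangent_space_def)

lemma tangent_not_smooth: "f \<notin> smooth_funs M \<Longrightarrow> D f = 0"
  using D by (simp add: tangent_space_def)

lemma tangent_const: "D (\<lambda>y. c) = 0"
proof -
  have "D (\<lambda>y. 1 * 1) = D (\<lambda>y. 1) + D (\<lambda>y. 1)"
    by (subst tangent_mult) (simp_all add: smooth_funs_const)
  then have "D (\<lambda>y. 1) = 0" by simp
  then show ?thesis using tangent_scale[OF smooth_funs_const, of c 1] by simp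
qed

lemma tangent_diff: "f \<in> smooth_funs M \<Longrightarrow> h \<in> smooth_funs M \<Longrightarrow> D (\<lambda>y. f y - h y) = D f - D h"
  using tangent_add[of f "\<lambda>y. (- 1) * h y"] tangent_scale[of h "- 1"] smooth_funs_scale[of h M "- 1"] by simp

lemma tangent_sum: "(\<And>i. i \<in> I \<Longrightarrow> f i \<in> smooth_funs M) \<Longrightarrow> D (\<lambda>y. \<Sum>i\<in>I. f i y) = (\<Sum>i\<in>I. D (f i))"
  by (induction I rule: infinite_finite_induct) (auto simp: tangent_const tangent_add smooth_funs_sum)

end

lemma paramD:
  assumes "param M \<phi> \<iota> S"
  shows "open S" "psmooth S M \<iota>" "openin (mtop M) (\<iota> ` S)" "\<And>z. z \<in> \<iota> ` S \<Longrightarrow> \<phi> z \<in> S"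
    "\<And>z. z \<in> \<iota> ` S \<Longrightarrow> \<iota> (\<phi> z) = z" "vsmooth M (\<iota> ` S) \<phi>"
    "continuous_map (subtopology (mtop M) (\<iota> ` S)) euclidean \<phi>"
  using assms unfolding param_def psmooth_def by auto

lemma param_smooth_funs:
  assumes "smooth_manifold M" "param M \<phi> \<iota> S" "f \<in> smooth_funs M"
  shows "smooth_on S (f \<circ> \<iota>)"
proof -
  have "smooth_on (S \<inter> \<iota> -` points M) (f \<circ> \<iota>)"
    using assms psmooth_vsmooth paramD(2) smooth_funs_iff_vsmooth by metis
  moreover have "S \<inter> \<iota> -` points M = S" using psmooth_in_points[OF paramD(2)[OF assms(2)]] by auto
  ultimately show ?thesis by simp
qed

text \<open>The functions \<open>c b\<close>, cut-off coordinates at \<open>y\<close>, are fixed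
  before \<open>v\<close> and \<open>f\<close>. Hadamard's lemma writes \<open>f - f y\<close> as a
  sum of coordinates times smooth coefficients. The coordinates vanish at \<open>y\<close>, so the
  product rule leaves only the coefficients at \<open>y\<close>, which are the partial
  derivatives.\<close>

lemma tangent_coordinates:
  fixes M :: "('a, 'e::euclidean_space) mfd"
  assumes M: "smooth_manifold M" and P: "param M \<phi> \<iota> S" "y \<in> \<iota> ` S"
  obtains c where "\<And>b. c b \<in> smooth_funs M"
    "\<And>v f. v \<in> tangent_space M y \<Longrightarrow> f \<in> smooth_funs M \<Longrightarrow> v f = (\<Sum>b\<in>Basis. v (c b) * dd (f \<circ> \<iota>) b (\<phi> y))"
proof -
  note p = paramD[OF P(1)]
  define x0 where "x0 = \<phi> y"
  have x0: "x0 \<in> S" "\<iota> x0 = y" using p(4,5) P(2) by (simp_all add: x0_def)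
  obtain r where r: "r > 0" "ball x0 r \<subseteq> S" using openE[OF p(1) x0(1)] by metis
  define N where "N = {z \<in> \<iota> ` S. \<phi> z \<in> ball x0 r}"
  have ts: "topspace (subtopology (mtop M) (\<iota> ` S)) = \<iota> ` S" using openin_subset[OF p(3)] by auto
  have "openin (subtopology (mtop M) (\<iota> ` S)) N"
    using openin_continuous_map_preimage[OF p(7), of "ball x0 r"] unfolding N_def ts by simp
  then have N: "openin (mtop M) N"
    using openin_trans_full[OF _ p(3)] by simp
  have yN: "y \<in> N" using P(2) r(1) by (simp add: N_def x0_def)
  have N\<phi>: "vsmooth M N \<phi>" by (rule vsmooth_subset[OF p(6)]) (auto simp: N_def)
  obtain b where b: "b \<in> smooth_funs M" "b y = 1" "\<And>z. z \<notin> N \<Longrightarrow> b z = 0"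
    "\<And>f. vsmooth M N f \<Longrightarrow> (\<lambda>z. if z \<in> N then b z * f z else 0) \<in> smooth_funs M"
    using cutoff_exists[OF M N yN] by blast
  define c where "c e z = (if z \<in> N then b z * ((\<phi> z - x0) \<bullet> e) else 0)" for e z
  have c: "c e \<in> smooth_funs M" for e
    unfolding c_def using b(4)[OF vsmooth_inner[OF vsmooth_diff[OF N\<phi> vsmooth_const] vsmooth_const]] .
  have cy: "c e y = 0" for e by (simp add: c_def x0_def)
  show thesis
  proof (rule that[OF c])
    fix v f assume v: "v \<in> tangent_space M y" and f: "f \<in> smooth_funs M"
    have fs: "smooth_on (ball x0 r) (f \<circ> \<iota>)"
      by (rule smooth_on_subset[OF param_smooth_funs[OF M P(1) f] r(2)])
    have x0b: "x0 \<in> ball x0 r" using r(1) by simp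
    obtain g where g: "\<And>e. smooth_on (ball x0 r) (g e)" "\<And>e. g e x0 = dd (f \<circ> \<iota>) e x0"
      "\<And>x. x \<in> ball x0 r \<Longrightarrow> (f \<circ> \<iota>) x = (f \<circ> \<iota>) x0 + (\<Sum>e\<in>Basis. ((x - x0) \<bullet> e) * g e x)"
      using hadamard[OF open_ball convex_ball x0b fs] by blast
    define k where "k e z = (if z \<in> N then b z * g e (\<phi> z) else 0)" for e z
    have k: "k e \<in> smooth_funs M" for e
      unfolding k_def by (rule b(4)[OF vsmooth_compose[OF N\<phi> g(1) _ M]]) (auto simp: N_def)
    have ky: "k e y = dd (f \<circ> \<iota>) e x0" for e
      using yN b(2) g(2) by (simp add: k_def x0_def)
    have fz: "f z - f y = (\<Sum>e\<in>Basis. ((\<phi> z - x0) \<bullet> e) * g e (\<phi> z))" if "z \<in> N" for z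
    proof -
      have "z \<in> \<iota> ` S" "\<phi> z \<in> ball x0 r" using that by (simp_all add: N_def)
      then show ?thesis using g(3)[of "\<phi> z"] p(5)[of z] x0(2) by simp
    qed
    \<comment> \<open>Two cutoff factors: one makes the coordinate \<open>c e\<close> global, the
      other the Hadamard coefficient \<open>k e\<close>.\<close>
    have "(b z * b z) * (f z - f y) = (\<Sum>e\<in>Basis. c e z * k e z)" for z
    proof (cases "z \<in> N")
      case True
      then show ?thesis by (simp add: fz c_def k_def sum_distrib_left mult_ac)
    qed (simp add: b(3) c_def)
    then have eq: "(\<lambda>z. (b z * b z) * (f z - f y)) = (\<lambda>z. \<Sum>e\<in>Basis. c e z * k e z)" by (rule ext)
    have "v (\<lambda>z. (b z * b z) * (f z - f y)) = v f"
      using b(1,2) f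
      by (simp add: tangent_mult[OF v] tangent_diff[OF v] tangent_const[OF v] smooth_funs_mult smooth_funs_diff smooth_funs_const)
    moreover have "v (\<lambda>z. \<Sum>e\<in>Basis. c e z * k e z) = (\<Sum>e\<in>Basis. v (c e) * k e y)"
      using c k by (simp add: tangent_sum[OF v] tangent_mult[OF v] smooth_funs_mult cy)
    ultimately show "v f = (\<Sum>e\<in>Basis. v (c e) * dd (f \<circ> \<iota>) e (\<phi> y))"
      using eq by (simp add: ky x0_def)
  qed
qed

lemma velocity_tangent:
  assumes M: "smooth_manifold M" and \<iota>: "psmooth S M \<iota>" "x \<in> S"
  shows "(\<lambda>f. if f \<in> smooth_funs M then dd (f \<circ> \<iota>) w x else 0) \<in> tangent_space M (\<iota> x)"
proof -
  have S: "open S" using \<iota>(1) by (simp add: psmooth_def)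
  have d: "(f \<circ> \<iota> has_derivative frechet_derivative (f \<circ> \<iota>) (at x)) (at x)" if "f \<in> smooth_funs M" for f
  proof -
    have "smooth_on (S \<inter> \<iota> -` points M) (f \<circ> \<iota>)"
      using that psmooth_vsmooth[OF M \<iota>(1)] smooth_funs_iff_vsmooth by blast
    moreover have "S \<inter> \<iota> -` points M = S" using psmooth_in_points[OF \<iota>(1)] by auto
    ultimately show ?thesis using smooth_on_has_derivative[OF S _ \<iota>(2)] by simp
  qed
  have 1: "frechet_derivative ((\<lambda>y. f y + h y) \<circ> \<iota>) (at x) =
      (\<lambda>v. frechet_derivative (f \<circ> \<iota>) (at x) v + frechet_derivative (h \<circ> \<iota>) (at x) v)"
    if "f \<in> smooth_funs M" "h \<in> smooth_funs M" for f h
    using frechet_derivative_at[OF has_derivative_add[OF d[OF that(1)] d[OF that(2)]]] by (simp add: o_def)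
  have 2: "frechet_derivative ((\<lambda>y. f y * h y) \<circ> \<iota>) (at x) =
      (\<lambda>v. f (\<iota> x) * frechet_derivative (h \<circ> \<iota>) (at x) v + frechet_derivative (f \<circ> \<iota>) (at x) v * h (\<iota> x))"
    if "f \<in> smooth_funs M" "h \<in> smooth_funs M" for f h
    using frechet_derivative_at[OF has_derivative_mult[OF d[OF that(1)] d[OF that(2)]]] by (simp add: o_def)
  have 3: "frechet_derivative ((\<lambda>y. c * f y) \<circ> \<iota>) (at x) = (\<lambda>v. c * frechet_derivative (f \<circ> \<iota>) (at x) v)"
    if "f \<in> smooth_funs M" for f c
    using frechet_derivative_at[OF has_derivative_mult_right[OF d[OF that]]] by (simp add: o_def)
  show ?thesis
    unfolding tangent_space_def mem_Collect_eq
    by (intro conjI ballI allI impI) (simp_all add: smooth_funs_add smooth_funs_mult smooth_funs_scale 1 2 3)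
qed

lemma tangent_zero: "0 \<in> tangent_space M x"
  by (simp add: tangent_space_def)

lemma tangent_space_add: "u \<in> tangent_space M x \<Longrightarrow> v \<in> tangent_space M x \<Longrightarrow> u + v \<in> tangent_space M x"
  unfolding tangent_space_def mem_Collect_eq by (auto simp: algebra_simps)

lemma tangent_space_scale: "u \<in> tangent_space M x \<Longrightarrow> (\<lambda>f. c * u f) \<in> tangent_space M x"
  unfolding tangent_space_def mem_Collect_eq by (auto simp: algebra_simps)

lemma tangent_space_diff: "u \<in> tangent_space M x \<Longrightarrow> v \<in> tangent_space M x \<Longrightarrow> u - v \<in> tangent_space M x"
  unfolding tangent_space_def mem_Collect_eq by (auto simp: algebra_simps)

lemma tangent_space_sum:
  "(\<And>i. i \<in> I \<Longrightarrow> u i \<in> tangent_space M x) \<Longrightarrow> (\<lambda>f. \<Sum>i\<in>I. c i * u i f) \<in> tangent_space M x"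
proof (induction I rule: infinite_finite_induct)
  case (insert i I)
  have "(\<lambda>f. c i * u i f) + (\<lambda>f. \<Sum>i\<in>I. c i * u i f) \<in> tangent_space M x"
    using insert by (intro tangent_space_add tangent_space_scale) auto
  then show ?case using insert by (simp add: plus_fun_def)
qed (use tangent_zero in \<open>simp_all add: zero_fun_def\<close>)

text \<open>The index set is the basis of the model type, while charts may take values in a proper
  subspace; hence the \<open>e b\<close> span the tangent space but need not be independent. The
  coefficients are read off by the fixed functions \<open>c b\<close>.\<close>

lemma tangent_finite_basis:
  fixes M :: "('a, 'e::euclidean_space) mfd"
  assumes M: "smooth_manifold M" and y: "y \<in> points M"
  obtains c :: "'e \<Rightarrow> 'a \<Rightarrow> real" and e where "\<And>b. c b \<in> smooth_funs M" "\<And>b. e b \<in> tangent_space M y"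
    "\<And>v. v \<in> tangent_space M y \<Longrightarrow> v = (\<lambda>f. \<Sum>b\<in>Basis. v (c b) * e b f)"
proof -
  obtain \<phi> \<iota> S where P: "param M \<phi> \<iota> S" "y \<in> \<iota> ` S"
    using param_exists[OF M openin_topspace y] by metis
  obtain c where c: "\<And>b. c b \<in> smooth_funs M"
    "\<And>v f. v \<in> tangent_space M y \<Longrightarrow> f \<in> smooth_funs M \<Longrightarrow> v f = (\<Sum>b\<in>Basis. v (c b) * dd (f \<circ> \<iota>) b (\<phi> y))"
    using tangent_coordinates[OF M P] by blast
  define e where "e b = (\<lambda>f. if f \<in> smooth_funs M then dd (f \<circ> \<iota>) b (\<phi> y) else 0)" for b
  have e: "e b \<in> tangent_space M y" for b
    using velocity_tangent[OF M paramD(2)[OF P(1)] paramD(4)[OF P], of b] paramD(5)[OF P] by (simp add: e_def)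
  show thesis
  proof (rule that[OF c(1) e], rule ext)
    fix v f assume v: "v \<in> tangent_space M y"
    show "v f = (\<Sum>b\<in>Basis. v (c b) * e b f)"
      by (cases "f \<in> smooth_funs M") (simp_all add: e_def c(2)[OF v, of f] tangent_not_smooth[OF v])
  qed
qed

text \<open>Derivations are local: with a cutoff \<open>b\<close> at \<open>y\<close>, the product
  of \<open>b\<close> and \<open>f - h\<close> vanishes identically, and the product rule evaluates
  its derivative to \<open>v f - v h\<close>.\<close>

lemma tangent_cong:
  assumes M: "smooth_manifold M" and v: "v \<in> tangent_space M y" and y: "y \<in> points M"
    and W: "openin (mtop M) W" "y \<in> W" and f: "f \<in> smooth_funs M" "h \<in> smooth_funs M" "\<And>z. z \<in> W \<Longrightarrow> f z = h z"
  shows "v f = v h"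
proof -
  obtain b where b: "b \<in> smooth_funs M" "b y = 1" "\<And>z. z \<notin> W \<Longrightarrow> b z = 0"
    using cutoff_exists[OF M W] by metis
  have "b z * (f z - h z) = 0" for z using b(3) f(3) by (cases "z \<in> W") auto
  then have "(\<lambda>z. b z * (f z - h z)) = (\<lambda>z. 0)" by (rule ext)
  then have "v (\<lambda>z. b z * (f z - h z)) = 0" by (simp add: tangent_const[OF v])
  moreover have "v (\<lambda>z. b z * (f z - h z)) = v f - v h"
    using b f W(2) by (simp add: tangent_mult[OF v] tangent_diff[OF v] smooth_funs_diff)
  ultimately show ?thesis by simp
qed

lemma tangent_maximum:
  assumes M: "smooth_manifold M" and v: "v \<in> tangent_space M y" and y: "y \<in> points M"
    and f: "f \<in> smooth_funs M" and max: "\<And>z. z \<in> points M \<Longrightarrow> f z \<le> f y"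
  shows "v f = 0"
proof -
  obtain \<phi> \<iota> S where P: "param M \<phi> \<iota> S" "y \<in> \<iota> ` S"
    using param_exists[OF M openin_topspace y] by metis
  note p = paramD[OF P(1)]
  have "frechet_derivative (f \<circ> \<iota>) (at (\<phi> y)) = (\<lambda>v. 0)"
    by (rule differential_zero_maxmin[OF p(4)[OF P(2)] p(1) smooth_on_has_derivative[OF p(1) param_smooth_funs[OF M P(1) f] p(4)[OF P(2)]]])
       (use max psmooth_in_points[OF p(2)] p(5)[OF P(2)] in auto)
  then show ?thesis
    using tangent_coordinates[OF M P] v f by (metis (no_types, lifting) mult_zero_right sum.neutral)
qed

section \<open>Smooth maps, products and submanifolds\<close>

lemma smooth_map_iff:
  "smooth_map M N F \<longleftrightarrow> continuous_map (mtop M) (mtop N) F \<and> (\<forall>(V, \<psi>)\<in>atlas N. vsmooth M (F -` V) (\<psi> \<circ> F))"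
  unfolding smooth_map_def vsmooth_def by (auto simp: o_assoc)

lemma smooth_map_vsmooth_chart: "smooth_map M N F \<Longrightarrow> (V, \<psi>) \<in> atlas N \<Longrightarrow> vsmooth M (F -` V) (\<psi> \<circ> F)"
  unfolding smooth_map_iff by auto

lemma smooth_map_in_points: "smooth_map M N F \<Longrightarrow> x \<in> points M \<Longrightarrow> F x \<in> points N"
  unfolding smooth_map_iff continuous_map_def by auto

lemma smooth_map_open_vimage:
  assumes "smooth_map M N F" "openin (mtop N) W"
  shows "openin (mtop M) {x \<in> points M. F x \<in> W}"
  using assms openin_continuous_map_preimage unfolding smooth_map_iff by blast

lemma vsmooth_smooth_map:
  fixes f :: "'b \<Rightarrow> 'c::real_normed_vector"
  assumes M: "smooth_manifold M" and N: "smooth_manifold N" and F: "smooth_map M N F" and f: "vsmooth N W f"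
  shows "vsmooth M (F -` W) (f \<circ> F)"
proof (rule vsmooth_local[OF M])
  fix x assume x: "x \<in> F -` W" "x \<in> points M"
  obtain V \<psi> where V: "(V, \<psi>) \<in> atlas N" "F x \<in> V"
    using atlas_cover[OF N smooth_map_in_points[OF F x(2)]] by blast
  note c = atlas_subset_charts[OF N V(1)]
  define W' where "W' = {x \<in> points M. F x \<in> V}"
  have 1: "vsmooth M (F -` W \<inter> W') (\<psi> \<circ> F)"
    by (rule vsmooth_subset[OF smooth_map_vsmooth_chart[OF F V(1)]]) (auto simp: W'_def)
  have "vsmooth M (F -` W \<inter> W') (\<lambda>z. (f \<circ> inv_into V \<psi>) ((\<psi> \<circ> F) z))"
    by (rule vsmooth_compose[OF 1 vsmooth_chart[OF N c f] _ M]) (auto simp: W'_def)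
  then have "vsmooth M (F -` W \<inter> W') (f \<circ> F)"
    by (rule vsmooth_cong) (use chart_inj[OF c] M in \<open>auto simp: W'_def\<close>)
  moreover have "openin (mtop M) W'"
    unfolding W'_def by (rule smooth_map_open_vimage[OF F chartD(1)[OF c]])
  moreover have "x \<in> W'" using x V by (simp add: W'_def)
  ultimately show "\<exists>W'. openin (mtop M) W' \<and> x \<in> W' \<and> vsmooth M (F -` W \<inter> W') (f \<circ> F)"
    by (intro exI[of _ W']) simp
qed

lemma smooth_funs_pullback:
  assumes M: "smooth_manifold M" and N: "smooth_manifold N" and F: "smooth_map M N F" and f: "f \<in> smooth_funs N"
  shows "f \<circ> F \<in> smooth_funs M"
proof -
  have "vsmooth M (F -` points N) (f \<circ> F)"
    using vsmooth_smooth_map[OF M N F] f by (simp add: smooth_funs_iff_vsmooth)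
  then show ?thesis
    unfolding smooth_funs_iff_vsmooth by (rule vsmooth_subset) (use smooth_map_in_points[OF F] in auto)
qed

text \<open>The components of a chart are local real functions, so it suffices to pull such
  functions back. The quotient structure of the flag manifold is given in exactly these
  terms.\<close>

lemma smooth_mapI:
  fixes M :: "('a, 'e::euclidean_space) mfd" and N :: "('b, 'f::euclidean_space) mfd"
  assumes N: "smooth_manifold N" and F: "continuous_map (mtop M) (mtop N) F"
    and f: "\<And>W (f :: 'b \<Rightarrow> real). openin (mtop N) W \<Longrightarrow> vsmooth N W f \<Longrightarrow> vsmooth M (F -` W) (f \<circ> F)"
  shows "smooth_map M N F"
  unfolding smooth_map_iff
proof (intro conjI F, clarify)
  fix V \<psi> assume V: "(V, \<psi>) \<in> atlas N"
  note c = atlas_subset_charts[OF N V]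
  show "vsmooth M (F -` V) (\<psi> \<circ> F)"
  proof (rule vsmooth_componentwise)
    fix b :: 'f
    have "vsmooth N V (\<lambda>y. \<psi> y \<bullet> b)"
      by (rule vsmooth_inner[OF vsmooth_of_chart[OF c] vsmooth_const])
    from f[OF chartD(1)[OF c] this] show "vsmooth M (F -` V) (\<lambda>x. (\<psi> \<circ> F) x \<bullet> b)"
      by (simp add: o_def)
  qed
qed

lemma smooth_map_compose:
  fixes L :: "('c, 'g::euclidean_space) mfd"
  assumes M: "smooth_manifold M" and N: "smooth_manifold N" and L: "smooth_manifold L"
    and F: "smooth_map M N F" and H: "smooth_map N L H"
  shows "smooth_map M L (H \<circ> F)"
proof (rule smooth_mapI[OF L])
  show "continuous_map (mtop M) (mtop L) (H \<circ> F)"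
    using F H continuous_map_compose unfolding smooth_map_iff by blast
  fix W and f :: "'c \<Rightarrow> real" assume "vsmooth L W f"
  from vsmooth_smooth_map[OF M N F vsmooth_smooth_map[OF N L H this]]
  show "vsmooth M ((H \<circ> F) -` W) (f \<circ> (H \<circ> F))" by (simp add: o_assoc vimage_comp)
qed

lemma smooth_map_id: "smooth_manifold M \<Longrightarrow> smooth_map M M (\<lambda>x. x)"
  by (rule smooth_mapI) (simp_all add: o_def)

lemma smooth_map_const:
  assumes "c \<in> points N"
  shows "smooth_map M N (\<lambda>x. c)"
  unfolding smooth_map_iff by (auto simp: assms o_def vsmooth_const)

lemma smooth_map_cong:
  assumes M: "smooth_manifold M" and F: "smooth_map M N F" and eq: "\<And>x. x \<in> points M \<Longrightarrow> F x = H x"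
  shows "smooth_map M N H"
  unfolding smooth_map_iff
proof (intro conjI, goal_cases)
  case 1
  then show ?case using F eq continuous_map_eq unfolding smooth_map_iff by blast
next
  case 2
  show ?case
  proof clarify
    fix V \<psi> assume V: "(V, \<psi>) \<in> atlas N"
    have "vsmooth M (F -` V \<inter> points M) (\<psi> \<circ> F)"
      by (rule vsmooth_subset[OF smooth_map_vsmooth_chart[OF F V]]) simp
    then have "vsmooth M (F -` V \<inter> points M) (\<psi> \<circ> H)" by (rule vsmooth_cong) (use eq M in auto)
    moreover have "F -` V \<inter> points M = H -` V \<inter> points M" using eq by auto
    ultimately show "vsmooth M (H -` V) (\<psi> \<circ> H)" using vsmooth_points[OF M] by metis
  qed
qed

lemma push_tangent:
  assumes M: "smooth_manifold M" and N: "smooth_manifold N" and F: "smooth_map M N F" and v: "v \<in> tangent_space M x"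
  shows "push N F v \<in> tangent_space N (F x)"
proof -
  note p = smooth_funs_pullback[OF M N F, unfolded o_def]
  show ?thesis
    unfolding tangent_space_def mem_Collect_eq push_def
    using tangent_add[OF v p p] tangent_scale[OF v p] tangent_mult[OF v p p]
    by (simp add: smooth_funs_add smooth_funs_scale smooth_funs_mult o_def)
qed

lemma push_compose:
  assumes N: "smooth_manifold N" and L: "smooth_manifold L" and H: "smooth_map N L H"
  shows "push L H (push N F v) = push L (H \<circ> F) v"
  using smooth_funs_pullback[OF N L H] by (auto simp: push_def o_assoc)

lemma push_cong:
  assumes M: "smooth_manifold M" and N: "smooth_manifold N" and v: "v \<in> tangent_space M x" and x: "x \<in> points M"
    and F: "smooth_map M N F" and eq: "\<And>z. z \<in> points M \<Longrightarrow> F z = H z"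
  shows "push N F v = push N H v"
proof
  fix f
  note H = smooth_map_cong[OF M F eq]
  show "push N F v f = push N H v f"
    using tangent_cong[OF M v x openin_topspace x smooth_funs_pullback[OF M N F] smooth_funs_pullback[OF M N H]] eq
    by (simp add: push_def)
qed

lemma push_ident:
  assumes M: "smooth_manifold M" and v: "v \<in> tangent_space M x"
  shows "push M (\<lambda>x. x) v = v"
  using tangent_not_smooth[OF v] by (auto simp: push_def o_def)

lemma push_add: "push N F (u + v) = push N F u + push N F v"
  by (auto simp: push_def)

lemma push_scale: "push N F (\<lambda>f. c * u f) = (\<lambda>f. c * push N F u f)"
  by (auto simp: push_def)

lemma push_diff: "push N F (u - v) = push N F u - push N F v"
  by (auto simp: push_def)

lemma push_zero: "push N F 0 = 0"
  by (auto simp: push_def)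

section \<open>Products of manifolds and differentiation in one factor\<close>

lemma points_prod: "points (prod_mfd M N) = points M \<times> points N"
  by (simp add: prod_mfd_def)

lemma prod_atlasE:
  assumes "c \<in> atlas (prod_mfd M N)"
  obtains U \<phi> V \<psi> where "c = (U \<times> V, map_prod \<phi> \<psi>)" "(U, \<phi>) \<in> atlas M" "(V, \<psi>) \<in> atlas N"
  using assms by (auto simp: prod_mfd_def)

lemma inv_into_map_prod:
  assumes "inj_on \<phi> U" "inj_on \<psi> V" "z \<in> (\<phi> ` U) \<times> (\<psi> ` V)"
  shows "inv_into (U \<times> V) (map_prod \<phi> \<psi>) z = (inv_into U \<phi> (fst z), inv_into V \<psi> (snd z))"
proof -
  obtain a b where z: "z = (\<phi> a, \<psi> b)" "a \<in> U" "b \<in> V" using assms(3) by auto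
  have "inj_on (map_prod \<phi> \<psi>) (U \<times> V)" using assms(1,2) by (rule map_prod_inj_on)
  then have "inv_into (U \<times> V) (map_prod \<phi> \<psi>) (map_prod \<phi> \<psi> (a, b)) = (a, b)" using z by (intro inv_into_f_f) auto
  then show ?thesis using z assms by simp
qed

lemma map_prod_image_Times: "map_prod \<phi> \<psi> ` (A \<times> B) = \<phi> ` A \<times> \<psi> ` B"
  by auto

lemma dim_Times:
  fixes E :: "'e::euclidean_space set" and F :: "'f::euclidean_space set"
  assumes "subspace E" "subspace F"
  shows "dim (E \<times> F) = dim E + dim F"
proof -
  have lin: "linear (\<lambda>x::'e. (x, 0::'f))" "linear (\<lambda>y::'f. (0::'e, y))" by (auto intro!: linearI)
  have 1: "subspace (E \<times> {0::'f})" "subspace ({0::'e} \<times> F)"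
    using assms by (auto simp: subspace_def zero_prod_def)
  have "{x + y |x y. x \<in> E \<times> {0::'f} \<and> y \<in> {0::'e} \<times> F} = E \<times> F" by force
  moreover have "(E \<times> {0::'f}) \<inter> ({0::'e} \<times> F) = {0}"
    using subspace_0[OF assms(1)] subspace_0[OF assms(2)] by (auto simp: zero_prod_def)
  ultimately have "dim (E \<times> F) = dim (E \<times> {0::'f}) + dim ({0::'e} \<times> F)"
    using dim_sums_Int[OF 1] by simp
  moreover have "E \<times> {0::'f} = (\<lambda>x. (x, 0)) ` E" "{0::'e} \<times> F = (\<lambda>y. (0, y)) ` F" by auto
  ultimately show ?thesis
    using dim_image_eq[OF lin(1), of E] dim_image_eq[OF lin(2), of F] by (simp add: inj_on_def)
qed

lemma second_countable_prod:
  assumes "second_countable X" "second_countable Y"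
  shows "second_countable (prod_topology X Y)"
proof -
  obtain A where A: "countable A" "\<forall>V\<in>A. openin X V"
    "\<forall>U x. openin X U \<and> x \<in> U \<longrightarrow> (\<exists>V\<in>A. x \<in> V \<and> V \<subseteq> U)"
    using assms(1) unfolding second_countable_def by metis
  obtain B where B: "countable B" "\<forall>V\<in>B. openin Y V"
    "\<forall>U x. openin Y U \<and> x \<in> U \<longrightarrow> (\<exists>V\<in>B. x \<in> V \<and> V \<subseteq> U)"
    using assms(2) unfolding second_countable_def by metis
  show ?thesis
    unfolding second_countable_def
  proof (intro exI conjI ballI allI impI)
    show "countable ((\<lambda>(U, V). U \<times> V) ` (A \<times> B))" using A B by simp
    show "openin (prod_topology X Y) V" if "V \<in> (\<lambda>(U, V). U \<times> V) ` (A \<times> B)" for V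
      using that A(2) B(2) by (auto simp: openin_prod_Times_iff)
    fix W z assume W: "openin (prod_topology X Y) W \<and> z \<in> W"
    obtain x y where z: "z = (x, y)" by fastforce
    obtain U V where UV: "openin X U" "openin Y V" "x \<in> U" "y \<in> V" "U \<times> V \<subseteq> W"
      using W z unfolding openin_prod_topology_alt by blast
    obtain U' where U': "U' \<in> A" "x \<in> U'" "U' \<subseteq> U" using A(3) UV(1,3) by metis
    obtain V' where V': "V' \<in> B" "y \<in> V'" "V' \<subseteq> V" using B(3) UV(2,4) by metis
    show "\<exists>V\<in>(\<lambda>(U, V). U \<times> V) ` (A \<times> B). z \<in> V \<and> V \<subseteq> W"
      by (rule bexI[of _ "U' \<times> V'"]) (use U' V' UV(5) z in auto)
  qed
qed

lemma smooth_manifold_points: "smooth_manifold M \<Longrightarrow> points M = (\<Union>(U, \<phi>)\<in>atlas M. U)"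
  by (simp add: smooth_manifold_def)

lemma smooth_manifold_dim:
  assumes "smooth_manifold M"
  obtains n where "\<And>U \<phi>. (U, \<phi>) \<in> atlas M \<Longrightarrow> \<exists>E. subspace E \<and> dim E = n \<and> openin (top_of_set E) (\<phi> ` U)"
proof -
  have "\<exists>n. \<forall>(U, \<phi>)\<in>atlas M. openin (mtop M) U \<and>
        (\<exists>E. subspace E \<and> dim E = n \<and> openin (top_of_set E) (\<phi> ` U)) \<and>
        homeomorphic_map (subtopology (mtop M) U) (top_of_set (\<phi> ` U)) \<phi>"
    using assms by (simp add: smooth_manifold_def)
  then obtain n where n: "\<forall>(U, \<phi>)\<in>atlas M. openin (mtop M) U \<and>
        (\<exists>E. subspace E \<and> dim E = n \<and> openin (top_of_set E) (\<phi> ` U)) \<and>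
        homeomorphic_map (subtopology (mtop M) U) (top_of_set (\<phi> ` U)) \<phi>" by (rule exE)
  show thesis
  proof (rule that)
    fix U \<phi> assume "(U, \<phi>) \<in> atlas M"
    from bspec[OF n this] show "\<exists>E. subspace E \<and> dim E = n \<and> openin (top_of_set E) (\<phi> ` U)" by simp
  qed
qed

lemma smooth_manifold_prod:
  fixes M :: "('a, 'e::euclidean_space) mfd" and N :: "('b, 'f::euclidean_space) mfd"
  assumes M: "smooth_manifold M" and N: "smooth_manifold N"
  shows "smooth_manifold (prod_mfd M N)"
  unfolding smooth_manifold_def
proof (intro conjI)
  have "Hausdorff_space (mtop M)" "Hausdorff_space (mtop N)" "second_countable (mtop M)" "second_countable (mtop N)"
    using M N by (simp_all add: smooth_manifold_def)
  then show "Hausdorff_space (mtop (prod_mfd M N))" "second_countable (mtop (prod_mfd M N))"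
    unfolding prod_mfd_def mfd.simps by (simp_all only: Hausdorff_space_prod_topology second_countable_prod simp_thms)
  show "points (prod_mfd M N) = (\<Union>(U, \<phi>)\<in>atlas (prod_mfd M N). U)"
  proof
    show "points (prod_mfd M N) \<subseteq> (\<Union>(U, \<phi>)\<in>atlas (prod_mfd M N). U)"
    proof
      fix z assume "z \<in> points (prod_mfd M N)"
      then have z: "fst z \<in> points M" "snd z \<in> points N" by (auto simp: points_prod)
      obtain U \<phi> V \<psi> where "(U, \<phi>) \<in> atlas M" "fst z \<in> U" "(V, \<psi>) \<in> atlas N" "snd z \<in> V"
        using atlas_cover[OF M z(1)] atlas_cover[OF N z(2)] by metis
      then have "(U \<times> V, map_prod \<phi> \<psi>) \<in> atlas (prod_mfd M N)" "z \<in> U \<times> V"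
        by (auto simp: prod_mfd_def mem_Times_iff)
      then show "z \<in> (\<Union>(U, \<phi>)\<in>atlas (prod_mfd M N). U)" by (intro UN_I) auto
    qed
    have "W \<subseteq> points (prod_mfd M N)" if w: "(W, \<kappa>) \<in> atlas (prod_mfd M N)" for W \<kappa>
    proof -
      obtain U \<phi> V \<psi> where W: "W = U \<times> V" and U: "(U, \<phi>) \<in> atlas M" and V: "(V, \<psi>) \<in> atlas N"
        using w by (elim prod_atlasE) simp
      show ?thesis
        unfolding W points_prod
        by (rule Sigma_mono[OF chart_subset[OF atlas_subset_charts[OF M U]] chart_subset[OF atlas_subset_charts[OF N V]]])
    qed
    then show "(\<Union>(U, \<phi>)\<in>atlas (prod_mfd M N). U) \<subseteq> points (prod_mfd M N)" by (intro UN_least) auto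
  qed
  obtain m where m: "\<And>U \<phi>. (U, \<phi>) \<in> atlas M \<Longrightarrow> \<exists>E. subspace E \<and> dim E = m \<and> openin (top_of_set E) (\<phi> ` U)"
    using smooth_manifold_dim[OF M] by metis
  obtain n where n: "\<And>U \<phi>. (U, \<phi>) \<in> atlas N \<Longrightarrow> \<exists>E. subspace E \<and> dim E = n \<and> openin (top_of_set E) (\<phi> ` U)"
    using smooth_manifold_dim[OF N] by metis
  show "\<exists>n. \<forall>(U, \<phi>)\<in>atlas (prod_mfd M N). openin (mtop (prod_mfd M N)) U \<and>
        (\<exists>E. subspace E \<and> dim E = n \<and> openin (top_of_set E) (\<phi> ` U)) \<and>
        homeomorphic_map (subtopology (mtop (prod_mfd M N)) U) (top_of_set (\<phi> ` U)) \<phi>"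
  proof (rule exI[of _ "m + n"], clarify)
    fix W \<kappa> assume "(W, \<kappa>) \<in> atlas (prod_mfd M N)"
    then obtain U \<phi> V \<psi> where W: "W = U \<times> V" "\<kappa> = map_prod \<phi> \<psi>" and U: "(U, \<phi>) \<in> atlas M" and V: "(V, \<psi>) \<in> atlas N"
      by (elim prod_atlasE) simp
    note cU = atlas_subset_charts[OF M U] and cV = atlas_subset_charts[OF N V]
    obtain E where E: "subspace E" "dim E = m" "openin (top_of_set E) (\<phi> ` U)" using m[OF U] by blast
    obtain F where F: "subspace F" "dim F = n" "openin (top_of_set F) (\<psi> ` V)" using n[OF V] by blast
    have "openin (mtop (prod_mfd M N)) W"
      using chartD(1)[OF cU] chartD(1)[OF cV] by (simp add: prod_mfd_def W openin_prod_Times_iff)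
    moreover have "subspace (E \<times> F)" using E F by (simp add: subspace_Times)
    moreover have "dim (E \<times> F) = m + n" using E F by (simp add: dim_Times)
    moreover have "openin (top_of_set (E \<times> F)) (\<kappa> ` W)"
      unfolding W map_prod_image_Times using E F by (intro openin_Times)
    moreover have "homeomorphic_map (subtopology (mtop (prod_mfd M N)) W) (top_of_set (\<kappa> ` W)) \<kappa>"
    proof -
      obtain g where g: "homeomorphic_maps (subtopology (mtop M) U) (top_of_set (\<phi> ` U)) \<phi> g"
        using chartD(3)[OF cU] homeomorphic_map_maps by metis
      obtain h where h: "homeomorphic_maps (subtopology (mtop N) V) (top_of_set (\<psi> ` V)) \<psi> h"
        using chartD(3)[OF cV] homeomorphic_map_maps by metis
      have "homeomorphic_maps (prod_topology (subtopology (mtop M) U) (subtopology (mtop N) V))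
         (prod_topology (top_of_set (\<phi> ` U)) (top_of_set (\<psi> ` V))) (\<lambda>(x, y). (\<phi> x, \<psi> y)) (\<lambda>(x, y). (g x, h y))"
        using g h by (simp only: homeomorphic_maps_prod simp_thms)
      then have "homeomorphic_map (prod_topology (subtopology (mtop M) U) (subtopology (mtop N) V))
         (prod_topology (top_of_set (\<phi> ` U)) (top_of_set (\<psi> ` V))) (\<lambda>(x, y). (\<phi> x, \<psi> y))"
        unfolding homeomorphic_map_maps by (rule exI[where x = "\<lambda>(x, y). (g x, h y)"])
      moreover have "\<kappa> ` W = \<phi> ` U \<times> \<psi> ` V" unfolding W map_prod_image_Times ..
      moreover have "\<kappa> = (\<lambda>(x, y). (\<phi> x, \<psi> y))" by (simp add: W map_prod_def)
      ultimately show ?thesis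
        by (simp only: W(1) prod_mfd_def mfd.simps subtopology_Times prod_topology_subtopology_eu)
    qed
    ultimately show "openin (mtop (prod_mfd M N)) W \<and>
        (\<exists>E. subspace E \<and> dim E = m + n \<and> openin (top_of_set E) (\<kappa> ` W)) \<and>
        homeomorphic_map (subtopology (mtop (prod_mfd M N)) W) (top_of_set (\<kappa> ` W)) \<kappa>"
      by (intro conjI exI[of _ "E \<times> F"])
  qed
  show "\<forall>(U, \<phi>)\<in>atlas (prod_mfd M N). \<forall>(V, \<psi>)\<in>atlas (prod_mfd M N).
     smooth_on (\<phi> ` (U \<inter> V)) (\<psi> \<circ> inv_into U \<phi>)"
  proof clarify
    fix W \<kappa> W' \<kappa>' assume "(W, \<kappa>) \<in> atlas (prod_mfd M N)" "(W', \<kappa>') \<in> atlas (prod_mfd M N)"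
    then obtain U \<phi> V \<psi> U' \<phi>' V' \<psi>' where W: "W = U \<times> V" "\<kappa> = map_prod \<phi> \<psi>" "W' = U' \<times> V'" "\<kappa>' = map_prod \<phi>' \<psi>'"
      and U: "(U, \<phi>) \<in> atlas M" "(U', \<phi>') \<in> atlas M" and V: "(V, \<psi>) \<in> atlas N" "(V', \<psi>') \<in> atlas N"
      by (elim prod_atlasE) simp
    note cU = atlas_subset_charts[OF M U(1)] and cV = atlas_subset_charts[OF N V(1)]
    let ?A = "\<phi> ` (U \<inter> U')" and ?B = "\<psi> ` (V \<inter> V')"
    have im: "\<kappa> ` (W \<inter> W') = ?A \<times> ?B"
      unfolding W Times_Int_Times map_prod_image_Times ..
    have 1: "smooth_on (?A \<times> ?B) (\<lambda>z. (\<phi>' \<circ> inv_into U \<phi>) (fst z))"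
      by (rule smooth_on_compose[OF smooth_on_bounded_linear[OF bounded_linear_fst] chartD(4)[OF cU U(2)]]) auto
    have 2: "smooth_on (?A \<times> ?B) (\<lambda>z. (\<psi>' \<circ> inv_into V \<psi>) (snd z))"
      by (rule smooth_on_compose[OF smooth_on_bounded_linear[OF bounded_linear_snd] chartD(4)[OF cV V(2)]]) auto
    have "smooth_on (?A \<times> ?B) (\<lambda>z. ((\<phi>' \<circ> inv_into U \<phi>) (fst z), (\<psi>' \<circ> inv_into V \<psi>) (snd z)))"
      by (rule smooth_on_Pair[OF 1 2])
    then show "smooth_on (\<kappa> ` (W \<inter> W')) (\<kappa>' \<circ> inv_into W \<kappa>)"
      unfolding im
    proof (rule smooth_on_cong)
      fix z assume "z \<in> ?A \<times> ?B"
      then have "z \<in> \<phi> ` U \<times> \<psi> ` V" by auto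
      from inv_into_map_prod[OF chart_inj[OF cU] chart_inj[OF cV] this]
      show "((\<phi>' \<circ> inv_into U \<phi>) (fst z), (\<psi>' \<circ> inv_into V \<psi>) (snd z)) = (\<kappa>' \<circ> inv_into W \<kappa>) z"
        by (simp add: W)
    qed
  qed
qed

lemma vsmooth_Pair:
  fixes f :: "'a \<Rightarrow> 'b::euclidean_space" and g :: "'a \<Rightarrow> 'c::euclidean_space"
  assumes "vsmooth M W f" "vsmooth M W g"
  shows "vsmooth M W (\<lambda>x. (f x, g x))"
  by (rule vsmoothI) (rule smooth_on_Pair[OF vsmoothD[OF assms(1)] vsmoothD[OF assms(2)]]; assumption)

lemma smooth_map_Pair:
  assumes F: "smooth_map L M F" and H: "smooth_map L N H"
  shows "smooth_map L (prod_mfd M N) (\<lambda>x. (F x, H x))"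
  unfolding smooth_map_iff
proof (intro conjI, goal_cases)
  case 1
  then show ?case using F H by (simp add: smooth_map_iff prod_mfd_def continuous_map_pairwise o_def)
next
  case 2
  show ?case
  proof clarify
    fix W \<kappa> assume "(W, \<kappa>) \<in> atlas (prod_mfd M N)"
    then obtain U \<phi> V \<psi> where W: "W = U \<times> V" "\<kappa> = map_prod \<phi> \<psi>" and U: "(U, \<phi>) \<in> atlas M" and V: "(V, \<psi>) \<in> atlas N"
      by (elim prod_atlasE) simp
    have "vsmooth L ((\<lambda>x. (F x, H x)) -` W) (\<phi> \<circ> F)" "vsmooth L ((\<lambda>x. (F x, H x)) -` W) (\<psi> \<circ> H)"
      by (rule vsmooth_subset[OF smooth_map_vsmooth_chart[OF F U]] vsmooth_subset[OF smooth_map_vsmooth_chart[OF H V]]; auto simp: W)+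
    from vsmooth_Pair[OF this] show "vsmooth L ((\<lambda>x. (F x, H x)) -` W) (\<kappa> \<circ> (\<lambda>x. (F x, H x)))"
      by (simp add: W o_def)
  qed
qed

lemma smooth_map_fst:
  assumes M: "smooth_manifold M" and N: "smooth_manifold N"
  shows "smooth_map (prod_mfd M N) M fst"
  unfolding smooth_map_iff
proof (intro conjI, goal_cases)
  case 1
  then show ?case by (simp add: prod_mfd_def continuous_map_fst)
next
  case 2
  show ?case
  proof clarify
    fix U' \<phi>' assume U': "(U', \<phi>') \<in> atlas M"
    show "vsmooth (prod_mfd M N) (fst -` U') (\<phi>' \<circ> fst)"
    proof (rule vsmoothI)
      fix W \<kappa> assume "(W, \<kappa>) \<in> atlas (prod_mfd M N)"
      then obtain U \<phi> V \<psi> where W: "W = U \<times> V" "\<kappa> = map_prod \<phi> \<psi>" and U: "(U, \<phi>) \<in> atlas M" and V: "(V, \<psi>) \<in> atlas N"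
        by (elim prod_atlasE) simp
      note cU = atlas_subset_charts[OF M U] and cV = atlas_subset_charts[OF N V]
      have im: "\<kappa> ` (W \<inter> fst -` U') = \<phi> ` (U \<inter> U') \<times> \<psi> ` V"
        unfolding W by auto
      have "smooth_on (\<phi> ` (U \<inter> U') \<times> \<psi> ` V) (\<lambda>z. (\<phi>' \<circ> inv_into U \<phi>) (fst z))"
        by (rule smooth_on_compose[OF smooth_on_bounded_linear[OF bounded_linear_fst] chartD(4)[OF cU U']]) auto
      then show "smooth_on (\<kappa> ` (W \<inter> fst -` U')) (\<lambda>z. (\<phi>' \<circ> fst) (inv_into W \<kappa> z))"
        unfolding im
      proof (rule smooth_on_cong)
        fix z assume "z \<in> \<phi> ` (U \<inter> U') \<times> \<psi> ` V"
        then have "z \<in> \<phi> ` U \<times> \<psi> ` V" by auto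
        from inv_into_map_prod[OF chart_inj[OF cU] chart_inj[OF cV] this]
        show "(\<phi>' \<circ> inv_into U \<phi>) (fst z) = (\<phi>' \<circ> fst) (inv_into W \<kappa> z)" by (simp add: W)
      qed
    qed
  qed
qed

lemma smooth_map_snd:
  assumes M: "smooth_manifold M" and N: "smooth_manifold N"
  shows "smooth_map (prod_mfd M N) N snd"
  unfolding smooth_map_iff
proof (intro conjI, goal_cases)
  case 1
  then show ?case by (simp add: prod_mfd_def continuous_map_snd)
next
  case 2
  show ?case
  proof clarify
    fix V' \<psi>' assume V': "(V', \<psi>') \<in> atlas N"
    show "vsmooth (prod_mfd M N) (snd -` V') (\<psi>' \<circ> snd)"
    proof (rule vsmoothI)
      fix W \<kappa> assume "(W, \<kappa>) \<in> atlas (prod_mfd M N)"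
      then obtain U \<phi> V \<psi> where W: "W = U \<times> V" "\<kappa> = map_prod \<phi> \<psi>" and U: "(U, \<phi>) \<in> atlas M" and V: "(V, \<psi>) \<in> atlas N"
        by (elim prod_atlasE) simp
      note cU = atlas_subset_charts[OF M U] and cV = atlas_subset_charts[OF N V]
      have im: "\<kappa> ` (W \<inter> snd -` V') = \<phi> ` U \<times> \<psi> ` (V \<inter> V')"
        unfolding W by auto
      have "smooth_on (\<phi> ` U \<times> \<psi> ` (V \<inter> V')) (\<lambda>z. (\<psi>' \<circ> inv_into V \<psi>) (snd z))"
        by (rule smooth_on_compose[OF smooth_on_bounded_linear[OF bounded_linear_snd] chartD(4)[OF cV V']]) auto
      then show "smooth_on (\<kappa> ` (W \<inter> snd -` V')) (\<lambda>z. (\<psi>' \<circ> snd) (inv_into W \<kappa> z))"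
        unfolding im
      proof (rule smooth_on_cong)
        fix z assume "z \<in> \<phi> ` U \<times> \<psi> ` (V \<inter> V')"
        then have "z \<in> \<phi> ` U \<times> \<psi> ` V" by auto
        from inv_into_map_prod[OF chart_inj[OF cU] chart_inj[OF cV] this]
        show "(\<psi>' \<circ> inv_into V \<psi>) (snd z) = (\<psi>' \<circ> snd) (inv_into W \<kappa> z)" by (simp add: W)
      qed
    qed
  qed
qed

lemma psmooth_prod:
  assumes \<iota>: "psmooth S M \<iota>" and \<kappa>: "psmooth R N \<kappa>"
  shows "psmooth (S \<times> R) (prod_mfd M N) (map_prod \<iota> \<kappa>)"
  unfolding psmooth_def
proof (intro conjI, goal_cases)
  case 1
  then show ?case using assms by (simp add: psmooth_def open_Times)
next
  case 2
  have "continuous_map (prod_topology (top_of_set S) (top_of_set R)) (prod_topology (mtop M) (mtop N)) (\<lambda>(x, y). (\<iota> x, \<kappa> y))"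
    unfolding continuous_map_prod_top using assms unfolding psmooth_def by blast
  then show ?case by (simp add: prod_mfd_def map_prod_def)
next
  case 3
  show ?case
  proof clarify
    fix W \<mu> assume "(W, \<mu>) \<in> atlas (prod_mfd M N)"
    then obtain U \<phi> V \<psi> where W: "W = U \<times> V" "\<mu> = map_prod \<phi> \<psi>" and U: "(U, \<phi>) \<in> atlas M" and V: "(V, \<psi>) \<in> atlas N"
      by (elim prod_atlasE) simp
    let ?A = "S \<times> R \<inter> map_prod \<iota> \<kappa> -` W"
    have u: "smooth_on (S \<inter> \<iota> -` U) (\<phi> \<circ> \<iota>)" and v: "smooth_on (R \<inter> \<kappa> -` V) (\<psi> \<circ> \<kappa>)"
      using assms U V unfolding psmooth_def by auto
    have 1: "smooth_on ?A (\<lambda>z. (\<phi> \<circ> \<iota>) (fst z))"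
      by (rule smooth_on_compose[OF smooth_on_bounded_linear[OF bounded_linear_fst] u]) (auto simp: W)
    have 2: "smooth_on ?A (\<lambda>z. (\<psi> \<circ> \<kappa>) (snd z))"
      by (rule smooth_on_compose[OF smooth_on_bounded_linear[OF bounded_linear_snd] v]) (auto simp: W)
    have "smooth_on ?A (\<lambda>z. ((\<phi> \<circ> \<iota>) (fst z), (\<psi> \<circ> \<kappa>) (snd z)))"
      by (rule smooth_on_Pair[OF 1 2])
    then show "smooth_on ?A (\<mu> \<circ> map_prod \<iota> \<kappa>)"
      by (rule smooth_on_cong) (auto simp: W)
  qed
qed

lemma psmooth_smooth_funs:
  assumes "smooth_manifold M" "psmooth S M \<iota>" "f \<in> smooth_funs M"
  shows "smooth_on S (f \<circ> \<iota>)"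
proof -
  have "smooth_on (S \<inter> \<iota> -` points M) (f \<circ> \<iota>)"
    using assms psmooth_vsmooth smooth_funs_iff_vsmooth by metis
  moreover have "S \<inter> \<iota> -` points M = S" using psmooth_in_points[OF assms(2)] by auto
  ultimately show ?thesis by simp
qed

lemma dd_cong:
  assumes "open S" "x \<in> S" "smooth_on S f" "\<And>y. y \<in> S \<Longrightarrow> f y = g y"
  shows "dd f v x = dd g v x"
proof -
  have "(g has_derivative frechet_derivative f (at x)) (at x)"
    by (rule has_derivative_transform_within_open[OF smooth_on_has_derivative[OF assms(1,3,2)] assms(1,2,4)])
  from frechet_derivative_at[OF this] show ?thesis by simp
qed

lemma dd_Pair:
  fixes G :: "'a::euclidean_space \<times> 'b::euclidean_space \<Rightarrow> real"
  assumes Q: "open Q" "smooth_on Q G" "(w, z) \<in> Q"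
  shows "dd (\<lambda>t. G (w, t)) b z = dd G (0, b) (w, z)" "dd (\<lambda>t. G (t, z)) a w = dd G (a, 0) (w, z)"
proof -
  note d = smooth_on_has_derivative[OF Q]
  have "((\<lambda>t. (w, t)) has_derivative (\<lambda>t. (0, t))) (at z)" "((\<lambda>t. (t, z)) has_derivative (\<lambda>t. (t, 0))) (at w)"
    by (intro has_derivative_Pair has_derivative_ident has_derivative_const)+
  from frechet_derivative_at[OF diff_chain_at[OF this(1) d]] frechet_derivative_at[OF diff_chain_at[OF this(2) d]]
  show "dd (\<lambda>t. G (w, t)) b z = dd G (0, b) (w, z)" "dd (\<lambda>t. G (t, z)) a w = dd G (a, 0) (w, z)"
    by (simp_all add: o_def fun_eq_iff)
qed

lemma smooth_funs_section:
  assumes M: "smooth_manifold M" and N: "smooth_manifold N" and K: "K \<in> smooth_funs (prod_mfd M N)"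
  shows "x \<in> points M \<Longrightarrow> (\<lambda>y. K (x, y)) \<in> smooth_funs N" "y \<in> points N \<Longrightarrow> (\<lambda>x. K (x, y)) \<in> smooth_funs M"
  using smooth_funs_pullback[OF N smooth_manifold_prod[OF M N] smooth_map_Pair[OF smooth_map_const smooth_map_id[OF N]] K]
    smooth_funs_pullback[OF M smooth_manifold_prod[OF M N] smooth_map_Pair[OF smooth_map_id[OF M] smooth_map_const] K]
  by (simp_all add: o_def)

text \<open>In coordinates at \<open>y\<close> the derivation \<open>v\<close> is a fixed
  combination of partial derivatives at \<open>z0\<close>, and each of these depends smoothly on the
  other variable.\<close>

lemma smooth_funs_partial:
  fixes M :: "('a, 'e::euclidean_space) mfd" and N :: "('b, 'f::euclidean_space) mfd"
  assumes M: "smooth_manifold M" and N: "smooth_manifold N" and K: "K \<in> smooth_funs (prod_mfd M N)"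
    and y: "y \<in> points N" and v: "v \<in> tangent_space N y"
  shows "(\<lambda>x. v (\<lambda>y. K (x, y))) \<in> smooth_funs M"
proof -
  obtain \<psi> \<kappa> R where Q: "param N \<psi> \<kappa> R" "y \<in> \<kappa> ` R" using param_exists[OF N openin_topspace y] by metis
  note q = paramD[OF Q(1)]
  define z0 where "z0 = \<psi> y"
  have z0: "z0 \<in> R" using q(4)[OF Q(2)] by (simp add: z0_def)
  obtain c where c: "\<And>b. c b \<in> smooth_funs N"
    "\<And>v f. v \<in> tangent_space N y \<Longrightarrow> f \<in> smooth_funs N \<Longrightarrow> v f = (\<Sum>b\<in>Basis. v (c b) * dd (f \<circ> \<kappa>) b (\<psi> y))"
    using tangent_coordinates[OF N Q] by blast
  note c = c(2)[folded z0_def]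
  define g where "g b x = dd (\<lambda>t. K (x, \<kappa> t)) b z0" for b x
  have g: "vsmooth M (points M) (g b)" for b
  proof (rule vsmooth_local[OF M])
    fix x assume x: "x \<in> points M"
    obtain \<phi> \<iota> S where P: "param M \<phi> \<iota> S" "x \<in> \<iota> ` S" using param_exists[OF M openin_topspace x] by metis
    note p = paramD[OF P(1)]
    let ?G = "K \<circ> map_prod \<iota> \<kappa>"
    have G: "smooth_on (S \<times> R) ?G"
      by (rule psmooth_smooth_funs[OF smooth_manifold_prod[OF M N] psmooth_prod[OF p(2) q(2)] K])
    have SR: "open (S \<times> R)" using p(1) q(1) by (rule open_Times)
    have pr: "smooth_on S (\<lambda>w. (w, z0))" by (intro smooth_on_Pair smooth_on_id smooth_on_const)
    have h: "smooth_on S (\<lambda>w. dd ?G (0, b) (w, z0))"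
      by (rule smooth_on_compose[OF pr smooth_on_derivative[OF SR G]]) (use z0 in auto)
    have "vsmooth M (\<iota> ` S) (\<lambda>x. dd ?G (0, b) (\<phi> x, z0))"
      by (rule vsmooth_compose[OF p(6) h _ M]) (use p(4) in auto)
    then have "vsmooth M (\<iota> ` S) (g b)"
    proof (rule vsmooth_cong)
      fix x assume "x \<in> \<iota> ` S"
      then have "(\<phi> x, z0) \<in> S \<times> R" "\<iota> (\<phi> x) = x" using p(4,5) z0 by auto
      with dd_Pair(1)[OF SR G this(1)] show "dd ?G (0, b) (\<phi> x, z0) = g b x" by (simp add: g_def)
    qed (fact M)
    then have "vsmooth M (points M \<inter> \<iota> ` S) (g b)" by (rule vsmooth_subset) simp
    with P p(3) show "\<exists>W'. openin (mtop M) W' \<and> x \<in> W' \<and> vsmooth M (points M \<inter> W') (g b)"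
      by (intro exI[of _ "\<iota> ` S"]) simp
  qed
  have "vsmooth M (points M) (\<lambda>x. \<Sum>b\<in>Basis. v (c b) * g b x)"
    by (intro vsmooth_sum vsmooth_mult vsmooth_const g)
  then show ?thesis
    unfolding smooth_funs_iff_vsmooth
  proof (rule vsmooth_cong)
    fix x assume "x \<in> points M"
    from c[OF v smooth_funs_section(1)[OF M N K this]]
    show "(\<Sum>b\<in>Basis. v (c b) * g b x) = v (\<lambda>y. K (x, y))" by (simp add: g_def o_def)
  qed (fact M)
qed

lemma dd_sum:
  fixes h :: "'i \<Rightarrow> 'a::euclidean_space \<Rightarrow> real"
  assumes "open S" "x \<in> S" "\<And>i. i \<in> I \<Longrightarrow> smooth_on S (h i)"
  shows "dd (\<lambda>w. \<Sum>i\<in>I. c i * h i w) v x = (\<Sum>i\<in>I. c i * dd (h i) v x)"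
proof -
  have "((\<lambda>w. \<Sum>i\<in>I. c i * h i w) has_derivative (\<lambda>v. \<Sum>i\<in>I. c i * frechet_derivative (h i) (at x) v)) (at x)"
    by (intro has_derivative_sum has_derivative_mult_right smooth_on_has_derivative[OF assms(1) assms(3) assms(2)])
  from frechet_derivative_at[OF this] show ?thesis by (simp add: fun_eq_iff)
qed

text \<open>Both sides expand into mixed second derivatives of \<open>K\<close> in a product
  parametrization, so this is the symmetry of second derivatives.\<close>

lemma tangent_commute:
  fixes M :: "('a, 'e::euclidean_space) mfd" and N :: "('b, 'f::euclidean_space) mfd"
  assumes M: "smooth_manifold M" and N: "smooth_manifold N" and K: "K \<in> smooth_funs (prod_mfd M N)"
    and x: "x \<in> points M" and u: "u \<in> tangent_space M x"
    and y: "y \<in> points N" and v: "v \<in> tangent_space N y"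
  shows "u (\<lambda>x. v (\<lambda>y. K (x, y))) = v (\<lambda>y. u (\<lambda>x. K (x, y)))"
proof -
  obtain \<phi> \<iota> S where P: "param M \<phi> \<iota> S" "x \<in> \<iota> ` S" using param_exists[OF M openin_topspace x] by metis
  obtain \<psi> \<kappa> R where Q: "param N \<psi> \<kappa> R" "y \<in> \<kappa> ` R" using param_exists[OF N openin_topspace y] by metis
  note p = paramD[OF P(1)] and q = paramD[OF Q(1)]
  define w0 z0 where "w0 = \<phi> x" and "z0 = \<psi> y"
  have w0: "w0 \<in> S" "\<iota> w0 = x" and z0: "z0 \<in> R" "\<kappa> z0 = y"
    using p(4,5)[OF P(2)] q(4,5)[OF Q(2)] by (simp_all add: w0_def z0_def)
  obtain c where c: "\<And>b. c b \<in> smooth_funs M"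
    "\<And>v f. v \<in> tangent_space M x \<Longrightarrow> f \<in> smooth_funs M \<Longrightarrow> v f = (\<Sum>b\<in>Basis. v (c b) * dd (f \<circ> \<iota>) b (\<phi> x))"
    using tangent_coordinates[OF M P] by blast
  obtain d where d: "\<And>b. d b \<in> smooth_funs N"
    "\<And>v f. v \<in> tangent_space N y \<Longrightarrow> f \<in> smooth_funs N \<Longrightarrow> v f = (\<Sum>b\<in>Basis. v (d b) * dd (f \<circ> \<kappa>) b (\<psi> y))"
    using tangent_coordinates[OF N Q] by blast
  note c = c(2)[folded w0_def] and d = d(2)[folded z0_def]
  let ?G = "K \<circ> map_prod \<iota> \<kappa>"
  have G: "smooth_on (S \<times> R) ?G"
    by (rule psmooth_smooth_funs[OF smooth_manifold_prod[OF M N] psmooth_prod[OF p(2) q(2)] K])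
  have SR: "open (S \<times> R)" using p(1) q(1) by (rule open_Times)
  have G': "smooth_on (S \<times> R) (dd ?G e)" for e by (rule smooth_on_derivative[OF SR G])
  have s1: "smooth_on S (\<lambda>w. dd ?G e (w, z0))" for e
    by (rule smooth_on_compose[OF smooth_on_Pair[OF smooth_on_id smooth_on_const] G']) (use z0 in auto)
  have s2: "smooth_on R (\<lambda>z. dd ?G e (w0, z))" for e
    by (rule smooth_on_compose[OF smooth_on_Pair[OF smooth_on_const smooth_on_id] G']) (use w0 in auto)
  have 1: "v (\<lambda>y. K (\<iota> w, y)) = (\<Sum>b\<in>Basis. v (d b) * dd ?G (0, b) (w, z0))" if "w \<in> S" for w
  proof -
    have "(w, z0) \<in> S \<times> R" using that z0 by simp
    from d[OF v smooth_funs_section(1)[OF M N K psmooth_in_points[OF p(2) that]]] dd_Pair(1)[OF SR G this]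
    show ?thesis by (simp add: o_def)
  qed
  have 2: "u (\<lambda>x. K (x, \<kappa> z)) = (\<Sum>a\<in>Basis. u (c a) * dd ?G (a, 0) (w0, z))" if "z \<in> R" for z
  proof -
    have "(w0, z) \<in> S \<times> R" using that w0 by simp
    from c[OF u smooth_funs_section(2)[OF M N K psmooth_in_points[OF q(2) that]]] dd_Pair(2)[OF SR G this]
    show ?thesis by (simp add: o_def)
  qed
  have in_SR: "(w0, z0) \<in> S \<times> R" using w0 z0 by simp
  have d1: "dd (\<lambda>w. \<Sum>b\<in>Basis. v (d b) * dd ?G (0, b) (w, z0)) a w0 =
      (\<Sum>b\<in>Basis. v (d b) * dd (dd ?G (0, b)) (a, 0) (w0, z0))" for a
    using dd_sum[OF p(1) w0(1), where I = Basis and h = "\<lambda>b w. dd ?G (0, b) (w, z0)" and c = "\<lambda>b. v (d b)" and v = a, OF s1]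
      dd_Pair(2)[OF SR G' in_SR] by simp
  have d2: "dd (\<lambda>z. \<Sum>a\<in>Basis. u (c a) * dd ?G (a, 0) (w0, z)) b z0 =
      (\<Sum>a\<in>Basis. u (c a) * dd (dd ?G (a, 0)) (0, b) (w0, z0))" for b
    using dd_sum[OF q(1) z0(1), where I = Basis and h = "\<lambda>a z. dd ?G (a, 0) (w0, z)" and c = "\<lambda>a. u (c a)" and v = b, OF s2]
      dd_Pair(1)[OF SR G' in_SR] by simp
  have "u (\<lambda>x. v (\<lambda>y. K (x, y))) = (\<Sum>a\<in>Basis. u (c a) * dd (\<lambda>w. v (\<lambda>y. K (\<iota> w, y))) a w0)"
    using c[OF u smooth_funs_partial[OF M N K y v]] by (simp add: o_def)
  also have "\<dots> = (\<Sum>a\<in>Basis. u (c a) * dd (\<lambda>w. \<Sum>b\<in>Basis. v (d b) * dd ?G (0, b) (w, z0)) a w0)"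
    by (intro sum.cong refl arg_cong2[of _ _ _ _ "(*)"] dd_cong[symmetric, OF p(1) w0(1)] smooth_on_sum smooth_on_mult smooth_on_const s1 1[symmetric])
  also have "\<dots> = (\<Sum>a\<in>Basis. u (c a) * (\<Sum>b\<in>Basis. v (d b) * dd (dd ?G (0, b)) (a, 0) (w0, z0)))"
    by (simp only: d1)
  also have "\<dots> = (\<Sum>a\<in>Basis. \<Sum>b\<in>Basis. u (c a) * (v (d b) * dd (dd ?G (a, 0)) (0, b) (w0, z0)))"
    by (simp add: sum_distrib_left second_derivative_symmetric[OF SR G in_SR, of "(0, _)" "(_, 0)"])
  also have "\<dots> = (\<Sum>b\<in>Basis. \<Sum>a\<in>Basis. u (c a) * (v (d b) * dd (dd ?G (a, 0)) (0, b) (w0, z0)))"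
    by (rule sum.swap)
  also have "\<dots> = (\<Sum>b\<in>Basis. v (d b) * (\<Sum>a\<in>Basis. u (c a) * dd (dd ?G (a, 0)) (0, b) (w0, z0)))"
    by (simp add: sum_distrib_left mult_ac)
  also have "\<dots> = (\<Sum>b\<in>Basis. v (d b) * dd (\<lambda>z. \<Sum>a\<in>Basis. u (c a) * dd ?G (a, 0) (w0, z)) b z0)"
    by (simp only: d2)
  also have "\<dots> = (\<Sum>b\<in>Basis. v (d b) * dd (\<lambda>z. u (\<lambda>x. K (x, \<kappa> z))) b z0)"
    by (intro sum.cong refl arg_cong2[of _ _ _ _ "(*)"] dd_cong[OF q(1) z0(1)] smooth_on_sum smooth_on_mult smooth_on_const s2 2[symmetric])
  also have "\<dots> = v (\<lambda>y. u (\<lambda>x. K (x, y)))"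
  proof -
    have "smooth_map (prod_mfd N M) (prod_mfd M N) (\<lambda>z. (snd z, fst z))"
      by (rule smooth_map_Pair[OF smooth_map_snd[OF N M] smooth_map_fst[OF N M]])
    from smooth_funs_pullback[OF smooth_manifold_prod[OF N M] smooth_manifold_prod[OF M N] this K]
    have "(\<lambda>z. K (snd z, fst z)) \<in> smooth_funs (prod_mfd N M)" by (simp add: o_def)
    from d[OF v smooth_funs_partial[OF N M this x u]] show ?thesis by (simp add: o_def)
  qed
  finally show ?thesis .
qed

section \<open>Diffeomorphisms acting on charts and submanifolds\<close>

lemma smooth_map_charts:
  assumes M: "smooth_manifold M" and N: "smooth_manifold N" and F: "smooth_map M N F" and c: "(V, \<psi>) \<in> charts N"
  shows "vsmooth M (F -` V) (\<psi> \<circ> F)"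
  by (rule vsmooth_smooth_map[OF M N F vsmooth_of_chart[OF c]])

context
  fixes M :: "('a, 'e::euclidean_space) mfd" and F H :: "'a \<Rightarrow> 'a"
  assumes M: "smooth_manifold M" and F: "smooth_map M M F" and H: "smooth_map M M H"
    and HF: "\<And>x. x \<in> points M \<Longrightarrow> H (F x) = x" and FH: "\<And>x. x \<in> points M \<Longrightarrow> F (H x) = x"
begin

lemma diffeo_image: "U \<subseteq> points M \<Longrightarrow> F ` U = {x \<in> points M. H x \<in> U}"
  using HF FH smooth_map_in_points[OF F] smooth_map_in_points[OF H] by (force simp: image_iff)

lemma chart_diffeo:
  assumes c: "(U, \<phi>) \<in> charts M"
  shows "(F ` U, \<phi> \<circ> H) \<in> charts M"
proof -
  have U: "U \<subseteq> points M" by (rule chart_subset[OF c])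
  have HFU: "H (F x) = x" if "x \<in> U" for x using HF that U by blast
  note inj = chart_inj[OF c]
  have im: "(\<phi> \<circ> H) ` (F ` U) = \<phi> ` U" using HFU by (force simp: image_iff)
  have inj': "inj_on (\<phi> \<circ> H) (F ` U)" using inj HFU by (auto simp: inj_on_def)
  have inv: "inv_into (F ` U) (\<phi> \<circ> H) z = F (inv_into U \<phi> z)" if "z \<in> \<phi> ` U" for z
  proof -
    obtain x where x: "x \<in> U" "z = \<phi> x" using \<open>z \<in> \<phi> ` U\<close> by blast
    have "inv_into (F ` U) (\<phi> \<circ> H) ((\<phi> \<circ> H) (F x)) = F x" by (rule inv_into_f_f[OF inj']) (use x in simp)
    then show ?thesis using x inj HFU by simp
  qed
  let ?A = "insert (F ` U, \<phi> \<circ> H) (atlas M)"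
  have op: "openin (mtop M) (F ` U)"
    unfolding diffeo_image[OF U] by (rule smooth_map_open_vimage[OF H chartD(1)[OF c]])
  have sm: "smooth_manifold (M\<lparr>atlas := insert (U, \<phi>) (atlas M)\<rparr>)" using c by (simp add: charts_def)
  obtain n where n: "\<And>V \<psi>. (V, \<psi>) \<in> insert (U, \<phi>) (atlas M) \<Longrightarrow> \<exists>E. subspace E \<and> dim E = n \<and> openin (top_of_set E) (\<psi> ` V)"
    using smooth_manifold_dim[OF sm] by auto
  have hH: "homeomorphic_map (mtop M) (mtop M) H"
    unfolding homeomorphic_map_maps
    by (rule exI[of _ F]) (use F H HF FH in \<open>simp add: homeomorphic_maps_def smooth_map_iff\<close>)
  have "H ` (points M \<inter> F ` U) = points M \<inter> U"
    using U HFU smooth_map_in_points[OF F] by (force simp: image_iff)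
  then have "homeomorphic_map (subtopology (mtop M) (F ` U)) (subtopology (mtop M) U) H"
    by (rule homeomorphic_map_subtopologies[OF hH])
  then have hom: "homeomorphic_map (subtopology (mtop M) (F ` U)) (top_of_set ((\<phi> \<circ> H) ` (F ` U))) (\<phi> \<circ> H)"
    unfolding im using chartD(3)[OF c] by (rule homeomorphic_map_compose)
  have t1: "smooth_on ((\<phi> \<circ> H) ` (F ` U \<inter> V)) (\<psi> \<circ> inv_into (F ` U) (\<phi> \<circ> H))" if V: "(V, \<psi>) \<in> atlas M" for V \<psi>
  proof -
    have "smooth_on (\<phi> ` (U \<inter> F -` V)) ((\<psi> \<circ> F) \<circ> inv_into U \<phi>)"
      by (rule vsmooth_chart[OF M c smooth_map_vsmooth_chart[OF F V]])
    moreover have "(\<phi> \<circ> H) ` (F ` U \<inter> V) = \<phi> ` (U \<inter> F -` V)" using HFU by (force simp: image_iff)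
    ultimately show ?thesis by (auto elim!: smooth_on_cong simp: inv)
  qed
  have t2: "smooth_on (\<psi> ` (V \<inter> F ` U)) ((\<phi> \<circ> H) \<circ> inv_into V \<psi>)" if V: "(V, \<psi>) \<in> atlas M" for V \<psi>
  proof -
    have "smooth_on (\<psi> ` (V \<inter> H -` U)) ((\<phi> \<circ> H) \<circ> inv_into V \<psi>)"
      using vsmooth_chart[OF M atlas_subset_charts[OF M V] smooth_map_charts[OF M M H c]] .
    then show ?thesis by (rule smooth_on_subset) (use diffeo_image[OF U] in auto)
  qed
  have t3: "smooth_on ((\<phi> \<circ> H) ` (F ` U \<inter> F ` U)) ((\<phi> \<circ> H) \<circ> inv_into (F ` U) (\<phi> \<circ> H))"
  proof (rule smooth_on_cong[OF smooth_on_id])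
    fix z assume "z \<in> (\<phi> \<circ> H) ` (F ` U \<inter> F ` U)"
    then have "z \<in> (\<phi> \<circ> H) ` (F ` U)" by simp
    from f_inv_into_f[OF this] show "z = ((\<phi> \<circ> H) \<circ> inv_into (F ` U) (\<phi> \<circ> H)) z"
      by (simp only: o_apply)
  qed
  have t4: "smooth_on (\<kappa> ` (V \<inter> V')) (\<psi> \<circ> inv_into V \<kappa>)" if "(V, \<kappa>) \<in> atlas M" "(V', \<psi>) \<in> atlas M" for V V' \<kappa> \<psi>
    using chartD(4)[OF atlas_subset_charts[OF M that(1)] that(2)] .
  have "smooth_manifold (M\<lparr>atlas := ?A\<rparr>)"
    unfolding smooth_manifold_def
  proof (intro conjI, goal_cases)
    case 1 then show ?case using M by (simp add: smooth_manifold_def)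
  next
    case 2 then show ?case using M by (simp add: smooth_manifold_def)
  next
    case 3 then show ?case
      using smooth_manifold_points[OF M] openin_subset[OF op] by auto
  next
    case 4
    show ?case
    proof (rule exI[of _ n], clarify)
      fix V \<psi> assume V: "(V, \<psi>) \<in> atlas (M\<lparr>atlas := ?A\<rparr>)"
      show "openin (mtop (M\<lparr>atlas := ?A\<rparr>)) V \<and> (\<exists>E. subspace E \<and> dim E = n \<and> openin (top_of_set E) (\<psi> ` V)) \<and>
        homeomorphic_map (subtopology (mtop (M\<lparr>atlas := ?A\<rparr>)) V) (top_of_set (\<psi> ` V)) \<psi>"
      proof (cases "(V, \<psi>) = (F ` U, \<phi> \<circ> H)")
        case True
        then show ?thesis using op hom n[of U \<phi>] im by simp
      next
        case False
        then have "(V, \<psi>) \<in> atlas M" using V by auto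
        then show ?thesis using n[of V \<psi>] chartD(1,3)[OF atlas_subset_charts[OF M]] by simp
      qed
    qed
  next
    case 5
    show ?case
    proof clarify
      fix V \<kappa> V' \<psi> assume "(V, \<kappa>) \<in> atlas (M\<lparr>atlas := ?A\<rparr>)" "(V', \<psi>) \<in> atlas (M\<lparr>atlas := ?A\<rparr>)"
      then consider "(V, \<kappa>) = (F ` U, \<phi> \<circ> H)" "(V', \<psi>) = (F ` U, \<phi> \<circ> H)" | "(V, \<kappa>) = (F ` U, \<phi> \<circ> H)" "(V', \<psi>) \<in> atlas M"
        | "(V, \<kappa>) \<in> atlas M" "(V', \<psi>) = (F ` U, \<phi> \<circ> H)" | "(V, \<kappa>) \<in> atlas M" "(V', \<psi>) \<in> atlas M" by auto
      then show "smooth_on (\<kappa> ` (V \<inter> V')) (\<psi> \<circ> inv_into V \<kappa>)"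
        using t1 t2 t3 t4 by cases (simp_all only: prod.inject)
    qed
  qed
  then show ?thesis by (simp add: charts_def)
qed

end

lemma sub_mfd_simps: "mtop (sub_mfd M X) = subtopology (mtop M) X"
  "atlas (sub_mfd M X) = {(U \<inter> X, \<phi>) |U \<phi>. (U, \<phi>) \<in> charts M \<and> (\<exists>S. subspace S \<and> \<phi> ` (U \<inter> X) = \<phi> ` U \<inter> S)}"
  by (simp_all add: sub_mfd_def)

lemma sub_atlasE:
  assumes "(A, \<phi>) \<in> atlas (sub_mfd M X)"
  obtains U S where "A = U \<inter> X" "(U, \<phi>) \<in> charts M" "subspace S" "\<phi> ` (U \<inter> X) = \<phi> ` U \<inter> S"
  using assms unfolding sub_mfd_simps by blast

lemma sub_atlasI:
  "(U, \<phi>) \<in> charts M \<Longrightarrow> subspace S \<Longrightarrow> \<phi> ` (U \<inter> X) = \<phi> ` U \<inter> S \<Longrightarrow> (U \<inter> X, \<phi>) \<in> atlas (sub_mfd M X)"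
  unfolding sub_mfd_simps by blast

lemma inv_into_subset:
  assumes "inj_on f A" "B \<subseteq> A" "z \<in> f ` B"
  shows "inv_into B f z = inv_into A f z"
proof -
  obtain x where x: "x \<in> B" "z = f x" using assms(3) by blast
  have "inj_on f B" by (rule inj_on_subset[OF assms(1,2)])
  then have "inv_into B f z = x" using x by simp
  moreover have "inv_into A f z = x" using x assms(1,2) by (simp add: subset_iff)
  ultimately show ?thesis by simp
qed

lemma chart_transition:
  assumes M: "smooth_manifold M" and c: "(U, \<phi>) \<in> charts M" and d: "(V, \<psi>) \<in> charts M"
  shows "smooth_on (\<phi> ` (U \<inter> V)) (\<psi> \<circ> inv_into U \<phi>)"
  by (rule vsmooth_chart[OF M c vsmooth_of_chart[OF d]])

text \<open>A slice chart of \<open>X\<close> composed with the inverse \<open>H\<close> is a slice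
  chart of the image with the same linear slice. For the common dimension, charts of the image are
  carried back to \<open>X\<close> by \<open>F\<close>. Needed for cosets, which are left translates
  of the torus.\<close>

lemma smooth_manifold_sub_mfd_diffeo:
  fixes M :: "('a, 'e::euclidean_space) mfd"
  assumes M: "smooth_manifold M" and F: "smooth_map M M F" and H: "smooth_map M M H"
    and HF: "\<And>x. x \<in> points M \<Longrightarrow> H (F x) = x" and FH: "\<And>x. x \<in> points M \<Longrightarrow> F (H x) = x"
    and X: "X \<subseteq> points M" and sub: "smooth_manifold (sub_mfd M X)"
  shows "smooth_manifold (sub_mfd M (F ` X))"
  unfolding smooth_manifold_def
proof (intro conjI)
  have FX: "F ` X \<subseteq> points M" using X smooth_map_in_points[OF F] by auto
  have HFX: "H (F x) = x" if "x \<in> X" for x using HF X that by auto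
  show "Hausdorff_space (mtop (sub_mfd M (F ` X)))" "second_countable (mtop (sub_mfd M (F ` X)))"
    using M by (simp_all add: sub_mfd_simps smooth_manifold_def Hausdorff_space_subtopology second_countable_subtopology)
  have pX: "points (sub_mfd M X) = X" "points (sub_mfd M (F ` X)) = F ` X" using X FX by (auto simp: sub_mfd_simps)
  show "points (sub_mfd M (F ` X)) = (\<Union>(U, \<phi>)\<in>atlas (sub_mfd M (F ` X)). U)"
  proof
    show "(\<Union>(U, \<phi>)\<in>atlas (sub_mfd M (F ` X)). U) \<subseteq> points (sub_mfd M (F ` X))"
      unfolding pX by (auto elim!: sub_atlasE)
    show "points (sub_mfd M (F ` X)) \<subseteq> (\<Union>(U, \<phi>)\<in>atlas (sub_mfd M (F ` X)). U)"
      unfolding pX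
    proof
      fix y assume "y \<in> F ` X"
      then obtain x where x: "x \<in> X" "y = F x" by blast
      obtain A \<phi> where A: "(A, \<phi>) \<in> atlas (sub_mfd M X)" "x \<in> A" using atlas_cover[OF sub] x(1) pX(1) by metis
      obtain U S where U: "A = U \<inter> X" "(U, \<phi>) \<in> charts M" "subspace S" "\<phi> ` (U \<inter> X) = \<phi> ` U \<inter> S"
        using sub_atlasE[OF A(1)] by metis
      have HFU: "H (F x) = x" if "x \<in> U" for x using HF chart_subset[OF U(2)] that by auto
      have "(\<phi> \<circ> H) ` (F ` U \<inter> F ` X) = \<phi> ` (U \<inter> X)"
      proof -
        have "F ` U \<inter> F ` X = F ` (U \<inter> X)" using HFU HFX by (auto simp: image_iff) (metis IntI)
        then show ?thesis using HFU by (force simp: image_iff)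
      qed
      moreover have "(\<phi> \<circ> H) ` F ` U = \<phi> ` U" using HFU by (force simp: image_iff)
      ultimately have "(\<phi> \<circ> H) ` (F ` U \<inter> F ` X) = (\<phi> \<circ> H) ` F ` U \<inter> S" using U(4) by simp
      from sub_atlasI[OF chart_diffeo[OF M F H HF FH U(2)] U(3) this]
      show "y \<in> (\<Union>(U, \<phi>)\<in>atlas (sub_mfd M (F ` X)). U)"
        by (rule UN_I) (use x A(2) U(1) in auto)
    qed
  qed
  obtain n where n: "\<And>A \<phi>. (A, \<phi>) \<in> atlas (sub_mfd M X) \<Longrightarrow> \<exists>E. subspace E \<and> dim E = n \<and> openin (top_of_set E) (\<phi> ` A)"
    using smooth_manifold_dim[OF sub] by metis
  show "\<exists>n. \<forall>(A, \<phi>)\<in>atlas (sub_mfd M (F ` X)). openin (mtop (sub_mfd M (F ` X))) A \<and>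
        (\<exists>E. subspace E \<and> dim E = n \<and> openin (top_of_set E) (\<phi> ` A)) \<and>
        homeomorphic_map (subtopology (mtop (sub_mfd M (F ` X))) A) (top_of_set (\<phi> ` A)) \<phi>"
  proof (rule exI[of _ n], clarify)
    fix A \<phi> assume "(A, \<phi>) \<in> atlas (sub_mfd M (F ` X))"
    then obtain U S where U: "A = U \<inter> F ` X" "(U, \<phi>) \<in> charts M" "subspace S" "\<phi> ` (U \<inter> F ` X) = \<phi> ` U \<inter> S"
      using sub_atlasE by metis
    have FHU: "F (H x) = x" if "x \<in> U" for x using FH chart_subset[OF U(2)] that by auto
    have "(\<phi> \<circ> F) ` (H ` U \<inter> X) = \<phi> ` (U \<inter> F ` X)"
    proof
      show "(\<phi> \<circ> F) ` (H ` U \<inter> X) \<subseteq> \<phi> ` (U \<inter> F ` X)" using FHU by (auto intro!: imageI)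
      show "\<phi> ` (U \<inter> F ` X) \<subseteq> (\<phi> \<circ> F) ` (H ` U \<inter> X)"
      proof clarify
        fix x assume x: "F x \<in> U" "x \<in> X"
        then have "x \<in> H ` U \<inter> X" using HFX[OF x(2)] by (metis IntI imageI)
        then show "\<phi> (F x) \<in> (\<phi> \<circ> F) ` (H ` U \<inter> X)" by (metis comp_apply imageI)
      qed
    qed
    moreover have "(\<phi> \<circ> F) ` H ` U = \<phi> ` U" using FHU by (force simp: image_iff)
    ultimately have e: "(\<phi> \<circ> F) ` (H ` U \<inter> X) = (\<phi> \<circ> F) ` H ` U \<inter> S" "(\<phi> \<circ> F) ` (H ` U \<inter> X) = \<phi> ` A" using U(1,4) by simp_all
    have dim: "\<exists>E. subspace E \<and> dim E = n \<and> openin (top_of_set E) (\<phi> ` A)"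
      using n[OF sub_atlasI[OF chart_diffeo[OF M H F FH HF U(2)] U(3) e(1)]] unfolding e(2) .
    have "openin (mtop (sub_mfd M (F ` X))) A"
      unfolding sub_mfd_simps U(1) by (rule openin_subtopology_Int[OF chartD(1)[OF U(2)]])
    moreover have "homeomorphic_map (subtopology (mtop (sub_mfd M (F ` X))) A) (top_of_set (\<phi> ` A)) \<phi>"
    proof -
      have AU: "A \<subseteq> U" "F ` X \<inter> A = A" using U(1) by auto
      have "homeomorphic_map (subtopology (subtopology (mtop M) U) A) (subtopology (top_of_set (\<phi> ` U)) (\<phi> ` A)) \<phi>"
        by (rule homeomorphic_map_subtopologies[OF chartD(3)[OF U(2)]]) (use AU chart_subset[OF U(2)] in auto)
      moreover have "U \<inter> A = A" "\<phi> ` U \<inter> \<phi> ` A = \<phi> ` A" using AU by auto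
      ultimately show ?thesis by (simp add: sub_mfd_simps subtopology_subtopology AU)
    qed
    ultimately show "openin (mtop (sub_mfd M (F ` X))) A \<and>
        (\<exists>E. subspace E \<and> dim E = n \<and> openin (top_of_set E) (\<phi> ` A)) \<and>
        homeomorphic_map (subtopology (mtop (sub_mfd M (F ` X))) A) (top_of_set (\<phi> ` A)) \<phi>"
      using dim by (intro conjI)
  qed
  show "\<forall>(A, \<phi>)\<in>atlas (sub_mfd M (F ` X)). \<forall>(B, \<psi>)\<in>atlas (sub_mfd M (F ` X)). smooth_on (\<phi> ` (A \<inter> B)) (\<psi> \<circ> inv_into A \<phi>)"
  proof clarify
    fix A \<phi> B \<psi> assume "(A, \<phi>) \<in> atlas (sub_mfd M (F ` X))" "(B, \<psi>) \<in> atlas (sub_mfd M (F ` X))"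
    then obtain U V where U: "A = U \<inter> F ` X" "(U, \<phi>) \<in> charts M" and V: "B = V \<inter> F ` X" "(V, \<psi>) \<in> charts M"
      using sub_atlasE by metis
    have "smooth_on (\<phi> ` (A \<inter> B)) (\<psi> \<circ> inv_into U \<phi>)"
      by (rule smooth_on_subset[OF chart_transition[OF M U(2) V(2)]]) (rule image_mono, use U V in auto)
    then show "smooth_on (\<phi> ` (A \<inter> B)) (\<psi> \<circ> inv_into A \<phi>)"
    proof (rule smooth_on_cong)
      fix z assume "z \<in> \<phi> ` (A \<inter> B)"
      then have "z \<in> \<phi> ` A" by blast
      from inv_into_subset[OF chart_inj[OF U(2)] _ this] show "(\<psi> \<circ> inv_into U \<phi>) z = (\<psi> \<circ> inv_into A \<phi>) z"
        using U(1) by simp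
    qed
  qed
qed

lemma vsmooth_sub_mfd:
  assumes M: "smooth_manifold M" and f: "vsmooth M W f"
  shows "vsmooth (sub_mfd M X) W f"
proof (rule vsmoothI)
  fix A \<phi> assume "(A, \<phi>) \<in> atlas (sub_mfd M X)"
  then obtain U where U: "A = U \<inter> X" "(U, \<phi>) \<in> charts M" using sub_atlasE by metis
  have "smooth_on (\<phi> ` (A \<inter> W)) (f \<circ> inv_into U \<phi>)"
    by (rule smooth_on_subset[OF vsmooth_chart[OF M U(2) f]]) (rule image_mono, use U in auto)
  then show "smooth_on (\<phi> ` (A \<inter> W)) (\<lambda>x. f (inv_into A \<phi> x))"
  proof (rule smooth_on_cong)
    fix z assume "z \<in> \<phi> ` (A \<inter> W)"
    then have "z \<in> \<phi> ` A" by blast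
    from inv_into_subset[OF chart_inj[OF U(2)] _ this] show "(f \<circ> inv_into U \<phi>) z = f (inv_into A \<phi> z)"
      using U(1) by simp
  qed
qed

lemma points_sub_mfd: "X \<subseteq> points M \<Longrightarrow> points (sub_mfd M X) = X"
  by (auto simp: sub_mfd_simps)

lemma smooth_map_inclusion:
  assumes M: "smooth_manifold M"
  shows "smooth_map (sub_mfd M X) M id"
proof (rule smooth_mapI[OF M])
  show "continuous_map (mtop (sub_mfd M X)) (mtop M) id"
    by (simp add: sub_mfd_simps continuous_map_from_subtopology)
  show "vsmooth (sub_mfd M X) (id -` W) (f \<circ> id)" if "vsmooth M W f" for W and f :: "'a \<Rightarrow> real"
    using vsmooth_sub_mfd[OF M that] by simp
qed

lemma smooth_map_sub_mfd:
  assumes M: "smooth_manifold M" and F: "smooth_map M M F" and X: "X \<subseteq> points M" and XY: "F ` X \<subseteq> Y"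
  shows "smooth_map (sub_mfd M X) (sub_mfd M Y) F"
  unfolding smooth_map_iff
proof (intro conjI, goal_cases)
  case 1
  show ?case
    using F XY X by (auto simp: sub_mfd_simps continuous_map_in_subtopology smooth_map_iff continuous_map_from_subtopology)
next
  case 2
  show ?case
  proof clarify
    fix A \<psi> assume "(A, \<psi>) \<in> atlas (sub_mfd M Y)"
    then obtain V where V: "A = V \<inter> Y" "(V, \<psi>) \<in> charts M" using sub_atlasE by metis
    have "vsmooth (sub_mfd M X) (F -` V) (\<psi> \<circ> F)"
      by (rule vsmooth_sub_mfd[OF M smooth_map_charts[OF M M F V(2)]])
    then show "vsmooth (sub_mfd M X) (F -` A) (\<psi> \<circ> F)" by (rule vsmooth_subset) (use V in auto)
  qed
qed

text \<open>Every smooth function on \<open>X\<close> agrees near \<open>x\<close> with the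
  restriction of a smooth function on \<open>M\<close>: in a slice chart it is precomposed with a
  linear projection onto the slice, then cut off. So a vector that vanishes on functions of
  \<open>M\<close> vanishes on functions of \<open>X\<close>.\<close>

lemma push_inclusion_injective:
  fixes M :: "('a, 'e::euclidean_space) mfd"
  assumes M: "smooth_manifold M" and X: "submanifold M X" and x: "x \<in> X"
    and u: "u \<in> tangent_space (sub_mfd M X) x" and 0: "push M id u = 0"
  shows "u = 0"
proof
  fix f
  have XM: "X \<subseteq> points M" and sub: "smooth_manifold (sub_mfd M X)" using X by (simp_all add: submanifold_def)
  note pX = points_sub_mfd[OF XM]
  have u0: "u h = 0" if "h \<in> smooth_funs M" for h
    using fun_cong[OF 0, of h] that by (simp add: push_def)
  show "u f = 0 f"
  proof (cases "f \<in> smooth_funs (sub_mfd M X)")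
    case True
    obtain A \<phi> where A: "(A, \<phi>) \<in> atlas (sub_mfd M X)" "x \<in> A" using atlas_cover[OF sub] x pX by metis
    obtain U S where U: "A = U \<inter> X" "(U, \<phi>) \<in> charts M" "subspace S" "\<phi> ` (U \<inter> X) = \<phi> ` U \<inter> S"
      using sub_atlasE[OF A(1)] by metis
    obtain E where E: "subspace E" "openin (top_of_set E) (\<phi> ` U)" using chartD(2)[OF U(2)] by blast
    obtain O2 where O2: "open O2" "\<phi> ` U = E \<inter> O2" using E(2) by (auto simp: openin_open)
    obtain q where q: "linear q" "range q \<subseteq> E \<inter> S" "\<And>z. z \<in> E \<inter> S \<Longrightarrow> q z = z"
      using linear_projection_exists[OF subspace_inter[OF E(1) U(3)]] by metis
    have qb: "bounded_linear q" using q(1) linear_conv_bounded_linear by blast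
    \<comment> \<open>Where the projected coordinates still lie in the chart image, so that the
      extension \<open>h\<close> below is given by values of \<open>f\<close>.\<close>
    define W where "W = {z \<in> U. q (\<phi> z) \<in> O2}"
    have im: "\<phi> ` A = E \<inter> O2 \<inter> S" using U(1,4) O2(2) by simp
    have qS: "q z \<in> \<phi> ` A" if "q z \<in> O2" for z using q(2) that unfolding im by blast
    have q\<phi>: "q (\<phi> z) = \<phi> z" if "z \<in> A" for z
    proof -
      have "\<phi> z \<in> E \<inter> O2 \<inter> S" using that im by blast
      then show ?thesis using q(3) by blast
    qed
    have W: "openin (mtop M) W"
    proof -
      have "continuous_map (subtopology (mtop M) U) euclidean \<phi>"
        using homeomorphic_imp_continuous_map[OF chartD(3)[OF U(2)]] by (simp add: continuous_map_in_subtopology)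
      moreover have "continuous_map euclidean euclidean q" using linear_continuous_on[OF qb] by simp
      ultimately have "continuous_map (subtopology (mtop M) U) euclidean (q \<circ> \<phi>)" by (rule continuous_map_compose)
      moreover have ts: "topspace (subtopology (mtop M) U) = U" using chart_subset[OF U(2)] by auto
      ultimately have "openin (subtopology (mtop M) U) W"
        using openin_continuous_map_preimage[of "subtopology (mtop M) U" euclidean "q \<circ> \<phi>" O2] O2(1)
        unfolding W_def ts by simp
      then show ?thesis using openin_trans_full[OF _ chartD(1)[OF U(2)]] by simp
    qed
    have AW: "A \<subseteq> W"
    proof
      fix z assume z: "z \<in> A"
      then have "\<phi> z \<in> O2" using im by blast
      then show "z \<in> W" using z q\<phi>[OF z] U(1) by (simp add: W_def)
    qed
    define h where "h z = (f \<circ> inv_into A \<phi>) (q (\<phi> z))" for z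
    have fA: "smooth_on (\<phi> ` A) (f \<circ> inv_into A \<phi>)"
    proof -
      have "vsmooth (sub_mfd M X) X f" using True pX by (simp add: smooth_funs_iff_vsmooth)
      from vsmoothD[OF this A(1)] have "smooth_on (\<phi> ` (A \<inter> X)) (f \<circ> inv_into A \<phi>)" by (simp add: o_def)
      moreover have "A \<inter> X = A" using U(1) by auto
      ultimately show ?thesis by simp
    qed
    have "vsmooth M W \<phi>" by (rule vsmooth_subset[OF vsmooth_of_chart[OF U(2)]]) (auto simp: W_def)
    then have "vsmooth M W (\<lambda>z. q (\<phi> z))"
      by (rule vsmooth_compose[OF _ smooth_on_bounded_linear[OF qb, of UNIV] _ M]) simp
    then have h: "vsmooth M W h"
      unfolding h_def by (rule vsmooth_compose[OF _ fA _ M]) (use qS in \<open>auto simp: W_def\<close>)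
    have hA: "h z = f z" if "z \<in> A" for z
    proof -
      have "inj_on \<phi> A" by (rule inj_on_subset[OF chart_inj[OF U(2)]]) (use U(1) in auto)
      then show ?thesis using that by (simp add: h_def q\<phi>)
    qed
    have xW: "x \<in> U \<inter> W" using A(2) U(1) AW by auto
    obtain b where b: "b \<in> smooth_funs M" "b x = 1" "\<And>z. z \<notin> U \<inter> W \<Longrightarrow> b z = 0"
      "\<And>f. vsmooth M (U \<inter> W) f \<Longrightarrow> (\<lambda>z. if z \<in> U \<inter> W then b z * f z else 0) \<in> smooth_funs M"
      using cutoff_exists[OF M openin_Int[OF chartD(1)[OF U(2)] W] xW] by blast
    define k where "k z = (if z \<in> U \<inter> W then b z * h z else 0)" for z
    have k: "k \<in> smooth_funs M" unfolding k_def by (rule b(4)[OF vsmooth_subset[OF h]]) simp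
    have bX: "b \<in> smooth_funs (sub_mfd M X)" "k \<in> smooth_funs (sub_mfd M X)"
      using b(1) k smooth_funs_pullback[OF sub M smooth_map_inclusion[OF M]] by fastforce+
    \<comment> \<open>\<open>u k\<close> is 0 because \<open>k\<close> is smooth on
      \<open>M\<close>. On \<open>X\<close> the function \<open>k\<close> is the product of
      \<open>b\<close> and \<open>f\<close>, whose derivative is \<open>u f\<close> since
      \<open>u b = 0\<close> and \<open>b x = 1\<close>.\<close>
    have "u k = u (\<lambda>z. b z * f z)"
    proof (rule tangent_cong[OF sub u])
      show "x \<in> points (sub_mfd M X)" "openin (mtop (sub_mfd M X)) X" "x \<in> X"
        using x pX openin_topspace[of "mtop (sub_mfd M X)"] by simp_all
      show "(\<lambda>z. b z * f z) \<in> smooth_funs (sub_mfd M X)" by (rule smooth_funs_mult[OF bX(1) True])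
      show "k z = b z * f z" if "z \<in> X" for z
        using that hA[of z] b(3)[of z] U(1) by (auto simp: k_def)
    qed (fact bX(2))
    also have "\<dots> = u f"
      using tangent_mult[OF u bX(1) True] u0[OF b(1)] b(2) by simp
    finally show ?thesis using u0[OF k] by simp
  qed (simp add: tangent_not_smooth[OF u])
qed

section \<open>Operators on complex vector spaces and Lie algebras\<close>

locale complex_vector_space = vector_space scale for scale :: "complex \<Rightarrow> 'b::ab_group_add \<Rightarrow> 'b"
begin

text \<open>Linearity is asked only on \<open>V\<close>: the operators in view are brackets, which
  need not be additive on functionals that are not tangent vectors.\<close>

definition endo :: "'b set \<Rightarrow> ('b \<Rightarrow> 'b) \<Rightarrow> bool" where
  "endo V A \<longleftrightarrow> subspace V \<and> (\<forall>x\<in>V. A x \<in> V) \<and> (\<forall>x\<in>V. \<forall>y\<in>V. A (x + y) = A x + A y) \<and>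
     (\<forall>c. \<forall>x\<in>V. A (scale c x) = scale c (A x))"

lemma endoD:
  assumes "endo V A"
  shows "subspace V" "\<And>x. x \<in> V \<Longrightarrow> A x \<in> V" "\<And>x y. x \<in> V \<Longrightarrow> y \<in> V \<Longrightarrow> A (x + y) = A x + A y"
    "\<And>c x. x \<in> V \<Longrightarrow> A (scale c x) = scale c (A x)"
  using assms unfolding endo_def by auto

lemma endo_0: "endo V A \<Longrightarrow> A 0 = 0"
  using endoD(4)[of V A 0 0] subspace_0[OF endoD(1)] by simp

lemma endo_diff: "endo V A \<Longrightarrow> x \<in> V \<Longrightarrow> y \<in> V \<Longrightarrow> A (x - y) = A x - A y"
  using endoD(3)[of V A x "scale (- 1) y"] endoD(4)[of V A y "- 1"] subspace_scale[OF endoD(1), of V A y "- 1"]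
  by simp

lemma endo_sum:
  assumes A: "endo V A" and f: "\<And>i. i \<in> I \<Longrightarrow> f i \<in> V"
  shows "A (\<Sum>i\<in>I. scale (c i) (f i)) = (\<Sum>i\<in>I. scale (c i) (A (f i)))"
  using f
proof (induction I rule: infinite_finite_induct)
  case (insert i I)
  have "(\<Sum>i\<in>I. scale (c i) (f i)) \<in> V"
    by (rule subspace_sum[OF endoD(1)[OF A]]) (use insert.prems subspace_scale[OF endoD(1)[OF A]] in auto)
  then show ?case
    using insert endoD(3,4)[OF A] subspace_scale[OF endoD(1)[OF A]] by simp
qed (simp_all add: endo_0[OF A])

lemma endo_subset: "endo V A \<Longrightarrow> subspace W \<Longrightarrow> W \<subseteq> V \<Longrightarrow> (\<And>x. x \<in> W \<Longrightarrow> A x \<in> W) \<Longrightarrow> endo W A"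
  unfolding endo_def by blast

lemma endo_funpow: "endo V A \<Longrightarrow> endo V (A ^^ k)"
  by (induction k) (auto simp: endo_def)

lemma endo_minus_scale: "endo V A \<Longrightarrow> endo V (\<lambda>x. A x - scale c x)"
  unfolding endo_def
  by (auto simp: subspace_diff subspace_scale scale_right_distrib scale_right_diff_distrib mult.commute)

lemma subspace_endo_image:
  assumes A: "endo V A" and W: "subspace W" "W \<subseteq> V"
  shows "subspace (A ` W)"
proof (rule subspaceI)
  show "0 \<in> A ` W" using endo_0[OF A] subspace_0[OF W(1)] by force
  fix x y assume "x \<in> A ` W" "y \<in> A ` W"
  then obtain u v where uv: "u \<in> W" "v \<in> W" "x = A u" "y = A v" by blast
  then have "x + y = A (u + v)" using endoD(3)[OF A, of u v] W(2) by (simp add: subset_iff)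
  then show "x + y \<in> A ` W" using subspace_add[OF W(1) uv(1,2)] by blast
next
  fix c x assume "x \<in> A ` W"
  then obtain u where u: "u \<in> W" "x = A u" by blast
  then have "scale c x = A (scale c u)" using endoD(4)[OF A, of u c] W(2) by (simp add: subset_iff)
  then show "scale c x \<in> A ` W" using subspace_scale[OF W(1) u(1)] by blast
qed

lemma subspace_endo_vimage:
  assumes A: "endo V A" and W: "subspace W"
  shows "subspace {x \<in> V. A x \<in> W}"
  by (rule subspaceI)
     (simp_all add: endo_0[OF A] endoD(3,4)[OF A] subspace_0 subspace_add subspace_scale endoD(1)[OF A] W)

text \<open>An indexed family with one member more than \<open>card B\<close>, rather than a set,
  because the iterates of an operator on a vector may repeat; a repetition gives the relation with
  coefficients 1 and -1.\<close>

lemma family_dependent: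
  fixes f :: "nat \<Rightarrow> 'b"
  assumes B: "finite B" and f: "\<And>i. f i \<in> span B"
  obtains c where "\<exists>i\<le>card B. c i \<noteq> 0" "(\<Sum>i\<le>card B. scale (c i) (f i)) = 0"
proof (cases "inj_on f {..card B}")
  case True
  have "dependent (f ` {..card B})"
  proof (rule ccontr)
    assume "independent (f ` {..card B})"
    moreover have "f ` {..card B} \<subseteq> span B" using f by auto
    ultimately have "card (f ` {..card B}) \<le> card B" using independent_span_bound[OF B] by blast
    then show False using card_image[OF True] by simp
  qed
  then obtain u where u: "\<exists>v\<in>f ` {..card B}. u v \<noteq> 0" "(\<Sum>v\<in>f ` {..card B}. scale (u v) v) = 0"
    using dependent_finite[of "f ` {..card B}"] by auto
  show thesis
    by (rule that[of "\<lambda>i. u (f i)"]) (use u sum.reindex[OF True, of "\<lambda>v. scale (u v) v"] in auto)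
next
  case False
  then obtain i j where ij: "i \<le> card B" "j \<le> card B" "i \<noteq> j" "f i = f j" by (auto simp: inj_on_def)
  define c :: "nat \<Rightarrow> complex" where "c k = (if k = i then 1 else if k = j then - 1 else 0)" for k
  have "(\<Sum>k\<le>card B. scale (c k) (f k)) = (\<Sum>k\<in>{i, j}. scale (c k) (f k))"
    by (rule sum.mono_neutral_right) (use ij in \<open>auto simp: c_def\<close>)
  also have "\<dots> = 0" using ij by (simp add: c_def)
  finally show thesis by (intro that[of c]) (use ij in \<open>auto simp: c_def\<close>)
qed

lemma finite_basis_exists:
  assumes "finite B" "V \<subseteq> span B"
  obtains C where "finite C" "C \<subseteq> V" "independent C" "V \<subseteq> span C"
proof -
  obtain C where C: "C \<subseteq> V" "independent C" "V \<subseteq> span C" using maximal_independent_subset[of V] by metis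
  then have "finite C" using independent_span_bound[OF assms(1), of C] assms(2) by auto
  then show thesis using that C by blast
qed

text \<open>The image of a basis \<open>C\<close> is independent and has the same number of
  elements; a vector of \<open>V\<close> outside its span would extend it to an independent set
  larger than \<open>C\<close>.\<close>

lemma endo_injective_surjective:
  assumes A: "endo V A" and B: "finite B" "V \<subseteq> span B" and inj: "\<And>x. x \<in> V \<Longrightarrow> A x = 0 \<Longrightarrow> x = 0"
  shows "A ` V = V"
proof
  show "A ` V \<subseteq> V" using endoD(2)[OF A] by auto
  obtain C where C: "finite C" "C \<subseteq> V" "independent C" "V \<subseteq> span C" using finite_basis_exists[OF B] by blast
  have injA: "inj_on A V"
  proof (rule inj_onI)
    fix x y assume xy: "x \<in> V" "y \<in> V" "A x = A y"
    then have "A (x - y) = 0" using endo_diff[OF A] by simp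
    then have "x - y = 0" using inj subspace_diff[OF endoD(1)[OF A] xy(1,2)] by blast
    then show "x = y" by simp
  qed
  have injC: "inj_on A C" using inj_on_subset[OF injA C(2)] .
  have comb: "(\<Sum>v\<in>A ` C. scale (u v) v) = A (\<Sum>v\<in>C. scale (u (A v)) v)" for u
  proof -
    have "A (\<Sum>v\<in>C. scale (u (A v)) v) = (\<Sum>v\<in>C. scale (u (A v)) (A v))"
      by (rule endo_sum[OF A]) (use C(2) in blast)
    then show ?thesis by (simp add: sum.reindex[OF injC])
  qed
  have combV: "(\<Sum>v\<in>C. scale (u v) v) \<in> V" for u
    by (rule subspace_sum[OF endoD(1)[OF A]]) (use C(2) subspace_scale[OF endoD(1)[OF A]] in auto)
  have indep: "independent (A ` C)"
  proof
    assume "dependent (A ` C)"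
    then obtain u where u: "\<exists>v\<in>A ` C. u v \<noteq> 0" "(\<Sum>v\<in>A ` C. scale (u v) v) = 0"
      using dependent_finite[of "A ` C"] C(1) by auto
    then have "(\<Sum>v\<in>C. scale (u (A v)) v) = 0" using comb inj[OF combV] by simp
    then have "u (A v) = 0" if "v \<in> C" for v
      using independentD[OF C(3,1) order_refl _ that, of "\<lambda>v. u (A v)"] by simp
    then show False using u(1) by auto
  qed
  show "V \<subseteq> A ` V"
  proof
    fix w assume w: "w \<in> V"
    have "w \<in> span (A ` C)"
    proof (rule ccontr)
      assume n: "w \<notin> span (A ` C)"
      then have "independent (insert w (A ` C))" using indep by (rule independent_insertI)
      moreover have "insert w (A ` C) \<subseteq> V" using w C(2) endoD(2)[OF A] by blast
      then have "insert w (A ` C) \<subseteq> span C" using C(4) by (rule order_trans)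
      ultimately have "card (insert w (A ` C)) \<le> card C" using independent_span_bound[OF C(1)] by blast
      moreover have "w \<notin> A ` C" using n span_base[of w "A ` C"] by auto
      ultimately show False using C(1) card_image[OF injC] by simp
    qed
    then obtain u where "w = (\<Sum>v\<in>A ` C. scale (u v) v)" using span_finite[of "A ` C"] C(1) by auto
    then show "w \<in> A ` V" using comb combV by auto
  qed
qed

text \<open>Membership in the invariant subspace \<open>K\<close> stands in for equality in a
  quotient space. Applying \<open>H\<close> minus \<open>\<mu> j\<close> to a relation removes its
  \<open>j\<close>-th term modulo \<open>K\<close> and multiplies the others by
  \<open>\<mu> i - \<mu> j\<close>.\<close>

lemma independent_eigenvectors_relative:
  assumes H: "endo V H" and K: "subspace K" "K \<subseteq> V" "\<And>x. x \<in> K \<Longrightarrow> H x \<in> K"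
    and w: "\<And>i. i \<in> I \<Longrightarrow> w i \<in> V" "\<And>i. i \<in> I \<Longrightarrow> w i \<notin> K" "\<And>i. i \<in> I \<Longrightarrow> H (w i) - scale (\<mu> i) (w i) \<in> K"
    and \<mu>: "inj_on \<mu> I" and I: "finite I" and s: "(\<Sum>i\<in>I. scale (c i) (w i)) \<in> K"
  shows "\<forall>i\<in>I. c i = 0"
  using I w \<mu> s
proof (induction I arbitrary: c rule: finite_induct)
  case (insert j I)
  let ?s = "\<Sum>i\<in>insert j I. scale (c i) (w i)"
  note wV = insert.prems(1)
  have Hs: "H ?s = (\<Sum>i\<in>insert j I. scale (c i) (H (w i)))" by (rule endo_sum[OF H]) (rule wV)
  have "H ?s - scale (\<mu> j) ?s \<in> K"
    using insert.prems(5) by (intro subspace_diff subspace_scale K) auto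
  moreover have "(\<Sum>i\<in>insert j I. scale (c i) (H (w i) - scale (\<mu> i) (w i))) \<in> K"
    using insert.prems(3) by (intro subspace_sum subspace_scale K) auto
  ultimately have "(H ?s - scale (\<mu> j) ?s) - (\<Sum>i\<in>insert j I. scale (c i) (H (w i) - scale (\<mu> i) (w i))) \<in> K"
    by (rule subspace_diff[OF K(1)])
  moreover have "(H ?s - scale (\<mu> j) ?s) - (\<Sum>i\<in>insert j I. scale (c i) (H (w i) - scale (\<mu> i) (w i)))
      = (\<Sum>i\<in>insert j I. scale (c i * (\<mu> i - \<mu> j)) (w i))"
    unfolding Hs
    by (simp only: scale_sum_right sum_subtractf[symmetric])
       (intro sum.cong refl, simp add: scale_right_diff_distrib scale_left_diff_distrib algebra_simps)
  ultimately have "(\<Sum>i\<in>I. scale (c i * (\<mu> i - \<mu> j)) (w i)) \<in> K"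
    using insert.hyps by simp
  then have "\<forall>i\<in>I. c i * (\<mu> i - \<mu> j) = 0"
    using insert.prems by (intro insert.IH) auto
  moreover have "\<mu> i \<noteq> \<mu> j" if "i \<in> I" for i using insert.prems(4) insert.hyps that by (auto simp: inj_on_def)
  ultimately have cI: "\<forall>i\<in>I. c i = 0" by simp
  then have "scale (c j) (w j) \<in> K" using insert.prems(5) insert.hyps by simp
  then have "c j = 0"
    using insert.prems(2)[of j] subspace_scale[OF K(1), of "scale (c j) (w j)" "inverse (c j)"] by (cases "c j = 0") auto
  then show ?case using cI by simp
qed simp

text \<open>Basis independence of the trace: each basis is expanded in the other and the two sums
  are exchanged.\<close>

lemma sum_change_basis:
  assumes B: "finite B" "independent B" "span B = V" and C: "finite C" "independent C" "span C = V" and L: "endo V L"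
  shows "(\<Sum>b\<in>B. representation B (L b) b) = (\<Sum>c\<in>C. representation C (L c) c)"
proof -
  let ?R = "representation B" and ?S = "representation C"
  have BV: "b \<in> V" if "b \<in> B" for b using that B(3) span_base by blast
  have CV: "c \<in> V" if "c \<in> C" for c using that C(3) span_base by blast
  have 1: "?R (L b) b = (\<Sum>c\<in>C. ?S b c * ?R (L c) b)" if "b \<in> B" for b
  proof -
    have "b = (\<Sum>c\<in>C. scale (?S b c) c)"
      using sum_representation_eq[of C b C] C BV[OF that] by simp
    then have "L b = (\<Sum>c\<in>C. scale (?S b c) (L c))"
      using endo_sum[OF L, of C "\<lambda>c. c" "?S b"] CV by metis
    then show ?thesis
      using representation_sum[of B C "\<lambda>c. scale (?S b c) (L c)"] representation_scale[of B] endoD(2)[OF L CV] B(2,3)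
        subspace_scale[OF endoD(1)[OF L]] by simp
  qed
  have 2: "(\<Sum>b\<in>B. ?R (L c) b * ?S b c) = ?S (L c) c" if "c \<in> C" for c
  proof -
    have "L c = (\<Sum>b\<in>B. scale (?R (L c) b) b)"
      using sum_representation_eq[of B "L c" B] B endoD(2)[OF L CV[OF that]] by simp
    then have "?S (L c) c = ?S (\<Sum>b\<in>B. scale (?R (L c) b) b) c" by simp
    also have "\<dots> = (\<Sum>b\<in>B. ?R (L c) b * ?S b c)"
      using representation_sum[of C B "\<lambda>b. scale (?R (L c) b) b"] representation_scale[of C] BV C(2,3)
        subspace_scale[OF endoD(1)[OF L]] by simp
    finally show ?thesis by simp
  qed
  have "(\<Sum>b\<in>B. ?R (L b) b) = (\<Sum>b\<in>B. \<Sum>c\<in>C. ?R (L c) b * ?S b c)"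
    by (intro sum.cong refl) (simp add: 1 mult.commute)
  also have "\<dots> = (\<Sum>c\<in>C. \<Sum>b\<in>B. ?R (L c) b * ?S b c)" by (rule sum.swap)
  also have "\<dots> = (\<Sum>c\<in>C. ?S (L c) c)" by (intro sum.cong refl 2)
  finally show ?thesis .
qed

text \<open>\<open>A\<close> carries \<open>B\<close> to a basis in which the conjugated operator
  has the same diagonal entries. Together with \<open>sum_change_basis\<close> this makes the trace,
  and hence the Killing form, invariant under \<open>Ad\<close>.\<close>

lemma sum_conjugate_basis:
  assumes B: "finite B" "independent B" "span B = V" and A: "endo V A" and L: "endo V L"
    and inj: "\<And>x. x \<in> V \<Longrightarrow> A' (A x) = x" and surj: "\<And>x. x \<in> V \<Longrightarrow> A' x \<in> V \<and> A (A' x) = x"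
  shows "\<exists>C. finite C \<and> independent C \<and> span C = V \<and>
    (\<Sum>c\<in>C. representation C (A (L (A' c))) c) = (\<Sum>b\<in>B. representation B (L b) b)"
proof -
  have BV: "b \<in> V" if "b \<in> B" for b using that B(3) span_base by blast
  have sV: "subspace V" using endoD(1)[OF A] .
  have injB: "inj_on A B" by (rule inj_on_inverseI[of _ A']) (use inj BV in auto)
  have comb: "(\<Sum>v\<in>A ` B. scale (u v) v) = A (\<Sum>v\<in>B. scale (u (A v)) v)" for u
  proof -
    have "A (\<Sum>v\<in>B. scale (u (A v)) v) = (\<Sum>v\<in>B. scale (u (A v)) (A v))"
      by (rule endo_sum[OF A]) (rule BV)
    then show ?thesis by (simp add: sum.reindex[OF injB])
  qed
  have combV: "(\<Sum>v\<in>B. scale (u v) v) \<in> V" for u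
    by (rule subspace_sum[OF sV]) (use BV subspace_scale[OF sV] in auto)
  have ind: "independent (A ` B)"
  proof
    assume "dependent (A ` B)"
    then obtain u where u: "\<exists>v\<in>A ` B. u v \<noteq> 0" "(\<Sum>v\<in>A ` B. scale (u v) v) = 0"
      using dependent_finite[of "A ` B"] B(1) by auto
    then have "A' (A (\<Sum>v\<in>B. scale (u (A v)) v)) = A' (A 0)" using comb endo_0[OF A] by simp
    then have "(\<Sum>v\<in>B. scale (u (A v)) v) = 0" using inj combV subspace_0[OF sV] by metis
    then have "u (A v) = 0" if "v \<in> B" for v
      using independentD[OF B(2,1) order_refl _ that, of "\<lambda>v. u (A v)"] by simp
    then show False using u(1) by auto
  qed
  have sp: "span (A ` B) = V"
  proof
    show "span (A ` B) \<subseteq> V" by (rule span_minimal) (use BV endoD(2)[OF A] sV in auto)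
    show "V \<subseteq> span (A ` B)"
    proof
      fix x assume x: "x \<in> V"
      then have "A' x \<in> span B" using surj B(3) by blast
      then obtain u where u: "A' x = (\<Sum>b\<in>B. scale (u b) b)" using span_finite[OF B(1)] by auto
      have "x = A (\<Sum>b\<in>B. scale (u b) b)" using surj[OF x] u by simp
      also have "\<dots> = (\<Sum>b\<in>B. scale (u b) (A b))" using endo_sum[OF A, of B "\<lambda>b. b" u] BV by auto
      also have "\<dots> \<in> span (A ` B)" by (intro span_sum span_scale span_base) auto
      finally show "x \<in> span (A ` B)" .
    qed
  qed
  have rep: "representation (A ` B) (A x) (A b) = representation B x b" if x: "x \<in> V" and b: "b \<in> B" for x b
  proof -
    let ?f = "\<lambda>v. if v \<in> A ` B then representation B x (A' v) else 0"
    have AB: "A' (A b) = b" if "b \<in> B" for b using inj BV that by auto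
    have "representation (A ` B) (A x) = ?f"
    proof (rule representation_eqI[OF ind])
      show "A x \<in> span (A ` B)" using sp endoD(2)[OF A x] by simp
      show "\<And>b. ?f b \<noteq> 0 \<Longrightarrow> b \<in> A ` B" by (auto split: if_splits)
      show fin: "finite {b. ?f b \<noteq> 0}" by (rule finite_subset[of _ "A ` B"]) (use B(1) in \<open>auto split: if_splits\<close>)
      have "(\<Sum>b | ?f b \<noteq> 0. scale (?f b) b) = (\<Sum>b\<in>A ` B. scale (?f b) b)"
        by (rule sum.mono_neutral_left) (use B(1) in \<open>auto split: if_splits\<close>)
      also have "\<dots> = A (\<Sum>b\<in>B. scale (?f (A b)) b)" by (rule comb)
      also have "(\<Sum>b\<in>B. scale (?f (A b)) b) = (\<Sum>b\<in>B. scale (representation B x b) b)"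
        by (intro sum.cong refl) (simp add: AB)
      also have "\<dots> = x" using sum_representation_eq[of B x B] B x by simp
      finally show "(\<Sum>b | ?f b \<noteq> 0. scale (?f b) b) = A x" .
    qed
    then show ?thesis using b AB by simp
  qed
  have "(\<Sum>c\<in>A ` B. representation (A ` B) (A (L (A' c))) c) = (\<Sum>b\<in>B. representation (A ` B) (A (L (A' (A b)))) (A b))"
    using sum.reindex[OF injB, of "\<lambda>c. representation (A ` B) (A (L (A' c))) c"] by simp
  also have "\<dots> = (\<Sum>b\<in>B. representation B (L b) b)"
    using BV inj rep endoD(2)[OF L] by (intro sum.cong refl) simp
  finally show ?thesis using ind sp B(1) by (intro exI[of _ "A ` B"]) auto
qed

definition poly_apply :: "('b \<Rightarrow> 'b) \<Rightarrow> complex poly \<Rightarrow> 'b \<Rightarrow> 'b" where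
  "poly_apply A p v = (\<Sum>i\<le>degree p. scale (coeff p i) ((A ^^ i) v))"

lemma poly_apply_bound: "degree p \<le> N \<Longrightarrow> poly_apply A p v = (\<Sum>i\<le>N. scale (coeff p i) ((A ^^ i) v))"
  unfolding poly_apply_def
  by (rule sum.mono_neutral_left) (auto simp: coeff_eq_0)

lemma poly_apply_in: "endo V A \<Longrightarrow> v \<in> V \<Longrightarrow> poly_apply A p v \<in> V"
  unfolding poly_apply_def
  by (intro subspace_sum subspace_scale) (use endoD(1) endoD(2)[OF endo_funpow] in blast)+

lemma poly_apply_linear_factor:
  assumes A: "endo V A" and v: "v \<in> V"
  shows "poly_apply A ([:- \<nu>, 1:] * q) v = A (poly_apply A q v) - scale \<nu> (poly_apply A q v)"
proof -
  let ?N = "degree q"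
  have c: "coeff ([:- \<nu>, 1:] * q) i = - \<nu> * coeff q i + coeff (pCons 0 q) i" for i by simp
  have "degree ([:- \<nu>, 1:] * q) \<le> Suc ?N" using degree_mult_le[of "[:- \<nu>, 1:]" q] by simp
  then have "poly_apply A ([:- \<nu>, 1:] * q) v = (\<Sum>i\<le>Suc ?N. scale (coeff ([:- \<nu>, 1:] * q) i) ((A ^^ i) v))"
    by (rule poly_apply_bound)
  also have "\<dots> = (\<Sum>i\<le>Suc ?N. scale (coeff (pCons 0 q) i) ((A ^^ i) v)) - (\<Sum>i\<le>Suc ?N. scale \<nu> (scale (coeff q i) ((A ^^ i) v)))"
    unfolding c by (simp only: sum_subtractf[symmetric]) (intro sum.cong refl, simp add: scale_left_diff_distrib)
  also have "(\<Sum>i\<le>Suc ?N. scale \<nu> (scale (coeff q i) ((A ^^ i) v))) = scale \<nu> (poly_apply A q v)"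
    using poly_apply_bound[of q "Suc ?N" A v] by (simp only: scale_sum_right)
  also have "(\<Sum>i\<le>Suc ?N. scale (coeff (pCons 0 q) i) ((A ^^ i) v)) = (\<Sum>i\<le>?N. scale (coeff q i) (A ((A ^^ i) v)))"
    by (subst sum.atMost_Suc_shift) simp
  also have "\<dots> = A (poly_apply A q v)"
    unfolding poly_apply_def using endo_sum[OF A, of "{..?N}" "\<lambda>i. (A ^^ i) v" "coeff q"] endoD(2)[OF endo_funpow[OF A] v] by simp
  finally show ?thesis .
qed

text \<open>Among the nonzero polynomials p for which p(A) sends some vector outside
  \<open>K\<close> into \<open>K\<close>, one of least degree is taken. It is not constant, so it
  has a root \<nu>; the cofactor of the linear factor, applied to that vector, stays outside
  \<open>K\<close> by minimality, and A - \<nu> sends the result into \<open>K\<close>.\<close>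

lemma eigenvector_relative:
  assumes B: "finite B" "V \<subseteq> span B" and A: "endo V A" and K: "subspace K" "K \<subseteq> V" "K \<noteq> V"
    and AK: "\<And>x. x \<in> K \<Longrightarrow> A x \<in> K"
  obtains \<nu> w where "w \<in> V" "w \<notin> K" "A w - scale \<nu> w \<in> K"
proof -
  define P where "P p \<longleftrightarrow> p \<noteq> 0 \<and> (\<exists>v\<in>V. v \<notin> K \<and> poly_apply A p v \<in> K)" for p
  obtain v where v: "v \<in> V" "v \<notin> K" using K by blast
  obtain c where c: "\<exists>i\<le>card B. c i \<noteq> 0" "(\<Sum>i\<le>card B. scale (c i) ((A ^^ i) v)) = 0"
    using family_dependent[OF B(1), of "\<lambda>i. (A ^^ i) v"] endoD(2)[OF endo_funpow[OF A] v(1)] B(2) by blast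
  define p0 where "p0 = (\<Sum>i\<le>card B. monom (c i) i)"
  have coeff: "coeff p0 i = (if i \<le> card B then c i else 0)" for i
    by (simp add: p0_def coeff_sum coeff_monom)
  have "degree p0 \<le> card B" by (rule degree_le) (simp add: coeff)
  then have "poly_apply A p0 v = 0" using c(2) by (simp add: poly_apply_bound[of p0 "card B"] coeff)
  moreover have "p0 \<noteq> 0" using c(1) coeff by (metis coeff_0)
  ultimately have "P p0" unfolding P_def using v subspace_0[OF K(1)] by auto
  then obtain p where p: "P p" "\<And>q. P q \<Longrightarrow> degree p \<le> degree q"
    using ex_has_least_nat[of P p0 degree] by blast
  then obtain v where v: "p \<noteq> 0" "v \<in> V" "v \<notin> K" "poly_apply A p v \<in> K" unfolding P_def by blast
  have "degree p \<noteq> 0"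
  proof
    assume d: "degree p = 0"
    then have "coeff p 0 \<noteq> 0" using v(1) by (metis leading_coeff_0_iff)
    moreover have "scale (coeff p 0) v \<in> K" using v(4) d by (simp add: poly_apply_def)
    ultimately have "v \<in> K" using subspace_scale[OF K(1), of "scale (coeff p 0) v" "inverse (coeff p 0)"] by simp
    with v(3) show False ..
  qed
  then have "\<not> constant (poly p)" by (simp add: constant_degree)
  then obtain \<nu> where "poly p \<nu> = 0" using fundamental_theorem_of_algebra by blast
  then obtain q where q: "p = [:- \<nu>, 1:] * q" using poly_eq_0_iff_dvd by (metis dvdE)
  have "q \<noteq> 0" using v(1) q by auto
  then have "degree p = degree [:- \<nu>, 1:] + degree q" unfolding q by (intro degree_mult_eq) auto
  then have deg: "degree p = Suc (degree q)" by simp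
  let ?w = "poly_apply A q v"
  have "\<not> P q" using p(2)[of q] deg by auto
  then have "?w \<notin> K" using \<open>q \<noteq> 0\<close> v(2,3) unfolding P_def by blast
  moreover have "A ?w - scale \<nu> ?w \<in> K"
    using v(4) poly_apply_linear_factor[OF A v(2)] q by simp
  ultimately show thesis using that poly_apply_in[OF A v(2)] by blast
qed

lemma eigenvector_exists:
  assumes B: "finite B" "V \<subseteq> span B" and A: "endo V A" and V: "V \<noteq> {0}"
  obtains \<nu> w where "w \<in> V" "w \<noteq> 0" "A w = scale \<nu> w"
proof -
  have s: "subspace {0}" "{0} \<subseteq> V" using subspace_0[OF endoD(1)[OF A]] by (auto simp: subspace_single_0)
  have "A x \<in> {0}" if "x \<in> {0}" for x using that endo_0[OF A] by simp
  from eigenvector_relative[OF B A s not_sym[OF V] this]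
  obtain \<nu> w where "w \<in> V" "w \<notin> {0}" "A w - scale \<nu> w \<in> {0}" by metis
  then show thesis using that[of w \<nu>] by simp
qed

text \<open>A nonzero range would contain an eigenvector of \<open>A\<close>, with eigenvalue 0 by
  \<open>eig\<close>. But by \<open>ker\<close> a vector of the range that \<open>A\<close> kills is
  zero.\<close>

lemma endo_zero_if_semisimple:
  assumes B: "finite B" "V \<subseteq> span B" and A: "endo V A"
    and eig: "\<And>\<nu> w. w \<in> V \<Longrightarrow> w \<noteq> 0 \<Longrightarrow> A w = scale \<nu> w \<Longrightarrow> \<nu> = 0"
    and ker: "\<And>x. x \<in> V \<Longrightarrow> A (A x) = 0 \<Longrightarrow> A x = 0" and x: "x \<in> V"
  shows "A x = 0"
proof (rule ccontr)
  assume n: "A x \<noteq> 0"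
  let ?R = "A ` V"
  have RV: "?R \<subseteq> V" using endoD(2)[OF A] by auto
  have R: "endo ?R A"
    by (rule endo_subset[OF A subspace_endo_image[OF A endoD(1)[OF A] order_refl] RV]) (use RV in auto)
  have "?R \<noteq> {0}" using n x by auto
  then obtain \<nu> w where w: "w \<in> ?R" "w \<noteq> 0" "A w = scale \<nu> w"
    using eigenvector_exists[OF B(1) order_trans[OF RV B(2)] R] by metis
  then have "\<nu> = 0" using eig RV by blast
  then have "A w = 0" using w(3) by simp
  moreover obtain z where "z \<in> V" "w = A z" using w(1) by auto
  ultimately show False using ker w(2) by auto
qed

text \<open>\<open>X\<close> raises eigenvalues of \<open>H\<close> by \<open>c\<close>. Let
  \<open>K\<close> consist of the vectors killed by some power of \<open>X\<close>. If it were
  proper, an eigenvector \<open>y\<close> of \<open>H\<close> modulo \<open>K\<close> would give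
  eigenvectors \<open>w j\<close> modulo \<open>K\<close> with the distinct eigenvalues
  \<open>\<mu> + of_nat j * c\<close>, too many for finite dimension. A finite basis then yields one
  exponent for all vectors.\<close>

lemma nilpotent_of_commutator:
  assumes B: "finite B" "V \<subseteq> span B" and H: "endo V H" and X: "endo V X" and c: "c \<noteq> 0"
    and HX: "\<And>v. v \<in> V \<Longrightarrow> H (X v) = X (H v) + scale c (X v)"
  shows "\<exists>k. \<forall>v\<in>V. (X ^^ k) v = 0"
proof -
  note Xk = endo_funpow[OF X] and sV = endoD(1)[OF X]
  have HXk: "H ((X ^^ k) v) = (X ^^ k) (H v) + scale (of_nat k * c) ((X ^^ k) v)" if v: "v \<in> V" for k v
  proof (induction k)
    case (Suc k)
    let ?y = "(X ^^ k) v"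
    have y: "?y \<in> V" "(X ^^ k) (H v) \<in> V" using endoD(2)[OF Xk] v endoD(2)[OF H] by auto
    have "H (X ?y) = X (H ?y) + scale c (X ?y)" using HX[OF y(1)] .
    also have "X (H ?y) = X ((X ^^ k) (H v)) + scale (of_nat k * c) (X ?y)"
      unfolding Suc.IH using y endoD(3,4)[OF X] subspace_scale[OF sV] by simp
    finally show ?case by (simp add: scale_left_distrib algebra_simps)
  qed simp
  define K where "K = {v \<in> V. \<exists>k. (X ^^ k) v = 0}"
  have Kk: "(X ^^ (k + l)) v = 0" if "(X ^^ k) v = 0" for k l v
    by (induction l) (use that endo_0[OF X] in auto)
  have K: "subspace K"
  proof (rule subspaceI)
    show "0 \<in> K" using subspace_0[OF sV] by (auto simp: K_def intro: exI[of _ 0])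
    fix x y assume "x \<in> K" "y \<in> K"
    then obtain k l where k: "x \<in> V" "y \<in> V" "(X ^^ k) x = 0" "(X ^^ l) y = 0" by (auto simp: K_def)
    then have "(X ^^ (k + l)) (x + y) = 0"
      using endoD(3)[OF Xk] Kk[of k x l] Kk[of l y k] by (simp add: add.commute)
    then show "x + y \<in> K" using k subspace_add[OF sV] by (auto simp: K_def)
  next
    fix c x assume "x \<in> K"
    then show "scale c x \<in> K" using endoD(4)[OF Xk] subspace_scale[OF sV] by (force simp: K_def)
  qed
  have KV: "K \<subseteq> V" by (auto simp: K_def)
  have HK: "H x \<in> K" if x: "x \<in> K" for x
  proof -
    obtain k where k: "x \<in> V" "(X ^^ k) x = 0" using x by (auto simp: K_def)
    have "(X ^^ k) (H x) = 0" using HXk[OF k(1), of k] k(2) endo_0[OF H] by simp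
    then show ?thesis using endoD(2)[OF H k(1)] by (auto simp: K_def)
  qed
  have "K = V"
  proof (rule ccontr)
    assume "K \<noteq> V"
    from eigenvector_relative[OF B H K KV this HK]
    obtain \<mu> y where y: "y \<in> V" "y \<notin> K" "H y - scale \<mu> y \<in> K" by metis
    define w where "w j = (X ^^ j) y" for j
    have wV: "w j \<in> V" for j using endoD(2)[OF Xk y(1)] by (simp add: w_def)
    have wK: "w j \<notin> K" for j
    proof
      assume "w j \<in> K"
      then obtain k where "(X ^^ (k + j)) y = 0" by (auto simp: K_def w_def funpow_add)
      then show False using y(1,2) by (auto simp: K_def)
    qed
    have XK: "(X ^^ j) x \<in> K" if x: "x \<in> K" for x j
    proof -
      obtain k where k: "x \<in> V" "(X ^^ k) x = 0" using x by (auto simp: K_def)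
      have "(X ^^ k) ((X ^^ j) x) = 0" using Kk[OF k(2), of j] by (simp add: funpow_add[symmetric] add.commute flip: o_apply[of "X ^^ _" "X ^^ _"])
      then show ?thesis using endoD(2)[OF Xk k(1)] by (auto simp: K_def)
    qed
    have wH: "H (w j) - scale (\<mu> + of_nat j * c) (w j) \<in> K" for j
    proof -
      have "H (w j) - scale (\<mu> + of_nat j * c) (w j) = (X ^^ j) (H y) - scale \<mu> (w j)"
        using HXk[OF y(1), of j] by (simp add: w_def scale_left_distrib)
      also have "\<dots> = (X ^^ j) (H y - scale \<mu> y)"
        using endo_diff[OF Xk endoD(2)[OF H y(1)] subspace_scale[OF sV y(1)]] endoD(4)[OF Xk y(1)] by (simp add: w_def)
      finally show ?thesis using XK[OF y(3)] by simp
    qed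
    obtain d where d: "\<exists>i\<le>card B. d i \<noteq> 0" "(\<Sum>i\<le>card B. scale (d i) (w i)) = 0"
      using family_dependent[OF B(1), of w] wV B(2) by blast
    have "\<forall>i\<in>{..card B}. d i = 0"
    proof (rule independent_eigenvectors_relative[OF H K KV HK, where w = w and \<mu> = "\<lambda>j. \<mu> + of_nat j * c"])
      show "inj_on (\<lambda>j. \<mu> + of_nat j * c) {..card B}" using c by (auto simp: inj_on_def)
      show "(\<Sum>i\<in>{..card B}. scale (d i) (w i)) \<in> K" using d(2) subspace_0[OF K] by simp
    qed (use wV wK wH in auto)
    then show False using d(1) by auto
  qed
  obtain C where C: "finite C" "C \<subseteq> V" "independent C" "V \<subseteq> span C" using finite_basis_exists[OF B] by blast
  have "\<exists>k. \<forall>v\<in>C. (X ^^ k) v = 0"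
    using C(1,2)
  proof (induction C rule: finite_induct)
    case (insert x C)
    then obtain k where "\<forall>v\<in>C. (X ^^ k) v = 0" by auto
    moreover obtain l where "(X ^^ l) x = 0" using insert.prems \<open>K = V\<close> by (auto simp: K_def)
    ultimately have k: "\<forall>v\<in>C. (X ^^ k) v = 0" "(X ^^ l) x = 0" by simp_all
    have "(X ^^ (k + l)) v = 0" if "v \<in> insert x C" for v
    proof (cases "v = x")
      case True
      then show ?thesis using Kk[OF k(2), of k] by (simp add: add.commute)
    next
      case False
      then show ?thesis using k(1) that Kk[of k v l] by simp
    qed
    then show ?case by blast
  qed simp
  then obtain k where k: "\<forall>v\<in>C. (X ^^ k) v = 0" by blast
  have "subspace {v \<in> V. (X ^^ k) v = 0}"
    by (rule subspaceI) (use endoD[OF Xk[of k]] endo_0[OF Xk[of k]] subspace_0[OF sV] subspace_add[OF sV] subspace_scale[OF sV] in auto)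
  then have "span C \<subseteq> {v \<in> V. (X ^^ k) v = 0}" by (rule span_minimal[rotated]) (use k C(2) in auto)
  then show ?thesis using C(4) by blast
qed

text \<open>Commuting operators preserve each other's eigenspaces, so \<open>W\<close> is cut down
  to an eigenspace of one operator at a time.\<close>

lemma joint_eigenvector:
  assumes F: "finite F" and B: "finite B" "V \<subseteq> span B"
    and A: "\<And>A. A \<in> F \<Longrightarrow> endo V A" and comm: "\<And>A A' v. A \<in> F \<Longrightarrow> A' \<in> F \<Longrightarrow> v \<in> V \<Longrightarrow> A (A' v) = A' (A v)"
    and W: "subspace W" "W \<subseteq> V" "W \<noteq> {0}" "\<And>A x. A \<in> F \<Longrightarrow> x \<in> W \<Longrightarrow> A x \<in> W"
  shows "\<exists>w\<in>W. w \<noteq> 0 \<and> (\<forall>A\<in>F. \<exists>\<nu>. A w = scale \<nu> w)"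
  using F A comm W
proof (induction F arbitrary: W rule: finite_induct)
  case empty
  then show ?case using subspace_0[of W] by auto
next
  case (insert A F)
  have AV: "endo V A" using insert.prems(1) by simp
  have AW: "endo W A" by (rule endo_subset[OF AV insert.prems(3,4)]) (use insert.prems(6) in auto)
  obtain \<nu> w where w: "w \<in> W" "w \<noteq> 0" "A w = scale \<nu> w"
    using eigenvector_exists[OF B(1) order_trans[OF insert.prems(4) B(2)] AW insert.prems(5)] by metis
  define W' where "W' = {x \<in> W. A x = scale \<nu> x}"
  have "subspace W'"
    unfolding W'_def
    by (rule subspaceI) (use endoD[OF AW] endo_0[OF AW] subspace_0[OF insert.prems(3)] in
      \<open>auto simp: scale_right_distrib mult.commute intro: subspace_add[OF insert.prems(3)] subspace_scale[OF insert.prems(3)]\<close>)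
  moreover have "W' \<subseteq> V" using insert.prems(4) by (auto simp: W'_def)
  moreover have "W' \<noteq> {0}" using w by (auto simp: W'_def)
  moreover have "A' x \<in> W'" if A': "A' \<in> F" and x: "x \<in> W'" for A' x
  proof -
    have x': "x \<in> W" "x \<in> V" "A x = scale \<nu> x" using x insert.prems(4) by (auto simp: W'_def)
    have "A (A' x) = A' (A x)" using insert.prems(2)[of A A' x] A' x' by simp
    also have "\<dots> = scale \<nu> (A' x)" using x' endoD(4)[OF insert.prems(1)[of A'] x'(2)] A' by simp
    finally show ?thesis using insert.prems(6)[of A' x] A' x' by (simp add: W'_def)
  qed
  ultimately have "\<exists>w\<in>W'. w \<noteq> 0 \<and> (\<forall>A\<in>F. \<exists>\<nu>. A w = scale \<nu> w)"
    using insert.prems(1,2) by (intro insert.IH) auto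
  then show ?case unfolding W'_def by auto
qed

end

text \<open>Finite dimension is carried by the parameter \<open>B\<close>, a finite set whose span
  contains \<open>V\<close>; as with \<open>endo\<close>, the laws are asked on \<open>V\<close>
  only.\<close>

locale complex_lie_algebra = complex_vector_space scale for scale :: "complex \<Rightarrow> 'b::ab_group_add \<Rightarrow> 'b" +
  fixes V :: "'b set" and br :: "'b \<Rightarrow> 'b \<Rightarrow> 'b" and B :: "'b set"
  assumes B: "finite B" "V \<subseteq> span B" and V: "subspace V"
    and br_in: "\<And>x y. x \<in> V \<Longrightarrow> y \<in> V \<Longrightarrow> br x y \<in> V"
    and br_add_left: "\<And>x y z. x \<in> V \<Longrightarrow> y \<in> V \<Longrightarrow> z \<in> V \<Longrightarrow> br (x + y) z = br x z + br y z"
    and br_scale_left: "\<And>c x y. x \<in> V \<Longrightarrow> y \<in> V \<Longrightarrow> br (scale c x) y = scale c (br x y)"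
    and br_skew: "\<And>x y. x \<in> V \<Longrightarrow> y \<in> V \<Longrightarrow> br x y = - br y x"
    and jacobi: "\<And>x y z. x \<in> V \<Longrightarrow> y \<in> V \<Longrightarrow> z \<in> V \<Longrightarrow> br x (br y z) = br (br x y) z + br y (br x z)"
begin

lemma br_add_right: "x \<in> V \<Longrightarrow> y \<in> V \<Longrightarrow> z \<in> V \<Longrightarrow> br x (y + z) = br x y + br x z"
  using br_skew[of x "y + z"] br_skew[of x y] br_skew[of x z] br_add_left[of y z x] subspace_add[OF V] by simp

lemma br_scale_right: "x \<in> V \<Longrightarrow> y \<in> V \<Longrightarrow> br x (scale c y) = scale c (br x y)"
  using br_skew[of x "scale c y"] br_skew[of x y] br_scale_left[of y x c] subspace_scale[OF V] by simp

lemma endo_br: "x \<in> V \<Longrightarrow> endo V (br x)"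
  unfolding endo_def using V br_in br_add_right br_scale_right by simp

lemma endo_br_left: "x \<in> V \<Longrightarrow> endo V (\<lambda>y. br y x)"
  unfolding endo_def using V br_in br_add_left br_scale_left by simp

text \<open>The descending chain got from \<open>V\<close> by repeatedly bracketing with elements of
  \<open>S\<close>. \<open>flag S k \<subseteq> {0}\<close> says that every product of
  \<open>k\<close> operators \<open>br s\<close> with \<open>s\<close> in \<open>S\<close> vanishes
  on \<open>V\<close>. There is no relation to the manifold of flags.\<close>

primrec flag :: "'b set \<Rightarrow> nat \<Rightarrow> 'b set" where
  "flag S 0 = V"
| "flag S (Suc i) = span {br s x |s x. s \<in> S \<and> x \<in> flag S i}"

lemma flag_subset: "S \<subseteq> V \<Longrightarrow> flag S i \<subseteq> V"
proof (induction i)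
  case (Suc i)
  have "{br s x |s x. s \<in> S \<and> x \<in> flag S i} \<subseteq> V" using Suc br_in by blast
  then show ?case using span_minimal[OF _ V] by simp
qed simp

lemma flag_subspace: "subspace (flag S i)"
  by (cases i) (simp_all add: V)

lemma flag_antimono: "S \<subseteq> V \<Longrightarrow> flag S (Suc i) \<subseteq> flag S i"
proof (induction i)
  case 0
  then show ?case using flag_subset[of S 1] by simp
next
  case (Suc i)
  then show ?case unfolding flag.simps(2)[of S "Suc i"] flag.simps(2)[of S i] by (intro span_mono) (auto simp del: flag.simps)
qed

lemma flag_br: "s \<in> S \<Longrightarrow> x \<in> flag S i \<Longrightarrow> br s x \<in> flag S (Suc i)"
  unfolding flag.simps by (rule span_base) blast

lemma flag_br_span:
  assumes S: "S \<subseteq> V" and s: "s \<in> span S" and x: "x \<in> flag S i"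
  shows "br s x \<in> flag S (Suc i)"
proof -
  have xV: "x \<in> V" using x flag_subset[OF S] by blast
  note e = endo_br_left[OF xV]
  have "subspace {s \<in> V. br s x \<in> flag S (Suc i)}" by (rule subspace_endo_vimage[OF e flag_subspace])
  then have "span S \<subseteq> {s \<in> V. br s x \<in> flag S (Suc i)}"
    by (rule span_minimal[rotated]) (use S flag_br[OF _ x] in \<open>auto simp del: flag.simps\<close>)
  then show ?thesis using s by blast
qed

text \<open>By the Jacobi identity \<open>br h\<close> acts as a derivation on
  \<open>br s y\<close>: the term with \<open>br h s\<close> stays in the chain because it comes
  from the span of \<open>S\<close>, the other one by induction.\<close>

lemma flag_invariant:
  assumes S: "S \<subseteq> V" and h: "h \<in> V" and hS: "\<And>s. s \<in> S \<Longrightarrow> br h s \<in> span S"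
  shows "x \<in> flag S i \<Longrightarrow> br h x \<in> flag S i"
proof (induction i arbitrary: x)
  case 0
  then show ?case using br_in[OF h] by simp
next
  case (Suc i)
  note e = endo_br[OF h]
  have "subspace {x \<in> V. br h x \<in> flag S (Suc i)}" by (rule subspace_endo_vimage[OF e flag_subspace])
  moreover have "br s y \<in> {x \<in> V. br h x \<in> flag S (Suc i)}" if s: "s \<in> S" and y: "y \<in> flag S i" for s y
  proof -
    have V': "s \<in> V" "y \<in> V" using s y S flag_subset[OF S] by auto
    have "br h (br s y) = br (br h s) y + br s (br h y)" by (rule jacobi[OF h V'])
    moreover have "br (br h s) y \<in> flag S (Suc i)" by (rule flag_br_span[OF S hS[OF s] y])
    moreover have "br s (br h y) \<in> flag S (Suc i)" by (rule flag_br[OF s Suc.IH[OF y]])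
    ultimately show ?thesis using subspace_add[OF flag_subspace] br_in[OF V'] by (simp del: flag.simps)
  qed
  ultimately have "flag S (Suc i) \<subseteq> {x \<in> V. br h x \<in> flag S (Suc i)}"
    unfolding flag.simps(2)[of S i] by (intro span_minimal) (auto simp del: flag.simps(2))
  then show ?case using Suc.prems by blast
qed

text \<open>A bracket with an element of \<open>S\<close> descends one step of the chain of
  \<open>S\<close>, and brackets with \<open>s\<close> preserve each step. Hence a product of
  \<open>q\<close> operators from \<open>insert s S\<close> either descends or consists of brackets
  with \<open>s\<close> alone, and the latter product is zero.\<close>

lemma nil_insert:
  assumes S: "S \<subseteq> V" and s: "s \<in> V" and k: "flag S k \<subseteq> {0}" and q: "\<forall>v\<in>V. (br s ^^ q) v = 0"
    and inv: "\<And>w. w \<in> S \<Longrightarrow> br s w \<in> span S"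
  shows "\<exists>m. flag (insert s S) m \<subseteq> {0}"
proof -
  let ?S = "insert s S"
  have S': "?S \<subseteq> V" using S s by simp
  note e = endo_br[OF s]
  have pow: "(br s ^^ l) x \<in> flag S i" if "x \<in> flag S i" for l x i
    by (induction l) (use that flag_invariant[OF S s inv] in \<open>auto simp del: flag.simps\<close>)
  \<comment> \<open>Modulo \<open>flag S (Suc i)\<close> only the products made of \<open>l\<close>
    brackets with \<open>s\<close> survive.\<close>
  have step: "flag ?S (j + l) \<subseteq> {(br s ^^ l) x + y |x y. x \<in> flag S i \<and> y \<in> flag S (Suc i)}"
    if j: "flag ?S j \<subseteq> flag S i" for i j l
  proof (induction l)
    case 0
    have "0 \<in> flag S (Suc i)" by (rule subspace_0[OF flag_subspace])
    then show ?case using j by (force simp del: flag.simps)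
  next
    case (Suc l)
    let ?G = "\<lambda>l. {(br s ^^ l) x + y |x y. x \<in> flag S i \<and> y \<in> flag S (Suc i)}"
    have fV: "x \<in> V" if "x \<in> flag S i" for x i using that flag_subset[OF S] by blast
    have "subspace (?G (Suc l))"
    proof -
      note el = endo_funpow[OF e, of "Suc l"]
      have "subspace ((br s ^^ Suc l) ` flag S i)"
        by (rule subspace_endo_image[OF el flag_subspace flag_subset[OF S]])
      from subspace_sums[OF this flag_subspace[of S "Suc i"]]
      have "subspace {x + y |x y. x \<in> (br s ^^ Suc l) ` flag S i \<and> y \<in> flag S (Suc i)}" .
      moreover have "{x + y |x y. x \<in> (br s ^^ Suc l) ` flag S i \<and> y \<in> flag S (Suc i)} = ?G (Suc l)" by blast
      ultimately show ?thesis by (simp only:)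
    qed
    moreover have "br t z \<in> ?G (Suc l)" if t: "t \<in> ?S" and z: "z \<in> flag ?S (j + l)" for t z
    proof -
      obtain x y where xy: "z = (br s ^^ l) x + y" "x \<in> flag S i" "y \<in> flag S (Suc i)" using z Suc.IH by blast
      have xl: "(br s ^^ l) x \<in> flag S i" by (rule pow[OF xy(2)])
      show ?thesis
      proof (cases "t = s")
        case True
        have "br t z = (br s ^^ Suc l) x + br s y"
          unfolding True xy(1) using br_add_right[OF s fV[OF xl] fV[OF xy(3)]] by simp
        moreover have "br s y \<in> flag S (Suc i)" by (rule flag_invariant[OF S s inv xy(3)])
        ultimately show ?thesis using xy(2) by blast
      next
        case False
        then have tS: "t \<in> S" using t by simp
        have "z \<in> flag S i"
          unfolding xy(1) using xl xy(3) flag_antimono[OF S, of i] by (intro subspace_add[OF flag_subspace]) auto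
        then have "br t z \<in> flag S (Suc i)" by (rule flag_br[OF tS])
        moreover have "(br s ^^ Suc l) 0 = 0" by (rule endo_0[OF endo_funpow[OF e]])
        ultimately show ?thesis
          using subspace_0[OF flag_subspace[of S i]] by (intro CollectI exI[of _ 0] exI[of _ "br t z"]) simp
      qed
    qed
    ultimately have "span {br t z |t z. t \<in> ?S \<and> z \<in> flag ?S (j + l)} \<subseteq> ?G (Suc l)"
      by (intro span_minimal) blast+
    then show ?case by simp
  qed
  have "\<exists>j. flag ?S j \<subseteq> flag S i" for i
  proof (induction i)
    case 0
    show ?case by (rule exI[of _ 0]) simp
  next
    case (Suc i)
    then obtain j where j: "flag ?S j \<subseteq> flag S i" by blast
    have "flag ?S (j + q) \<subseteq> flag S (Suc i)"
    proof
      fix z assume "z \<in> flag ?S (j + q)"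
      then obtain x y where xy: "z = (br s ^^ q) x + y" "x \<in> flag S i" "y \<in> flag S (Suc i)" using step[OF j, of q] by blast
      then have "(br s ^^ q) x = 0" using q flag_subset[OF S] by blast
      then show "z \<in> flag S (Suc i)" using xy by simp
    qed
    then show ?case by blast
  qed
  then show ?thesis using k by blast
qed

text \<open>Jacobson's theorem on weakly closed sets: a maximal independent family whose
  span meets \<open>S\<close> in a set generating a nilpotent action can be enlarged unless it spans \<open>S\<close>.\<close>

lemma weakly_closed_nilpotent:
  assumes S: "S \<subseteq> V" and closed: "\<And>x y. x \<in> S \<Longrightarrow> y \<in> S \<Longrightarrow> br x y \<in> S"
    and nil: "\<And>s. s \<in> S \<Longrightarrow> \<exists>k. \<forall>v\<in>V. (br s ^^ k) v = 0"
  shows "\<exists>k. flag S k \<subseteq> {0}"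
proof -
  define P where "P J \<longleftrightarrow> J \<subseteq> S \<and> independent J \<and> (\<exists>k. flag (S \<inter> span J) k \<subseteq> {0})" for J
  have card: "finite J \<and> card J \<le> card B" if "P J" for J
  proof -
    have "independent J" "J \<subseteq> S" using that unfolding P_def by blast+
    then show ?thesis using independent_span_bound[OF B(1), of J] S B(2) by (meson order_trans)
  qed
  have "P {}"
  proof -
    have "br s x = 0" if "s = 0" "x \<in> V" for s x using endo_0[OF endo_br_left[OF that(2)]] that(1) by simp
    then have "{br s x |s x. s \<in> S \<inter> span {} \<and> x \<in> V} \<subseteq> {0}" by auto
    then have "span {br s x |s x. s \<in> S \<inter> span {} \<and> x \<in> V} \<subseteq> {0}"
      by (rule span_minimal) (simp add: subspace_single_0)
    then have "flag (S \<inter> span {}) 1 \<subseteq> {0}" by simp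
    then show ?thesis unfolding P_def using independent_empty by blast
  qed
  then obtain J where J: "P J" "\<And>J'. P J' \<Longrightarrow> card J' \<le> card J"
    using ex_has_greatest_nat[of P "{}" card "Suc (card B)"] card by (metis le_imp_less_Suc)
  define \<Omega> where "\<Omega> = S \<inter> span J"
  have J': "J \<subseteq> S" "independent J" "finite J" using J(1) card unfolding P_def by auto
  obtain k where k: "flag \<Omega> k \<subseteq> {0}" using J(1) unfolding P_def \<Omega>_def by blast
  have \<Omega>V: "\<Omega> \<subseteq> V" using S by (auto simp: \<Omega>_def)
  have sp\<Omega>: "span \<Omega> = span J"
  proof
    show "span \<Omega> \<subseteq> span J" by (rule span_minimal) (auto simp: \<Omega>_def)
    show "span J \<subseteq> span \<Omega>" by (rule span_mono) (use J'(1) span_base in \<open>auto simp: \<Omega>_def\<close>)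
  qed
  show ?thesis
  proof (cases "S \<subseteq> span J")
    case True
    then have "\<Omega> = S" by (auto simp: \<Omega>_def)
    then show ?thesis using k by blast
  next
    case False
    then obtain s0 where s0: "s0 \<in> S" "s0 \<notin> span J" by blast
    \<comment> \<open>Otherwise each element of \<open>S\<close> outside \<open>span J\<close> could
      be bracketed with some element of \<open>\<Omega>\<close> to another one. After
      \<open>k\<close> rounds this gives an element of \<open>flag \<Omega> k\<close> outside
      \<open>span J\<close>, although that member of the chain is zero.\<close>
    have "\<exists>s\<in>S. s \<notin> span J \<and> (\<forall>w\<in>\<Omega>. br w s \<in> span J)"
    proof (rule ccontr)
      assume "\<not> ?thesis"
      then have ex: "\<exists>w\<in>\<Omega>. br w s \<notin> span J" if "s \<in> S" "s \<notin> span J" for s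
        using that by blast
      have "\<exists>s\<in>S. s \<notin> span J \<and> s \<in> flag \<Omega> n" for n
      proof (induction n)
        case 0
        then show ?case using s0 S by auto
      next
        case (Suc n)
        then obtain s where s: "s \<in> S" "s \<notin> span J" "s \<in> flag \<Omega> n" by blast
        then obtain w where w: "w \<in> \<Omega>" "br w s \<notin> span J" using ex by blast
        have "br w s \<in> S" using closed w(1) s(1) by (auto simp: \<Omega>_def)
        moreover have "br w s \<in> flag \<Omega> (Suc n)" by (rule flag_br[OF w(1) s(3)])
        ultimately show ?case using w(2) by blast
      qed
      then obtain s where "s \<notin> span J" "s \<in> flag \<Omega> k" by blast
      then show False using k span_zero by blast
    qed
    then obtain s where s: "s \<in> S" "s \<notin> span J" "\<And>w. w \<in> \<Omega> \<Longrightarrow> br w s \<in> span J" by blast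
    have sV: "s \<in> V" using s(1) S by blast
    obtain q where q: "\<forall>v\<in>V. (br s ^^ q) v = 0" using nil[OF s(1)] by blast
    have inv: "br s w \<in> span \<Omega>" if "w \<in> \<Omega>" for w
    proof -
      have "br s w = - br w s" using br_skew sV \<Omega>V that by blast
      then show ?thesis using s(3)[OF that] sp\<Omega> span_neg by simp
    qed
    obtain m where m: "flag (insert s \<Omega>) m \<subseteq> {0}"
      using nil_insert[OF \<Omega>V sV k q inv] by blast
    have sub: "S \<inter> span (insert s J) \<subseteq> span (insert s \<Omega>)"
      using span_mono[of "insert s J" "insert s \<Omega>"] J'(1) span_base by (auto simp: \<Omega>_def)
    have i\<Omega>: "insert s \<Omega> \<subseteq> V" using sV \<Omega>V by simp
    have "flag (S \<inter> span (insert s J)) i \<subseteq> flag (insert s \<Omega>) i" for i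
    proof (induction i)
      case (Suc i)
      have "{br t x |t x. t \<in> S \<inter> span (insert s J) \<and> x \<in> flag (S \<inter> span (insert s J)) i} \<subseteq> flag (insert s \<Omega>) (Suc i)"
        using flag_br_span[OF i\<Omega>] sub Suc by blast
      then show ?case unfolding flag.simps(2)[of "S \<inter> span (insert s J)"] by (rule span_minimal[OF _ flag_subspace])
    qed simp
    then have 1: "flag (S \<inter> span (insert s J)) m \<subseteq> {0}" using m by (rule order_trans)
    have 2: "independent (insert s J)" using s(2) J'(2) by (rule independent_insertI)
    have "P (insert s J)"
      unfolding P_def by (intro conjI exI[of _ m] 1 2) (use s(1) J'(1) in simp)
    from J(2)[OF this] have "card (insert s J) \<le> card J" .
    moreover have "s \<notin> J" using s(2) span_base[of s J] by auto
    ultimately show ?thesis using J'(3) by simp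
  qed
qed

text \<open>The operators of \<open>z\<close> and \<open>z + n\<close> preserve the chain and agree
  on its successive quotients. If \<nu> were not an eigenvalue for \<open>y\<close>, then
  \<open>br y\<close> minus \<nu> would be bijective on every member of the chain, and the
  eigenvector \<open>w\<close> would slide down to zero. The disjunctions for \<open>x\<close> and
  \<open>y\<close> cover both directions by one proof.\<close>

lemma eigenvalue_transfer:
  assumes S: "S \<subseteq> V" and k: "flag S k \<subseteq> {0}" and n: "n \<in> span S"
    and z: "z \<in> V" and zS: "\<And>s. s \<in> S \<Longrightarrow> br z s \<in> span S"
    and x: "x = z \<or> x = z + n" and y: "y = z \<or> y = z + n"
    and w: "w \<in> V" "w \<noteq> 0" "br x w = scale \<nu> w"
  shows "\<exists>w'\<in>V. w' \<noteq> 0 \<and> br y w' = scale \<nu> w'"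
proof (rule ccontr)
  assume no: "\<not> ?thesis"
  have nV: "n \<in> V" using n span_minimal[OF S V] by blast
  have xV: "x \<in> V" and yV: "y \<in> V" using x y z nV subspace_add[OF V] by auto
  have zn: "br (z + n) v \<in> flag S i" if "v \<in> flag S i" for v i
  proof -
    have "br (z + n) v = br z v + br n v" using br_add_left[OF z nV] that flag_subset[OF S] by blast
    moreover have "br n v \<in> flag S i" using flag_br_span[OF S n that] flag_antimono[OF S] by blast
    ultimately show ?thesis using flag_invariant[OF S z zS that] subspace_add[OF flag_subspace] by simp
  qed
  have yinv: "br y v \<in> flag S i" if "v \<in> flag S i" for v i
    using y zn[OF that] flag_invariant[OF S z zS that] by auto
  have diff: "br y v - br x v \<in> flag S (Suc i)" if v: "v \<in> flag S i" for v i
  proof -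
    have vV: "v \<in> V" using v flag_subset[OF S] by blast
    have eq: "br (z + n) v = br z v + br n v" by (rule br_add_left[OF z nV vV])
    have "br n v \<in> flag S (Suc i)" by (rule flag_br_span[OF S n v])
    moreover have "br y v - br x v \<in> {0, br n v, - br n v}" using x y eq by auto
    ultimately show ?thesis
      by (elim insertE emptyE) (simp_all only: subspace_0[OF flag_subspace] subspace_neg[OF flag_subspace])
  qed
  define Y where "Y v = br y v - scale \<nu> v" for v
  have Y: "endo V Y" unfolding Y_def by (rule endo_minus_scale[OF endo_br[OF yV]])
  have Yinj: "v = 0" if "v \<in> V" "Y v = 0" for v
    using no that unfolding Y_def by auto
  have Yf: "endo (flag S i) Y" for i
    by (rule endo_subset[OF Y flag_subspace flag_subset[OF S]])
       (simp add: Y_def yinv subspace_diff[OF flag_subspace] subspace_scale[OF flag_subspace])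
  have "w \<in> flag S i" for i
  proof (induction i)
    case 0
    then show ?case using w by simp
  next
    case (Suc i)
    \<comment> \<open>\<open>Y w\<close> lies one step lower. Surjectivity of \<open>Y\<close> on
      that lower member and injectivity on \<open>V\<close> put \<open>w\<close> itself
      there.\<close>
    have "Y w = br y w - br x w" by (simp add: Y_def w(3))
    then have "Y w \<in> flag S (Suc i)" using diff[OF Suc] by simp
    moreover have "Y ` flag S (Suc i) = flag S (Suc i)"
      by (rule endo_injective_surjective[OF Yf B(1)]) (use flag_subset[OF S] B(2) Yinj in blast)+
    ultimately obtain v where v: "v \<in> flag S (Suc i)" "Y w = Y v" by (metis imageE)
    have "v \<in> V" using v(1) flag_subset[OF S] by blast
    then have "Y (w - v) = 0" using endo_diff[OF Y w(1)] v(2) by simp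
    then have "w - v = 0" using Yinj subspace_diff[OF V w(1) \<open>v \<in> V\<close>] by blast
    then show ?case using v(1) by simp
  qed
  then show False using k w(2) by blast
qed

end

section \<open>The Lie algebra of a Lie group\<close>

text \<open>\<open>smooth_funs\<close> constrains chart expressions only; continuity for the
  topology of the manifold is recovered through parametrizations. It is what lets functions on the
  compact group attain a maximum.\<close>

lemma smooth_funs_continuous:
  fixes f :: "'a \<Rightarrow> real"
  assumes M: "smooth_manifold M" and f: "f \<in> smooth_funs M"
  shows "continuous_map (mtop M) euclideanreal f"
  unfolding continuous_map_def
proof (intro conjI allI impI)
  fix U :: "real set" assume "openin euclideanreal U"
  then have U: "open U" by simp
  show "openin (mtop M) {x \<in> points M. f x \<in> U}"
  proof (subst openin_subopen, intro ballI)
    fix x assume "x \<in> {x \<in> points M. f x \<in> U}"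
    then have x: "x \<in> points M" "f x \<in> U" by simp_all
    obtain \<phi> \<iota> S where P: "param M \<phi> \<iota> S" "x \<in> \<iota> ` S" using param_exists[OF M openin_topspace x(1)] by metis
    note p = paramD[OF P(1)]
    have "openin (top_of_set S) (S \<inter> (f \<circ> \<iota>) -` U)"
      using continuous_openin_preimage_gen[OF smooth_on_imp_continuous_on[OF psmooth_smooth_funs[OF M p(2) f]] U] .
    then have "open (S \<inter> (f \<circ> \<iota>) -` U)" using p(1) openin_open_trans by blast
    define T where "T = {z \<in> \<iota> ` S. \<phi> z \<in> S \<inter> (f \<circ> \<iota>) -` U}"
    have ts: "topspace (subtopology (mtop M) (\<iota> ` S)) = \<iota> ` S" using openin_subset[OF p(3)] by auto
    have "openin (subtopology (mtop M) (\<iota> ` S)) T"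
      using openin_continuous_map_preimage[OF p(7), of "S \<inter> (f \<circ> \<iota>) -` U"] \<open>open (S \<inter> (f \<circ> \<iota>) -` U)\<close>
      unfolding T_def ts by simp
    then have "openin (mtop M) T" using openin_trans_full[OF _ p(3)] by blast
    moreover have "x \<in> T" using P(2) p(4,5)[OF P(2)] x by (simp add: T_def)
    moreover have "T \<subseteq> {x \<in> points M. f x \<in> U}"
      using openin_subset[OF p(3)] p(5) by (auto simp: T_def)
    ultimately show "\<exists>T. openin (mtop M) T \<and> x \<in> T \<and> T \<subseteq> {x \<in> points M. f x \<in> U}" by blast
  qed
qed simp

lemma tangent_cong_points:
  assumes M: "smooth_manifold M" and v: "v \<in> tangent_space M x" and x: "x \<in> points M"
    and f: "f \<in> smooth_funs M" and eq: "\<And>y. y \<in> points M \<Longrightarrow> f y = h y"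
  shows "v f = v h"
proof (rule tangent_cong[OF M v x openin_topspace x f _ eq])
  show "h \<in> smooth_funs M"
    unfolding smooth_funs_iff_vsmooth
    by (rule vsmooth_cong[OF f[unfolded smooth_funs_iff_vsmooth] eq M])
qed

lemma smooth_funs_cong:
  assumes M: "smooth_manifold M" and f: "f \<in> smooth_funs M" and eq: "\<And>y. y \<in> points M \<Longrightarrow> f y = h y"
  shows "h \<in> smooth_funs M"
  unfolding smooth_funs_iff_vsmooth
  by (rule vsmooth_cong[OF f[unfolded smooth_funs_iff_vsmooth] eq M])

lemma tangent_eqI:
  assumes "u \<in> tangent_space M x" "v \<in> tangent_space M x" "\<And>f. f \<in> smooth_funs M \<Longrightarrow> u f = v f"
  shows "u = v"
proof
  fix f show "u f = v f"
    by (cases "f \<in> smooth_funs M") (simp_all add: assms(3) tangent_not_smooth[OF assms(1)] tangent_not_smooth[OF assms(2)])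
qed

locale smooth_group =
  fixes G :: "'g monoid" (structure) and MG :: "('g, 'e::euclidean_space) mfd"
  assumes lie: "lie_group G MG"
begin

sublocale group G using lie by (simp add: lie_group_def)

lemma M: "smooth_manifold MG" using lie by (simp add: lie_group_def)

lemma points_carrier: "points MG = carrier G" using lie by (simp add: lie_group_def)

lemma one_in_points: "\<one> \<in> points MG" by (simp add: points_carrier)

abbreviation \<gg> :: "'g tvec set" where "\<gg> \<equiv> tangent_space MG \<one>"

lemma smooth_map_mult:
  assumes N: "smooth_manifold N" and F: "smooth_map N MG F" and H: "smooth_map N MG H"
  shows "smooth_map N MG (\<lambda>x. F x \<otimes> H x)"
proof -
  have "smooth_map (prod_mfd MG MG) MG (\<lambda>(x, y). x \<otimes> y)" using lie by (simp add: lie_group_def)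
  from smooth_map_compose[OF N smooth_manifold_prod[OF M M] M smooth_map_Pair[OF F H] this]
  show ?thesis by (simp add: o_def)
qed

lemma smooth_map_inv:
  assumes N: "smooth_manifold N" and F: "smooth_map N MG F"
  shows "smooth_map N MG (\<lambda>x. inv (F x))"
  using smooth_map_compose[OF N M M F, of "\<lambda>x. inv x"] lie by (simp add: lie_group_def o_def)

lemma smooth_map_left: "g \<in> carrier G \<Longrightarrow> smooth_map MG MG (\<lambda>x. g \<otimes> x)"
  by (intro smooth_map_mult M smooth_map_const smooth_map_id) (simp add: points_carrier)

lemma smooth_map_right: "g \<in> carrier G \<Longrightarrow> smooth_map MG MG (\<lambda>x. x \<otimes> g)"
  by (intro smooth_map_mult M smooth_map_const smooth_map_id) (simp add: points_carrier)

lemma smooth_map_conj: "g \<in> carrier G \<Longrightarrow> smooth_map MG MG (\<lambda>x. g \<otimes> x \<otimes> inv g)"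
  by (intro smooth_map_mult M smooth_map_const smooth_map_id) (simp_all add: points_carrier)

lemma tangent_cong_carrier:
  "v \<in> tangent_space MG x \<Longrightarrow> x \<in> carrier G \<Longrightarrow> f \<in> smooth_funs MG \<Longrightarrow> (\<And>y. y \<in> carrier G \<Longrightarrow> f y = h y) \<Longrightarrow> v f = v h"
  using tangent_cong_points[OF M, of v x f h] by (simp add: points_carrier)

lemma smooth_funs_cong_carrier:
  "f \<in> smooth_funs MG \<Longrightarrow> (\<And>y. y \<in> carrier G \<Longrightarrow> f y = h y) \<Longrightarrow> h \<in> smooth_funs MG"
  using smooth_funs_cong[OF M, of f h] by (simp add: points_carrier)

lemma smooth_funs_left: "g \<in> carrier G \<Longrightarrow> f \<in> smooth_funs MG \<Longrightarrow> (\<lambda>x. f (g \<otimes> x)) \<in> smooth_funs MG"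
  using smooth_funs_pullback[OF M M smooth_map_left] by (simp add: o_def)

lemma smooth_funs_conj: "g \<in> carrier G \<Longrightarrow> f \<in> smooth_funs MG \<Longrightarrow> (\<lambda>x. f (g \<otimes> x \<otimes> inv g)) \<in> smooth_funs MG"
  using smooth_funs_pullback[OF M M smooth_map_conj] by (simp add: o_def)

lemma smooth_funs_mult2: "f \<in> smooth_funs MG \<Longrightarrow> (\<lambda>p. f (fst p \<otimes> snd p)) \<in> smooth_funs (prod_mfd MG MG)"
  using smooth_funs_pullback[OF smooth_manifold_prod[OF M M] M
      smooth_map_mult[OF smooth_manifold_prod[OF M M] smooth_map_fst[OF M M] smooth_map_snd[OF M M]]]
  by (simp add: o_def)

lemma smooth_funs_mult2': "f \<in> smooth_funs MG \<Longrightarrow> (\<lambda>p. f (snd p \<otimes> fst p)) \<in> smooth_funs (prod_mfd MG MG)"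
  using smooth_funs_pullback[OF smooth_manifold_prod[OF M M] M
      smooth_map_mult[OF smooth_manifold_prod[OF M M] smooth_map_snd[OF M M] smooth_map_fst[OF M M]]]
  by (simp add: o_def)

lemma smooth_funs_conj2: "f \<in> smooth_funs MG \<Longrightarrow> (\<lambda>p. f (fst p \<otimes> snd p \<otimes> inv (fst p))) \<in> smooth_funs (prod_mfd MG MG)"
  using smooth_funs_pullback[OF smooth_manifold_prod[OF M M] M
      smooth_map_mult[OF smooth_manifold_prod[OF M M]
        smooth_map_mult[OF smooth_manifold_prod[OF M M] smooth_map_fst[OF M M] smooth_map_snd[OF M M]]
        smooth_map_inv[OF smooth_manifold_prod[OF M M] smooth_map_fst[OF M M]]]]
  by (simp add: o_def)

definition lder :: "'g tvec \<Rightarrow> ('g \<Rightarrow> real) \<Rightarrow> 'g \<Rightarrow> real" where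
  "lder v f g = v (\<lambda>x. f (g \<otimes> x))"

lemma lie_bracket_lder: "lie_bracket G u v f = u (lder v f) - v (lder u f)"
  unfolding lie_bracket_def lder_def ..

lemma lder_smooth: "v \<in> \<gg> \<Longrightarrow> f \<in> smooth_funs MG \<Longrightarrow> lder v f \<in> smooth_funs MG"
  using smooth_funs_partial[OF M M smooth_funs_mult2 one_in_points] unfolding lder_def[abs_def] by simp

lemma lder_one: "v \<in> \<gg> \<Longrightarrow> f \<in> smooth_funs MG \<Longrightarrow> lder v f \<one> = v f"
  unfolding lder_def using tangent_cong_carrier[of v "\<one>" f "\<lambda>x. f (\<one> \<otimes> x)"] by simp

lemma inv_mult_cancel: "g \<in> carrier G \<Longrightarrow> x \<in> carrier G \<Longrightarrow> inv g \<otimes> (g \<otimes> x) = x"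
  using m_assoc[of "inv g" g x] by simp

lemma mult_inv_cancel: "g \<in> carrier G \<Longrightarrow> x \<in> carrier G \<Longrightarrow> g \<otimes> (inv g \<otimes> x) = x"
  using m_assoc[of g "inv g" x] by simp

text \<open>Tangent vectors are 0 on non-smooth functions by convention; this convention survives
  translation because translation by the inverse restores smoothness.\<close>

lemma not_smooth_left:
  assumes g: "g \<in> carrier G" and f: "f \<notin> smooth_funs MG"
  shows "(\<lambda>x. f (g \<otimes> x)) \<notin> smooth_funs MG"
proof
  assume "(\<lambda>x. f (g \<otimes> x)) \<in> smooth_funs MG"
  then have "(\<lambda>x. f (g \<otimes> (inv g \<otimes> x))) \<in> smooth_funs MG" using smooth_funs_left[of "inv g" "\<lambda>x. f (g \<otimes> x)"] g by simp
  then have "f \<in> smooth_funs MG" by (rule smooth_funs_cong_carrier) (simp add: g mult_inv_cancel)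
  with f show False ..
qed

lemma not_smooth_conj:
  assumes g: "g \<in> carrier G" and f: "f \<notin> smooth_funs MG"
  shows "(\<lambda>x. f (g \<otimes> x \<otimes> inv g)) \<notin> smooth_funs MG"
proof
  assume "(\<lambda>x. f (g \<otimes> x \<otimes> inv g)) \<in> smooth_funs MG"
  then have "(\<lambda>x. f (g \<otimes> (inv g \<otimes> x \<otimes> inv (inv g)) \<otimes> inv g)) \<in> smooth_funs MG"
    using smooth_funs_conj[of "inv g" "\<lambda>x. f (g \<otimes> x \<otimes> inv g)"] g by simp
  then have "f \<in> smooth_funs MG"
  proof (rule smooth_funs_cong_carrier)
    fix y assume y: "y \<in> carrier G"
    show "f (g \<otimes> (inv g \<otimes> y \<otimes> inv (inv g)) \<otimes> inv g) = f y" using g y by (simp add: m_assoc mult_inv_cancel)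
  qed
  with f show False ..
qed

lemma lder_not_smooth: "v \<in> \<gg> \<Longrightarrow> f \<notin> smooth_funs MG \<Longrightarrow> g \<in> carrier G \<Longrightarrow> lder v f g = 0"
  unfolding lder_def by (rule tangent_not_smooth[OF _ not_smooth_left])

lemma tangent_zero_carrier:
  assumes "v \<in> \<gg>" "\<And>y. y \<in> carrier G \<Longrightarrow> f y = 0"
  shows "v f = 0"
proof -
  have "v (\<lambda>y. 0) = v f" by (rule tangent_cong_carrier[OF assms(1)]) (simp_all add: assms(2) smooth_funs_const)
  then show ?thesis using tangent_const[OF assms(1), of 0] by simp
qed

lemma bracket_not_smooth: "u \<in> \<gg> \<Longrightarrow> v \<in> \<gg> \<Longrightarrow> f \<notin> smooth_funs MG \<Longrightarrow> lie_bracket G u v f = 0"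
  unfolding lie_bracket_lder using tangent_zero_carrier[of u "lder v f"] tangent_zero_carrier[of v "lder u f"] lder_not_smooth by simp

lemma lder_add:
  assumes v: "v \<in> \<gg>" and f: "f \<in> smooth_funs MG" and h: "h \<in> smooth_funs MG" and g: "g \<in> carrier G"
  shows "lder v (\<lambda>x. f x + h x) g = lder v f g + lder v h g"
  unfolding lder_def using tangent_add[OF v smooth_funs_left[OF g f] smooth_funs_left[OF g h]] .

lemma lder_scale:
  assumes v: "v \<in> \<gg>" and f: "f \<in> smooth_funs MG" and g: "g \<in> carrier G"
  shows "lder v (\<lambda>x. c * f x) g = c * lder v f g"
  unfolding lder_def using tangent_scale[OF v smooth_funs_left[OF g f]] .

lemma lder_mult:
  assumes v: "v \<in> \<gg>" and f: "f \<in> smooth_funs MG" and h: "h \<in> smooth_funs MG" and g: "g \<in> carrier G"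
  shows "lder v (\<lambda>x. f x * h x) g = lder v f g * h g + f g * lder v h g"
  unfolding lder_def using tangent_mult[OF v smooth_funs_left[OF g f] smooth_funs_left[OF g h]] g by simp

lemma tangent_lder_add:
  assumes u: "u \<in> \<gg>" and v: "v \<in> \<gg>" and f: "f \<in> smooth_funs MG" and h: "h \<in> smooth_funs MG"
  shows "u (lder v (\<lambda>x. f x + h x)) = u (lder v f) + u (lder v h)"
proof -
  have "u (lder v (\<lambda>x. f x + h x)) = u (\<lambda>g. lder v f g + lder v h g)"
    by (rule tangent_cong_carrier[OF u]) (simp_all add: lder_smooth lder_add smooth_funs_add u v f h)
  then show ?thesis using tangent_add[OF u lder_smooth[OF v f] lder_smooth[OF v h]] by simp
qed

lemma tangent_lder_scale:
  assumes u: "u \<in> \<gg>" and v: "v \<in> \<gg>" and f: "f \<in> smooth_funs MG"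
  shows "u (lder v (\<lambda>x. c * f x)) = c * u (lder v f)"
proof -
  have "u (lder v (\<lambda>x. c * f x)) = u (\<lambda>g. c * lder v f g)"
    by (rule tangent_cong_carrier[OF u]) (simp_all add: lder_smooth lder_scale smooth_funs_scale u v f)
  then show ?thesis using tangent_scale[OF u lder_smooth[OF v f]] by simp
qed

lemma tangent_lder_mult:
  assumes u: "u \<in> \<gg>" and v: "v \<in> \<gg>" and f: "f \<in> smooth_funs MG" and h: "h \<in> smooth_funs MG"
  shows "u (lder v (\<lambda>x. f x * h x)) = u (lder v f) * h \<one> + v f * u h + u f * v h + f \<one> * u (lder v h)"
proof -
  have "u (lder v (\<lambda>x. f x * h x)) = u (\<lambda>g. lder v f g * h g + f g * lder v h g)"
    by (rule tangent_cong_carrier[OF u]) (simp_all add: lder_smooth lder_mult smooth_funs_mult u v f h)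
  then show ?thesis
    by (simp add: tangent_add[OF u] tangent_mult[OF u] smooth_funs_mult lder_smooth lder_one u v f h)
qed

lemma bracket_tangent: "u \<in> \<gg> \<Longrightarrow> v \<in> \<gg> \<Longrightarrow> lie_bracket G u v \<in> \<gg>"
  unfolding tangent_space_def[of MG \<one>] mem_Collect_eq
proof (intro conjI ballI allI impI, goal_cases)
  case (1 f h)
  then have "u \<in> \<gg>" "v \<in> \<gg>" by (simp_all add: tangent_space_def)
  with 1 show ?case by (simp add: lie_bracket_lder tangent_lder_add)
next
  case (2 c f)
  then have "u \<in> \<gg>" "v \<in> \<gg>" by (simp_all add: tangent_space_def)
  with 2 show ?case by (simp add: lie_bracket_lder tangent_lder_scale algebra_simps)
next
  case (3 f h)
  then have "u \<in> \<gg>" "v \<in> \<gg>" by (simp_all add: tangent_space_def)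
  with 3 show ?case by (simp add: lie_bracket_lder tangent_lder_mult algebra_simps)
next
  case (4 f)
  then have "u \<in> \<gg>" "v \<in> \<gg>" by (simp_all add: tangent_space_def)
  with 4 show ?case by (simp add: bracket_not_smooth)
qed

lemma bracket_skew: "lie_bracket G u v = - lie_bracket G v u"
  by (auto simp: lie_bracket_def)

lemma bracket_add_left:
  assumes "u \<in> \<gg>" "u' \<in> \<gg>" "v \<in> \<gg>"
  shows "lie_bracket G (u + u') v = lie_bracket G u v + lie_bracket G u' v"
proof (rule tangent_eqI)
  show "lie_bracket G (u + u') v \<in> \<gg>" "lie_bracket G u v + lie_bracket G u' v \<in> \<gg>"
    using assms by (simp_all add: bracket_tangent tangent_space_add)
  fix f assume f: "f \<in> smooth_funs MG"
  have "lder (u + u') f = (\<lambda>g. lder u f g + lder u' f g)" by (rule ext) (simp add: lder_def)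
  then show "lie_bracket G (u + u') v f = (lie_bracket G u v + lie_bracket G u' v) f"
    using tangent_add[OF assms(3) lder_smooth[OF assms(1) f] lder_smooth[OF assms(2) f]] by (simp add: lie_bracket_lder)
qed

lemma bracket_scale_left:
  assumes "u \<in> \<gg>" "v \<in> \<gg>"
  shows "lie_bracket G (\<lambda>f. c * u f) v = (\<lambda>f. c * lie_bracket G u v f)"
proof (rule tangent_eqI)
  show "lie_bracket G (\<lambda>f. c * u f) v \<in> \<gg>" "(\<lambda>f. c * lie_bracket G u v f) \<in> \<gg>"
    using assms by (simp_all add: bracket_tangent tangent_space_scale)
  fix f assume f: "f \<in> smooth_funs MG"
  have "lder (\<lambda>f. c * u f) f = (\<lambda>g. c * lder u f g)" by (rule ext) (simp add: lder_def)
  then show "lie_bracket G (\<lambda>f. c * u f) v f = c * lie_bracket G u v f"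
    using tangent_scale[OF assms(2) lder_smooth[OF assms(1) f]] by (simp add: lie_bracket_lder algebra_simps)
qed

lemma bracket_add_right:
  assumes "u \<in> \<gg>" "v \<in> \<gg>" "v' \<in> \<gg>"
  shows "lie_bracket G u (v + v') = lie_bracket G u v + lie_bracket G u v'"
  using bracket_add_left[OF assms(2,3,1)] bracket_skew[of u] by simp

lemma bracket_scale_right:
  assumes "u \<in> \<gg>" "v \<in> \<gg>"
  shows "lie_bracket G u (\<lambda>f. c * v f) = (\<lambda>f. c * lie_bracket G u v f)"
  using bracket_scale_left[OF assms(2,1), of c] bracket_skew[of u] by (auto simp: fun_eq_iff)

text \<open>Since \<open>lder\<close> commutes with left translation, the bracket is the commutator
  of left-invariant derivations at every point and not only at the unit. The Jacobi identity then
  becomes that of commutators.\<close>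

lemma tangent_lder_bracket:
  assumes w: "w \<in> \<gg>" and u: "u \<in> \<gg>" and v: "v \<in> \<gg>" and f: "f \<in> smooth_funs MG"
  shows "w (lder (lie_bracket G u v) f) = w (lder u (lder v f)) - w (lder v (lder u f))"
proof -
  have 1: "a (lder b (\<lambda>x. f (g \<otimes> x))) = lder a (lder b f) g" if "a \<in> \<gg>" "b \<in> \<gg>" "g \<in> carrier G" for a b g
  proof -
    have "a (lder b (\<lambda>x. f (g \<otimes> x))) = a (\<lambda>h. lder b f (g \<otimes> h))"
    proof (rule tangent_cong_carrier[OF that(1)])
      fix h assume h: "h \<in> carrier G"
      show "lder b (\<lambda>x. f (g \<otimes> x)) h = lder b f (g \<otimes> h)"
        unfolding lder_def
        by (rule tangent_cong_carrier[OF that(2)]) (simp_all add: m_assoc h that smooth_funs_left[OF h smooth_funs_left[OF that(3) f]])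
    qed (simp_all add: lder_smooth smooth_funs_left that f)
    then show ?thesis by (simp add: lder_def)
  qed
  have "w (lder (lie_bracket G u v) f) = w (\<lambda>g. lder u (lder v f) g - lder v (lder u f) g)"
  proof (rule tangent_cong_carrier[OF w])
    fix g assume g: "g \<in> carrier G"
    show "lder (lie_bracket G u v) f g = lder u (lder v f) g - lder v (lder u f) g"
      using 1[OF u v g] 1[OF v u g] by (simp add: lder_def[of "lie_bracket G u v"] lie_bracket_lder)
  qed (simp_all add: lder_smooth bracket_tangent u v f)
  then show ?thesis by (simp add: tangent_diff[OF w] lder_smooth u v f)
qed

lemma bracket_jacobi:
  assumes x: "x \<in> \<gg>" and y: "y \<in> \<gg>" and z: "z \<in> \<gg>"
  shows "lie_bracket G x (lie_bracket G y z) = lie_bracket G (lie_bracket G x y) z + lie_bracket G y (lie_bracket G x z)"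
proof (rule tangent_eqI[where M = MG and x = "\<one>"])
  fix f assume f: "f \<in> smooth_funs MG"
  show "lie_bracket G x (lie_bracket G y z) f = (lie_bracket G (lie_bracket G x y) z + lie_bracket G y (lie_bracket G x z)) f"
    using tangent_lder_bracket[OF x y z f] tangent_lder_bracket[OF z x y f] tangent_lder_bracket[OF y x z f]
    by (simp add: lie_bracket_lder)
qed (simp_all add: bracket_tangent tangent_space_add x y z)

section \<open>The adjoint action, its derivative, and consequences of compactness\<close>

lemma Ad_push:
  assumes v: "v \<in> \<gg>" and g: "g \<in> carrier G"
  shows "Ad G g v = push MG (\<lambda>x. g \<otimes> x \<otimes> inv g) v"
  unfolding Ad_def push_def using tangent_not_smooth[OF v not_smooth_conj[OF g]] by (auto simp: o_def fun_eq_iff)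

lemma Ad_tangent: "v \<in> \<gg> \<Longrightarrow> g \<in> carrier G \<Longrightarrow> Ad G g v \<in> \<gg>"
  using push_tangent[OF M M smooth_map_conj, of g v \<one>] by (simp add: Ad_push)

lemma Ad_mult:
  assumes v: "v \<in> \<gg>" and g: "g \<in> carrier G" "h \<in> carrier G"
  shows "Ad G (g \<otimes> h) v = Ad G g (Ad G h v)"
proof (rule tangent_eqI)
  show "Ad G (g \<otimes> h) v \<in> \<gg>" "Ad G g (Ad G h v) \<in> \<gg>" using assms by (simp_all add: Ad_tangent)
  fix f assume f: "f \<in> smooth_funs MG"
  show "Ad G (g \<otimes> h) v f = Ad G g (Ad G h v) f"
    unfolding Ad_def
    by (rule tangent_cong_carrier[OF v one_closed smooth_funs_conj[OF m_closed[OF g] f]])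
       (simp add: g inv_mult_group m_assoc)
qed

lemma Ad_one: "v \<in> \<gg> \<Longrightarrow> Ad G \<one> v = v"
proof (rule tangent_eqI)
  assume v: "v \<in> \<gg>"
  show "Ad G \<one> v \<in> \<gg>" using v by (simp add: Ad_tangent)
  fix f assume f: "f \<in> smooth_funs MG"
  show "Ad G \<one> v f = v f"
    unfolding Ad_def by (rule tangent_cong_carrier[OF v]) (use smooth_funs_conj[OF one_closed f] in simp_all)
qed

lemma Ad_inv: "v \<in> \<gg> \<Longrightarrow> g \<in> carrier G \<Longrightarrow> Ad G (inv g) (Ad G g v) = v"
  using Ad_mult[of v "inv g" g] Ad_one by simp

lemma Ad_bracket:
  assumes u: "u \<in> \<gg>" and v: "v \<in> \<gg>" and g: "g \<in> carrier G"
  shows "Ad G g (lie_bracket G u v) = lie_bracket G (Ad G g u) (Ad G g v)"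
proof (rule tangent_eqI)
  show "Ad G g (lie_bracket G u v) \<in> \<gg>" "lie_bracket G (Ad G g u) (Ad G g v) \<in> \<gg>"
    using assms by (simp_all add: Ad_tangent bracket_tangent)
  fix f assume f: "f \<in> smooth_funs MG"
  let ?C = "\<lambda>x. g \<otimes> x \<otimes> inv g"
  have C: "?C (h \<otimes> x) = ?C h \<otimes> ?C x" if "h \<in> carrier G" "x \<in> carrier G" for h x
  proof -
    show ?thesis using that g by (simp add: m_assoc inv_mult_cancel)
  qed
  have 1: "a (lder b (\<lambda>x. f (?C x))) = (Ad G g a) (lder (Ad G g b) f)" if "a \<in> \<gg>" "b \<in> \<gg>" for a b
  proof -
    have "a (lder b (\<lambda>x. f (?C x))) = a (\<lambda>h. lder (Ad G g b) f (?C h))"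
    proof (rule tangent_cong_carrier[OF that(1)])
      fix h assume h: "h \<in> carrier G"
      show "lder b (\<lambda>x. f (?C x)) h = lder (Ad G g b) f (?C h)"
        unfolding lder_def Ad_def
        by (rule tangent_cong_carrier[OF that(2)]) (simp_all add: C h g smooth_funs_left[OF h smooth_funs_conj[OF g f]])
    qed (simp_all add: lder_smooth smooth_funs_conj g f that)
    then show ?thesis by (simp add: Ad_def)
  qed
  show "Ad G g (lie_bracket G u v) f = lie_bracket G (Ad G g u) (Ad G g v) f"
    using 1[OF u v] 1[OF v u] by (simp add: Ad_def[of G g "lie_bracket G u v"] lie_bracket_lder)
qed

lemma Ad_smooth: "v \<in> \<gg> \<Longrightarrow> f \<in> smooth_funs MG \<Longrightarrow> (\<lambda>s. Ad G s v f) \<in> smooth_funs MG"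
  using smooth_funs_partial[OF M M smooth_funs_conj2 one_in_points] unfolding Ad_def by simp

text \<open>The identity \<open>f (s r) = f ((s r s\<^sup>-\<^sup>1) s)\<close> splits the
  derivative of the left hand side into the derivative of \<open>Ad\<close> and a derivative from the right.\<close>

lemma Ad_derivative:
  assumes u: "u \<in> \<gg>" and v: "v \<in> \<gg>" and f: "f \<in> smooth_funs MG"
  shows "u (\<lambda>s. Ad G s v f) = lie_bracket G u v f"
proof -
  obtain c :: "'e \<Rightarrow> 'g \<Rightarrow> real" and e where ce: "\<And>b. c b \<in> smooth_funs MG" "\<And>b. e b \<in> \<gg>"
    "\<And>v. v \<in> \<gg> \<Longrightarrow> v = (\<lambda>f. \<Sum>b\<in>Basis. v (c b) * e b f)"
    using tangent_finite_basis[OF M one_in_points] by blast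
  have repr: "w h = (\<Sum>b\<in>Basis. w (c b) * e b h)" if "w \<in> \<gg>" for w h using fun_cong[OF ce(3)[OF that], of h] .
  \<comment> \<open>\<open>a b s\<close> are coordinates of \<open>Ad G s v\<close> in the spanning
    family, and \<open>k b\<close> is the derivative of \<open>f\<close> along the right-invariant
    field of \<open>e b\<close>; \<open>lder v f\<close> is the sum of their products.\<close>
  define a where "a b s = Ad G s v (c b)" for b s
  define k where "k b t = e b (\<lambda>r. f (r \<otimes> t))" for b t
  have a: "a b \<in> smooth_funs MG" for b unfolding a_def by (rule Ad_smooth[OF v ce(1)])
  have k: "k b \<in> smooth_funs MG" for b
    unfolding k_def using smooth_funs_partial[OF M M smooth_funs_mult2'[OF f] one_in_points ce(2)] by simp
  have k1: "k b \<one> = e b f" for b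
    unfolding k_def by (rule tangent_cong_carrier[OF ce(2), symmetric]) (simp_all add: f)
  have a1: "a b \<one> = v (c b)" for b by (simp add: a_def Ad_one[OF v])
  have ak: "lder v f s = (\<Sum>b\<in>Basis. a b s * k b s)" if s: "s \<in> carrier G" for s
  proof -
    have "lder v f s = Ad G s v (\<lambda>r. f (r \<otimes> s))"
      unfolding lder_def Ad_def
      by (rule tangent_cong_carrier[OF v]) (simp_all add: s smooth_funs_left[OF s f] m_assoc)
    then show ?thesis using repr[OF Ad_tangent[OF v s], of "\<lambda>r. f (r \<otimes> s)"] by (simp add: a_def k_def)
  qed
  have "u (lder v f) = u (\<lambda>s. \<Sum>b\<in>Basis. a b s * k b s)"
    by (rule tangent_cong_carrier[OF u]) (simp_all add: ak lder_smooth v f)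
  also have "\<dots> = (\<Sum>b\<in>Basis. u (a b) * e b f) + (\<Sum>b\<in>Basis. v (c b) * u (k b))"
    using a k by (simp add: tangent_sum[OF u] tangent_mult[OF u] smooth_funs_mult k1 a1 sum.distrib)
  also have "(\<Sum>b\<in>Basis. u (a b) * e b f) = u (\<lambda>s. \<Sum>b\<in>Basis. e b f * a b s)"
    unfolding tangent_sum[OF u smooth_funs_scale[OF a]] tangent_scale[OF u a] by (simp only: mult.commute)
  also have "\<dots> = u (\<lambda>s. Ad G s v f)"
  proof (rule tangent_cong_carrier[OF u one_closed smooth_funs_sum[OF smooth_funs_scale[OF a]]])
    fix s assume s: "s \<in> carrier G"
    show "(\<Sum>b\<in>Basis. e b f * a b s) = Ad G s v f"
      unfolding a_def repr[OF Ad_tangent[OF v s], of f] by (simp only: mult.commute)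
  qed
  also have "(\<Sum>b\<in>Basis. v (c b) * u (k b)) = u (\<lambda>t. \<Sum>b\<in>Basis. v (c b) * k b t)"
    using k by (simp add: tangent_sum[OF u] tangent_scale[OF u] smooth_funs_scale)
  also have "\<dots> = u (\<lambda>t. v (\<lambda>r. f (r \<otimes> t)))"
    unfolding k_def repr[OF v, symmetric] ..
  \<comment> \<open>Exchanging the two derivations turns the right-handed term into
    \<open>v (lder u f)\<close>, the second half of the bracket.\<close>
  also have "\<dots> = v (\<lambda>r. u (\<lambda>t. f (r \<otimes> t)))"
    using tangent_commute[OF M M smooth_funs_mult2'[OF f] one_in_points u one_in_points v] by simp
  finally show ?thesis by (simp add: lie_bracket_lder lder_def[abs_def])
qed

lemma Ad_derivative_left:
  assumes u: "u \<in> \<gg>" and v: "v \<in> \<gg>" and f: "f \<in> smooth_funs MG" and g: "g \<in> carrier G"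
  shows "u (\<lambda>s. Ad G (g \<otimes> s) v f) = Ad G g (lie_bracket G u v) f"
proof -
  have "u (\<lambda>s. Ad G (g \<otimes> s) v f) = u (\<lambda>s. Ad G s v (\<lambda>x. f (g \<otimes> x \<otimes> inv g)))"
  proof (rule tangent_cong_carrier[OF u])
    show "(\<lambda>s. Ad G (g \<otimes> s) v f) \<in> smooth_funs MG" using smooth_funs_left[OF g Ad_smooth[OF v f]] .
    show "Ad G (g \<otimes> s) v f = Ad G s v (\<lambda>x. f (g \<otimes> x \<otimes> inv g))" if "s \<in> carrier G" for s
      using Ad_mult[OF v g that] by (simp add: Ad_def[of G g])
  qed simp
  also have "\<dots> = lie_bracket G u v (\<lambda>x. f (g \<otimes> x \<otimes> inv g))"
    by (rule Ad_derivative[OF u v smooth_funs_conj[OF g f]])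
  finally show ?thesis by (simp add: Ad_def[of G g])
qed

lemma critical_point:
  assumes comp: "compact_space (mtop MG)" and f: "f \<in> smooth_funs MG"
  obtains g where "g \<in> carrier G" "\<And>x. x \<in> carrier G \<Longrightarrow> f x \<le> f g" "\<And>u. u \<in> \<gg> \<Longrightarrow> u (\<lambda>s. f (g \<otimes> s)) = 0"
proof -
  have "compactin euclideanreal (f ` carrier G)"
    using image_compactin[OF _ smooth_funs_continuous[OF M f]] comp by (simp add: compact_space_def points_carrier)
  then have "compact (f ` carrier G)" by simp
  moreover have "f ` carrier G \<noteq> {}" using one_closed by blast
  ultimately obtain m where "m \<in> f ` carrier G" "\<forall>t\<in>f ` carrier G. t \<le> m" using compact_attains_sup by blast
  then obtain g where g: "g \<in> carrier G" "\<And>x. x \<in> carrier G \<Longrightarrow> f x \<le> f g" by auto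
  have "u (\<lambda>s. f (g \<otimes> s)) = 0" if u: "u \<in> \<gg>" for u
    by (rule tangent_maximum[OF M u one_in_points smooth_funs_left[OF g(1) f]]) (use g in \<open>simp add: points_carrier\<close>)
  with g show thesis using that by blast
qed

text \<open>\<open>\<psi>\<close> is the coordinate inner product of \<open>Ad G s y\<close> with
  \<open>Ad G s ?z\<close>, where \<open>?z\<close> is the bracket of \<open>u\<close> and
  \<open>y\<close>. As \<open>u\<close> commutes with \<open>?z\<close>, the derivative of
  \<open>\<psi>\<close> along \<open>u\<close> at \<open>g\<close> is the squared length of
  \<open>Ad G g ?z\<close>, and it vanishes at a critical point.\<close>

lemma bracket_semisimple:
  assumes comp: "compact_space (mtop MG)" and u: "u \<in> \<gg>" and y: "y \<in> \<gg>"
    and z: "lie_bracket G u (lie_bracket G u y) = 0"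
  shows "lie_bracket G u y = 0"
proof -
  let ?z = "lie_bracket G u y"
  obtain c :: "'e \<Rightarrow> 'g \<Rightarrow> real" and e where ce: "\<And>b. c b \<in> smooth_funs MG" "\<And>b. e b \<in> \<gg>"
    "\<And>v. v \<in> \<gg> \<Longrightarrow> v = (\<lambda>f. \<Sum>b\<in>Basis. v (c b) * e b f)"
    using tangent_finite_basis[OF M one_in_points] by blast
  have zg: "?z \<in> \<gg>" by (rule bracket_tangent[OF u y])
  define \<psi> where "\<psi> s = (\<Sum>b\<in>Basis. Ad G s y (c b) * Ad G s ?z (c b))" for s
  have s: "(\<lambda>s. Ad G s v (c b)) \<in> smooth_funs MG" if "v \<in> \<gg>" for v b by (rule Ad_smooth[OF that ce(1)])
  have "\<psi> \<in> smooth_funs MG" unfolding \<psi>_def by (intro smooth_funs_sum smooth_funs_mult s y zg)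
  then obtain g where g: "g \<in> carrier G" "\<And>u. u \<in> \<gg> \<Longrightarrow> u (\<lambda>s. \<psi> (g \<otimes> s)) = 0"
    using critical_point[OF comp] by metis
  note sl = smooth_funs_left[OF g(1) s]
  have 0: "Ad G g (lie_bracket G u ?z) (c b) = 0" for b unfolding z by (simp add: Ad_def)
  have "u (\<lambda>s. \<psi> (g \<otimes> s)) = (\<Sum>b\<in>Basis. Ad G g ?z (c b) * Ad G g ?z (c b))"
    unfolding \<psi>_def
    by (simp add: tangent_sum[OF u] tangent_mult[OF u] smooth_funs_mult sl y zg ce(1) Ad_derivative_left[OF u] g(1) 0)
  then have "(\<Sum>b\<in>Basis. Ad G g ?z (c b) * Ad G g ?z (c b)) = 0" using g(2)[OF u] by simp
  then have "Ad G g ?z (c b) = 0" if "b \<in> Basis" for b using that by (simp add: sum_nonneg_eq_0_iff)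
  then have "Ad G g ?z = 0" using ce(3)[OF Ad_tangent[OF zg g(1)]] by (auto simp: fun_eq_iff)
  then have "Ad G (inv g) (Ad G g ?z) = 0" by (simp add: Ad_def fun_eq_iff)
  then show ?thesis using Ad_inv[OF zg g(1)] by simp
qed

text \<open>At a maximum of the squared norm of \<open>Ad\<^sub>g (y + i z)\<close> on the compact group its derivative along
  \<open>u\<close> vanishes, but for an eigenvector of \<open>ad u\<close> this derivative is proportional to the norm.\<close>

lemma bracket_eigenvalue_imaginary:
  assumes comp: "compact_space (mtop MG)" and u: "u \<in> \<gg>" and y: "y \<in> \<gg>" and z: "z \<in> \<gg>"
    and uy: "lie_bracket G u y = (\<lambda>f. p * y f - q * z f)" and uz: "lie_bracket G u z = (\<lambda>f. q * y f + p * z f)"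
    and nz: "y \<noteq> 0 \<or> z \<noteq> 0"
  shows "p = 0"
proof -
  obtain c :: "'e \<Rightarrow> 'g \<Rightarrow> real" and e where ce: "\<And>b. c b \<in> smooth_funs MG" "\<And>b. e b \<in> \<gg>"
    "\<And>v. v \<in> \<gg> \<Longrightarrow> v = (\<lambda>f. \<Sum>b\<in>Basis. v (c b) * e b f)"
    using tangent_finite_basis[OF M one_in_points] by blast
  define \<psi> where "\<psi> s = (\<Sum>b\<in>Basis. Ad G s y (c b) * Ad G s y (c b) + Ad G s z (c b) * Ad G s z (c b))" for s
  have s: "(\<lambda>s. Ad G s v (c b)) \<in> smooth_funs MG" if "v \<in> \<gg>" for v b by (rule Ad_smooth[OF that ce(1)])
  have "\<psi> \<in> smooth_funs MG" unfolding \<psi>_def by (intro smooth_funs_sum smooth_funs_add smooth_funs_mult s y z)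
  then obtain g where g: "g \<in> carrier G" "\<And>x. x \<in> carrier G \<Longrightarrow> \<psi> x \<le> \<psi> g" "\<And>u. u \<in> \<gg> \<Longrightarrow> u (\<lambda>s. \<psi> (g \<otimes> s)) = 0"
    using critical_point[OF comp] by metis
  note sl = smooth_funs_left[OF g(1) s]
  have d: "Ad G g (lie_bracket G u y) (c b) = p * Ad G g y (c b) - q * Ad G g z (c b)"
    "Ad G g (lie_bracket G u z) (c b) = q * Ad G g y (c b) + p * Ad G g z (c b)" for b
    unfolding uy uz by (simp_all add: Ad_def)
  have "u (\<lambda>s. \<psi> (g \<otimes> s)) = (\<Sum>b\<in>Basis. 2 * p * (Ad G g y (c b) * Ad G g y (c b) + Ad G g z (c b) * Ad G g z (c b)))"
    unfolding \<psi>_def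
    by (simp add: tangent_sum[OF u] tangent_add[OF u] tangent_mult[OF u] smooth_funs_add smooth_funs_mult sl y z ce(1)
        Ad_derivative_left[OF u] g(1) d algebra_simps)
  also have "\<dots> = 2 * p * \<psi> g" by (simp add: \<psi>_def sum_distrib_left)
  finally have "p * \<psi> g = 0" using g(3)[OF u] by simp
  \<comment> \<open>A maximum equal to 0 would force the nonnegative function \<open>\<psi>\<close>
    to vanish at the unit as well, hence \<open>y\<close> and \<open>z\<close> to be zero.\<close>
  moreover have "\<psi> g \<noteq> 0"
  proof
    assume "\<psi> g = 0"
    moreover have "\<psi> \<one> = (\<Sum>b\<in>Basis. y (c b) * y (c b) + z (c b) * z (c b))" by (simp add: \<psi>_def Ad_one y z)
    ultimately have "(\<Sum>b\<in>Basis. y (c b) * y (c b) + z (c b) * z (c b)) \<le> 0" using g(2)[OF one_closed] by simp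
    then have "(\<Sum>b\<in>Basis. y (c b) * y (c b) + z (c b) * z (c b)) = 0" by (intro antisym sum_nonneg) auto
    then have "y (c b) = 0 \<and> z (c b) = 0" if "b \<in> Basis" for b
      using that by (subst (asm) sum_nonneg_eq_0_iff) (auto simp: add_nonneg_eq_0_iff)
    then have "y = 0" "z = 0" using ce(3)[OF y] ce(3)[OF z] by (auto simp: fun_eq_iff)
    with nz show False by simp
  qed
  ultimately show ?thesis by simp
qed

end

section \<open>Complexification and roots\<close>

interpretation cv: complex_vector_space scaleC
  by unfold_locales (auto simp: scaleC_def fun_eq_iff algebra_simps)

lemma part_simps [simp]:
  "re_part (x + y) = re_part x + re_part y" "im_part (x + y) = im_part x + im_part y"
  "re_part (x - y) = re_part x - re_part y" "im_part (x - y) = im_part x - im_part y"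
  "re_part (- x) = - re_part x" "im_part (- x) = - im_part x"
  "re_part 0 = 0" "im_part 0 = 0"
  "re_part (cplx u) = u" "im_part (cplx u) = 0"
  "re_part (scaleC c x) = (\<lambda>f. Re c * re_part x f - Im c * im_part x f)"
  "im_part (scaleC c x) = (\<lambda>f. Re c * im_part x f + Im c * re_part x f)"
  by (simp_all add: re_part_def im_part_def cplx_def scaleC_def fun_eq_iff)

lemma ctvec_eqI: "re_part x = re_part y \<Longrightarrow> im_part x = im_part y \<Longrightarrow> x = y"
  by (auto simp: re_part_def im_part_def fun_eq_iff complex_eq_iff)

lemma cplx_simps: "cplx (u + v) = cplx u + cplx v" "cplx (u - v) = cplx u - cplx v" "cplx 0 = 0"
  "cplx (\<lambda>f. c * u f) = scaleC (of_real c) (cplx u)"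
  by (simp_all add: cplx_def scaleC_def fun_eq_iff)

lemma part_Ad [simp]: "re_part (Ad G g x) = Ad G g (re_part x)" "im_part (Ad G g x) = Ad G g (im_part x)"
  by (simp_all add: re_part_def im_part_def Ad_def fun_eq_iff)

lemma Ad_cplx: "Ad G g (cplx u) = cplx (Ad G g u)"
  by (simp add: Ad_def cplx_def)

lemma Ad_linear:
  fixes x y :: "('g \<Rightarrow> real) \<Rightarrow> 'k::ring_1"
  shows "Ad G g (x + y) = Ad G g x + Ad G g y" "Ad G g (x - y) = Ad G g x - Ad G g y"
    "Ad G g (\<lambda>f. c * x f) = (\<lambda>f. c * Ad G g x f)" "Ad G g 0 = 0"
  by (simp_all add: Ad_def fun_eq_iff)

lemma Ad_scaleC: "Ad G g (scaleC c x) = scaleC c (Ad G g x)"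
  by (simp add: Ad_def scaleC_def)

lemma part_dbracket [simp]:
  "re_part (dbracket G x y) = lie_bracket G (re_part x) (re_part y) - lie_bracket G (im_part x) (im_part y)"
  "im_part (dbracket G x y) = lie_bracket G (re_part x) (im_part y) + lie_bracket G (im_part x) (re_part y)"
  unfolding dbracket_def by (simp_all add: fun_eq_iff)

context smooth_group
begin

lemma bracket_diff_left:
  assumes "u \<in> \<gg>" "u' \<in> \<gg>" "v \<in> \<gg>"
  shows "lie_bracket G (u - u') v = lie_bracket G u v - lie_bracket G u' v"
  using bracket_add_left[OF tangent_space_diff[OF assms(1,2)] assms(2,3)] by simp

lemma bracket_diff_right:
  assumes "u \<in> \<gg>" "v \<in> \<gg>" "v' \<in> \<gg>"
  shows "lie_bracket G u (v - v') = lie_bracket G u v - lie_bracket G u v'"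
  using bracket_add_right[OF assms(1) tangent_space_diff[OF assms(2,3)] assms(3)] by simp

lemma bracket_zero: "u \<in> \<gg> \<Longrightarrow> lie_bracket G u 0 = 0" "u \<in> \<gg> \<Longrightarrow> lie_bracket G 0 u = 0"
  using bracket_add_right[of u 0 0] bracket_add_left[of 0 0 u] by (simp_all add: tangent_zero)

lemma dalgI: "re_part x \<in> \<gg> \<Longrightarrow> im_part x \<in> \<gg> \<Longrightarrow> x \<in> dalg G MG"
  by (simp add: complexification_def)

lemma dalgD: "x \<in> dalg G MG \<Longrightarrow> re_part x \<in> \<gg>" "x \<in> dalg G MG \<Longrightarrow> im_part x \<in> \<gg>"
  by (simp_all add: complexification_def)

lemma cplx_dalg: "u \<in> \<gg> \<Longrightarrow> cplx u \<in> dalg G MG"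
  by (simp add: complexification_def tangent_zero)

lemma tangent_space_scale_add: "u \<in> \<gg> \<Longrightarrow> v \<in> \<gg> \<Longrightarrow> (\<lambda>f. a * u f + b * v f) \<in> \<gg>"
  using tangent_space_add[OF tangent_space_scale tangent_space_scale, of u MG \<one> v a b] by (simp add: plus_fun_def)

lemma tangent_space_scale_diff: "u \<in> \<gg> \<Longrightarrow> v \<in> \<gg> \<Longrightarrow> (\<lambda>f. a * u f - b * v f) \<in> \<gg>"
  using tangent_space_diff[OF tangent_space_scale tangent_space_scale, of u MG \<one> v a b] by (simp add: fun_diff_def)

lemma subspace_dalg: "cv.subspace (dalg G MG)"
  unfolding cv.subspace_def
  by (auto intro!: dalgI tangent_space_add tangent_space_scale_add tangent_space_scale_diff tangent_zero dest: dalgD)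

lemma bracket_scale_add_left:
  assumes "u \<in> \<gg>" "v \<in> \<gg>" "w \<in> \<gg>"
  shows "lie_bracket G (\<lambda>f. a * u f + b * v f) w = (\<lambda>f. a * lie_bracket G u w f + b * lie_bracket G v w f)"
  using bracket_add_left[OF tangent_space_scale[OF assms(1), of a] tangent_space_scale[OF assms(2), of b] assms(3)]
  by (simp add: plus_fun_def bracket_scale_left assms)

lemma bracket_scale_diff_left:
  assumes "u \<in> \<gg>" "v \<in> \<gg>" "w \<in> \<gg>"
  shows "lie_bracket G (\<lambda>f. a * u f - b * v f) w = (\<lambda>f. a * lie_bracket G u w f - b * lie_bracket G v w f)"
  using bracket_diff_left[OF tangent_space_scale[OF assms(1), of a] tangent_space_scale[OF assms(2), of b] assms(3)]
  by (simp add: fun_diff_def bracket_scale_left assms)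

text \<open>One fixed choice, because \<open>complex_lie_algebra\<close> takes its finite spanning
  set as a parameter.\<close>

definition dspan :: "'g ctvec set" where
  "dspan = (SOME B. finite B \<and> dalg G MG \<subseteq> cv.span B)"

lemma dspan: "finite dspan" "dalg G MG \<subseteq> cv.span dspan"
proof -
  obtain c :: "'e \<Rightarrow> 'g \<Rightarrow> real" and e where ce: "\<And>b. c b \<in> smooth_funs MG" "\<And>b. e b \<in> \<gg>"
    "\<And>v. v \<in> \<gg> \<Longrightarrow> v = (\<lambda>f. \<Sum>b\<in>Basis. v (c b) * e b f)"
    using tangent_finite_basis[OF M one_in_points] by blast
  have "dalg G MG \<subseteq> cv.span ((\<lambda>b. cplx (e b)) ` Basis)"
  proof
    fix x assume x: "x \<in> dalg G MG"
    have sc: "(\<Sum>b\<in>A. scaleC (k b) (cplx (e b))) = (\<lambda>f. \<Sum>b\<in>A. k b * complex_of_real (e b f))" for A k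
      by (induction A rule: infinite_finite_induct) (auto simp: scaleC_def cplx_def fun_eq_iff)
    have "x = (\<Sum>b\<in>Basis. scaleC (Complex (re_part x (c b)) (im_part x (c b))) (cplx (e b)))"
    proof (rule ctvec_eqI)
      show "re_part x = re_part (\<Sum>b\<in>Basis. scaleC (Complex (re_part x (c b)) (im_part x (c b))) (cplx (e b)))"
        unfolding sc re_part_def[of "\<lambda>f. \<Sum>b\<in>Basis. _ b * _ b f"] using ce(3)[OF dalgD(1)[OF x]] by simp
      show "im_part x = im_part (\<Sum>b\<in>Basis. scaleC (Complex (re_part x (c b)) (im_part x (c b))) (cplx (e b)))"
        unfolding sc im_part_def[of "\<lambda>f. \<Sum>b\<in>Basis. _ b * _ b f"] using ce(3)[OF dalgD(2)[OF x]] by simp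
    qed
    also have "\<dots> \<in> cv.span ((\<lambda>b. cplx (e b)) ` Basis)"
      by (intro cv.span_sum cv.span_scale cv.span_base imageI)
    finally show "x \<in> cv.span ((\<lambda>b. cplx (e b)) ` Basis)" .
  qed
  then have "\<exists>B. finite B \<and> dalg G MG \<subseteq> cv.span B" using finite_imageI[OF finite_Basis] by blast
  then have "finite dspan \<and> dalg G MG \<subseteq> cv.span dspan" unfolding dspan_def by (rule someI_ex)
  then show "finite dspan" "dalg G MG \<subseteq> cv.span dspan" by simp_all
qed

text \<open>Real and imaginary parts expand into the eight real Jacobi identities
  \<open>j\<close>.\<close>

lemma dbracket_jacobi:
  assumes "x \<in> dalg G MG" "y \<in> dalg G MG" "z \<in> dalg G MG"
  shows "dbracket G x (dbracket G y z) = dbracket G (dbracket G x y) z + dbracket G y (dbracket G x z)"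
proof -
  note d = dalgD[OF assms(1)] dalgD[OF assms(2)] dalgD[OF assms(3)]
  note j = bracket_jacobi[OF d(1,3,5)] bracket_jacobi[OF d(1,3,6)] bracket_jacobi[OF d(1,4,5)] bracket_jacobi[OF d(1,4,6)]
    bracket_jacobi[OF d(2,3,5)] bracket_jacobi[OF d(2,3,6)] bracket_jacobi[OF d(2,4,5)] bracket_jacobi[OF d(2,4,6)]
  show ?thesis
    by (rule ctvec_eqI)
       (simp_all add: d bracket_tangent bracket_add_left bracket_add_right bracket_diff_left bracket_diff_right j)
qed

sublocale cla: complex_lie_algebra scaleC "dalg G MG" "dbracket G" dspan
proof
  show "finite dspan" "dalg G MG \<subseteq> cv.span dspan" by (rule dspan)+
  show "cv.subspace (dalg G MG)" by (rule subspace_dalg)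
  fix x y z :: "'g ctvec" and c :: complex
  assume x: "x \<in> dalg G MG" and y: "y \<in> dalg G MG"
  note d = dalgD[OF x] dalgD[OF y]
  show "dbracket G x y \<in> dalg G MG" by (rule dalgI) (simp_all add: d tangent_space_add tangent_space_diff bracket_tangent)
  show "dbracket G (scaleC c x) y = scaleC c (dbracket G x y)"
    by (rule ctvec_eqI) (simp_all add: d bracket_scale_add_left bracket_scale_diff_left fun_eq_iff algebra_simps)
  show "dbracket G x y = - dbracket G y x"
    using bracket_skew[of "re_part x" "re_part y"] bracket_skew[of "im_part x" "im_part y"]
      bracket_skew[of "re_part x" "im_part y"] bracket_skew[of "im_part x" "re_part y"]
    by (intro ctvec_eqI) simp_all
  assume z: "z \<in> dalg G MG"
  note d = d dalgD[OF z]
  show "dbracket G (x + y) z = dbracket G x z + dbracket G y z"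
    by (rule ctvec_eqI) (simp_all add: d bracket_add_left)
  show "dbracket G x (dbracket G y z) = dbracket G (dbracket G x y) z + dbracket G y (dbracket G x z)"
    by (rule dbracket_jacobi[OF x y z])
qed

lemma dAd_in: "x \<in> dalg G MG \<Longrightarrow> g \<in> carrier G \<Longrightarrow> Ad G g x \<in> dalg G MG"
  by (rule dalgI) (simp_all add: Ad_tangent dalgD)

lemma dAd_mult: "x \<in> dalg G MG \<Longrightarrow> g \<in> carrier G \<Longrightarrow> h \<in> carrier G \<Longrightarrow> Ad G (g \<otimes> h) x = Ad G g (Ad G h x)"
  by (rule ctvec_eqI) (simp_all add: Ad_mult dalgD)

lemma dAd_inv: "x \<in> dalg G MG \<Longrightarrow> g \<in> carrier G \<Longrightarrow> Ad G (inv g) (Ad G g x) = x"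
  by (rule ctvec_eqI) (simp_all add: Ad_inv dalgD)

lemma dAd_inv': "x \<in> dalg G MG \<Longrightarrow> g \<in> carrier G \<Longrightarrow> Ad G g (Ad G (inv g) x) = x"
  using dAd_inv[of x "inv g"] by simp

lemma dAd_bracket:
  assumes "x \<in> dalg G MG" "y \<in> dalg G MG" and g: "g \<in> carrier G"
  shows "Ad G g (dbracket G x y) = dbracket G (Ad G g x) (Ad G g y)"
  by (rule ctvec_eqI) (simp_all add: Ad_linear Ad_bracket dalgD assms)

lemma endo_Ad: "g \<in> carrier G \<Longrightarrow> cv.endo (dalg G MG) (Ad G g)"
  unfolding cv.endo_def by (simp add: subspace_dalg dAd_in Ad_linear Ad_scaleC)

text \<open>Literally the choice made inside \<open>ctrace\<close>, so that
  \<open>ctrace_dbasis\<close> is an unfolding.\<close>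

definition dbasis :: "'g ctvec set" where
  "dbasis = (SOME B. finite B \<and> \<not> cv.dependent B \<and> cv.span B = dalg G MG)"

lemma dbasis: "finite dbasis" "cv.independent dbasis" "cv.span dbasis = dalg G MG"
proof -
  obtain C where C: "finite C" "C \<subseteq> dalg G MG" "cv.independent C" "dalg G MG \<subseteq> cv.span C"
    using cv.finite_basis_exists[OF dspan] by metis
  have "cv.span C = dalg G MG" using C(4) cv.span_minimal[OF C(2) subspace_dalg] by (rule subset_antisym[rotated])
  with C have "\<exists>B. finite B \<and> \<not> cv.dependent B \<and> cv.span B = dalg G MG" by blast
  then have "finite dbasis \<and> \<not> cv.dependent dbasis \<and> cv.span dbasis = dalg G MG"
    unfolding dbasis_def by (rule someI_ex)
  then show "finite dbasis" "cv.independent dbasis" "cv.span dbasis = dalg G MG" by simp_all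
qed

lemma ctrace_dbasis: "ctrace (dalg G MG) L = (\<Sum>b\<in>dbasis. cv.representation dbasis (L b) b)"
  unfolding ctrace_def dbasis_def Let_def ..

lemma dbasis_in: "b \<in> dbasis \<Longrightarrow> b \<in> dalg G MG"
  using cv.span_base[of b dbasis] dbasis(3) by simp

lemma ctrace_add:
  assumes "\<And>z. z \<in> dalg G MG \<Longrightarrow> L z \<in> dalg G MG" "\<And>z. z \<in> dalg G MG \<Longrightarrow> L' z \<in> dalg G MG"
  shows "ctrace (dalg G MG) (\<lambda>z. L z + L' z) = ctrace (dalg G MG) L + ctrace (dalg G MG) L'"
  unfolding ctrace_dbasis sum.distrib[symmetric]
  by (rule sum.cong) (simp_all add: cv.representation_add dbasis assms dbasis_in)

lemma ctrace_scale:
  assumes "\<And>z. z \<in> dalg G MG \<Longrightarrow> L z \<in> dalg G MG"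
  shows "ctrace (dalg G MG) (\<lambda>z. scaleC c (L z)) = c * ctrace (dalg G MG) L"
  unfolding ctrace_dbasis sum_distrib_left
  by (rule sum.cong) (simp_all add: cv.representation_scale dbasis assms dbasis_in)

lemma ctrace_cong: "(\<And>z. z \<in> dalg G MG \<Longrightarrow> L z = L' z) \<Longrightarrow> ctrace (dalg G MG) L = ctrace (dalg G MG) L'"
  unfolding ctrace_dbasis by (rule sum.cong) (simp_all add: dbasis_in)

lemma ctrace_conj:
  assumes L: "cv.endo (dalg G MG) L" and g: "g \<in> carrier G"
  shows "ctrace (dalg G MG) (\<lambda>z. Ad G g (L (Ad G (inv g) z))) = ctrace (dalg G MG) L"
proof -
  obtain C where C: "finite C" "cv.independent C" "cv.span C = dalg G MG"
    "(\<Sum>c\<in>C. cv.representation C (Ad G g (L (Ad G (inv g) c))) c) = (\<Sum>b\<in>dbasis. cv.representation dbasis (L b) b)"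
    using cv.sum_conjugate_basis[OF dbasis endo_Ad[OF g] L, of "Ad G (inv g)"] g by (auto simp: dAd_inv dAd_inv' dAd_in)
  have "cv.endo (dalg G MG) (\<lambda>z. Ad G g (L (Ad G (inv g) z)))"
    using cv.endoD[OF L] g unfolding cv.endo_def by (simp add: dAd_in Ad_linear Ad_scaleC)
  from cv.sum_change_basis[OF dbasis C(1-3) this] C(4) show ?thesis by (simp add: ctrace_dbasis)
qed

lemma killing_form_add:
  assumes "x \<in> dalg G MG" "y \<in> dalg G MG" "y' \<in> dalg G MG"
  shows "killing_form G MG x (y + y') = killing_form G MG x y + killing_form G MG x y'"
proof -
  have "killing_form G MG x (y + y') = ctrace (dalg G MG) (\<lambda>z. dbracket G x (dbracket G y z) + dbracket G x (dbracket G y' z))"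
    unfolding killing_form_def by (rule ctrace_cong) (simp add: assms cla.br_add_left cla.br_add_right cla.br_in)
  then show ?thesis unfolding killing_form_def by (simp add: ctrace_add assms cla.br_in)
qed

lemma killing_form_scale:
  assumes "x \<in> dalg G MG" "y \<in> dalg G MG"
  shows "killing_form G MG x (scaleC c y) = c * killing_form G MG x y"
proof -
  have "killing_form G MG x (scaleC c y) = ctrace (dalg G MG) (\<lambda>z. scaleC c (dbracket G x (dbracket G y z)))"
    unfolding killing_form_def by (rule ctrace_cong) (simp add: assms cla.br_scale_left cla.br_scale_right cla.br_in)
  then show ?thesis unfolding killing_form_def by (simp add: ctrace_scale assms cla.br_in)
qed

text \<open>\<open>Ad G g\<close> respects brackets, so it conjugates the operator whose trace is
  the Killing form.\<close>

lemma killing_form_Ad: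
  assumes x: "x \<in> dalg G MG" and y: "y \<in> dalg G MG" and g: "g \<in> carrier G"
  shows "killing_form G MG (Ad G g x) (Ad G g y) = killing_form G MG x y"
proof -
  have "cv.endo (dalg G MG) (\<lambda>z. dbracket G x (dbracket G y z))"
    using cv.endoD[OF cla.endo_br[OF x]] cv.endoD[OF cla.endo_br[OF y]] unfolding cv.endo_def by simp
  from ctrace_conj[OF this g]
  have "ctrace (dalg G MG) (\<lambda>z. Ad G g (dbracket G x (dbracket G y (Ad G (inv g) z)))) = killing_form G MG x y"
    by (simp add: killing_form_def)
  moreover have "ctrace (dalg G MG) (\<lambda>z. Ad G g (dbracket G x (dbracket G y (Ad G (inv g) z)))) = killing_form G MG (Ad G g x) (Ad G g y)"
    unfolding killing_form_def by (rule ctrace_cong) (simp add: dAd_bracket dAd_in dAd_inv' cla.br_in x y g)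
  ultimately show ?thesis by simp
qed

text \<open>Real and imaginary part of the complex eigenvalue equation are the pair of real
  equations treated in \<open>bracket_eigenvalue_imaginary\<close>.\<close>

lemma dbracket_eigenvalue_imaginary:
  assumes comp: "compact_space (mtop MG)" and u: "u \<in> \<gg>" and w: "w \<in> dalg G MG" "w \<noteq> 0"
    and eig: "dbracket G (cplx u) w = scaleC \<nu> w"
  shows "Re \<nu> = 0"
proof (rule bracket_eigenvalue_imaginary[OF comp u dalgD[OF w(1)]])
  show "lie_bracket G u (re_part w) = (\<lambda>f. Re \<nu> * re_part w f - Im \<nu> * im_part w f)"
    using arg_cong[OF eig, of re_part] by (simp add: bracket_zero dalgD w)
  show "lie_bracket G u (im_part w) = (\<lambda>f. Im \<nu> * re_part w f + Re \<nu> * im_part w f)"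
    using arg_cong[OF eig, of im_part] by (simp add: bracket_zero dalgD w add.commute)
  show "re_part w \<noteq> 0 \<or> im_part w \<noteq> 0" using ctvec_eqI[of w 0] w(2) by auto
qed

end

section \<open>Torus algebra, root spaces, and eigenvalues on \<open>halg\<close>\<close>

locale flag_setup = smooth_group G MG for G :: "'g monoid" (structure) and MG :: "('g, 'e::euclidean_space) mfd" +
  fixes T :: "'g set" and P :: "('g ctvec \<Rightarrow> complex) set"
  assumes semisimple: "semisimple_lie_group G MG" and compact: "compact_space (mtop MG)"
    and torus: "torus_in G MG T" and positive: "positive_roots G MG T P"
begin

abbreviation "\<tt> \<equiv> torus_algebra G MG T"

lemma T: "subgroup T G" "submanifold MG T" "\<And>s t. s \<in> T \<Longrightarrow> t \<in> T \<Longrightarrow> s \<otimes> t = t \<otimes> s"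
  using torus by (simp_all add: torus_in_def)

lemma T_sub: "smooth_manifold (sub_mfd MG T)" "T \<subseteq> points MG"
  using T(2) by (simp_all add: submanifold_def)

lemma T_carrier: "t \<in> T \<Longrightarrow> t \<in> carrier G"
  using subgroup.subset[OF T(1)] by blast

lemma one_T: "\<one> \<in> T" by (rule subgroup.one_closed[OF T(1)])

lemma sub_id: "smooth_map (sub_mfd MG T) MG id"
  by (rule smooth_map_inclusion[OF M])

lemma torus_algebra_subset: "u \<in> \<tt> \<Longrightarrow> u \<in> \<gg>"
  unfolding torus_algebra_def using push_tangent[OF T_sub(1) M sub_id, of _ \<one>] one_T by (auto simp: points_sub_mfd)

text \<open>A vector tangent to the torus sees only the restriction of a function to the torus.
  Through this, commutativity of the group \<open>T\<close> passes to its Lie algebra.\<close>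

lemma torus_algebra_cong:
  assumes w: "w \<in> \<tt>" and f: "f \<in> smooth_funs MG" and h: "h \<in> smooth_funs MG" and eq: "\<And>s. s \<in> T \<Longrightarrow> f s = h s"
  shows "w f = w h"
proof -
  obtain w' where w': "w' \<in> tangent_space (sub_mfd MG T) \<one>" "w = push MG id w'" using w by (auto simp: torus_algebra_def)
  have "f \<in> smooth_funs (sub_mfd MG T)" using smooth_funs_pullback[OF T_sub(1) M sub_id f] by simp
  then have "w' f = w' h"
    using tangent_cong_points[OF T_sub(1) w'(1)] one_T eq T_sub(2) by (simp add: points_sub_mfd Int_absorb1)
  then show ?thesis by (simp add: w'(2) push_def f h)
qed

lemma Ad_torus:
  assumes t: "t \<in> T" and u: "u \<in> \<tt>"
  shows "Ad G t u = u"
proof (rule tangent_eqI)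
  note t' = T_carrier[OF t]
  show "u \<in> \<gg>" by (rule torus_algebra_subset[OF u])
  then show "Ad G t u \<in> \<gg>" using t' by (rule Ad_tangent)
  fix f assume f: "f \<in> smooth_funs MG"
  show "Ad G t u f = u f"
    unfolding Ad_def
  proof (rule torus_algebra_cong[OF u smooth_funs_conj[OF t' f] f])
    fix s assume s: "s \<in> T"
    show "f (t \<otimes> s \<otimes> inv t) = f s" using T(3)[OF t s] T_carrier[OF s] t' by (simp add: m_assoc)
  qed
qed

text \<open>\<open>Ad G s w\<close> is constant for \<open>s\<close> in the torus, and its
  derivative along \<open>u\<close> is the bracket.\<close>

lemma torus_bracket:
  assumes u: "u \<in> \<tt>" and w: "w \<in> \<tt>"
  shows "lie_bracket G u w = 0"
proof (rule tangent_eqI)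
  note g = torus_algebra_subset[OF u] torus_algebra_subset[OF w]
  show "lie_bracket G u w \<in> \<gg>" "0 \<in> \<gg>" by (simp_all add: bracket_tangent g tangent_zero)
  fix f assume f: "f \<in> smooth_funs MG"
  have "u (\<lambda>s. Ad G s w f) = u (\<lambda>s. w f)"
    by (rule torus_algebra_cong[OF u Ad_smooth[OF g(2) f] smooth_funs_const]) (simp_all add: Ad_torus w M)
  then show "lie_bracket G u w f = 0 f" using Ad_derivative[OF g f] tangent_const[OF g(1)] by simp
qed

lemma torus_algebra_zero: "0 \<in> \<tt>"
  and torus_algebra_add: "u \<in> \<tt> \<Longrightarrow> v \<in> \<tt> \<Longrightarrow> u + v \<in> \<tt>"
  and torus_algebra_diff: "u \<in> \<tt> \<Longrightarrow> v \<in> \<tt> \<Longrightarrow> u - v \<in> \<tt>"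
  and torus_algebra_scale: "u \<in> \<tt> \<Longrightarrow> (\<lambda>f. c * u f) \<in> \<tt>"
proof -
  show "0 \<in> \<tt>" unfolding torus_algebra_def using push_zero tangent_zero by (metis imageI)
  show "u + v \<in> \<tt>" if "u \<in> \<tt>" "v \<in> \<tt>"
    using that unfolding torus_algebra_def by (auto simp: push_add[symmetric] intro!: imageI tangent_space_add)
  show "u - v \<in> \<tt>" if "u \<in> \<tt>" "v \<in> \<tt>"
    using that unfolding torus_algebra_def by (auto simp: push_diff[symmetric] intro!: imageI tangent_space_diff)
  show "(\<lambda>f. c * u f) \<in> \<tt>" if "u \<in> \<tt>"
    using that unfolding torus_algebra_def by (auto simp: push_scale[symmetric] intro!: imageI tangent_space_scale)
qed

lemma tcalgD: "h \<in> tcalg G MG T \<Longrightarrow> re_part h \<in> \<tt>" "h \<in> tcalg G MG T \<Longrightarrow> im_part h \<in> \<tt>"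
  by (simp_all add: complexification_def)

lemma tcalgI: "re_part h \<in> \<tt> \<Longrightarrow> im_part h \<in> \<tt> \<Longrightarrow> h \<in> tcalg G MG T"
  by (simp add: complexification_def)

lemma cplx_tcalg: "u \<in> \<tt> \<Longrightarrow> cplx u \<in> tcalg G MG T"
  by (simp add: complexification_def torus_algebra_zero)

lemma tcalg_dalg: "h \<in> tcalg G MG T \<Longrightarrow> h \<in> dalg G MG"
  by (simp add: complexification_def torus_algebra_subset)

lemma subspace_tcalg: "cv.subspace (tcalg G MG T)"
proof -
  have 1: "(\<lambda>f. a * u f + b * v f) \<in> \<tt>" "(\<lambda>f. a * u f - b * v f) \<in> \<tt>" if "u \<in> \<tt>" "v \<in> \<tt>" for u v a b
    using torus_algebra_add[OF torus_algebra_scale torus_algebra_scale, OF that, of a b]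
      torus_algebra_diff[OF torus_algebra_scale torus_algebra_scale, OF that, of a b]
    by (simp_all add: plus_fun_def fun_diff_def)
  show ?thesis
    unfolding cv.subspace_def
    by (auto intro!: tcalgI torus_algebra_add 1 torus_algebra_zero dest: tcalgD)
qed

lemma tcalg_bracket: "h \<in> tcalg G MG T \<Longrightarrow> k \<in> tcalg G MG T \<Longrightarrow> dbracket G h k = 0"
  by (rule ctvec_eqI) (simp_all add: torus_bracket tcalgD)

lemma Ad_tcalg: "h \<in> tcalg G MG T \<Longrightarrow> t \<in> T \<Longrightarrow> Ad G t h = h"
  by (rule ctvec_eqI) (simp_all add: Ad_torus tcalgD)

lemma rootD:
  assumes "\<alpha> \<in> roots G MG T"
  shows "\<And>h k. h \<in> tcalg G MG T \<Longrightarrow> k \<in> tcalg G MG T \<Longrightarrow> \<alpha> (h + k) = \<alpha> h + \<alpha> k"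
    "\<And>c h. h \<in> tcalg G MG T \<Longrightarrow> \<alpha> (scaleC c h) = c * \<alpha> h" "\<And>h. h \<notin> tcalg G MG T \<Longrightarrow> \<alpha> h = 0"
    "\<alpha> \<noteq> 0" "root_space G MG T \<alpha> \<noteq> {0}"
  using assms by (simp_all add: roots_def)

lemma root_diff:
  assumes "\<alpha> \<in> roots G MG T" "h \<in> tcalg G MG T" "k \<in> tcalg G MG T"
  shows "\<alpha> (h - k) = \<alpha> h - \<alpha> k"
  using rootD(1)[OF assms(1) cv.subspace_diff[OF subspace_tcalg assms(2,3)] assms(3)] by simp

lemma root_spaceD:
  assumes "x \<in> root_space G MG T \<alpha>"
  shows "x \<in> dalg G MG" "\<And>h. h \<in> tcalg G MG T \<Longrightarrow> dbracket G h x = scaleC (\<alpha> h) x"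
  using assms by (simp_all add: root_space_def)

lemma zero_root_space: "0 \<in> root_space G MG T \<alpha>"
  unfolding root_space_def
  by (simp add: cv.subspace_0[OF subspace_dalg] cv.endo_0[OF cla.endo_br] tcalg_dalg)

lemma root_space_bracket:
  assumes x: "x \<in> root_space G MG T \<alpha>" and y: "y \<in> root_space G MG T \<beta>"
  shows "dbracket G x y \<in> root_space G MG T (\<alpha> + \<beta>)"
  unfolding root_space_def mem_Collect_eq
proof (intro conjI ballI)
  note d = root_spaceD(1)[OF x] root_spaceD(1)[OF y]
  show "dbracket G x y \<in> dalg G MG" by (rule cla.br_in[OF d])
  fix h assume h: "h \<in> tcalg G MG T"
  show "dbracket G h (dbracket G x y) = scaleC ((\<alpha> + \<beta>) h) (dbracket G x y)"
    using cla.jacobi[OF tcalg_dalg[OF h] d] root_spaceD(2)[OF x h] root_spaceD(2)[OF y h]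
    by (simp add: cla.br_scale_left cla.br_scale_right d cv.scale_left_distrib)
qed

text \<open>The union of the root spaces and not their span: its elements are visibly ad-nilpotent
  and it is closed under brackets, which is what the theorem on weakly closed sets asks for.\<close>

abbreviation posvecs :: "'g ctvec set" where "posvecs \<equiv> \<Union>\<alpha>\<in>P. root_space G MG T \<alpha>"

lemma P_roots: "\<alpha> \<in> P \<Longrightarrow> \<alpha> \<in> roots G MG T"
  using positive by (auto simp: positive_roots_def)

lemma posvecs_dalg: "posvecs \<subseteq> dalg G MG"
  using root_spaceD(1) by blast

text \<open>A nonzero bracket lies in the root space of \<open>\<alpha> + \<beta>\<close>, and this
  sum is nonzero because a positive system contains only one of a root and its negative. A zero
  bracket lies in every root space.\<close>

lemma posvecs_closed:
  assumes x: "x \<in> posvecs" and y: "y \<in> posvecs"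
  shows "dbracket G x y \<in> posvecs"
proof (cases "dbracket G x y = 0")
  case True
  then show ?thesis using x zero_root_space by auto
next
  case False
  obtain \<alpha> \<beta> where a: "\<alpha> \<in> P" "x \<in> root_space G MG T \<alpha>" and b: "\<beta> \<in> P" "y \<in> root_space G MG T \<beta>" using x y by blast
  note ra = P_roots[OF a(1)] and rb = P_roots[OF b(1)]
  have rs: "dbracket G x y \<in> root_space G MG T (\<alpha> + \<beta>)" by (rule root_space_bracket[OF a(2) b(2)])
  have "\<alpha> + \<beta> \<noteq> 0"
  proof
    assume "\<alpha> + \<beta> = 0"
    then have "\<beta> = - \<alpha>" by (simp add: add_eq_0_iff2 minus_unique)
    then show False using positive ra a(1) b(1) by (auto simp: positive_roots_def)
  qed
  then have "\<alpha> + \<beta> \<in> roots G MG T"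
    using rs False rootD(1-3)[OF ra] rootD(1-3)[OF rb] unfolding roots_def by (auto simp: algebra_simps)
  then have "\<alpha> + \<beta> \<in> P" using positive a(1) b(1) unfolding positive_roots_def by blast
  with rs show ?thesis by blast
qed

text \<open>A root is a nonzero functional; an \<open>h\<close> with \<open>\<alpha> h\<close>
  nonzero provides the commutator relation of \<open>nilpotent_of_commutator\<close>.\<close>

lemma posvecs_nilpotent:
  assumes s: "s \<in> posvecs"
  shows "\<exists>k. \<forall>v\<in>dalg G MG. (dbracket G s ^^ k) v = 0"
proof -
  obtain \<alpha> where a: "\<alpha> \<in> P" "s \<in> root_space G MG T \<alpha>" using s by blast
  obtain h where h: "\<alpha> h \<noteq> 0" using rootD(4)[OF P_roots[OF a(1)]] by (auto simp: fun_eq_iff)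
  then have ht: "h \<in> tcalg G MG T" using rootD(3)[OF P_roots[OF a(1)]] by blast
  note sd = root_spaceD[OF a(2)]
  show ?thesis
  proof (rule cv.nilpotent_of_commutator[OF dspan cla.endo_br[OF tcalg_dalg[OF ht]] cla.endo_br[OF sd(1)] h])
    fix v assume v: "v \<in> dalg G MG"
    show "dbracket G h (dbracket G s v) = dbracket G s (dbracket G h v) + scaleC (\<alpha> h) (dbracket G s v)"
      using cla.jacobi[OF tcalg_dalg[OF ht] sd(1) v] sd(2)[OF ht] by (simp add: cla.br_scale_left sd(1) v)
  qed
qed

lemma posvecs_flag: "\<exists>k. cla.flag posvecs k \<subseteq> {0}"
  by (rule cla.weakly_closed_nilpotent[OF posvecs_dalg posvecs_closed posvecs_nilpotent])

lemma tcalg_posvecs: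
  assumes z: "z \<in> tcalg G MG T" and s: "s \<in> posvecs"
  shows "dbracket G z s \<in> cv.span posvecs"
proof -
  obtain \<alpha> where a: "\<alpha> \<in> P" "s \<in> root_space G MG T \<alpha>" using s by blast
  show ?thesis unfolding root_spaceD(2)[OF a(2) z] by (rule cv.span_scale[OF cv.span_base[OF s]])
qed

text \<open>The eigenspace \<open>W\<close> of \<open>z\<close> is invariant under the commuting
  operators of the torus algebra, so it contains a joint eigenvector \<open>x\<close>. Its
  eigenvalues form a linear functional \<open>\<beta>\<close> that is zero or a root, and \<nu> is
  the value at \<open>z\<close>.\<close>

lemma tcalg_eigenvalue:
  assumes z: "z \<in> tcalg G MG T" and w: "w \<in> dalg G MG" "w \<noteq> 0" and eig: "dbracket G z w = scaleC \<nu> w"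
  shows "\<nu> = 0 \<or> (\<exists>\<beta>\<in>roots G MG T. \<nu> = \<beta> z)"
proof -
  have "tcalg G MG T \<subseteq> cv.span dspan" using dspan(2) tcalg_dalg by blast
  then obtain C where C: "finite C" "C \<subseteq> tcalg G MG T" "tcalg G MG T \<subseteq> cv.span C"
    using cv.finite_basis_exists[OF dspan(1)] by metis
  have comm: "dbracket G h (dbracket G k x) = dbracket G k (dbracket G h x)"
    if "h \<in> tcalg G MG T" "k \<in> tcalg G MG T" "x \<in> dalg G MG" for h k x
    using cla.jacobi[of h k x] tcalg_bracket[OF that(1,2)] cv.endo_0[OF cla.endo_br_left[OF that(3)]]
    by (simp add: tcalg_dalg that)
  define W where "W = {x \<in> dalg G MG. dbracket G z x = scaleC \<nu> x}"
  have zd: "z \<in> dalg G MG" by (rule tcalg_dalg[OF z])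
  have Ws: "cv.subspace W"
    unfolding W_def cv.subspace_def
    using cv.endoD[OF cla.endo_br[OF zd]] cv.endo_0[OF cla.endo_br[OF zd]] subspace_dalg
    by (auto simp: cv.subspace_def cv.scale_right_distrib mult.commute)
  have "\<exists>w\<in>W. w \<noteq> 0 \<and> (\<forall>A\<in>dbracket G ` C. \<exists>\<nu>. A w = scaleC \<nu> w)"
  proof (rule cv.joint_eigenvector[OF finite_imageI[OF C(1)] dspan _ _ Ws])
    show "cv.endo (dalg G MG) A" if "A \<in> dbracket G ` C" for A
      using that C(2) cla.endo_br tcalg_dalg by blast
    show "A (A' v) = A' (A v)" if "A \<in> dbracket G ` C" "A' \<in> dbracket G ` C" "v \<in> dalg G MG" for A A' v
      using that by (auto intro!: comm intro: subsetD[OF C(2)])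
    show "W \<subseteq> dalg G MG" by (auto simp: W_def)
    show "W \<noteq> {0}" using w eig by (auto simp: W_def)
    show "A x \<in> W" if A: "A \<in> dbracket G ` C" and x: "x \<in> W" for A x
    proof -
      obtain k where k: "k \<in> tcalg G MG T" "A = dbracket G k" using A C(2) by blast
      have x': "x \<in> dalg G MG" "dbracket G z x = scaleC \<nu> x" using x by (simp_all add: W_def)
      show ?thesis
        using comm[OF z k(1) x'(1)] x' tcalg_dalg[OF k(1)] by (simp add: W_def k(2) cla.br_in cla.br_scale_right)
    qed
  qed
  then obtain x where x: "x \<in> W" "x \<noteq> 0" "\<And>h. h \<in> C \<Longrightarrow> \<exists>\<nu>. dbracket G h x = scaleC \<nu> x" by blast
  have xd: "x \<in> dalg G MG" "dbracket G z x = scaleC \<nu> x" using x(1) by (simp_all add: W_def)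
  have ev: "h \<in> tcalg G MG T \<and> (\<exists>\<nu>. dbracket G h x = scaleC \<nu> x)" if "h \<in> cv.span C" for h
    using that
  proof (induction rule: cv.span_induct_alt)
    case base
    show ?case
      using cv.subspace_0[OF subspace_tcalg] cv.endo_0[OF cla.endo_br_left[OF xd(1)]] by (auto simp: zero_fun_def[symmetric] intro: exI[of _ 0])
  next
    case (step c h k)
    have h: "h \<in> tcalg G MG T" using C(2) step(1) by blast
    obtain \<mu> \<mu>' where "dbracket G h x = scaleC \<mu> x" "dbracket G k x = scaleC \<mu>' x" using x(3)[OF step(1)] step(2) by blast
    then have "dbracket G (scaleC c h + k) x = scaleC (c * \<mu> + \<mu>') x"
      using h step(2) xd(1)
      by (simp add: cla.br_add_left cla.br_scale_left tcalg_dalg cv.subspace_scale[OF subspace_dalg] cv.scale_left_distrib)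
    then show ?case using h step(2) cv.subspace_add[OF subspace_tcalg cv.subspace_scale[OF subspace_tcalg]] by blast
  qed
  \<comment> \<open>Zero outside the complexified torus algebra, as \<open>roots\<close> demands of
    its elements.\<close>
  define \<beta> where "\<beta> h = (if h \<in> tcalg G MG T then SOME \<nu>. dbracket G h x = scaleC \<nu> x else 0)" for h
  have \<beta>: "dbracket G h x = scaleC (\<beta> h) x" if "h \<in> tcalg G MG T" for h
    using someI_ex[OF conjunct2[OF ev[OF subsetD[OF C(3) that]]]] that by (simp add: \<beta>_def)
  have uniq: "a = b" if "scaleC a x = scaleC b x" for a b using that x(2) cv.scale_right_imp_eq by blast
  have add: "\<beta> (h + k) = \<beta> h + \<beta> k" if "h \<in> tcalg G MG T" "k \<in> tcalg G MG T" for h k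
    using \<beta>[OF cv.subspace_add[OF subspace_tcalg that]] \<beta>[OF that(1)] \<beta>[OF that(2)]
    by (intro uniq) (simp add: cla.br_add_left tcalg_dalg that xd(1) cv.scale_left_distrib)
  have scl: "\<beta> (scaleC c h) = c * \<beta> h" if "h \<in> tcalg G MG T" for h c
    using \<beta>[OF cv.subspace_scale[OF subspace_tcalg that, of c]] \<beta>[OF that]
    by (intro uniq) (auto simp: cla.br_scale_left tcalg_dalg that xd(1))
  have \<nu>: "\<nu> = \<beta> z" using \<beta>[OF z] xd(2) by (intro uniq) simp
  show ?thesis
  proof (cases "\<beta> = 0")
    case True
    then show ?thesis using \<nu> by simp
  next
    case False
    have "x \<in> root_space G MG T \<beta>" using \<beta> xd(1) by (simp add: root_space_def)
    then have "root_space G MG T \<beta> \<noteq> {0}" using x(2) by blast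
    then have "\<beta> \<in> roots G MG T" using add scl False unfolding roots_def by (simp add: \<beta>_def)
    then show ?thesis using \<nu> by blast
  qed
qed

lemma nplus_eq: "nplus G MG T P = cv.span posvecs"
  by (simp add: nplus_def)

lemma nplus_dalg: "n \<in> nplus G MG T P \<Longrightarrow> n \<in> dalg G MG"
  unfolding nplus_eq using cv.span_minimal[OF posvecs_dalg subspace_dalg] by blast

lemma aalg_tcalg: "a \<in> aalg G MG T \<Longrightarrow> a \<in> tcalg G MG T"
  by (simp add: aalg_def)

lemma halgE:
  assumes "v \<in> halg G MG T P"
  obtains a n where "a \<in> aalg G MG T" "n \<in> nplus G MG T P" "v = a + n"
  using assms by (auto simp: halg_def)

lemma halgI: "a \<in> aalg G MG T \<Longrightarrow> n \<in> nplus G MG T P \<Longrightarrow> a + n \<in> halg G MG T P"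
  by (auto simp: halg_def)

lemma halg_dalg: "v \<in> halg G MG T P \<Longrightarrow> v \<in> dalg G MG"
  by (elim halgE) (simp add: cv.subspace_add[OF subspace_dalg] tcalg_dalg aalg_tcalg nplus_dalg)

lemma shift_eigenvalue:
  assumes z: "z \<in> tcalg G MG T" and n: "n \<in> nplus G MG T P"
    and x: "x = z \<or> x = z + n" and y: "y = z \<or> y = z + n"
    and w: "w \<in> dalg G MG" "w \<noteq> 0" "dbracket G x w = scaleC \<nu> w"
  shows "\<exists>w'\<in>dalg G MG. w' \<noteq> 0 \<and> dbracket G y w' = scaleC \<nu> w'"
proof -
  obtain k where k: "cla.flag posvecs k \<subseteq> {0}" using posvecs_flag by blast
  show ?thesis
    by (rule cla.eigenvalue_transfer[OF posvecs_dalg k n[unfolded nplus_eq] tcalg_dalg[OF z] tcalg_posvecs[OF z] x y w])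
qed

lemma halg_eigenvalue_real:
  assumes v: "v \<in> halg G MG T P" and w: "w \<in> dalg G MG" "w \<noteq> 0" "dbracket G v w = scaleC \<nu> w"
  shows "\<nu> \<in> \<real>"
proof -
  obtain a n where an: "a \<in> aalg G MG T" "n \<in> nplus G MG T P" "v = a + n" using v by (rule halgE)
  obtain w' where w': "w' \<in> dalg G MG" "w' \<noteq> 0" "dbracket G a w' = scaleC \<nu> w'"
    using shift_eigenvalue[OF aalg_tcalg[OF an(1)] an(2) disjI2[OF an(3)] disjI1[OF refl] w] by blast
  from tcalg_eigenvalue[OF aalg_tcalg[OF an(1)] w'] show ?thesis using an(1) by (auto simp: aalg_def)
qed

text \<open>By \<open>bracket_semisimple\<close>, applied to real and imaginary parts, ad u and its
  square have the same kernel; with no eigenvalue but 0 this makes ad u zero. The real line through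
  \<open>u\<close> is then a commutative ideal, which semisimplicity forces to be
  \<open>{0}\<close>.\<close>

lemma zero_if_eigenvalues_zero:
  assumes u: "u \<in> \<gg>" and eig: "\<And>\<nu> w. w \<in> dalg G MG \<Longrightarrow> w \<noteq> 0 \<Longrightarrow> dbracket G (cplx u) w = scaleC \<nu> w \<Longrightarrow> \<nu> = 0"
  shows "u = 0"
proof -
  have ad: "dbracket G (cplx u) x = 0" if x: "x \<in> dalg G MG" for x
  proof (rule cv.endo_zero_if_semisimple[OF dspan cla.endo_br[OF cplx_dalg[OF u]] eig _ x])
    fix x assume x: "x \<in> dalg G MG" and 0: "dbracket G (cplx u) (dbracket G (cplx u) x) = 0"
    note b = bracket_tangent[OF u dalgD(1)[OF x]] bracket_tangent[OF u dalgD(2)[OF x]]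
    have "lie_bracket G u (lie_bracket G u (re_part x)) = 0" "lie_bracket G u (lie_bracket G u (im_part x)) = 0"
      using arg_cong[OF 0, of re_part] arg_cong[OF 0, of im_part] by (simp_all add: bracket_zero dalgD[OF x] b tangent_zero)
    then have "lie_bracket G u (re_part x) = 0" "lie_bracket G u (im_part x) = 0"
      using bracket_semisimple[OF compact u dalgD(1)[OF x]] bracket_semisimple[OF compact u dalgD(2)[OF x]] by simp_all
    then show "dbracket G (cplx u) x = 0" by (intro ctvec_eqI) (simp_all add: bracket_zero dalgD[OF x])
  qed
  have central: "lie_bracket G u v = 0" if "v \<in> \<gg>" for v
    using arg_cong[OF ad[OF cplx_dalg[OF that]], of re_part] by (simp add: bracket_zero tangent_zero)
  have central': "lie_bracket G v u = 0" if "v \<in> \<gg>" for v using bracket_skew[of v u] central[OF that] by simp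
  define I where "I = range (\<lambda>c f. c * u f)"
  have c: "lie_bracket G v (\<lambda>f. c * u f) = 0" if "v \<in> \<gg>" for v c
    using bracket_scale_right[OF that u, of c] central'[OF that] by (simp add: fun_eq_iff)
  have Ig: "I \<subseteq> \<gg>" using tangent_space_scale[OF u] by (auto simp: I_def)
  have I0: "0 \<in> I" unfolding I_def by (rule image_eqI[of _ _ 0]) (simp_all add: fun_eq_iff)
  have "lie_ideal G MG I"
    unfolding lie_ideal_def
  proof (intro conjI ballI allI)
    show "a + b \<in> I" if ab: "a \<in> I" "b \<in> I" for a b
    proof -
      obtain c d where "a = (\<lambda>f. c * u f)" "b = (\<lambda>f. d * u f)" using ab by (auto simp: I_def)
      then show ?thesis unfolding I_def by (intro image_eqI[of _ _ "c + d"]) (auto simp: fun_eq_iff algebra_simps)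
    qed
    show "(\<lambda>f. c * a f) \<in> I" if a: "a \<in> I" for a c
    proof -
      obtain d where "a = (\<lambda>f. d * u f)" using a by (auto simp: I_def)
      then show ?thesis unfolding I_def by (intro image_eqI[of _ _ "c * d"]) (auto simp: fun_eq_iff)
    qed
    show "lie_bracket G v a \<in> I" if "v \<in> \<gg>" "a \<in> I" for v a using that c I0 by (auto simp: I_def)
  qed (use Ig I0 in simp_all)
  moreover have "\<forall>a\<in>I. \<forall>b\<in>I. lie_bracket G a b = 0" using Ig c by (auto simp: I_def)
  ultimately have "I = {0}" using semisimple by (simp add: semisimple_lie_group_def)
  moreover have "u \<in> I" unfolding I_def by (rule image_eqI[of _ _ 1]) simp_all
  ultimately show ?thesis by simp
qed

text \<open>Eigenvalues are imaginary for real vectors, by compactness, and real on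
  \<open>halg\<close>. This is the uniqueness behind the definite description
  \<open>pr_g\<close>.\<close>

lemma real_halg_zero:
  assumes u: "u \<in> \<gg>" and h: "cplx u \<in> halg G MG T P"
  shows "u = 0"
proof (rule zero_if_eigenvalues_zero[OF u])
  fix \<nu> w assume w: "w \<in> dalg G MG" "w \<noteq> 0" "dbracket G (cplx u) w = scaleC \<nu> w"
  show "\<nu> = 0"
    using dbracket_eigenvalue_imaginary[OF compact u w] halg_eigenvalue_real[OF h w]
    by (auto elim!: Reals_cases)
qed

text \<open>The eigenvalues of \<open>ad\<close> on \<open>v - u = (a - u) + n\<close> are the values of the roots on \<open>a - u\<close>; they are
  real because \<open>Ad\<^sub>g\<close> preserves eigenvalues, while the roots are real on \<open>a\<close> and imaginary on \<open>u\<close>.\<close>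

lemma torus_halg_zero:
  assumes u: "u \<in> \<tt>" and v: "v \<in> halg G MG T P" and g: "g \<in> carrier G"
    and h: "Ad G g (v - cplx u) \<in> halg G MG T P"
  shows "u = 0"
proof (rule zero_if_eigenvalues_zero[OF torus_algebra_subset[OF u]])
  fix \<nu> w assume w: "w \<in> dalg G MG" "w \<noteq> 0" "dbracket G (cplx u) w = scaleC \<nu> w"
  note ut = cplx_tcalg[OF u]
  have im: "Re \<nu> = 0" by (rule dbracket_eigenvalue_imaginary[OF compact torus_algebra_subset[OF u] w])
  from tcalg_eigenvalue[OF ut w] show "\<nu> = 0"
  proof
    assume "\<exists>\<beta>\<in>roots G MG T. \<nu> = \<beta> (cplx u)"
    then obtain \<beta> where b: "\<beta> \<in> roots G MG T" "\<nu> = \<beta> (cplx u)" by blast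
    obtain a n where an: "a \<in> aalg G MG T" "n \<in> nplus G MG T P" "v = a + n" using v by (rule halgE)
    let ?z = "a - cplx u"
    have z: "?z \<in> tcalg G MG T" by (rule cv.subspace_diff[OF subspace_tcalg aalg_tcalg[OF an(1)] ut])
    \<comment> \<open>A root vector of \<open>\<beta>\<close> is an eigenvector for the torus part
      \<open>?z\<close>. Its eigenvalue \<open>\<beta> ?z\<close> passes to \<open>?z + n\<close>,
      and by \<open>Ad G g\<close> to an element of \<open>halg\<close>, where eigenvalues are
      real.\<close>
    obtain x where x: "x \<in> root_space G MG T \<beta>" "x \<noteq> 0" using rootD(5)[OF b(1)] zero_root_space by blast
    note xd = root_spaceD[OF x(1)]
    have eq: "v - cplx u = ?z + n" using an(3) by simp
    obtain x' where x': "x' \<in> dalg G MG" "x' \<noteq> 0" "dbracket G (v - cplx u) x' = scaleC (\<beta> ?z) x'"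
      using shift_eigenvalue[OF z an(2) disjI1[OF refl] disjI2[OF eq] xd(1) x(2) xd(2)[OF z]] by blast
    have vu: "v - cplx u \<in> dalg G MG" by (rule cv.subspace_diff[OF subspace_dalg halg_dalg[OF v] tcalg_dalg[OF ut]])
    have "dbracket G (Ad G g (v - cplx u)) (Ad G g x') = scaleC (\<beta> ?z) (Ad G g x')"
      using dAd_bracket[OF vu x'(1) g] x'(3) by (simp add: Ad_scaleC)
    moreover have "Ad G g x' \<noteq> 0" using dAd_inv[OF x'(1) g] x'(2) by (auto simp: Ad_linear)
    ultimately have "\<beta> ?z \<in> \<real>" using halg_eigenvalue_real[OF h dAd_in[OF x'(1) g]] by blast
    moreover have "\<beta> a \<in> \<real>" using an(1) b(1) by (simp add: aalg_def)
    ultimately have "\<nu> \<in> \<real>"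
      using root_diff[OF b(1) aalg_tcalg[OF an(1)] ut] Reals_diff[of "\<beta> a" "\<beta> ?z"] by (simp add: b(2))
    with im show "\<nu> = 0" by (auto elim!: Reals_cases)
  qed
qed

lemma halg_add: "v \<in> halg G MG T P \<Longrightarrow> w \<in> halg G MG T P \<Longrightarrow> v + w \<in> halg G MG T P"
proof (elim halgE)
  fix a n b m assume h: "a \<in> aalg G MG T" "n \<in> nplus G MG T P" "v = a + n" "b \<in> aalg G MG T" "m \<in> nplus G MG T P" "w = b + m"
  have "a + b \<in> aalg G MG T"
    using h(1,4) cv.subspace_add[OF subspace_tcalg] unfolding aalg_def by (auto simp: rootD(1))
  moreover have "n + m \<in> nplus G MG T P" using h(2,5) unfolding nplus_eq by (rule cv.span_add)
  ultimately have "(a + b) + (n + m) \<in> halg G MG T P" by (rule halgI)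
  then show "v + w \<in> halg G MG T P" by (simp add: h(3,6) algebra_simps)
qed

text \<open>Real scalars only: the reality conditions that cut out \<open>aalg\<close> need not be
  preserved by complex ones.\<close>

lemma halg_scale: "v \<in> halg G MG T P \<Longrightarrow> scaleC (of_real c) v \<in> halg G MG T P"
proof (elim halgE)
  fix a n assume h: "a \<in> aalg G MG T" "n \<in> nplus G MG T P" "v = a + n"
  have "scaleC (of_real c) a \<in> aalg G MG T"
    using h(1) cv.subspace_scale[OF subspace_tcalg] unfolding aalg_def by (auto simp: rootD(2))
  moreover have "scaleC (of_real c) n \<in> nplus G MG T P" using h(2) unfolding nplus_eq by (rule cv.span_scale)
  ultimately show "scaleC (of_real c) v \<in> halg G MG T P" unfolding h(3) cv.scale_right_distrib by (rule halgI)
qed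

lemma halg_diff: "v \<in> halg G MG T P \<Longrightarrow> w \<in> halg G MG T P \<Longrightarrow> v - w \<in> halg G MG T P"
  using halg_add[of v "scaleC (of_real (-1)) w"] halg_scale[of w "-1"] by simp

text \<open>The torus fixes its complexified Lie algebra pointwise; hence \<open>Ad G t\<close>
  commutes with the action of that algebra and preserves every root space.\<close>

lemma Ad_halg:
  assumes t: "t \<in> T" and v: "v \<in> halg G MG T P"
  shows "Ad G t v \<in> halg G MG T P"
proof -
  note t' = T_carrier[OF t]
  obtain a n where an: "a \<in> aalg G MG T" "n \<in> nplus G MG T P" "v = a + n" using v by (rule halgE)
  have rs: "Ad G t x \<in> root_space G MG T \<alpha>" if x: "x \<in> root_space G MG T \<alpha>" for x \<alpha>
  proof -
    note xd = root_spaceD[OF x]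
    have "dbracket G h (Ad G t x) = scaleC (\<alpha> h) (Ad G t x)" if h: "h \<in> tcalg G MG T" for h
      using dAd_bracket[OF tcalg_dalg[OF h] xd(1) t'] xd(2)[OF h] by (simp add: Ad_tcalg[OF h t] Ad_scaleC)
    then show ?thesis using dAd_in[OF xd(1) t'] by (simp add: root_space_def)
  qed
  have "Ad G t n \<in> nplus G MG T P"
    using an(2) unfolding nplus_eq
  proof (induction rule: cv.span_induct_alt)
    case base show ?case by (simp add: Ad_linear cv.span_zero zero_fun_def[symmetric])
  next
    case (step c x y)
    then have "Ad G t x \<in> posvecs" using rs by blast
    then show ?case unfolding Ad_linear Ad_scaleC by (rule cv.span_add[OF cv.span_scale[OF cv.span_base] step(2)])
  qed
  then show ?thesis unfolding an(3) Ad_linear Ad_tcalg[OF aalg_tcalg[OF an(1)] t] by (rule halgI[OF an(1)])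
qed

end

section \<open>Fibres of the projection\<close>

text \<open>With \<open>p\<close> a projection onto \<open>R\<close>, the map \<open>x - p x\<close>
  kills \<open>R\<close> and is injective on \<open>X\<close>, since \<open>X\<close> meets
  \<open>R\<close> trivially. Following it by a linear left inverse \<open>k\<close> gives
  \<open>K\<close>.\<close>

lemma (in vector_space) projection_exists:
  assumes X: "subspace X" and R: "subspace R" and XR: "X \<inter> R \<subseteq> {0}"
  shows "\<exists>K. Vector_Spaces.linear scale scale K \<and> range K \<subseteq> X \<and> (\<forall>x\<in>X. K x = x) \<and> (\<forall>x\<in>R. K x = 0)"
proof -
  interpret vp: vector_space_pair scale scale ..
  obtain p where p: "range p \<subseteq> R" "Vector_Spaces.linear scale scale p" "\<And>v. v \<in> R \<Longrightarrow> p v = v"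
    using vp.linear_exists_left_inverse_on[OF linear_id R] by auto
  have q: "Vector_Spaces.linear scale scale (\<lambda>x. x - p x)" by (rule vp.linear_compose_sub[OF linear_ident p(2)])
  have "inj_on (\<lambda>x. x - p x) X"
  proof (rule inj_onI)
    fix x y assume h: "x \<in> X" "y \<in> X" "x - p x = y - p y"
    then have "x - y = p x - p y" by (simp add: algebra_simps)
    moreover have "p x - p y \<in> R" using p(1) by (intro subspace_diff[OF R]) auto
    ultimately show "x = y" using subspace_diff[OF X h(1,2)] XR by auto
  qed
  then obtain k where k: "range k \<subseteq> X" "Vector_Spaces.linear scale scale k" "\<And>v. v \<in> X \<Longrightarrow> k (v - p v) = v"
    using vp.linear_exists_left_inverse_on[OF q X] by auto
  show ?thesis
  proof (intro exI conjI ballI)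
    show "Vector_Spaces.linear scale scale (\<lambda>x. k (x - p x))" using Vector_Spaces.linear_compose[OF q k(2)] by (simp add: o_def)
    show "range (\<lambda>x. k (x - p x)) \<subseteq> X" using k(1) by blast
    show "k (x - p x) = x" if "x \<in> X" for x by (rule k(3)[OF that])
    show "k (x - p x) = 0" if "x \<in> R" for x using p(3)[OF that] vp.linear_0[OF k(2)] by simp
  qed
qed

lemma vector_space_tvec: "vector_space (\<lambda>c (u :: 'a tvec) f. c * u f)"
  by unfold_locales (auto simp: fun_eq_iff algebra_simps)

lemma cotangentD:
  assumes "\<xi> \<in> cotangent_space M x"
  shows "\<And>u v. u \<in> tangent_space M x \<Longrightarrow> v \<in> tangent_space M x \<Longrightarrow> \<xi> (u + v) = \<xi> u + \<xi> v"
    "\<And>c u. u \<in> tangent_space M x \<Longrightarrow> \<xi> (\<lambda>f. c * u f) = c * \<xi> u" "\<And>u. u \<notin> tangent_space M x \<Longrightarrow> \<xi> u = 0"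
  using assms by (simp_all add: cotangent_space_def)

lemma cotangent_0: "\<xi> \<in> cotangent_space M x \<Longrightarrow> \<xi> 0 = 0"
  using cotangentD(2)[of \<xi> M x 0 0] tangent_zero[of M x] by (simp add: zero_fun_def)

lemma cotangent_add: "\<xi> \<in> cotangent_space M x \<Longrightarrow> \<eta> \<in> cotangent_space M x \<Longrightarrow> \<xi> + \<eta> \<in> cotangent_space M x"
  and cotangent_scale: "\<xi> \<in> cotangent_space M x \<Longrightarrow> (\<lambda>u. c * \<xi> u) \<in> cotangent_space M x"
  and cotangent_zero: "0 \<in> cotangent_space M x"
  unfolding cotangent_space_def by (auto simp: algebra_simps)

lemma cotangent_eqI:
  assumes "\<xi> \<in> cotangent_space M x" "\<eta> \<in> cotangent_space M x" "\<And>u. u \<in> tangent_space M x \<Longrightarrow> \<xi> u = \<eta> u"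
  shows "\<xi> = \<eta>"
proof
  fix u show "\<xi> u = \<eta> u"
    using assms(3) cotangentD(3)[OF assms(1)] cotangentD(3)[OF assms(2)] by (cases "u \<in> tangent_space M x") simp_all
qed

lemma differential_cotangent: "differential M f x \<in> cotangent_space M x"
  unfolding cotangent_space_def differential_def by (auto simp: tangent_space_add tangent_space_scale)

lemma differential_arith:
  assumes f: "f \<in> smooth_funs M" and h: "h \<in> smooth_funs M"
  shows "differential M (\<lambda>y. f y + h y) x = differential M f x + differential M h x"
    "differential M (\<lambda>y. c * f y) x = (\<lambda>u. c * differential M f x u)"
    "differential M (\<lambda>y. f y * h y) x = (\<lambda>u. h x * differential M f x u) + (\<lambda>u. f x * differential M h x u)"
  by (auto simp: differential_def fun_eq_iff tangent_add[OF _ f h] tangent_scale[OF _ f] tangent_mult[OF _ f h])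

lemma cotangent_sum:
  assumes \<xi>: "\<xi> \<in> cotangent_space M x" and e: "\<And>i. i \<in> I \<Longrightarrow> e i \<in> tangent_space M x"
  shows "\<xi> (\<lambda>f. \<Sum>i\<in>I. k i * e i f) = (\<Sum>i\<in>I. k i * \<xi> (e i))"
  using e
proof (induction I rule: infinite_finite_induct)
  case (insert i I)
  have "(\<lambda>f. \<Sum>i\<in>insert i I. k i * e i f) = (\<lambda>f. k i * e i f) + (\<lambda>f. \<Sum>i\<in>I. k i * e i f)"
    using insert(1,2) by (simp add: fun_eq_iff)
  moreover have "(\<lambda>f. k i * e i f) \<in> tangent_space M x" "(\<lambda>f. \<Sum>i\<in>I. k i * e i f) \<in> tangent_space M x"
    using insert(4) by (simp_all add: tangent_space_scale tangent_space_sum)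
  ultimately show ?case
    using insert cotangentD(1)[OF \<xi>] cotangentD(2)[OF \<xi>] by simp
qed (use cotangent_0[OF \<xi>] in \<open>simp_all add: zero_fun_def\<close>)

text \<open>Take the coordinate functions \<open>c b\<close> with the values of the covector on the
  spanning vectors as weights. Bivectors can thus be compared on differentials alone.\<close>

lemma covector_differential:
  fixes M :: "('a, 'e::euclidean_space) mfd"
  assumes M: "smooth_manifold M" and x: "x \<in> points M" and \<xi>: "\<xi> \<in> cotangent_space M x"
  obtains f where "f \<in> smooth_funs M" "\<xi> = differential M f x"
proof -
  obtain c :: "'e \<Rightarrow> 'a \<Rightarrow> real" and e where ce: "\<And>b. c b \<in> smooth_funs M" "\<And>b. e b \<in> tangent_space M x"
    "\<And>v. v \<in> tangent_space M x \<Longrightarrow> v = (\<lambda>f. \<Sum>b\<in>Basis. v (c b) * e b f)"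
    using tangent_finite_basis[OF M x] by blast
  define f where "f y = (\<Sum>b\<in>Basis. \<xi> (e b) * c b y)" for y
  have f: "f \<in> smooth_funs M" unfolding f_def by (intro smooth_funs_sum smooth_funs_scale ce(1) M)
  have "\<xi> = differential M f x"
  proof (rule cotangent_eqI[OF \<xi> differential_cotangent])
    fix u assume u: "u \<in> tangent_space M x"
    have "\<xi> u = \<xi> (\<lambda>f. \<Sum>b\<in>Basis. u (c b) * e b f)" using ce(3)[OF u] by simp
    also have "\<dots> = (\<Sum>b\<in>Basis. u (c b) * \<xi> (e b))" by (rule cotangent_sum[OF \<xi> ce(2)])
    also have "\<dots> = u f"
      unfolding f_def tangent_sum[OF u smooth_funs_scale[OF ce(1)]] tangent_scale[OF u ce(1)] by (simp only: mult.commute)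
    finally show "\<xi> u = differential M f x u" using u by (simp add: differential_def)
  qed
  with f show thesis by (rule that)
qed

lemma tangent_eq_zeroI:
  assumes u: "u \<in> tangent_space M x" and 0: "\<And>\<eta>. \<eta> \<in> cotangent_space M x \<Longrightarrow> \<eta> u = 0"
  shows "u = 0"
proof (rule tangent_eqI[OF u tangent_zero])
  fix f show "u f = 0 f" using 0[OF differential_cotangent, of f] u by (simp add: differential_def)
qed

lemma bivectorD:
  assumes "bivector_field M \<pi>" "x \<in> points M"
  shows "\<And>\<xi> \<eta>. \<xi> \<in> cotangent_space M x \<Longrightarrow> \<eta> \<in> cotangent_space M x \<Longrightarrow> \<pi> x \<xi> \<eta> = - \<pi> x \<eta> \<xi>"
    "\<And>\<xi> \<xi>' \<eta>. \<xi> \<in> cotangent_space M x \<Longrightarrow> \<xi>' \<in> cotangent_space M x \<Longrightarrow> \<eta> \<in> cotangent_space M x \<Longrightarrow> \<pi> x (\<xi> + \<xi>') \<eta> = \<pi> x \<xi> \<eta> + \<pi> x \<xi>' \<eta>"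
    "\<And>c \<xi> \<eta>. \<xi> \<in> cotangent_space M x \<Longrightarrow> \<eta> \<in> cotangent_space M x \<Longrightarrow> \<pi> x (\<lambda>u. c * \<xi> u) \<eta> = c * \<pi> x \<xi> \<eta>"
  using assms unfolding bivector_field_def by blast+

lemma bivector_right:
  assumes b: "bivector_field M \<pi>" "x \<in> points M" and \<xi>: "\<xi> \<in> cotangent_space M x" and \<eta>: "\<eta> \<in> cotangent_space M x"
  shows "\<eta>' \<in> cotangent_space M x \<Longrightarrow> \<pi> x \<xi> (\<eta> + \<eta>') = \<pi> x \<xi> \<eta> + \<pi> x \<xi> \<eta>'"
    "\<pi> x \<xi> (\<lambda>u. c * \<eta> u) = c * \<pi> x \<xi> \<eta>"
  using bivectorD(1)[OF b \<xi> cotangent_add[OF \<eta>]] bivectorD(1)[OF b \<xi> \<eta>] bivectorD(1)[OF b \<xi>] bivectorD(2)[OF b \<eta> _ \<xi>]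
    bivectorD(1)[OF b \<xi> cotangent_scale[OF \<eta>]] bivectorD(3)[OF b \<eta> \<xi>]
  by simp_all

text \<open>The vector is the derivation that pairs \<open>\<xi>\<close> with the differential of a
  function through \<open>\<pi>\<close>; it satisfies the product rule because differentials
  do.\<close>

lemma Gr_exists:
  assumes b: "bivector_field M \<pi>" and x: "x \<in> points M" and M: "smooth_manifold M" and \<xi>: "\<xi> \<in> cotangent_space M x"
  obtains u where "(u, \<xi>) \<in> Gr M \<pi> x"
proof -
  define u where "u h = (if h \<in> smooth_funs M then \<pi> x \<xi> (differential M h x) else 0)" for h
  note br = bivector_right[OF b x \<xi>]
  have u: "u \<in> tangent_space M x"
    unfolding tangent_space_def mem_Collect_eq
    by (auto simp: u_def smooth_funs_add smooth_funs_scale smooth_funs_mult differential_arith br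
        differential_cotangent cotangent_scale)
  have "\<eta> u = \<pi> x \<xi> \<eta>" if \<eta>: "\<eta> \<in> cotangent_space M x" for \<eta>
  proof -
    obtain f where f: "f \<in> smooth_funs M" "\<eta> = differential M f x" by (rule covector_differential[OF M x \<eta>])
    then show ?thesis using u by (simp add: differential_def[of M f x] u_def)
  qed
  with u \<xi> show thesis by (intro that[of u]) (simp add: Gr_def)
qed

lemma GrD:
  assumes "(u, \<xi>) \<in> Gr M \<pi> x"
  shows "u \<in> tangent_space M x" "\<xi> \<in> cotangent_space M x" "\<And>\<eta>. \<eta> \<in> cotangent_space M x \<Longrightarrow> \<eta> u = \<pi> x \<xi> \<eta>"
  using assms by (simp_all add: Gr_def)

lemma cotangent_diff_vec:
  assumes \<eta>: "\<eta> \<in> cotangent_space M x" and u: "u \<in> tangent_space M x" and v: "v \<in> tangent_space M x"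
  shows "\<eta> (u - v) = \<eta> u - \<eta> v"
  using cotangentD(1)[OF \<eta> tangent_space_diff[OF u v] v] by simp

lemma Gr_unique:
  assumes "(u, \<xi>) \<in> Gr M \<pi> x" "(v, \<xi>) \<in> Gr M \<pi> x"
  shows "u = v"
proof -
  note u = GrD[OF assms(1)] and v = GrD[OF assms(2)]
  have "u - v = 0"
    by (rule tangent_eq_zeroI[OF tangent_space_diff[OF u(1) v(1)]]) (simp add: cotangent_diff_vec u v)
  then show ?thesis by simp
qed

lemma Gr_add:
  assumes b: "bivector_field M \<pi>" "x \<in> points M" and "(u, \<xi>) \<in> Gr M \<pi> x" "(v, \<eta>) \<in> Gr M \<pi> x"
  shows "(u + v, \<xi> + \<eta>) \<in> Gr M \<pi> x"
  using GrD[OF assms(3)] GrD[OF assms(4)] unfolding Gr_def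
  by (auto simp: tangent_space_add cotangent_add cotangentD(1) bivectorD(2)[OF b])

lemma Gr_scale:
  assumes b: "bivector_field M \<pi>" "x \<in> points M" and "(u, \<xi>) \<in> Gr M \<pi> x"
  shows "((\<lambda>f. c * u f), (\<lambda>w. c * \<xi> w)) \<in> Gr M \<pi> x"
  using GrD[OF assms(3)] unfolding Gr_def
  by (auto simp: tangent_space_scale cotangent_scale cotangentD(2) bivectorD(3)[OF b])

text \<open>By skew-symmetry the kernel of \<open>\<pi>\<^sup>\<sharp>\<close> is the annihilator of its image, so covectors on a
  complement of the image extend to kernel elements.\<close>

lemma restrict_covec_kernel:
  fixes M :: "('a, 'e::euclidean_space) mfd"
  assumes M: "smooth_manifold M" and b: "bivector_field M \<pi>" and X: "submanifold M X" and x: "x \<in> X"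
    and trans: "\<forall>u\<in>tangent_space (sub_mfd M X) x. \<forall>\<xi>. (push M id u, \<xi>) \<in> Gr M \<pi> x \<longrightarrow> push M id u = 0"
    and \<eta>: "\<eta> \<in> cotangent_space (sub_mfd M X) x"
  obtains \<xi> where "(0, \<xi>) \<in> Gr M \<pi> x" "restrict_covec M X x \<xi> = \<eta>"
proof -
  interpret rv: vector_space "\<lambda>c (u :: 'a tvec) f. c * u f" by (rule vector_space_tvec)
  let ?N = "sub_mfd M X"
  have xM: "x \<in> points M" and N: "smooth_manifold ?N" using X x by (auto simp: submanifold_def)
  note b' = b xM
  define W where "W = push M id ` tangent_space ?N x"
  define R where "R = {u. \<exists>\<xi>. (u, \<xi>) \<in> Gr M \<pi> x}"
  have WT: "W \<subseteq> tangent_space M x"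
    unfolding W_def using push_tangent[OF N M smooth_map_inclusion[OF M], of _ x] by auto
  have Ws: "rv.subspace W"
    unfolding rv.subspace_def W_def
  proof (intro conjI ballI allI)
    show "0 \<in> push M id ` tangent_space ?N x" by (rule image_eqI[of _ _ 0]) (simp_all add: push_zero tangent_zero)
  qed (auto simp: push_add[symmetric] push_scale[symmetric] intro!: imageI tangent_space_add tangent_space_scale)
  have "(0, 0) \<in> Gr M \<pi> x"
    using bivectorD(3)[OF b' cotangent_zero, of _ 0] unfolding Gr_def
    by (auto simp: tangent_zero cotangent_zero cotangent_0 zero_fun_def[symmetric])
  then have Rs: "rv.subspace R"
    unfolding rv.subspace_def R_def mem_Collect_eq
    by (intro conjI ballI allI) (use Gr_add[OF b'] Gr_scale[OF b'] in fast)+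
  have "W \<inter> R \<subseteq> {0}" using trans by (auto simp: W_def R_def)
  \<comment> \<open>\<open>K\<close> projects onto the tangent space \<open>W\<close> of the
    submanifold and kills the image \<open>R\<close> of the bivector; it exists because these meet
    trivially.\<close>
  then obtain K where
    K: "Vector_Spaces.linear (\<lambda>c (u :: 'a tvec) f. c * u f) (\<lambda>c (u :: 'a tvec) f. c * u f) K"
    "range K \<subseteq> W" "\<forall>u\<in>W. K u = u" "\<forall>u\<in>R. K u = 0"
    using rv.projection_exists[OF Ws Rs] by auto
  have KW: "K u \<in> W" for u using K(2) by auto
  interpret K: Vector_Spaces.linear "\<lambda>c (u :: 'a tvec) f. c * u f" "\<lambda>c (u :: 'a tvec) f. c * u f" K by (rule K(1))
  define J where "J w = (SOME u. u \<in> tangent_space ?N x \<and> push M id u = w)" for w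
  have J: "J w \<in> tangent_space ?N x" "push M id (J w) = w" if "w \<in> W" for w
  proof -
    have "\<exists>u. u \<in> tangent_space ?N x \<and> push M id u = w" using that by (auto simp: W_def)
    from someI_ex[OF this] show "J w \<in> tangent_space ?N x" "push M id (J w) = w" by (simp_all add: J_def)
  qed
  have inj: "u = v" if h: "u \<in> tangent_space ?N x" "v \<in> tangent_space ?N x" "push M id u = push M id v" for u v
    using push_inclusion_injective[OF M X x tangent_space_diff[OF h(1,2)]] h(3) by (simp add: push_diff)
  have Jadd: "J (v + w) = J v + J w" if "v \<in> W" "w \<in> W" for v w
    by (rule inj) (simp_all add: J that rv.subspace_add[OF Ws] push_add tangent_space_add)
  have Jscale: "J (\<lambda>f. c * w f) = (\<lambda>f. c * J w f)" if "w \<in> W" for c w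
    by (rule inj) (simp_all add: J that rv.subspace_scale[OF Ws] push_scale tangent_space_scale)
  have J0: "J 0 = 0" by (rule inj) (simp_all add: J rv.subspace_0[OF Ws] push_zero tangent_zero)
  \<comment> \<open>The extension of \<open>\<eta>\<close> along the projection; \<open>J\<close>
    inverts the tangent map of the inclusion on \<open>W\<close>. It annihilates \<open>R\<close> by
    the choice of \<open>K\<close>, and skew-symmetry turns this into membership in the
    kernel.\<close>
  define \<xi> where "\<xi> u = (if u \<in> tangent_space M x then \<eta> (J (K u)) else 0)" for u
  have \<xi>: "\<xi> \<in> cotangent_space M x"
    unfolding cotangent_space_def mem_Collect_eq
    by (simp add: \<xi>_def tangent_space_add tangent_space_scale K.add K.scale Jadd Jscale KW J cotangentD(1,2)[OF \<eta>])
  have ker: "\<pi> x \<xi> \<eta>' = 0" if e: "\<eta>' \<in> cotangent_space M x" for \<eta>'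
  proof -
    obtain v where v: "(v, \<eta>') \<in> Gr M \<pi> x" using Gr_exists[OF b xM M e] by metis
    then have "v \<in> R" by (auto simp: R_def)
    then have "\<xi> v = 0" using K(4) by (simp add: \<xi>_def J0 cotangent_0[OF \<eta>])
    then have "\<pi> x \<eta>' \<xi> = 0" using GrD(3)[OF v \<xi>] by simp
    then show ?thesis using bivectorD(1)[OF b' \<xi> e] by simp
  qed
  show thesis
  proof (rule that)
    show "(0, \<xi>) \<in> Gr M \<pi> x" unfolding Gr_def using \<xi> ker by (simp add: tangent_zero cotangent_0)
    show "restrict_covec M X x \<xi> = \<eta>"
    proof
      fix u show "restrict_covec M X x \<xi> u = \<eta> u"
      proof (cases "u \<in> tangent_space ?N x")
        case True
        then have w: "push M id u \<in> W" by (simp add: W_def)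
        then have "J (K (push M id u)) = u" using bspec[OF K(3) w] J[OF w] True by - (rule inj, simp_all)
        then show ?thesis using True w WT by (auto simp: restrict_covec_def \<xi>_def)
      qed (simp add: restrict_covec_def cotangentD(3)[OF \<eta>])
    qed
  qed
qed

lemma Gr_zero_bivector:
  assumes "x \<in> points M"
  shows "Gr M zero_bivector x = {0} \<times> cotangent_space M x"
  by (auto simp: Gr_def zero_bivector_def tangent_zero cotangent_0 intro: tangent_eq_zeroI)

lemma bivector_field_zero: "smooth_manifold M \<Longrightarrow> bivector_field M zero_bivector"
  unfolding bivector_field_def zero_bivector_def by (simp add: smooth_funs_const)

lemma restrict_covec_cotangent:
  assumes M: "smooth_manifold M" and X: "submanifold M X" and \<xi>: "\<xi> \<in> cotangent_space M x"
  shows "restrict_covec M X x \<xi> \<in> cotangent_space (sub_mfd M X) x"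
proof -
  have "push M id u \<in> tangent_space M x" if "u \<in> tangent_space (sub_mfd M X) x" for u
    using push_tangent[OF _ M smooth_map_inclusion[OF M] that] X by (simp add: submanifold_def)
  then show ?thesis
    unfolding cotangent_space_def mem_Collect_eq restrict_covec_def
    by (simp add: tangent_space_add tangent_space_scale push_add push_scale cotangentD(1,2)[OF \<xi>])
qed

text \<open>Transversality leaves only the vector 0 in the pulled-back graph, and
  \<open>restrict_covec_kernel\<close> makes every covector occur. The equivalence for arbitrary
  \<open>\<sigma>\<close> gives existence and uniqueness together, and with them the value of the
  description \<open>induced_poisson\<close>.\<close>

lemma induces_zero_bivector:
  assumes M: "smooth_manifold M" and b: "bivector_field M \<pi>" and X: "submanifold M X"
    and trans: "\<forall>x\<in>X. \<forall>u\<in>tangent_space (sub_mfd M X) x. \<forall>\<xi>. (push M id u, \<xi>) \<in> Gr M \<pi> x \<longrightarrow> push M id u = 0"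
  shows "induces_bivector M \<pi> X \<sigma> \<longleftrightarrow> \<sigma> = zero_bivector"
proof -
  let ?N = "sub_mfd M X"
  have XM: "X \<subseteq> points M" and N: "smooth_manifold ?N" using X by (simp_all add: submanifold_def)
  have pN: "points ?N = X" by (rule points_sub_mfd[OF XM])
  let ?D = "\<lambda>x. {(u, restrict_covec M X x \<xi>) |u \<xi>. u \<in> tangent_space ?N x \<and> (push M id u, \<xi>) \<in> Gr M \<pi> x}"
  have D: "?D x = {0} \<times> cotangent_space ?N x" if x: "x \<in> X" for x
  proof (intro equalityI subsetI)
    fix z assume "z \<in> ?D x"
    then obtain u \<xi> where z: "z = (u, restrict_covec M X x \<xi>)" "u \<in> tangent_space ?N x" "(push M id u, \<xi>) \<in> Gr M \<pi> x" by blast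
    have "u = 0" using push_inclusion_injective[OF M X x z(2)] trans x z(2,3) by blast
    then show "z \<in> {0} \<times> cotangent_space ?N x" using restrict_covec_cotangent[OF M X GrD(2)[OF z(3)]] z(1) by simp
  next
    fix z :: "'a tvec \<times> 'a covec" assume "z \<in> {0} \<times> cotangent_space ?N x"
    then obtain \<eta> where z: "z = (0, \<eta>)" "\<eta> \<in> cotangent_space ?N x" by auto
    obtain \<xi> where \<xi>: "(0, \<xi>) \<in> Gr M \<pi> x" "restrict_covec M X x \<xi> = \<eta>"
      by (rule restrict_covec_kernel[OF M b X x bspec[OF trans x] z(2)])
    show "z \<in> ?D x"
      unfolding mem_Collect_eq
      by (rule exI[of _ 0], rule exI[of _ \<xi>]) (simp add: z(1) \<xi> tangent_zero push_zero)
  qed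
  show ?thesis
  proof
    assume "\<sigma> = zero_bivector"
    then show "induces_bivector M \<pi> X \<sigma>"
      unfolding induces_bivector_def using D by (simp add: bivector_field_zero[OF N] Gr_zero_bivector pN)
  next
    assume ind: "induces_bivector M \<pi> X \<sigma>"
    then have bs: "bivector_field ?N \<sigma>" by (simp add: induces_bivector_def)
    have G: "Gr ?N \<sigma> x = {0} \<times> cotangent_space ?N x" if "x \<in> X" for x
      using ind D[OF that] that by (simp add: induces_bivector_def)
    have "\<sigma> x \<xi> \<eta> = 0" for x \<xi> \<eta>
    proof (cases "x \<in> X \<and> \<xi> \<in> cotangent_space ?N x \<and> \<eta> \<in> cotangent_space ?N x")
      case True
      then have "(0, \<xi>) \<in> Gr ?N \<sigma> x" using G by simp
      from GrD(3)[OF this, of \<eta>] show ?thesis using True cotangent_0[of \<eta> ?N x] by simp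
    next
      case False
      then show ?thesis using bs unfolding bivector_field_def pN by blast
    qed
    then show "\<sigma> = zero_bivector" by (simp add: zero_bivector_def fun_eq_iff)
  qed
qed

section \<open>The graph of the standard bivector along a coset\<close>

locale standard_setup = flag_setup G MG T P
  for G :: "'g monoid" (structure) and MG :: "('g, 'e::euclidean_space) mfd" and T P +
  fixes \<pi> :: "'g bivector"
  assumes standard: "standard_poisson G MG T P \<pi>"
begin

lemma pi: "poisson_structure MG \<pi>" "bivector_field MG \<pi>"
  using standard by (simp_all add: standard_poisson_def poisson_structure_def)

lemma pi_Gr: "g \<in> carrier G \<Longrightarrow> Gr MG \<pi> g = {(rho G MG T P v g, theta_covec G MG v g) |v. v \<in> halg G MG T P}"
  using standard by (simp add: standard_poisson_def)

lemma rho_Gr: "g \<in> carrier G \<Longrightarrow> v \<in> halg G MG T P \<Longrightarrow> (rho G MG T P v g, theta_covec G MG v g) \<in> Gr MG \<pi> g"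
  using pi_Gr by blast

lemma maurer_cartan_in: "g \<in> carrier G \<Longrightarrow> u \<in> tangent_space MG g \<Longrightarrow> maurer_cartan G MG g u \<in> \<gg>"
  unfolding maurer_cartan_def using push_tangent[OF M M smooth_map_left[of "inv g"], of u g] by simp

lemma theta_covec_linear:
  assumes g: "g \<in> carrier G" and v: "v \<in> halg G MG T P"
  shows "v' \<in> halg G MG T P \<Longrightarrow> theta_covec G MG (v + v') g = theta_covec G MG v g + theta_covec G MG v' g"
    "theta_covec G MG (scaleC (of_real c) v) g = (\<lambda>u. c * theta_covec G MG v g u)"
  by (auto simp: theta_covec_def pairing_def fun_eq_iff killing_form_add killing_form_scale halg_dalg v
      cplx_dalg maurer_cartan_in[OF g])

text \<open>Linearity is read off from the graph instead of the definite description
  \<open>pr_g\<close>: \<open>theta_covec\<close> is linear in \<open>v\<close>, the graph of a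
  bivector is a linear subspace, and in it the covector determines the vector.\<close>

lemma rho_linear:
  assumes g: "g \<in> carrier G" and v: "v \<in> halg G MG T P"
  shows "v' \<in> halg G MG T P \<Longrightarrow> rho G MG T P (v + v') g = rho G MG T P v g + rho G MG T P v' g"
    "rho G MG T P (scaleC (of_real c) v) g = (\<lambda>f. c * rho G MG T P v g f)"
proof -
  note gp = g[folded points_carrier]
  show "rho G MG T P (v + v') g = rho G MG T P v g + rho G MG T P v' g" if v': "v' \<in> halg G MG T P"
    using Gr_add[OF pi(2) gp rho_Gr[OF g v] rho_Gr[OF g v']] rho_Gr[OF g halg_add[OF v v']]
    unfolding theta_covec_linear(1)[OF g v v'] by (rule Gr_unique[rotated])
  show "rho G MG T P (scaleC (of_real c) v) g = (\<lambda>f. c * rho G MG T P v g f)"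
    using Gr_scale[OF pi(2) gp rho_Gr[OF g v], of c] rho_Gr[OF g halg_scale[OF v]]
    unfolding theta_covec_linear(2)[OF g v] by (rule Gr_unique[rotated])
qed

lemma pr_g_eq:
  assumes u: "u \<in> \<gg>" and h: "x - cplx u \<in> halg G MG T P"
  shows "pr_g G MG T P x = u"
  unfolding pr_g_def
proof (rule the_equality)
  show "u \<in> \<gg> \<and> x - cplx u \<in> halg G MG T P" using u h by simp
  fix u' assume u': "u' \<in> \<gg> \<and> x - cplx u' \<in> halg G MG T P"
  have "cplx (u - u') = (x - cplx u') - (x - cplx u)" by (simp add: cplx_simps)
  also have "\<dots> \<in> halg G MG T P" using u' h by (blast intro: halg_diff)
  finally have "u - u' = 0" using real_halg_zero[OF tangent_space_diff[OF u]] u' by blast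
  then show "u' = u" by simp
qed

text \<open>If some \<open>Ad\<^sub>g v\<close> had no component in the Lie algebra, then \<open>pr_g\<close> would be constant on all
  such elements, and linearity of the graph would force \<open>rho\<close> to vanish at \<open>g\<close>. Hence the
  decomposition of the complexified Lie algebra is not needed.\<close>

lemma rho_cases:
  assumes g: "g \<in> carrier G" and v: "v \<in> halg G MG T P"
  shows "rho G MG T P v g = 0 \<or>
    (\<exists>u\<in>\<gg>. Ad G g (v - cplx u) \<in> halg G MG T P \<and> rho G MG T P v g = push MG (\<lambda>x. g \<otimes> x) u)"
proof (cases "\<forall>v\<in>halg G MG T P. \<exists>u\<in>\<gg>. Ad G g v - cplx u \<in> halg G MG T P")
  case True
  then obtain u where u: "u \<in> \<gg>" "Ad G g v - cplx u \<in> halg G MG T P" using v by blast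
  let ?u = "Ad G (inv g) u"
  have "?u \<in> \<gg>" using Ad_tangent[OF u(1)] g by simp
  moreover have "Ad G g (v - cplx ?u) = Ad G g v - cplx u"
    using dAd_inv'[OF cplx_dalg[OF u(1)] g] by (simp add: Ad_linear Ad_cplx)
  moreover have "rho G MG T P v g = push MG (\<lambda>x. g \<otimes> x) ?u" by (simp add: rho_def pr_g_eq[OF u])
  ultimately show ?thesis using u(2) by (intro disjI2 bexI[of _ ?u]) simp_all
next
  case False
  define D where "D = {v. \<exists>u\<in>\<gg>. Ad G g v - cplx u \<in> halg G MG T P}"
  \<comment> \<open>The value of \<open>rho\<close> wherever the description in \<open>pr_g\<close>
    has no solution: \<open>THE\<close> then denotes one fixed element, the same for all such
    \<open>v\<close>.\<close>
  define Z where "Z = push MG (\<lambda>x. g \<otimes> x) (Ad G (inv g) (THE u::'g tvec. False))"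
  have Z: "rho G MG T P v g = Z" if "v \<notin> D" for v
  proof -
    have "(\<lambda>u. u \<in> \<gg> \<and> Ad G g v - cplx u \<in> halg G MG T P) = (\<lambda>u. False)" using that by (auto simp: D_def)
    then show ?thesis by (simp add: rho_def pr_g_def Z_def)
  qed
  obtain v0 where v0: "v0 \<in> halg G MG T P" "v0 \<notin> D" using False by (auto simp: D_def)
  have half: "v \<in> D" if dv: "scaleC (of_real 2) v \<in> D" for v
  proof -
    obtain u where u: "u \<in> \<gg>" "Ad G g (scaleC (of_real 2) v) - cplx u \<in> halg G MG T P" using dv unfolding D_def by blast
    have "scaleC (of_real (1/2)) (Ad G g (scaleC (of_real 2) v) - cplx u) = Ad G g v - cplx (\<lambda>f. 1/2 * u f)"
      by (simp add: Ad_def scaleC_def cplx_def fun_eq_iff)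
    then have "Ad G g v - cplx (\<lambda>f. 1/2 * u f) \<in> halg G MG T P" using halg_scale[OF u(2), of "1/2"] by simp
    with tangent_space_scale[OF u(1), of "1/2"] show ?thesis unfolding D_def by blast
  qed
  \<comment> \<open>\<open>v0\<close> and its double both lie outside \<open>D\<close>, so
    \<open>rho\<close> has the value \<open>Z\<close> on each, while by linearity the second value
    is twice the first.\<close>
  have "scaleC (of_real 2) v0 \<notin> D" using half v0(2) by blast
  then have "Z = (\<lambda>f. 2 * Z f)" using rho_linear(2)[OF g v0(1), of 2] Z[OF v0(2)] Z by metis
  then have Z0: "Z = 0" by (auto simp: fun_eq_iff)
  show ?thesis
  proof (cases "v \<in> D")
    case False
    then show ?thesis using Z Z0 by simp
  next
    case True
    \<comment> \<open>So \<open>rho\<close> takes the value \<open>Z\<close> on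
      \<open>v0 + v\<close> and on \<open>v0\<close>, and additivity leaves 0 for
      \<open>v\<close>.\<close>
    have "v0 + v \<notin> D"
    proof
      assume "v0 + v \<in> D"
      then obtain u where u: "u \<in> \<gg>" "Ad G g (v0 + v) - cplx u \<in> halg G MG T P" by (auto simp: D_def)
      obtain u' where u': "u' \<in> \<gg>" "Ad G g v - cplx u' \<in> halg G MG T P" using True by (auto simp: D_def)
      have "Ad G g v0 - cplx (u - u') = (Ad G g (v0 + v) - cplx u) - (Ad G g v - cplx u')"
        by (simp add: Ad_linear cplx_simps)
      also have "\<dots> \<in> halg G MG T P" by (rule halg_diff[OF u(2) u'(2)])
      finally have "v0 \<in> D" using tangent_space_diff[OF u(1) u'(1)] by (auto simp: D_def)
      with v0(2) show False by simp
    qed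
    then have "Z = Z + rho G MG T P v g" using rho_linear(1)[OF g v0(1) v] Z[OF v0(2)] Z by metis
    then show ?thesis by simp
  qed
qed

lemma left_push_cancel:
  assumes g: "g \<in> carrier G" and u: "u \<in> tangent_space MG x" and x: "x \<in> carrier G"
  shows "push MG (\<lambda>x. inv g \<otimes> x) (push MG (\<lambda>x. g \<otimes> x) u) = u"
proof -
  have "push MG (\<lambda>x. inv g \<otimes> x) (push MG (\<lambda>x. g \<otimes> x) u) = push MG (\<lambda>x. inv g \<otimes> (g \<otimes> x)) u"
    using push_compose[OF M M smooth_map_left[of "inv g"], of "\<lambda>x. g \<otimes> x" u] g by (simp add: o_def)
  also have "\<dots> = push MG (\<lambda>x. x) u"
    by (rule push_cong[symmetric, OF M M u]) (simp_all add: points_carrier x smooth_map_id[OF M] inv_mult_cancel g)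
  finally show ?thesis by (simp add: push_ident[OF M u])
qed

lemma fibre_transversal:
  assumes g: "g \<in> carrier G" and w: "push MG (\<lambda>x. inv g \<otimes> x) w \<in> \<tt>" and gr: "(w, \<xi>) \<in> Gr MG \<pi> g"
  shows "w = 0"
proof -
  obtain v where v: "v \<in> halg G MG T P" "w = rho G MG T P v g" using gr pi_Gr[OF g] by auto
  from rho_cases[OF g v(1)] show ?thesis
  proof
    assume "\<exists>u\<in>\<gg>. Ad G g (v - cplx u) \<in> halg G MG T P \<and> rho G MG T P v g = push MG (\<lambda>x. g \<otimes> x) u"
    then obtain u where u: "u \<in> \<gg>" "Ad G g (v - cplx u) \<in> halg G MG T P" "w = push MG (\<lambda>x. g \<otimes> x) u" using v(2) by auto
    have "u \<in> \<tt>" using w left_push_cancel[OF g u(1)] u(3) by simp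
    from torus_halg_zero[OF this v(1) g u(2)] show ?thesis by (simp add: u(3) push_zero)
  qed (simp add: v(2))
qed

lemma coset_submanifold:
  assumes g: "g \<in> carrier G"
  shows "submanifold MG (g <# T)"
proof -
  have eq: "(\<lambda>x. g \<otimes> x) ` T = g <# T" by (auto simp: l_coset_def)
  have "smooth_manifold (sub_mfd MG ((\<lambda>x. g \<otimes> x) ` T))"
    by (rule smooth_manifold_sub_mfd_diffeo[OF M smooth_map_left[OF g] smooth_map_left[of "inv g"] _ _ T_sub(2,1)])
       (simp_all add: g points_carrier inv_mult_cancel mult_inv_cancel)
  then show ?thesis unfolding submanifold_def eq using l_coset_subset_G[OF _ g, of T] T_sub(2) by (simp add: points_carrier)
qed

text \<open>Left translation by \<open>inv x\<close> carries the coset to the torus and the tangent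
  vector into \<open>torus_algebra\<close>, where \<open>fibre_transversal\<close> applies.\<close>

lemma coset_transversal:
  assumes g: "g \<in> carrier G" and x: "x \<in> g <# T" and u: "u \<in> tangent_space (sub_mfd MG (g <# T)) x"
    and gr: "(push MG id u, \<xi>) \<in> Gr MG \<pi> x"
  shows "push MG id u = 0"
proof -
  have X: "g <# T = x <# T" by (rule l_repr_independence[OF x g T(1)])
  note S = coset_submanifold[OF g, unfolded submanifold_def]
  have xc: "x \<in> carrier G" using S x points_carrier by blast
  let ?L = "\<lambda>y. inv x \<otimes> y"
  have "?L ` (g <# T) \<subseteq> T" unfolding X unfolding l_coset_def using T_carrier by (auto simp: inv_mult_cancel xc)
  then have L: "smooth_map (sub_mfd MG (g <# T)) (sub_mfd MG T) ?L"
    using smooth_map_sub_mfd[OF M smooth_map_left[of "inv x"], of "g <# T" T] S xc by simp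
  have "push (sub_mfd MG T) ?L u \<in> tangent_space (sub_mfd MG T) \<one>"
    using push_tangent[OF _ T_sub(1) L u] S xc by simp
  then have "push MG id (push (sub_mfd MG T) ?L u) \<in> \<tt>" by (simp add: torus_algebra_def)
  moreover have "push MG id (push (sub_mfd MG T) ?L u) = push MG ?L (push MG id u)"
    using push_compose[OF T_sub(1) M sub_id, of ?L u] push_compose[OF M M smooth_map_left[of "inv x"], of id u] xc
    by (simp add: o_def)
  ultimately show ?thesis using fibre_transversal[OF xc _ gr] by simp
qed

lemma coset_induces:
  assumes g: "g \<in> carrier G"
  shows "induces_bivector MG \<pi> (g <# T) \<sigma> \<longleftrightarrow> \<sigma> = zero_bivector"
proof (rule induces_zero_bivector[OF M pi(2) coset_submanifold[OF g]])
  show "\<forall>x\<in>g <# T. \<forall>u\<in>tangent_space (sub_mfd MG (g <# T)) x. \<forall>\<xi>. (push MG id u, \<xi>) \<in> Gr MG \<pi> x \<longrightarrow> push MG id u = 0"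
    by (intro ballI allI impI) (rule coset_transversal[OF g])
qed

end

section \<open>The flag manifold\<close>

lemma psmooth_compose:
  fixes h :: "'f::euclidean_space \<Rightarrow> 'h::euclidean_space"
  assumes \<iota>: "psmooth S M \<iota>" and R: "open R" and h: "smooth_on R h" "h ` R \<subseteq> S"
  shows "psmooth R M (\<lambda>x. \<iota> (h x))"
  unfolding psmooth_def
proof (intro conjI ballI)
  have "continuous_map (top_of_set R) (top_of_set S) h"
    using smooth_on_imp_continuous_on[OF h(1)] h(2) by (auto simp: continuous_map_in_subtopology)
  from continuous_map_compose[OF this, of "mtop M" \<iota>] show "continuous_map (top_of_set R) (mtop M) (\<lambda>x. \<iota> (h x))"
    using \<iota> by (simp add: psmooth_def o_def)
  fix c assume c: "c \<in> atlas M"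
  obtain V \<psi> where c': "c = (V, \<psi>)" by fastforce
  have s: "smooth_on (S \<inter> \<iota> -` V) (\<psi> \<circ> \<iota>)" using \<iota> c c' by (auto simp: psmooth_def)
  have "smooth_on (R \<inter> (\<lambda>x. \<iota> (h x)) -` V) (\<lambda>x. (\<psi> \<circ> \<iota>) (h x))"
    by (rule smooth_on_compose[OF smooth_on_subset[OF h(1)] s]) (use h(2) in auto)
  then show "case c of (V, \<psi>) \<Rightarrow> smooth_on (R \<inter> (\<lambda>x. \<iota> (h x)) -` V) (\<psi> \<circ> (\<lambda>x. \<iota> (h x)))"
    by (simp add: c' o_def)
qed (rule R)

lemma psmooth_map:
  assumes M: "smooth_manifold M" and \<iota>: "psmooth S M \<iota>" and F: "smooth_map M N F"
  shows "psmooth S N (\<lambda>x. F (\<iota> x))"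
  unfolding psmooth_def
proof (intro conjI ballI)
  show "open S" using \<iota> by (simp add: psmooth_def)
  show "continuous_map (top_of_set S) (mtop N) (\<lambda>x. F (\<iota> x))"
    using continuous_map_compose[of "top_of_set S" "mtop M" \<iota> "mtop N" F] \<iota> F by (simp add: psmooth_def smooth_map_def o_def)
  fix c assume c: "c \<in> atlas N"
  obtain V \<psi> where c': "c = (V, \<psi>)" by fastforce
  have "smooth_on (S \<inter> \<iota> -` (F -` V)) ((\<psi> \<circ> F) \<circ> \<iota>)"
    by (rule psmooth_vsmooth[OF M \<iota> smooth_map_vsmooth_chart[OF F]]) (use c c' in simp)
  then show "case c of (V, \<psi>) \<Rightarrow> smooth_on (S \<inter> (\<lambda>x. F (\<iota> x)) -` V) (\<psi> \<circ> (\<lambda>x. F (\<iota> x)))"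
    by (simp add: c' o_def vimage_def)
qed

context smooth_group
begin

lemma psmooth_mult:
  fixes \<iota> \<kappa> :: "'f::euclidean_space \<Rightarrow> 'g"
  assumes \<iota>: "psmooth S MG \<iota>" and \<kappa>: "psmooth S MG \<kappa>"
  shows "psmooth S MG (\<lambda>x. \<iota> x \<otimes> \<kappa> x)"
proof -
  have S: "open S" using \<iota> by (simp add: psmooth_def)
  have "psmooth S (prod_mfd MG MG) (\<lambda>x. map_prod \<iota> \<kappa> (x, x))"
    by (rule psmooth_compose[OF psmooth_prod[OF \<iota> \<kappa>] S smooth_on_Pair[OF smooth_on_id smooth_on_id]]) auto
  from psmooth_map[OF smooth_manifold_prod[OF M M] this, of MG "\<lambda>(x, y). x \<otimes> y"]
  show ?thesis using lie by (simp add: lie_group_def)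
qed

lemma psmooth_inv: "psmooth S MG \<iota> \<Longrightarrow> psmooth S MG (\<lambda>x. inv (\<iota> x))"
  by (rule psmooth_map[OF M _ smooth_map_inv[OF M smooth_map_id[OF M]]])

end

context flag_setup
begin

text \<open>Near the unit the group is a product of a slice and the torus: in a chart in which the torus
  is linear, \<open>(n, s) \<mapsto> n s\<close> has identity derivative at the unit, with respect to a linear
  complement of the torus directions. The last property holds since two points of a small slice in
  the same coset differ by an element of the torus that is close to the unit.\<close>

lemma torus_slice:
  obtains W R and q :: "'g \<Rightarrow> 'e" and \<sigma> where
    "openin (mtop MG) W" "\<one> \<in> W" "vsmooth MG W q" "open R" "convex R" "0 \<in> R" "psmooth R MG \<sigma>" "\<sigma> 0 = \<one>" "q \<one> = 0"
    "q ` W \<subseteq> R" "\<And>x. x \<in> W \<Longrightarrow> \<exists>t\<in>T. x = \<sigma> (q x) \<otimes> t"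
    "\<And>x t. x \<in> W \<Longrightarrow> t \<in> T \<Longrightarrow> x \<otimes> t \<in> W \<Longrightarrow> q (x \<otimes> t) = q x"
proof -
  have "\<one> \<in> points (sub_mfd MG T)" using one_T T_sub(2) by (simp add: points_sub_mfd)
  then obtain A \<phi> where A: "(A, \<phi>) \<in> atlas (sub_mfd MG T)" "\<one> \<in> A" using atlas_cover[OF T_sub(1)] by blast
  from A(1) obtain U S where US: "A = U \<inter> T" "(U, \<phi>) \<in> charts MG" "subspace S" "\<phi> ` (U \<inter> T) = \<phi> ` U \<inter> S" by (rule sub_atlasE)
  obtain E where E: "subspace E" "openin (top_of_set E) (\<phi> ` U)" using chartD(2)[OF US(2)] by blast
  obtain pE where pE: "linear pE" "range pE \<subseteq> E" "\<And>x. x \<in> E \<Longrightarrow> pE x = x" using linear_projection_exists[OF E(1)] by blast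
  have SE: "subspace (S \<inter> E)" by (rule subspace_inter[OF US(3) E(1)])
  obtain p1 where p1: "linear p1" "range p1 \<subseteq> S \<inter> E" "\<And>x. x \<in> S \<inter> E \<Longrightarrow> p1 x = x" using linear_projection_exists[OF SE] by blast
  define \<iota> where "\<iota> = inv_into U \<phi> \<circ> pE"
  obtain Q where Q: "param MG \<phi> \<iota> Q" "\<iota> ` Q = U" "\<And>x. x \<in> Q \<Longrightarrow> pE x \<in> \<phi> ` U"
    using param_of_chart[OF M US(2) E(2) pE openin_topspace] openin_subset[OF chartD(1)[OF US(2)]]
    unfolding \<iota>_def by (metis Int_absorb2)
  note par = paramD[OF Q(1), unfolded Q(2)]
  have \<phi>E: "\<phi> z \<in> E" if "z \<in> U" for z using openin_imp_subset[OF E(2)] that by blast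
  have \<phi>\<iota>: "\<phi> (\<iota> x) = pE x" "\<iota> x \<in> U" if "x \<in> Q" for x
    using Q(3)[OF that] Q(2) that by (auto simp: \<iota>_def f_inv_into_f)
  have oneU: "\<one> \<in> U" using A(2) US(1) by simp
  define x0 where "x0 = \<phi> \<one>"
  have x0: "x0 \<in> S" "x0 \<in> E" "x0 \<in> Q" "\<iota> x0 = \<one>"
    using US(4) oneU one_T \<phi>E par(4,5) by (auto simp: x0_def)
  have lift: "\<iota> x \<in> T" if "x \<in> Q" "x \<in> S" "x \<in> E" for x
  proof -
    have "x \<in> \<phi> ` (U \<inter> T)" using Q(3)[OF that(1)] pE(3)[OF that(3)] that(2) US(4) by auto
    then obtain t where "t \<in> U" "t \<in> T" "x = \<phi> t" by blast
    then show ?thesis using par(5) by simp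
  qed
  \<comment> \<open>\<open>\<pi>S\<close> and \<open>\<pi>N\<close> split the model subspace
    \<open>E\<close> into the torus directions \<open>S \<inter> E\<close> and a complement; both
    vanish on the kernel of \<open>pE\<close>.\<close>
  define \<pi>S where "\<pi>S w = p1 (pE w)" for w
  define \<pi>N where "\<pi>N w = pE w - \<pi>S w" for w
  have lin: "linear \<pi>S" "linear \<pi>N"
    unfolding \<pi>N_def[abs_def] \<pi>S_def[abs_def] using linear_compose[OF pE(1) p1(1)] pE(1)
    by (auto simp: o_def intro: linear_compose_sub)
  have SS: "\<pi>S w \<in> S" "\<pi>S w \<in> E" "\<pi>N w \<in> E" "pE w \<in> E" for w
  proof -
    show 1: "pE w \<in> E" using pE(2) by blast
    have "p1 (pE w) \<in> S \<inter> E" using p1(2) by blast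
    then show "\<pi>S w \<in> S" "\<pi>S w \<in> E" by (simp_all add: \<pi>S_def)
    then show "\<pi>N w \<in> E" unfolding \<pi>N_def by (intro subspace_diff[OF E(1) 1])
  qed
  have proj: "\<pi>S (\<pi>S w) = \<pi>S w" "\<pi>N (\<pi>N w) = \<pi>N w" "\<pi>S (\<pi>N w) = 0" "\<pi>N (\<pi>S w) = 0" for w
  proof -
    have "\<pi>S (\<pi>S w) = \<pi>S w" using SS(1,2)[of w] pE(3) p1(3) by (simp add: \<pi>S_def)
    moreover have "\<pi>S (pE w) = \<pi>S w" using pE(3)[OF SS(4)] by (simp add: \<pi>S_def)
    moreover have "pE (\<pi>S w) = \<pi>S w" "pE (\<pi>N w) = \<pi>N w" using pE(3) SS by simp_all
    ultimately show "\<pi>S (\<pi>S w) = \<pi>S w" "\<pi>N (\<pi>N w) = \<pi>N w" "\<pi>S (\<pi>N w) = 0" "\<pi>N (\<pi>S w) = 0"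
      using linear_diff[OF lin(1), of "pE w" "\<pi>S w"] by (simp_all add: \<pi>N_def)
  qed
  have z: "\<pi>S 0 = 0" "\<pi>N 0 = 0" "pE 0 = 0" using lin pE(1) by (simp_all add: linear_0)
  define R0 where "R0 = {w. x0 + \<pi>N w \<in> Q \<and> x0 + \<pi>S w \<in> Q}"
  define F where "F w = \<iota> (x0 + \<pi>N w) \<otimes> \<iota> (x0 + \<pi>S w)" for w
  have sa: "smooth_on X (\<lambda>w. x0 + L w)" if "linear L" for L :: "'e \<Rightarrow> 'e" and X
    by (intro smooth_on_add smooth_on_const smooth_on_bounded_linear linear_conv_bounded_linear[THEN iffD1] that)
  have cl: "continuous_on UNIV (\<lambda>w. x0 + L w)" if "linear L" for L :: "'e \<Rightarrow> 'e"
    by (rule smooth_on_imp_continuous_on[OF sa[OF that]])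
  have "open ((\<lambda>w. x0 + \<pi>N w) -` Q \<inter> (\<lambda>w. x0 + \<pi>S w) -` Q)"
    using continuous_open_vimage par(1) cl[OF lin(1)] cl[OF lin(2)] by (intro open_Int open_vimage) auto
  then have R0: "open R0" unfolding R0_def by (simp add: vimage_def Collect_conj_eq)
  have Fs: "psmooth R0 MG F"
    unfolding F_def[abs_def]
    by (intro psmooth_mult psmooth_compose[OF par(2) R0] sa lin) (auto simp: R0_def)
  define \<Omega> where "\<Omega> = R0 \<inter> F -` U"
  have \<Omega>: "open \<Omega>" unfolding \<Omega>_def by (rule psmooth_open_vimage[OF Fs chartD(1)[OF US(2)]])
  have \<phi>F: "smooth_on \<Omega> (\<phi> \<circ> F)" unfolding \<Omega>_def by (rule psmooth_vsmooth[OF M Fs vsmooth_of_chart[OF US(2)]])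
  \<comment> \<open>The chart has values in \<open>E\<close>, but the inverse function theorem is
    applied in the whole Euclidean space. The summand \<open>w - pE w\<close> supplies the identity
    on the kernel of \<open>pE\<close>, along which \<open>F\<close> is constant.\<close>
  define \<mu> where "\<mu> w = \<phi> (F w) + (w - pE w)" for w
  have \<mu>s: "smooth_on \<Omega> \<mu>"
    unfolding \<mu>_def
    using \<phi>F pE(1) linear_conv_bounded_linear smooth_on_bounded_linear[of pE \<Omega>]
    by (intro smooth_on_add smooth_on_diff smooth_on_id) (auto simp: o_def)
  have F0: "F 0 = \<one>" by (simp add: F_def z x0)
  have \<Omega>0: "0 \<in> \<Omega>" by (simp add: \<Omega>_def R0_def z x0 F0 oneU)
  have FN: "F (\<pi>N w) = \<iota> (x0 + \<pi>N w)" if "x0 + \<pi>N w \<in> Q" for w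
    using \<phi>\<iota>(2)[OF that] openin_subset[OF chartD(1)[OF US(2)]] by (auto simp: F_def proj x0 points_carrier)
  have FS: "F (\<pi>S w) = \<iota> (x0 + \<pi>S w)" if "x0 + \<pi>S w \<in> Q" for w
    using \<phi>\<iota>(2)[OF that] openin_subset[OF chartD(1)[OF US(2)]] by (auto simp: F_def proj x0 points_carrier)
  have \<mu>id: "(\<mu> has_derivative (\<lambda>w. w)) (at 0)"
  proof -
    define L where "L = frechet_derivative (\<phi> \<circ> F) (at 0)"
    have L: "((\<phi> \<circ> F) has_derivative L) (at 0)" unfolding L_def by (rule smooth_on_has_derivative[OF \<Omega> \<phi>F \<Omega>0])
    have ldiff: "L (u + v) = L u + L v" for u v using linear_add[OF has_derivative_linear[OF L]] .
    \<comment> \<open>If the chart expression of \<open>F\<close> is affine along \<open>K\<close>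
      near 0 with linear part \<open>K'\<close>, uniqueness of derivatives gives the equation. It is
      used for the slice directions, the torus directions and the kernel of
      \<open>pE\<close>.\<close>
    have aff: "L (K w) = K' w"
      if K: "linear K" "linear K'" and O': "open O'" "0 \<in> O'" "\<And>w. w \<in> O' \<Longrightarrow> \<phi> (F (K w)) = x0 + K' w" for K K' :: "'e \<Rightarrow> 'e" and O' w
    proof -
      have K0: "K 0 = 0" by (rule linear_0[OF K(1)])
      have bl: "bounded_linear K" "bounded_linear K'" using K linear_conv_bounded_linear by auto
      have "((\<lambda>w. (\<phi> \<circ> F) (K w)) has_derivative (\<lambda>w. L (K w))) (at 0)"
        by (rule has_derivative_compose[OF bounded_linear_imp_has_derivative[OF bl(1)]]) (simp add: K0 L[unfolded o_def])
      moreover have "((\<lambda>w. (\<phi> \<circ> F) (K w)) has_derivative K') (at 0)"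
      proof (rule has_derivative_transform_within_open[OF _ O'(1,2)])
        show "((\<lambda>w. x0 + K' w) has_derivative K') (at 0)"
          using has_derivative_add[OF has_derivative_const bounded_linear_imp_has_derivative[OF bl(2)]] by simp
      qed (simp add: O'(3))
      ultimately have "(\<lambda>w. L (K w)) = K'" by (rule has_derivative_unique)
      then show ?thesis by (rule fun_cong)
    qed
    have oN: "open {w. x0 + \<pi>N w \<in> Q}" "open {w. x0 + \<pi>S w \<in> Q}"
      using open_vimage[OF par(1) cl[OF lin(2)]] open_vimage[OF par(1) cl[OF lin(1)]] by (simp_all add: vimage_def)
    have 1: "L (\<pi>N w) = \<pi>N w" for w
      by (rule aff[OF lin(2,2) oN(1)])
         (simp_all add: z x0 FN \<phi>\<iota> linear_add[OF pE(1)] pE(3) SS)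
    have 2: "L (\<pi>S w) = \<pi>S w" for w
      by (rule aff[OF lin(1,1) oN(2)])
         (simp_all add: z x0 FS \<phi>\<iota> linear_add[OF pE(1)] pE(3) SS)
    have k: "\<pi>N (w - pE w) = 0" "\<pi>S (w - pE w) = 0" for w
      using pE(3)[OF SS(4)[of w]] linear_diff[OF pE(1)] linear_0[OF p1(1)] by (simp_all add: \<pi>N_def \<pi>S_def)
    have lk: "linear (\<lambda>w. w - pE w)" using pE(1) by (intro linear_compose_sub linear_ident)
    have 3: "L (w - pE w) = 0" for w
    proof (rule aff[OF lk linear_zero open_UNIV UNIV_I])
      have "F (w - pE w) = \<one>" for w by (simp add: F_def k x0)
      then show "\<phi> (F (w - pE w)) = x0 + 0" for w by (simp add: x0_def)
    qed
    have "L w = pE w" for w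
    proof -
      have "w = \<pi>N w + \<pi>S w + (w - pE w)" by (simp add: \<pi>N_def)
      then have "L w = L (\<pi>N w) + L (\<pi>S w) + L (w - pE w)" by (metis ldiff)
      then show ?thesis unfolding 1 2 3 by (simp add: \<pi>N_def)
    qed
    then have "L = pE" by auto
    with L have "(\<phi> \<circ> F has_derivative pE) (at 0)" by simp
    moreover have "(pE has_derivative pE) (at 0)"
      using pE(1) linear_conv_bounded_linear bounded_linear_imp_has_derivative by blast
    ultimately have "((\<lambda>w. (\<phi> \<circ> F) w + (w - pE w)) has_derivative (\<lambda>w. pE w + (w - pE w))) (at 0)"
      by (intro has_derivative_add has_derivative_diff has_derivative_ident)
    then show ?thesis by (simp add: \<mu>_def[abs_def])
  qed
  obtain U0 V \<nu> where U0: "open U0" "0 \<in> U0" "U0 \<subseteq> \<Omega>" and V: "open V" and hom: "homeomorphism U0 V \<mu> \<nu>" and \<nu>s: "smooth_on V \<nu>"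
    by (rule smooth_local_inverse[OF \<Omega> \<mu>s \<Omega>0 \<mu>id])
  have h\<nu>: "\<And>y. y \<in> V \<Longrightarrow> \<nu> y \<in> U0 \<and> \<mu> (\<nu> y) = y" and h\<mu>: "\<And>w. w \<in> U0 \<Longrightarrow> \<mu> w \<in> V \<and> \<nu> (\<mu> w) = w"
    using hom by (auto simp: homeomorphism_def)
  \<comment> \<open>If \<open>\<mu> w\<close> lies in \<open>E\<close>, the auxiliary summand
    \<open>w - pE w\<close> vanishes, so inverting \<open>\<mu>\<close> over the chart image inverts
    the chart expression of \<open>F\<close>.\<close>
  have inE: "pE w = w \<and> \<phi> (F w) = \<mu> w" if w: "w \<in> U0" "\<mu> w \<in> E" for w
  proof -
    have "F w \<in> U" using w(1) U0(3) by (auto simp: \<Omega>_def)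
    then have "\<mu> w - \<phi> (F w) \<in> E" by (intro subspace_diff[OF E(1)] w(2) \<phi>E)
    then have "pE (w - pE w) = w - pE w" using pE(3) by (simp add: \<mu>_def)
    moreover have "pE (w - pE w) = 0" using pE(3)[OF SS(4)[of w]] linear_diff[OF pE(1)] by simp
    ultimately show ?thesis by (simp add: \<mu>_def)
  qed
  \<comment> \<open>\<open>K\<close> below is the quotient of two slice points. If that quotient
    lies in the torus, \<open>J\<close> is the parameter at which \<open>F\<close>, starting from
    the first slice point, reaches the second. The radius of \<open>R\<close> keeps \<open>J\<close>
    inside \<open>U0\<close>, where \<open>\<mu>\<close> is injective.\<close>
  define R1 where "R1 = {z :: 'e \<times> 'e. x0 + fst z \<in> Q \<and> x0 + snd z \<in> Q}"
  define K where "K z = inv (\<iota> (x0 + fst z)) \<otimes> \<iota> (x0 + snd z)" for z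
  have s1: "smooth_on X (\<lambda>z :: 'e \<times> 'e. x0 + fst z)" "smooth_on X (\<lambda>z :: 'e \<times> 'e. x0 + snd z)" for X
    by (intro smooth_on_add smooth_on_const smooth_on_bounded_linear bounded_linear_fst bounded_linear_snd)+
  have "open ((\<lambda>z :: 'e \<times> 'e. x0 + fst z) -` Q \<inter> (\<lambda>z :: 'e \<times> 'e. x0 + snd z) -` Q)"
    by (intro open_Int open_vimage par(1) smooth_on_imp_continuous_on[OF s1(1)] smooth_on_imp_continuous_on[OF s1(2)])
  then have R1: "open R1" unfolding R1_def by (simp add: vimage_def Collect_conj_eq)
  have Ks: "psmooth R1 MG K"
    unfolding K_def[abs_def]
    by (intro psmooth_mult psmooth_inv psmooth_compose[OF par(2) R1] s1) (auto simp: R1_def)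
  define \<Omega>2 where "\<Omega>2 = R1 \<inter> K -` U"
  have \<Omega>2: "open \<Omega>2" unfolding \<Omega>2_def by (rule psmooth_open_vimage[OF Ks chartD(1)[OF US(2)]])
  define J where "J z = fst z + (\<phi> (K z) - x0)" for z
  have "smooth_on \<Omega>2 (\<phi> \<circ> K)" unfolding \<Omega>2_def by (rule psmooth_vsmooth[OF M Ks vsmooth_of_chart[OF US(2)]])
  then have Jc: "continuous_on \<Omega>2 J"
    unfolding J_def[abs_def] using smooth_on_imp_continuous_on by (intro continuous_intros) (auto simp: o_def)
  have "open (\<Omega>2 \<inter> J -` U0)" by (rule continuous_open_preimage[OF Jc \<Omega>2 U0(1)])
  moreover have K0: "K (0, 0) = \<one>" by (simp add: K_def x0)
  then have "(0, 0) \<in> \<Omega>2 \<inter> J -` U0" by (simp add: \<Omega>2_def R1_def x0 oneU J_def U0 x0_def[symmetric])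
  ultimately obtain B C where BC: "open B" "open C" "0 \<in> B" "0 \<in> C" "B \<times> C \<subseteq> \<Omega>2 \<inter> J -` U0"
    by (metis open_prod_elim mem_Sigma_iff)
  have "open (B \<inter> C \<inter> U0)" "0 \<in> B \<inter> C \<inter> U0" using BC U0 by auto
  then obtain e where e: "e > 0" "ball 0 e \<subseteq> B \<inter> C \<inter> U0" using open_contains_ball by blast
  \<comment> \<open>A ball, because the convexity of \<open>R\<close> is used by Hadamard's lemma in
    \<open>critical_descends\<close>.\<close>
  define R :: "'e set" where "R = ball 0 e"
  have R: "n \<in> U0" "(n, n') \<in> \<Omega>2" "J (n, n') \<in> U0" "x0 + n \<in> Q" if "n \<in> R" "n' \<in> R" for n n'
  proof -
    have "n \<in> B" "n \<in> U0" "n' \<in> C" using that e(2) by (auto simp: R_def)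
    then show "n \<in> U0" "(n, n') \<in> \<Omega>2" "J (n, n') \<in> U0" using BC(5) by auto
    then show "x0 + n \<in> Q" by (simp add: \<Omega>2_def R1_def)
  qed
  define \<sigma> where "\<sigma> n = \<iota> (x0 + n)" for n
  define q where "q x = \<pi>N (\<nu> (\<phi> x))" for x
  define W where "W = {x \<in> U. \<phi> x \<in> V \<and> q x \<in> R}"
  have Uc: "x \<in> U \<Longrightarrow> x \<in> carrier G" for x using openin_subset[OF chartD(1)[OF US(2)]] points_carrier by auto
  have \<sigma>c: "\<sigma> n \<in> U" "\<sigma> n \<in> carrier G" if "n \<in> R" for n
    using \<phi>\<iota>(2)[OF R(4)[OF that that]] Uc by (simp_all add: \<sigma>_def)
  have qN: "\<pi>N (q x) = q x" "\<pi>S (q x) = 0" "q x \<in> E" for x by (simp_all add: q_def proj SS)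
  have dec: "\<exists>t\<in>T. x = \<sigma> (q x) \<otimes> t" if x: "x \<in> W" for x
  proof -
    have xU: "x \<in> U" "\<phi> x \<in> V" using x by (simp_all add: W_def)
    let ?w = "\<nu> (\<phi> x)"
    have w: "?w \<in> U0" "\<mu> ?w = \<phi> x" using h\<nu>[OF xU(2)] by simp_all
    have w\<Omega>: "?w \<in> R0" "F ?w \<in> U" using w(1) U0(3) by (auto simp: \<Omega>_def)
    have "\<phi> (F ?w) = \<phi> x" using inE[OF w(1)] w(2) \<phi>E[OF xU(1)] by simp
    then have "F ?w = x" using par(5)[OF w\<Omega>(2)] par(5)[OF xU(1)] by metis
    moreover have "\<iota> (x0 + \<pi>S ?w) \<in> T"
      using w\<Omega>(1) subspace_add[OF US(3) x0(1) SS(1)] subspace_add[OF E(1) x0(2) SS(2)] by (intro lift) (auto simp: R0_def)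
    ultimately show ?thesis unfolding F_def \<sigma>_def q_def by metis
  qed
  have invar: "q (x \<otimes> t) = q x" if x: "x \<in> W" and t: "t \<in> T" and xt: "x \<otimes> t \<in> W" for x t
  proof -
    let ?n = "q x" and ?m = "q (x \<otimes> t)"
    have nR: "?n \<in> R" "?m \<in> R" using x xt by (simp_all add: W_def)
    obtain a where a: "a \<in> T" "x = \<sigma> ?n \<otimes> a" using dec[OF x] by blast
    obtain b where b: "b \<in> T" "x \<otimes> t = \<sigma> ?m \<otimes> b" using dec[OF xt] by blast
    note c = \<sigma>c(2)[OF nR(1)] \<sigma>c(2)[OF nR(2)] T_carrier[OF a(1)] T_carrier[OF b(1)] T_carrier[OF t]
    let ?s = "inv (\<sigma> ?n) \<otimes> \<sigma> ?m"
    have "\<sigma> ?m = \<sigma> ?n \<otimes> (a \<otimes> t \<otimes> inv b)"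
      using a(2) b(2) c by (metis inv_closed inv_solve_right m_assoc m_closed)
    then have "?s = a \<otimes> t \<otimes> inv b" using c inv_mult_cancel by simp
    then have sT: "?s \<in> T" using a(1) t b(1) by (simp add: subgroup.m_closed[OF T(1)] subgroup.m_inv_closed[OF T(1)])
    have sK: "?s = K (?n, ?m)" by (simp add: K_def \<sigma>_def)
    have sU: "?s \<in> U" using R(2)[OF nR] sK by (simp add: \<Omega>2_def)
    let ?b = "\<phi> ?s - x0"
    have "\<phi> ?s \<in> S" using sT sU US(4) by blast
    then have bS: "?b \<in> S" "?b \<in> E" using subspace_diff[OF US(3) _ x0(1)] subspace_diff[OF E(1) \<phi>E[OF sU] x0(2)] by auto
    have b: "\<pi>S ?b = ?b" "pE ?b = ?b" "\<pi>N ?b = 0" using bS pE(3) p1(3) by (simp_all add: \<pi>S_def \<pi>N_def)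
    \<comment> \<open>Both \<open>?n + ?b\<close> and \<open>?m\<close> lie in \<open>U0\<close> and
      have the same image under \<open>\<mu>\<close>, so they coincide. Their torus components are
      \<open>?b\<close> and 0; hence \<open>?b = 0\<close>, and the slice coordinates agree.\<close>
    have "?n + ?b \<in> U0" using R(3)[OF nR] by (simp add: J_def sK)
    moreover have "?m \<in> U0" using R(1)[OF nR(2,2)] .
    moreover have "\<mu> (?n + ?b) = \<phi> (\<sigma> ?m)"
    proof -
      have "F (?n + ?b) = \<sigma> ?n \<otimes> ?s"
        by (simp add: F_def linear_add[OF lin(1)] linear_add[OF lin(2)] qN b \<sigma>_def[symmetric] par(5)[OF sU])
      also have "\<dots> = \<sigma> ?m" by (rule mult_inv_cancel[OF c(1,2)])
      finally show ?thesis by (simp add: \<mu>_def linear_add[OF pE(1)] pE(3)[OF qN(3)] b)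
    qed
    moreover have "\<mu> ?m = \<phi> (\<sigma> ?m)"
      using c(2) by (simp add: \<mu>_def F_def qN x0 \<sigma>_def[symmetric] pE(3)[OF qN(3)])
    ultimately have eq: "?n + ?b = ?m" using h\<mu> by metis
    then have "\<pi>S (?n + ?b) = \<pi>S ?m" by simp
    then have "?b = 0" by (simp only: linear_add[OF lin(1)] qN b add_0)
    with eq show ?thesis by simp
  qed
  have \<nu>N: "smooth_on V (\<lambda>y. \<pi>N (\<nu> y))"
    by (rule smooth_on_compose[OF \<nu>s smooth_on_bounded_linear[of \<pi>N UNIV]]) (use lin(2) linear_conv_bounded_linear in auto)
  have "open (V \<inter> (\<lambda>y. \<pi>N (\<nu> y)) -` R)"
    by (rule continuous_open_preimage[OF smooth_on_imp_continuous_on[OF \<nu>N] V]) (simp add: R_def)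
  then have "openin euclidean (V \<inter> (\<lambda>y. \<pi>N (\<nu> y)) -` R)" by simp
  from openin_continuous_map_preimage[OF par(7) this]
  have "openin (subtopology (mtop MG) U) {x \<in> topspace (subtopology (mtop MG) U). \<phi> x \<in> V \<inter> (\<lambda>y. \<pi>N (\<nu> y)) -` R}" .
  moreover have "{x \<in> topspace (subtopology (mtop MG) U). \<phi> x \<in> V \<inter> (\<lambda>y. \<pi>N (\<nu> y)) -` R} = W"
    using openin_subset[OF chartD(1)[OF US(2)]] by (auto simp: W_def q_def)
  ultimately have "openin (subtopology (mtop MG) U) W" by (simp only:)
  then have Wo: "openin (mtop MG) W" using openin_trans_full[OF _ chartD(1)[OF US(2)]] by blast
  have \<mu>0: "\<mu> 0 = x0" by (simp add: \<mu>_def F0 z x0_def)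
  then have x0V: "x0 \<in> V" "\<nu> x0 = 0" using h\<mu>[OF U0(2)] by simp_all
  then have q1: "q \<one> = 0" by (simp add: q_def x0_def[symmetric] z)
  show thesis
  proof (rule that[of W q R \<sigma>])
    show "\<one> \<in> W" using oneU x0V q1 e(1) by (simp add: W_def x0_def[symmetric] R_def)
    show "vsmooth MG W q"
      unfolding q_def[abs_def]
      by (rule vsmooth_compose[OF vsmooth_subset[OF vsmooth_of_chart[OF US(2)]] \<nu>N _ M]) (auto simp: W_def)
    show "psmooth R MG \<sigma>"
      unfolding \<sigma>_def[abs_def]
    proof (rule psmooth_compose[OF par(2)])
      show "smooth_on R (\<lambda>n. x0 + n)" by (intro smooth_on_add smooth_on_const smooth_on_id)
      show "(+) x0 ` R \<subseteq> Q" using R(4) by auto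
    qed (simp add: R_def)
    show "q ` W \<subseteq> R" by (auto simp: W_def)
  qed (use Wo q1 x0 e(1) dec invar in \<open>auto simp: R_def \<sigma>_def\<close>)
qed

end

definition pull_covec :: "('a, 'e::euclidean_space) mfd \<Rightarrow> ('b, 'f::euclidean_space) mfd \<Rightarrow> ('a \<Rightarrow> 'b) \<Rightarrow> 'a \<Rightarrow> 'b covec \<Rightarrow> 'a covec" where
  "pull_covec M N F x \<xi> = (\<lambda>u. if u \<in> tangent_space M x then \<xi> (push N F u) else 0)"

lemma pull_covec_cotangent:
  assumes M: "smooth_manifold M" and N: "smooth_manifold N" and F: "smooth_map M N F" and \<xi>: "\<xi> \<in> cotangent_space N (F x)"
  shows "pull_covec M N F x \<xi> \<in> cotangent_space M x"
  unfolding cotangent_space_def mem_Collect_eq pull_covec_def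
  by (simp add: tangent_space_add tangent_space_scale push_add push_scale cotangentD(1,2)[OF \<xi>] push_tangent[OF M N F])

lemma pull_covec_linear:
  assumes M: "smooth_manifold M" and N: "smooth_manifold N" and F: "smooth_map M N F"
  shows "pull_covec M N F x (\<xi> + \<eta>) = pull_covec M N F x \<xi> + pull_covec M N F x \<eta>"
    "pull_covec M N F x (\<lambda>u. c * \<xi> u) = (\<lambda>u. c * pull_covec M N F x \<xi> u)"
  by (auto simp: pull_covec_def fun_eq_iff)

lemma pull_covec_differential:
  assumes M: "smooth_manifold M" and N: "smooth_manifold N" and F: "smooth_map M N F" and f: "f \<in> smooth_funs N"
  shows "pull_covec M N F x (differential N f (F x)) = differential M (f \<circ> F) x"
proof
  fix u show "pull_covec M N F x (differential N f (F x)) u = differential M (f \<circ> F) x u"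
  proof (cases "u \<in> tangent_space M x")
    case True
    from push_tangent[OF M N F True] True show ?thesis by (simp add: pull_covec_def differential_def) (simp add: push_def f)
  qed (simp add: pull_covec_def differential_def)
qed

lemma differential_cong:
  assumes M: "smooth_manifold M" and x: "x \<in> points M" and f: "f \<in> smooth_funs M" and eq: "\<And>y. y \<in> points M \<Longrightarrow> f y = h y"
  shows "differential M f x = differential M h x"
  using tangent_cong_points[OF M _ x f eq] by (auto simp: differential_def)

section \<open>The quotient by the torus: submersion and descent of the bivector\<close>

locale flag_quotient = standard_setup G MG T P \<pi>
  for G :: "'g monoid" (structure) and MG :: "('g, 'e::euclidean_space) mfd" and T P \<pi> +
  fixes Q :: "('g set, 'f::euclidean_space) mfd"
  assumes quotient: "flag_manifold G MG T Q"
begin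

abbreviation "p \<equiv> flag_proj G T"

lemma Q: "smooth_manifold Q" and quotient_map: "quotient_map (mtop MG) (mtop Q) p"
  using quotient by (simp_all add: flag_manifold_def quotient_manifold_def)

lemma vsmooth_quotient: "openin (mtop Q) W \<Longrightarrow> vsmooth Q W f \<longleftrightarrow> vsmooth MG {x \<in> points MG. p x \<in> W} (f \<circ> p)"
  for f :: "'g set \<Rightarrow> real"
  using quotient by (simp add: flag_manifold_def quotient_manifold_def smooth_fun_on_iff_vsmooth)

lemma p_image: "p ` carrier G = points Q"
  using quotient_imp_surjective_map[OF quotient_map] by (simp add: points_carrier)

lemma p_in: "g \<in> carrier G \<Longrightarrow> p g \<in> points Q"
  using p_image by blast

lemma openin_quotient: "W \<subseteq> points Q \<Longrightarrow> openin (mtop Q) W \<longleftrightarrow> openin (mtop MG) {x \<in> points MG. p x \<in> W}"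
  using quotient_map by (simp add: quotient_map_def)

lemma p_mult:
  assumes g: "g \<in> carrier G" and t: "t \<in> T"
  shows "p (g \<otimes> t) = p g"
proof -
  have "g \<otimes> t \<in> g <# T" using t by (auto simp: l_coset_def)
  from l_repr_independence[OF this g T(1)] show ?thesis by (simp add: flag_proj_def)
qed

lemma p_eq:
  assumes g: "g \<in> carrier G" and h: "h \<in> carrier G" and eq: "p g = p h"
  obtains t where "t \<in> T" "h = g \<otimes> t"
proof -
  have "h \<in> h <# T" using one_T h by (auto simp: l_coset_def intro!: bexI[of _ "\<one>"])
  then have "h \<in> g <# T" using eq by (simp add: flag_proj_def)
  then show thesis using that by (auto simp: l_coset_def)
qed

lemma p_smooth: "smooth_map MG Q p"
proof (rule smooth_mapI[OF Q quotient_imp_continuous_map[OF quotient_map]])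
  fix W and f :: "'g set \<Rightarrow> real" assume W: "openin (mtop Q) W" and f: "vsmooth Q W f"
  have "vsmooth MG {x \<in> points MG. p x \<in> W} (f \<circ> p)" using vsmooth_quotient[OF W] f by blast
  moreover have "p -` W \<inter> points MG = {x \<in> points MG. p x \<in> W}" by auto
  ultimately show "vsmooth MG (p -` W) (f \<circ> p)" by (subst vsmooth_points[OF M]) simp
qed

lemma smooth_funs_quotient:
  assumes f: "f \<circ> p \<in> smooth_funs MG"
  shows "f \<in> smooth_funs Q"
proof -
  have "{x \<in> points MG. p x \<in> points Q} = points MG" using p_in points_carrier by auto
  then show ?thesis
    using f vsmooth_quotient[OF openin_topspace, of f] by (simp add: smooth_funs_iff_vsmooth)
qed

text \<open>Near a coset, \<open>f\<close> is a function of slice coordinates that vanish there; if \<open>f \<circ> p\<close> is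
  critical, Hadamard's lemma writes \<open>f\<close> as a constant plus a sum of products of two vanishing functions.\<close>

lemma critical_descends:
  assumes g: "g \<in> carrier G" and f: "f \<in> smooth_funs Q" and D: "D \<in> tangent_space Q (p g)"
    and crit: "\<And>u. u \<in> tangent_space MG g \<Longrightarrow> u (f \<circ> p) = 0"
  shows "D f = 0"
proof -
  obtain W R and q :: "'g \<Rightarrow> 'e" and \<sigma> where W: "openin (mtop MG) W" "\<one> \<in> W" and q: "vsmooth MG W q"
    and R: "open R" "convex R" "0 \<in> R" and \<sigma>: "psmooth R MG \<sigma>" "\<sigma> 0 = \<one>" and q1: "q \<one> = 0" and qR: "q ` W \<subseteq> R"
    and dec: "\<And>x. x \<in> W \<Longrightarrow> \<exists>t\<in>T. x = \<sigma> (q x) \<otimes> t"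
    and qinv: "\<And>x t. x \<in> W \<Longrightarrow> t \<in> T \<Longrightarrow> x \<otimes> t \<in> W \<Longrightarrow> q (x \<otimes> t) = q x"
    by (rule torus_slice) (rule that)
  have Wc: "x \<in> carrier G" if "x \<in> W" for x using openin_subset[OF W(1)] that points_carrier by auto
  have \<sigma>c: "\<sigma> n \<in> carrier G" if "n \<in> R" for n using psmooth_in_points[OF \<sigma>(1) that] points_carrier by simp
  have fp: "f \<circ> p \<in> smooth_funs MG" by (rule smooth_funs_pullback[OF M Q p_smooth f])
  have \<sigma>g: "psmooth R MG (\<lambda>n. g \<otimes> \<sigma> n)" by (rule psmooth_map[OF M \<sigma>(1) smooth_map_left[OF g]])
  define k where "k n = f (p (g \<otimes> \<sigma> n))" for n
  have k: "smooth_on R k" using psmooth_smooth_funs[OF M \<sigma>g fp] by (simp add: k_def[abs_def] o_def)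
  \<comment> \<open>Velocities of the slice at \<open>g\<close> are tangent vectors of the group, so
    criticality kills all first partial derivatives of \<open>k\<close> at 0.\<close>
  have dk: "dd k b 0 = 0" for b
    using crit[of "\<lambda>f. if f \<in> smooth_funs MG then dd (f \<circ> (\<lambda>n. g \<otimes> \<sigma> n)) b 0 else 0"] velocity_tangent[OF M \<sigma>g R(3), of b] fp g
    by (simp add: \<sigma>(2) k_def[abs_def] o_def)
  obtain r where r: "\<And>b. smooth_on R (r b)" "\<And>b. r b 0 = dd k b 0"
    "\<And>x. x \<in> R \<Longrightarrow> k x = k 0 + (\<Sum>b\<in>Basis. ((x - 0) \<bullet> b) * r b x)"
    by (rule hadamard[OF R(1,2,3) k]) (rule that)
  define V where "V = {p (g \<otimes> x) |x. x \<in> W}"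
  have VQ: "V \<subseteq> points Q" using p_in g Wc by (auto simp: V_def)
  \<comment> \<open>The preimage of \<open>V\<close> is a union of preimages of \<open>W\<close>
    under translations, hence open; the quotient topology then makes \<open>V\<close> open.\<close>
  have Vpre: "{y \<in> points MG. p y \<in> V} = (\<Union>t\<in>T. {y \<in> points MG. inv g \<otimes> y \<otimes> inv t \<in> W})"
  proof (intro equalityI subsetI)
    fix y assume "y \<in> {y \<in> points MG. p y \<in> V}"
    then obtain x where x: "y \<in> carrier G" "x \<in> W" "p (g \<otimes> x) = p y" by (auto simp: V_def points_carrier)
    obtain t where t: "t \<in> T" "y = g \<otimes> x \<otimes> t" by (rule p_eq[OF _ x(1) x(3)]) (use g Wc[OF x(2)] in auto)
    have "inv g \<otimes> y \<otimes> inv t = x" using g Wc[OF x(2)] T_carrier[OF t(1)] by (simp add: t(2) m_assoc inv_mult_cancel)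
    then show "y \<in> (\<Union>t\<in>T. {y \<in> points MG. inv g \<otimes> y \<otimes> inv t \<in> W})" using x t(1) by (auto simp: points_carrier)
  next
    fix y assume "y \<in> (\<Union>t\<in>T. {y \<in> points MG. inv g \<otimes> y \<otimes> inv t \<in> W})"
    then obtain t where t: "t \<in> T" "y \<in> carrier G" "inv g \<otimes> y \<otimes> inv t \<in> W" by (auto simp: points_carrier)
    have "g \<otimes> (inv g \<otimes> y \<otimes> inv t) = y \<otimes> inv t" using g t(2) T_carrier[OF t(1)] by (simp add: m_assoc mult_inv_cancel)
    then have "p (g \<otimes> (inv g \<otimes> y \<otimes> inv t)) = p y" using p_mult[OF t(2)] t(1) by (simp add: subgroup.m_inv_closed[OF T(1)])
    then have "p y \<in> V" unfolding V_def using t(3) by (metis (mono_tags, lifting) mem_Collect_eq)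
    then show "y \<in> {y \<in> points MG. p y \<in> V}" using t(2) by (simp add: points_carrier)
  qed
  have tr: "smooth_map MG MG (\<lambda>y. inv g \<otimes> y \<otimes> inv t)" if "t \<in> T" for t
    using that g T_carrier by (intro smooth_map_mult M smooth_map_const smooth_map_id) (auto simp: points_carrier)
  have tro: "openin (mtop MG) {y \<in> points MG. inv g \<otimes> y \<otimes> inv t \<in> W}" if "t \<in> T" for t
    by (rule smooth_map_open_vimage[OF tr[OF that] W(1)])
  have V: "openin (mtop Q) V" unfolding openin_quotient[OF VQ] Vpre using tro by blast
  \<comment> \<open>The slice coordinate on the quotient. It does not depend on the chosen
    representative because \<open>q\<close> is constant along cosets within
    \<open>W\<close>.\<close>
  define qb where "qb m = q (SOME x. x \<in> W \<and> p (g \<otimes> x) = m)" for m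
  have qb: "qb (p (g \<otimes> x)) = q x" if x: "x \<in> W" for x
  proof -
    define x' where "x' = (SOME x'. x' \<in> W \<and> p (g \<otimes> x') = p (g \<otimes> x))"
    have "x' \<in> W \<and> p (g \<otimes> x') = p (g \<otimes> x)" unfolding x'_def by (rule someI[of _ x]) (simp add: x)
    then have x': "x' \<in> W" "p (g \<otimes> x') = p (g \<otimes> x)" by simp_all
    obtain t where t: "t \<in> T" "g \<otimes> x = g \<otimes> x' \<otimes> t" by (rule p_eq[OF _ _ x'(2)]) (use g Wc x x'(1) in auto)
    then have "x = x' \<otimes> t" using g Wc[OF x] Wc[OF x'(1)] T_carrier[OF t(1)] by (simp add: m_assoc)
    then have "q x = q x'" using qinv[OF x'(1) t(1)] x by simp
    then show ?thesis by (simp add: qb_def x'_def)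
  qed
  have qbR: "qb ` V \<subseteq> R" using qb qR by (auto simp: V_def)
  \<comment> \<open>Near a point of the preimage a left and a right translation lead into
    \<open>W\<close>, and there the descended coordinate is \<open>q\<close> after a smooth
    map.\<close>
  have "vsmooth MG {y \<in> points MG. p y \<in> V} (\<lambda>y. qb (p y))"
  proof (rule vsmooth_local[OF M])
    fix y assume "y \<in> {y \<in> points MG. p y \<in> V}" "y \<in> points MG"
    then obtain t where t: "t \<in> T" "y \<in> carrier G" "inv g \<otimes> y \<otimes> inv t \<in> W" unfolding Vpre by (auto simp: points_carrier)
    let ?A = "{y \<in> points MG. inv g \<otimes> y \<otimes> inv t \<in> W}"
    have eq: "q (inv g \<otimes> z \<otimes> inv t) = qb (p z)" if z: "z \<in> ?A" for z
    proof -
      have zc: "z \<in> carrier G" "inv g \<otimes> z \<otimes> inv t \<in> W" using z by (simp_all add: points_carrier)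
      have "g \<otimes> (inv g \<otimes> z \<otimes> inv t) = z \<otimes> inv t" using g zc(1) T_carrier[OF t(1)] by (simp add: m_assoc mult_inv_cancel)
      then have "p (g \<otimes> (inv g \<otimes> z \<otimes> inv t)) = p z" using p_mult[OF zc(1)] t(1) by (simp add: subgroup.m_inv_closed[OF T(1)])
      then show ?thesis using qb[OF zc(2)] by simp
    qed
    have "vsmooth MG ((\<lambda>y. inv g \<otimes> y \<otimes> inv t) -` W) (q \<circ> (\<lambda>y. inv g \<otimes> y \<otimes> inv t))"
      by (rule vsmooth_smooth_map[OF M M tr[OF t(1)] q])
    then have "vsmooth MG ?A (q \<circ> (\<lambda>y. inv g \<otimes> y \<otimes> inv t))" by (rule vsmooth_subset) auto
    then have "vsmooth MG ?A (\<lambda>y. qb (p y))" by (rule vsmooth_cong[OF _ _ M]) (simp add: eq)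
    then have "vsmooth MG ({y \<in> points MG. p y \<in> V} \<inter> ?A) (\<lambda>y. qb (p y))" by (rule vsmooth_subset) auto
    then show "\<exists>W'. openin (mtop MG) W' \<and> y \<in> W' \<and> vsmooth MG ({y \<in> points MG. p y \<in> V} \<inter> W') (\<lambda>y. qb (p y))"
      using tro[OF t(1)] t by (intro exI[of _ ?A]) (simp add: points_carrier)
  qed
  then have "vsmooth MG {y \<in> points MG. p y \<in> V} ((\<lambda>m. qb m \<bullet> b) \<circ> p)" for b
    using vsmooth_inner[OF _ vsmooth_const] by (simp add: o_def)
  then have qbi: "vsmooth Q V (\<lambda>m. qb m \<bullet> b)" for b using vsmooth_quotient[OF V] by blast
  then have qbs: "vsmooth Q V qb" by (rule vsmooth_componentwise)
  have rs: "vsmooth Q V (\<lambda>m. r b (qb m))" for b by (rule vsmooth_compose[OF qbs r(1) qbR Q])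
  have pgV: "p g \<in> V" "qb (p g) = 0" using qb[OF W(2)] W(2) g q1 by (auto simp: V_def intro!: exI[of _ "\<one>"])
  have fV: "f m = f (p g) + (\<Sum>b\<in>Basis. (qb m \<bullet> b) * r b (qb m))" if m: "m \<in> V" for m
  proof -
    obtain x where x: "x \<in> W" "m = p (g \<otimes> x)" using m by (auto simp: V_def)
    have qx: "q x \<in> R" using qR x(1) by blast
    obtain t where t: "t \<in> T" "x = \<sigma> (q x) \<otimes> t" using dec[OF x(1)] by blast
    have "g \<otimes> x = g \<otimes> \<sigma> (q x) \<otimes> t" using g \<sigma>c[OF qx] T_carrier[OF t(1)] t(2) by (metis m_assoc)
    then have "m = p (g \<otimes> \<sigma> (q x))" using p_mult[OF _ t(1), of "g \<otimes> \<sigma> (q x)"] g \<sigma>c[OF qx] x(2) by simp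
    then have "f m = k (q x)" by (simp add: k_def)
    moreover have "k 0 = f (p g)" using g by (simp add: k_def \<sigma>(2))
    ultimately show ?thesis using r(3)[OF qx] qb[OF x(1)] x(2) by simp
  qed
  obtain c where c: "c \<in> smooth_funs Q" "c (p g) = 1" "\<And>z. z \<notin> V \<Longrightarrow> c z = 0"
    "\<And>f. vsmooth Q V f \<Longrightarrow> (\<lambda>z. if z \<in> V then c z * f z else 0) \<in> smooth_funs Q"
    by (rule cutoff_exists[OF Q V pgV(1)]) (rule that)
  \<comment> \<open>At \<open>p g\<close> the factors \<open>A b\<close> vanish as slice coordinates
    and the factors \<open>B b\<close> by criticality, so \<open>D\<close> kills all the products.
    Each factor carries one cutoff \<open>c\<close>.\<close>
  define A where "A b z = (if z \<in> V then c z * (qb z \<bullet> b) else 0)" for b z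
  define B where "B b z = (if z \<in> V then c z * r b (qb z) else 0)" for b z
  have AB: "A b \<in> smooth_funs Q" "B b \<in> smooth_funs Q" for b
    unfolding A_def[abs_def] B_def[abs_def] using c(4)[OF qbi] c(4)[OF rs] by simp_all
  have AB0: "A b (p g) = 0" "B b (p g) = 0" for b using pgV r(2) dk by (simp_all add: A_def B_def)
  have f0: "(\<lambda>z. f z - f (p g)) \<in> smooth_funs Q" by (intro smooth_funs_diff smooth_funs_const f Q)
  have cf: "(\<lambda>z. c z * (f z - f (p g))) \<in> smooth_funs Q" by (rule smooth_funs_mult[OF c(1) f0])
  have "(\<lambda>z. c z * (c z * (f z - f (p g)))) = (\<lambda>z. \<Sum>b\<in>Basis. A b z * B b z)"
  proof
    fix z show "c z * (c z * (f z - f (p g))) = (\<Sum>b\<in>Basis. A b z * B b z)"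
    proof (cases "z \<in> V")
      case True
      have "c z * (c z * (f z - f (p g))) = (\<Sum>b\<in>Basis. c z * (c z * ((qb z \<bullet> b) * r b (qb z))))"
        using fV[OF True] by (simp add: sum_distrib_left)
      also have "\<dots> = (\<Sum>b\<in>Basis. A b z * B b z)" using True by (intro sum.cong) (simp_all add: A_def B_def)
      finally show ?thesis .
    qed (simp add: c(3) A_def)
  qed
  moreover have "D (\<lambda>z. c z * (c z * (f z - f (p g)))) = D f"
    using tangent_mult[OF D c(1) cf] tangent_mult[OF D c(1) f0] tangent_diff[OF D f smooth_funs_const, of "f (p g)"]
      tangent_const[OF D, of "f (p g)"] c(2) by simp
  moreover have "D (\<lambda>z. \<Sum>b\<in>Basis. A b z * B b z) = 0"
    using tangent_sum[OF D smooth_funs_mult[OF AB]] tangent_mult[OF D AB] by (simp add: AB0)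
  ultimately show ?thesis by simp
qed

text \<open>If \<open>D\<close> were not in the image \<open>I\<close> of the tangent map, some
  covector would kill \<open>I\<close> but not \<open>D\<close>. It is the differential of a
  function whose pullback is critical at \<open>g\<close>, contradicting
  \<open>critical_descends\<close>.\<close>

lemma p_submersion: "submersion MG Q p"
  unfolding submersion_def
proof (intro conjI ballI M Q p_smooth subset_antisym subsetI)
  fix g w assume g: "g \<in> points MG" and "w \<in> push Q p ` tangent_space MG g"
  then show "w \<in> tangent_space Q (p g)" using push_tangent[OF M Q p_smooth] by blast
next
  fix g D assume g: "g \<in> points MG" and D: "D \<in> tangent_space Q (p g)"
  note gc = g[unfolded points_carrier]
  interpret rv: vector_space "\<lambda>c (u :: 'g set tvec) f. c * u f" by (rule vector_space_tvec)
  define I where "I = push Q p ` tangent_space MG g"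
  have Is: "rv.subspace I"
    unfolding rv.subspace_def I_def
  proof (intro conjI ballI allI)
    show "0 \<in> push Q p ` tangent_space MG g" by (rule image_eqI[of _ _ 0]) (simp_all add: push_zero tangent_zero)
  qed (auto simp: push_add[symmetric] push_scale[symmetric] intro!: imageI tangent_space_add tangent_space_scale)
  show "D \<in> push Q p ` tangent_space MG g"
  proof (rule ccontr)
    assume nD: "D \<notin> push Q p ` tangent_space MG g"
    define X where "X = range (\<lambda>c f. c * D f)"
    have Xs: "rv.subspace X"
      unfolding rv.subspace_def X_def
    proof (intro conjI ballI allI)
      show "0 \<in> range (\<lambda>c f. c * D f)" by (rule image_eqI[of _ _ 0]) (simp_all add: fun_eq_iff)
      fix u v assume "u \<in> range (\<lambda>c f. c * D f)" "v \<in> range (\<lambda>c f. c * D f)"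
      then obtain a b where "u = (\<lambda>f. a * D f)" "v = (\<lambda>f. b * D f)" by blast
      then show "u + v \<in> range (\<lambda>c f. c * D f)" by (intro image_eqI[of _ _ "a + b"]) (simp_all add: fun_eq_iff algebra_simps)
    next
      fix c u assume "u \<in> range (\<lambda>c f. c * D f)"
      then obtain a where "u = (\<lambda>f. a * D f)" by blast
      then show "(\<lambda>f. c * u f) \<in> range (\<lambda>c f. c * D f)" by (intro image_eqI[of _ _ "c * a"]) (simp_all add: fun_eq_iff)
    qed
    have "X \<inter> I \<subseteq> {0}"
    proof
      fix u assume u: "u \<in> X \<inter> I"
      then obtain a where a: "u = (\<lambda>f. a * D f)" by (auto simp: X_def)
      have "a = 0"
      proof (rule ccontr)
        assume "a \<noteq> 0"
        then have "D = (\<lambda>f. inverse a * u f)" by (simp add: a fun_eq_iff)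
        then have "D \<in> I" using rv.subspace_scale[OF Is, of u "inverse a"] u by simp
        then show False using nD by (simp add: I_def)
      qed
      then show "u \<in> {0}" by (simp add: a fun_eq_iff)
    qed
    then obtain K where
      K: "Vector_Spaces.linear (\<lambda>c (u :: 'g set tvec) f. c * u f) (\<lambda>c (u :: 'g set tvec) f. c * u f) K"
      "\<forall>u\<in>X. K u = u" "\<forall>u\<in>I. K u = 0"
      using rv.projection_exists[OF Xs Is] by auto
    interpret K: Vector_Spaces.linear "\<lambda>c (u :: 'g set tvec) f. c * u f" "\<lambda>c (u :: 'g set tvec) f. c * u f" K by (rule K(1))
    have "D \<noteq> 0" using nD Is by (auto simp: I_def rv.subspace_def)
    then obtain h where h: "D h \<noteq> 0" by (auto simp: fun_eq_iff)
    \<comment> \<open>The projection \<open>K\<close> onto the line of \<open>D\<close>, evaluated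
      at a function \<open>h\<close> with \<open>D h\<close> nonzero: a linear functional that
      vanishes on \<open>I\<close> and not on \<open>D\<close>.\<close>
    define \<xi> where "\<xi> u = (if u \<in> tangent_space Q (p g) then K u h else 0)" for u
    have "\<xi> \<in> cotangent_space Q (p g)"
      unfolding cotangent_space_def mem_Collect_eq by (simp add: \<xi>_def tangent_space_add tangent_space_scale K.add K.scale)
    then obtain f where f: "f \<in> smooth_funs Q" "\<xi> = differential Q f (p g)"
      by (rule covector_differential[OF Q p_in[OF gc]])
    have "D f = 0"
    proof (rule critical_descends[OF gc f(1) D])
      fix u assume u: "u \<in> tangent_space MG g"
      have pu: "push Q p u \<in> tangent_space Q (p g)" by (rule push_tangent[OF M Q p_smooth u])
      have "\<xi> (push Q p u) = 0" using K(3) u pu by (simp add: \<xi>_def I_def)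
      then show "u (f \<circ> p) = 0" using pu f by (simp add: differential_def push_def)
    qed
    moreover have "\<xi> D = D f" using D f(2) by (simp add: differential_def)
    moreover have "\<xi> D = D h"
    proof -
      have "D \<in> X" unfolding X_def by (rule image_eqI[of _ _ 1]) simp_all
      then show ?thesis using K(2) D by (simp add: \<xi>_def)
    qed
    ultimately show False using h by simp
  qed
qed

lemma rho_eq: "u \<in> \<gg> \<Longrightarrow> g \<in> carrier G \<Longrightarrow> v \<in> halg G MG T P \<Longrightarrow> Ad G g (v - cplx u) \<in> halg G MG T P \<Longrightarrow>
    rho G MG T P v g = push MG (\<lambda>x. g \<otimes> x) u"
  using pr_g_eq[OF Ad_tangent, of u g "Ad G g v"] Ad_inv[of u g]
  by (simp add: rho_def Ad_linear Ad_cplx)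

text \<open>Both composites are the map that sends \<open>x\<close> to
  \<open>g \<otimes> x \<otimes> t\<close>: conjugation by \<open>inv t\<close> followed by left
  translation by \<open>g \<otimes> t\<close> is left translation by \<open>g\<close> followed by
  right translation by \<open>t\<close>.\<close>

lemma right_push:
  assumes u: "u \<in> \<gg>" and g: "g \<in> carrier G" and t: "t \<in> T"
  shows "push MG (\<lambda>x. g \<otimes> t \<otimes> x) (Ad G (inv t) u) = push MG (\<lambda>x. x \<otimes> t) (push MG (\<lambda>x. g \<otimes> x) u)"
proof -
  note t' = T_carrier[OF t]
  have "push MG (\<lambda>x. g \<otimes> t \<otimes> x) (Ad G (inv t) u) = push MG ((\<lambda>x. g \<otimes> t \<otimes> x) \<circ> (\<lambda>x. inv t \<otimes> x \<otimes> inv (inv t))) u"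
    using Ad_push[OF u, of "inv t"] t' g by (simp add: push_compose[OF M M smooth_map_left])
  also have "\<dots> = push MG ((\<lambda>x. x \<otimes> t) \<circ> (\<lambda>x. g \<otimes> x)) u"
  proof (rule push_cong[OF M M u])
    show "smooth_map MG MG ((\<lambda>x. g \<otimes> t \<otimes> x) \<circ> (\<lambda>x. inv t \<otimes> x \<otimes> inv (inv t)))"
      using smooth_map_compose[OF M M M smooth_map_conj[of "inv t"] smooth_map_left[of "g \<otimes> t"]] g t' by simp
    show "((\<lambda>x. g \<otimes> t \<otimes> x) \<circ> (\<lambda>x. inv t \<otimes> x \<otimes> inv (inv t))) z = ((\<lambda>x. x \<otimes> t) \<circ> (\<lambda>x. g \<otimes> x)) z" if "z \<in> points MG" for z
      using that g t' by (simp add: points_carrier m_assoc mult_inv_cancel)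
  qed (simp add: points_carrier)
  also have "\<dots> = push MG (\<lambda>x. x \<otimes> t) (push MG (\<lambda>x. g \<otimes> x) u)"
    using push_compose[OF M M smooth_map_right[OF t'], of "\<lambda>x. g \<otimes> x" u] by simp
  finally show ?thesis .
qed

text \<open>\<open>Ad G (g \<otimes> t)\<close> after \<open>Ad G (inv t)\<close> is
  \<open>Ad G g\<close>, so a solution \<open>u\<close> of the defining condition at
  \<open>g\<close> corresponds to the solution \<open>Ad G (inv t) u\<close> at
  \<open>g \<otimes> t\<close>.\<close>

lemma rho_right:
  assumes v: "v \<in> halg G MG T P" and g: "g \<in> carrier G" and t: "t \<in> T"
  shows "rho G MG T P (Ad G (inv t) v) (g \<otimes> t) = push MG (\<lambda>x. x \<otimes> t) (rho G MG T P v g)"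
proof -
  note t' = T_carrier[OF t]
  have gt: "g \<otimes> t \<in> carrier G" using g t' by simp
  have it: "inv t \<in> T" using t by (rule subgroup.m_inv_closed[OF T(1)])
  have v': "Ad G (inv t) v \<in> halg G MG T P" by (rule Ad_halg[OF it v])
  have shift: "Ad G (g \<otimes> t) (Ad G (inv t) w) = Ad G g w" if w: "w \<in> dalg G MG" for w
    using dAd_mult[OF dAd_in[OF w, of "inv t"] g t'] dAd_inv'[OF w t'] t' by simp
  show ?thesis
  proof (cases "\<exists>u\<in>\<gg>. Ad G g (v - cplx u) \<in> halg G MG T P")
    case True
    then obtain u where u: "u \<in> \<gg>" "Ad G g (v - cplx u) \<in> halg G MG T P" by blast
    have vu: "v - cplx u \<in> dalg G MG" by (rule cv.subspace_diff[OF subspace_dalg halg_dalg[OF v] cplx_dalg[OF u(1)]])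
    have "Ad G (g \<otimes> t) (Ad G (inv t) v - cplx (Ad G (inv t) u)) \<in> halg G MG T P"
      using shift[OF vu] u(2) by (simp add: Ad_linear(2)[of G "inv t"] Ad_cplx)
    then have "rho G MG T P (Ad G (inv t) v) (g \<otimes> t) = push MG (\<lambda>x. g \<otimes> t \<otimes> x) (Ad G (inv t) u)"
      using u(1) t' by (intro rho_eq[OF _ gt v']) (simp_all add: Ad_tangent)
    then show ?thesis using rho_eq[OF u(1) g v u(2)] right_push[OF u(1) g t] by simp
  next
    case False
    have "\<not> (\<exists>u\<in>\<gg>. Ad G (g \<otimes> t) (Ad G (inv t) v - cplx u) \<in> halg G MG T P)"
    proof
      assume "\<exists>u\<in>\<gg>. Ad G (g \<otimes> t) (Ad G (inv t) v - cplx u) \<in> halg G MG T P"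
      then obtain u where u: "u \<in> \<gg>" "Ad G (g \<otimes> t) (Ad G (inv t) v - cplx u) \<in> halg G MG T P" by blast
      have tu: "Ad G t u \<in> \<gg>" by (rule Ad_tangent[OF u(1) t'])
      have vu: "v - cplx (Ad G t u) \<in> dalg G MG" by (rule cv.subspace_diff[OF subspace_dalg halg_dalg[OF v] cplx_dalg[OF tu]])
      have "Ad G (inv t) (v - cplx (Ad G t u)) = Ad G (inv t) v - cplx u"
        using Ad_inv[OF u(1) t'] by (simp add: Ad_linear Ad_cplx)
      then have "Ad G g (v - cplx (Ad G t u)) \<in> halg G MG T P" using shift[OF vu] u(2) by simp
      with False tu show False by blast
    qed
    \<comment> \<open>Neither point admits a solution, and \<open>rho_cases\<close> then leaves 0 on
      both sides.\<close>
    then show ?thesis using rho_cases[OF gt v'] rho_cases[OF g v] False by (auto simp: push_zero)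
  qed
qed

text \<open>Right translation by \<open>t\<close> changes the Maurer-Cartan form by
  \<open>Ad G (inv t)\<close>, and the Killing form is invariant under \<open>Ad\<close>.\<close>

lemma theta_right:
  assumes v: "v \<in> halg G MG T P" and g: "g \<in> carrier G" and t: "t \<in> T" and u: "u \<in> tangent_space MG g"
  shows "theta_covec G MG (Ad G (inv t) v) (g \<otimes> t) (push MG (\<lambda>x. x \<otimes> t) u) = theta_covec G MG v g u"
proof -
  note t' = T_carrier[OF t]
  have pu: "push MG (\<lambda>x. x \<otimes> t) u \<in> tangent_space MG (g \<otimes> t)" by (rule push_tangent[OF M M smooth_map_right[OF t'] u])
  note mc = maurer_cartan_in[OF g u]
  have "maurer_cartan G MG (g \<otimes> t) (push MG (\<lambda>x. x \<otimes> t) u) = push MG ((\<lambda>x. inv (g \<otimes> t) \<otimes> x) \<circ> (\<lambda>x. x \<otimes> t)) u"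
    unfolding maurer_cartan_def using g t' by (intro push_compose[OF M M smooth_map_left]) simp
  also have "\<dots> = push MG ((\<lambda>x. inv t \<otimes> x \<otimes> inv (inv t)) \<circ> (\<lambda>x. inv g \<otimes> x)) u"
  proof (rule push_cong[OF M M u])
    show "smooth_map MG MG ((\<lambda>x. inv (g \<otimes> t) \<otimes> x) \<circ> (\<lambda>x. x \<otimes> t))"
      using g t' by (intro smooth_map_compose[OF M M M smooth_map_right smooth_map_left]) simp_all
    show "((\<lambda>x. inv (g \<otimes> t) \<otimes> x) \<circ> (\<lambda>x. x \<otimes> t)) z = ((\<lambda>x. inv t \<otimes> x \<otimes> inv (inv t)) \<circ> (\<lambda>x. inv g \<otimes> x)) z"
      if "z \<in> points MG" for z
      using that g t' by (simp add: points_carrier m_assoc inv_mult_group)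
  qed (simp add: points_carrier g)
  also have "\<dots> = Ad G (inv t) (maurer_cartan G MG g u)"
    using Ad_push[OF mc, of "inv t"] t' push_compose[OF M M smooth_map_conj[of "inv t"], of "\<lambda>x. inv g \<otimes> x" u]
    by (simp add: maurer_cartan_def)
  finally have "pairing G MG (cplx (maurer_cartan G MG (g \<otimes> t) (push MG (\<lambda>x. x \<otimes> t) u))) (Ad G (inv t) v)
      = pairing G MG (cplx (maurer_cartan G MG g u)) v"
    using killing_form_Ad[OF cplx_dalg[OF mc] halg_dalg[OF v], of "inv t"] t' by (simp add: pairing_def Ad_cplx)
  then show ?thesis using u pu by (simp add: theta_covec_def)
qed

abbreviation pull :: "'g \<Rightarrow> 'g set covec \<Rightarrow> 'g covec" where "pull \<equiv> pull_covec MG Q p"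

lemma pull_cotangent: "\<xi> \<in> cotangent_space Q (p g) \<Longrightarrow> pull g \<xi> \<in> cotangent_space MG g"
  by (rule pull_covec_cotangent[OF M Q p_smooth])

lemma push_p_right:
  assumes g: "g \<in> carrier G" and t: "t \<in> T" and u: "u \<in> tangent_space MG g"
  shows "push Q p (push MG (\<lambda>x. x \<otimes> t) u) = push Q p u"
proof -
  have "push Q p (push MG (\<lambda>x. x \<otimes> t) u) = push Q (p \<circ> (\<lambda>x. x \<otimes> t)) u" by (rule push_compose[OF M Q p_smooth])
  also have "\<dots> = push Q p u"
    by (rule push_cong[OF M Q u, symmetric]) (simp_all add: points_carrier g p_smooth p_mult t)
  finally show ?thesis .
qed

text \<open>Right translation by \<open>t\<close> maps the graph over \<open>g\<close> into the
  graph over \<open>g \<otimes> t\<close>, by \<open>rho_right\<close> and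
  \<open>theta_right\<close>, and it matches the pullbacks of a covector of the quotient to the two
  points.\<close>

lemma pull_right_invariant:
  assumes g: "g \<in> carrier G" and t: "t \<in> T" and \<xi>: "\<xi> \<in> cotangent_space Q (p g)" and \<eta>: "\<eta> \<in> cotangent_space Q (p g)"
  shows "\<pi> (g \<otimes> t) (pull (g \<otimes> t) \<xi>) (pull (g \<otimes> t) \<eta>) = \<pi> g (pull g \<xi>) (pull g \<eta>)"
proof -
  note t' = T_carrier[OF t]
  have gt: "g \<otimes> t \<in> carrier G" "p (g \<otimes> t) = p g" using g t' p_mult[OF g t] by simp_all
  let ?R = "push MG (\<lambda>x. x \<otimes> t)"
  have R: "?R u \<in> tangent_space MG (g \<otimes> t)" if "u \<in> tangent_space MG g" for u
    by (rule push_tangent[OF M M smooth_map_right[OF t'] that])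
  have pullR: "pull (g \<otimes> t) \<zeta> (?R u) = pull g \<zeta> u" if "u \<in> tangent_space MG g" for \<zeta> u
    using R[OF that] that push_p_right[OF g t that] by (simp add: pull_covec_def)
  obtain w where w: "(w, pull g \<xi>) \<in> Gr MG \<pi> g" by (rule Gr_exists[OF pi(2) _ M pull_cotangent[OF \<xi>]]) (simp_all add: g points_carrier)
  then obtain v where v: "v \<in> halg G MG T P" "w = rho G MG T P v g" "pull g \<xi> = theta_covec G MG v g" using pi_Gr[OF g] by auto
  have v': "Ad G (inv t) v \<in> halg G MG T P" using t v(1) by (intro Ad_halg subgroup.m_inv_closed[OF T(1)])
  have gr: "(?R w, theta_covec G MG (Ad G (inv t) v) (g \<otimes> t)) \<in> Gr MG \<pi> (g \<otimes> t)"
    using rho_Gr[OF gt(1) v'] rho_right[OF v(1) g t] v(2) by simp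
  have "theta_covec G MG (Ad G (inv t) v) (g \<otimes> t) = pull (g \<otimes> t) \<xi>"
  proof (rule cotangent_eqI[OF GrD(2)[OF gr]])
    show "pull (g \<otimes> t) \<xi> \<in> cotangent_space MG (g \<otimes> t)" using \<xi> gt(2) by (intro pull_cotangent) simp
    fix u assume u: "u \<in> tangent_space MG (g \<otimes> t)"
    let ?u = "push MG (\<lambda>x. x \<otimes> inv t) u"
    have u': "?u \<in> tangent_space MG g"
      using push_tangent[OF M M smooth_map_right[of "inv t"] u] t' g by (simp add: m_assoc)
    have "?R ?u = push MG ((\<lambda>x. x \<otimes> t) \<circ> (\<lambda>x. x \<otimes> inv t)) u" by (rule push_compose[OF M M smooth_map_right[OF t']])
    also have "\<dots> = push MG (\<lambda>x. x) u"
      using t' gt(1) by (intro push_cong[OF M M u, symmetric]) (simp_all add: points_carrier smooth_map_id[OF M] m_assoc)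
    also have "\<dots> = u" by (rule push_ident[OF M u])
    finally have "u = ?R ?u" ..
    then show "theta_covec G MG (Ad G (inv t) v) (g \<otimes> t) u = pull (g \<otimes> t) \<xi> u"
      using theta_right[OF v(1) g t u'] pullR[OF u', of \<xi>] v(3) by simp
  qed
  then have gr': "(?R w, pull (g \<otimes> t) \<xi>) \<in> Gr MG \<pi> (g \<otimes> t)" using gr by simp
  have "\<pi> (g \<otimes> t) (pull (g \<otimes> t) \<xi>) (pull (g \<otimes> t) \<eta>) = pull (g \<otimes> t) \<eta> (?R w)"
    using \<eta> gt(2) by (intro GrD(3)[OF gr', symmetric] pull_cotangent) simp
  also have "\<dots> = pull g \<eta> w" by (rule pullR[OF GrD(1)[OF w]])
  also have "\<dots> = \<pi> g (pull g \<xi>) (pull g \<eta>)" by (rule GrD(3)[OF w pull_cotangent[OF \<eta>]])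
  finally show ?thesis .
qed

text \<open>The choice of representative is harmless by \<open>pull_right_invariant\<close>; the
  value 0 elsewhere is the convention in \<open>bivector_field\<close>.\<close>

definition flag_bivector :: "'g set bivector" where
  "flag_bivector m \<xi> \<eta> =
    (if m \<in> points Q \<and> \<xi> \<in> cotangent_space Q m \<and> \<eta> \<in> cotangent_space Q m
     then let g = (SOME g. g \<in> carrier G \<and> p g = m) in \<pi> g (pull g \<xi>) (pull g \<eta>) else 0)"

lemma flag_bivector_eq:
  assumes g: "g \<in> carrier G" and \<xi>: "\<xi> \<in> cotangent_space Q (p g)" and \<eta>: "\<eta> \<in> cotangent_space Q (p g)"
  shows "flag_bivector (p g) \<xi> \<eta> = \<pi> g (pull g \<xi>) (pull g \<eta>)"
proof -
  define h where "h = (SOME h. h \<in> carrier G \<and> p h = p g)"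
  have "h \<in> carrier G \<and> p h = p g" unfolding h_def by (rule someI[of _ g]) (simp add: g)
  then have h: "h \<in> carrier G" "p g = p h" by simp_all
  obtain t where t: "t \<in> T" "h = g \<otimes> t" by (rule p_eq[OF g h])
  have "flag_bivector (p g) \<xi> \<eta> = \<pi> h (pull h \<xi>) (pull h \<eta>)"
    using p_in[OF g] \<xi> \<eta> by (simp add: flag_bivector_def h_def Let_def)
  then show ?thesis using pull_right_invariant[OF g t(1) \<xi> \<eta>] t(2) by simp
qed

lemma pbracket_flag:
  assumes g: "g \<in> carrier G" and f: "f \<in> smooth_funs Q" and h: "h \<in> smooth_funs Q"
  shows "pbracket Q flag_bivector f h (p g) = pbracket MG \<pi> (f \<circ> p) (h \<circ> p) g"
  unfolding pbracket_def
  by (simp add: flag_bivector_eq[OF g differential_cotangent differential_cotangent]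
      pull_covec_differential[OF M Q p_smooth] f h)

lemma pbracket_smooth:
  assumes f: "f \<in> smooth_funs Q" and h: "h \<in> smooth_funs Q"
  shows "pbracket Q flag_bivector f h \<in> smooth_funs Q"
proof (rule smooth_funs_quotient, rule smooth_funs_cong_carrier)
  have "f \<circ> p \<in> smooth_funs MG" "h \<circ> p \<in> smooth_funs MG" by (rule smooth_funs_pullback[OF M Q p_smooth], fact)+
  then show "pbracket MG \<pi> (f \<circ> p) (h \<circ> p) \<in> smooth_funs MG"
    using pi(2) by (simp add: bivector_field_def pbracket_def[abs_def])
  show "pbracket MG \<pi> (f \<circ> p) (h \<circ> p) g = (pbracket Q flag_bivector f h \<circ> p) g" if "g \<in> carrier G" for g
    using pbracket_flag[OF that f h] by simp
qed

lemma flag_bivector_field: "bivector_field Q flag_bivector"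
  unfolding bivector_field_def
proof (intro conjI ballI allI impI)
  fix m \<xi> \<eta> assume m: "m \<in> points Q" and \<xi>: "\<xi> \<in> cotangent_space Q m" and \<eta>: "\<eta> \<in> cotangent_space Q m"
  obtain g where g: "g \<in> carrier G" "m = p g" using m p_image by blast
  note gp = g(1)[folded points_carrier]
  note \<xi>' = \<xi>[unfolded g(2)] and \<eta>' = \<eta>[unfolded g(2)]
  note pc = pull_cotangent[OF \<xi>'] pull_cotangent[OF \<eta>']
  note lin = pull_covec_linear[OF M Q p_smooth]
  show "flag_bivector m \<xi> \<eta> = - flag_bivector m \<eta> \<xi>"
    unfolding g(2) flag_bivector_eq[OF g(1) \<xi>' \<eta>'] flag_bivector_eq[OF g(1) \<eta>' \<xi>'] by (rule bivectorD(1)[OF pi(2) gp pc])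
  show "flag_bivector m (\<lambda>u. c * \<xi> u) \<eta> = c * flag_bivector m \<xi> \<eta>" for c
    unfolding g(2) flag_bivector_eq[OF g(1) \<xi>' \<eta>'] flag_bivector_eq[OF g(1) cotangent_scale[OF \<xi>'] \<eta>'] lin
    by (rule bivectorD(3)[OF pi(2) gp pc])
  fix \<xi>2 assume "\<xi>2 \<in> cotangent_space Q m"
  then have x2: "\<xi>2 \<in> cotangent_space Q (p g)" by (simp add: g(2))
  show "flag_bivector m (\<xi> + \<xi>2) \<eta> = flag_bivector m \<xi> \<eta> + flag_bivector m \<xi>2 \<eta>"
    unfolding g(2) flag_bivector_eq[OF g(1) \<xi>' \<eta>'] flag_bivector_eq[OF g(1) x2 \<eta>'] flag_bivector_eq[OF g(1) cotangent_add[OF \<xi>' x2] \<eta>'] lin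
    by (rule bivectorD(2)[OF pi(2) gp pc(1) pull_cotangent[OF x2] pc(2)])
next
  fix f h assume "f \<in> smooth_funs Q" "h \<in> smooth_funs Q"
  then show "(\<lambda>x. flag_bivector x (differential Q f x) (differential Q h x)) \<in> smooth_funs Q"
    using pbracket_smooth by (simp add: pbracket_def[abs_def])
qed (auto simp: flag_bivector_def)

lemma flag_poisson_structure: "poisson_structure Q flag_bivector"
  unfolding poisson_structure_def
proof (intro conjI ballI Q flag_bivector_field)
  fix a b c m assume abc: "a \<in> smooth_funs Q" "b \<in> smooth_funs Q" "c \<in> smooth_funs Q" and "m \<in> points Q"
  then obtain g where g: "g \<in> carrier G" "m = p g" using p_image by blast
  note pb = smooth_funs_pullback[OF M Q p_smooth]
  have nest: "pbracket Q flag_bivector x (pbracket Q flag_bivector y z) m = pbracket MG \<pi> (x \<circ> p) (pbracket MG \<pi> (y \<circ> p) (z \<circ> p)) g"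
    if "x \<in> smooth_funs Q" "y \<in> smooth_funs Q" "z \<in> smooth_funs Q" for x y z
  proof -
    \<comment> \<open>The inner brackets are known to agree on the carrier only, which is enough for
      their differentials.\<close>
    have "differential MG (pbracket Q flag_bivector y z \<circ> p) g = differential MG (pbracket MG \<pi> (y \<circ> p) (z \<circ> p)) g"
      by (rule differential_cong[OF M _ pb[OF pbracket_smooth[OF that(2,3)]]]) (simp_all add: points_carrier g pbracket_flag that)
    then show ?thesis
      using pbracket_flag[OF g(1) that(1) pbracket_smooth[OF that(2,3)]] by (simp add: g(2) pbracket_def[of MG])
  qed
  show "pbracket Q flag_bivector a (pbracket Q flag_bivector b c) m + pbracket Q flag_bivector b (pbracket Q flag_bivector c a) m
      + pbracket Q flag_bivector c (pbracket Q flag_bivector a b) m = 0"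
    using pi(1) pb[OF abc(1)] pb[OF abc(2)] pb[OF abc(3)] g(1) abc by (simp add: nest poisson_structure_def points_carrier)
qed

lemma p_poisson: "poisson_map MG \<pi> Q flag_bivector p"
  unfolding poisson_map_def using pi(1) flag_poisson_structure p_smooth pbracket_flag by (simp add: points_carrier)

text \<open>Uniqueness holds because \<open>p\<close> is onto and every covector of the quotient is
  a differential, so the brackets upstairs determine the bivector. Arguments outside the cotangent
  spaces are settled by the convention of value 0.\<close>

lemma flag_poisson_eq: "flag_poisson G MG T \<pi> Q = flag_bivector"
  unfolding flag_poisson_def pushed_poisson_def
proof (rule the_equality)
  show "poisson_structure Q flag_bivector \<and> poisson_map MG \<pi> Q flag_bivector p" using flag_poisson_structure p_poisson by simp
  fix \<tau> assume \<tau>: "poisson_structure Q \<tau> \<and> poisson_map MG \<pi> Q \<tau> p"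
  have "\<tau> m \<xi> \<eta> = flag_bivector m \<xi> \<eta>" for m \<xi> \<eta>
  proof (cases "m \<in> points Q \<and> \<xi> \<in> cotangent_space Q m \<and> \<eta> \<in> cotangent_space Q m")
    case True
    then obtain g where g: "g \<in> carrier G" "m = p g" using p_image by blast
    obtain f where f: "f \<in> smooth_funs Q" "\<xi> = differential Q f m" using covector_differential[OF Q, of m \<xi>] True by blast
    obtain h where h: "h \<in> smooth_funs Q" "\<eta> = differential Q h m" using covector_differential[OF Q, of m \<eta>] True by blast
    have "pbracket MG \<pi> (f \<circ> p) (h \<circ> p) g = pbracket Q \<tau> f h (p g)"
      using \<tau> f(1) h(1) g(1) by (simp add: poisson_map_def points_carrier)
    then show ?thesis using pbracket_flag[OF g(1) f(1) h(1)] by (simp add: pbracket_def f(2) h(2) g(2))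
  next
    case False
    moreover have "bivector_field Q \<tau>" using \<tau> by (simp add: poisson_structure_def)
    ultimately show ?thesis using flag_bivector_field unfolding bivector_field_def by metis
  qed
  then show "\<tau> = flag_bivector" by (simp add: fun_eq_iff)
qed

lemma fibre_coset:
  assumes g: "g \<in> carrier G"
  shows "fibre MG p (p g) = g <# T"
proof (intro equalityI subsetI)
  fix x assume "x \<in> fibre MG p (p g)"
  then have x: "x \<in> carrier G" "p g = p x" by (simp_all add: fibre_def points_carrier)
  obtain t where "t \<in> T" "x = g \<otimes> t" by (rule p_eq[OF g x])
  then show "x \<in> g <# T" by (auto simp: l_coset_def)
next
  fix x assume "x \<in> g <# T"
  then obtain t where "t \<in> T" "x = g \<otimes> t" by (auto simp: l_coset_def)
  then show "x \<in> fibre MG p (p g)" using p_mult[OF g] g T_carrier by (simp add: fibre_def points_carrier)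
qed

lemma fibre_induces:
  assumes "m \<in> points Q"
  shows "submanifold MG (fibre MG p m)" "induces_bivector MG \<pi> (fibre MG p m) \<sigma> \<longleftrightarrow> \<sigma> = zero_bivector"
proof -
  obtain g where "g \<in> carrier G" "m = p g" using assms p_image by blast
  then show "submanifold MG (fibre MG p m)" "induces_bivector MG \<pi> (fibre MG p m) \<sigma> \<longleftrightarrow> \<sigma> = zero_bivector"
    using coset_submanifold coset_induces by (simp_all add: fibre_coset)
qed

lemma p_poisson_submersion: "poisson_submersion MG \<pi> Q (flag_poisson G MG T \<pi> Q) p"
  unfolding flag_poisson_eq poisson_submersion_def using p_submersion p_poisson by simp

lemma p_poisson_fibres: "has_poisson_fibres MG \<pi> Q p"
  unfolding has_poisson_fibres_def poisson_dirac_def using p_submersion pi(1) fibre_induces by blast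

lemma p_induced_poisson: "m \<in> points Q \<Longrightarrow> induced_poisson MG \<pi> (fibre MG p m) = zero_bivector"
  unfolding induced_poisson_def by (rule the_equality) (simp_all add: fibre_induces(2))

end

theorem proposition4p10:
  fixes G :: "'g monoid"
    and MG :: "('g, 'e::euclidean_space) mfd"
    and T :: "'g set"
    and P :: "('g ctvec \<Rightarrow> complex) set"
    and piG :: "'g bivector"
    and M :: "('g set, 'f::euclidean_space) mfd"
  assumes "semisimple_lie_group G MG"
    and "compact_space (mtop MG)"
    and "connected_space (mtop MG)"
    and "maximal_torus G MG T"
    and "positive_roots G MG T P"
    and "standard_poisson G MG T P piG"
    and "flag_manifold G MG T M"
  shows "poisson_submersion MG piG M (flag_poisson G MG T piG M) (flag_proj G T) \<and>
         has_poisson_fibres MG piG M (flag_proj G T) \<and>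
         (\<forall>m\<in>points M. induced_poisson MG piG (fibre MG (flag_proj G T) m) = zero_bivector)"
proof -
  interpret flag_quotient G MG T P piG M
    using assms by unfold_locales (simp_all add: semisimple_lie_group_def maximal_torus_def)
  show ?thesis using p_poisson_submersion p_poisson_fibres p_induced_poisson by blast
qed

end
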